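(* Let $k$ be a field, $H$ a finite dimensional semisimple Hopf algebra over $k$, and $A$ an $H$-module algebra. Then $$\mathrm{HH}^m_{\mathrm{Hopf}}(A,M)\cong\mathrm{HH}^m(A\# H,M)$$ for all $m$ and any $A\# H$-bimodule $M$.
   Context: $\otimes=\otimes_k$, Sweedler notation $\Delta(h)=h_1\otimes h_2$, and $S$ is the antipode of $H$. $A$ is an $H$-module algebra: ${}^h(ab)=({}^{h_1}a)({}^{h_2}b)$ and ${}^h1=\varepsilon(h)1$. The smash product $A\# H$ is $A\otimes H$ as a vector space with multiplication $(a\otimes h)(b\otimes l)=a({}^{h_1}b)\otimes h_2l$; $ah$ denotes $a\otimes h$. $\mathrm{HH}^*(R,M)=\mathrm{Ext}^*_{R\otimes R^{op}}(R,M)$ denotes Hochschild cohomology. Let $\Gamma=A^e\otimes H$ (with $A^e=A\otimes A^{op}$) be the associative algebra with multiplication $(a\otimes b\otimes h)(c\otimes d\otimes l)=a({}^{h_1}c)\otimes({}^{h_3}d)b\otimes h_2l$. An $H$-equivariant $A$-bimodule is an $H$-module and $A$-bimodule $M$ with ${}^h(amb)=({}^{h_1}a)({}^{h_2}m)({}^{h_3}b)$; equivalently it is a $\Gamma$-module via $(a\otimes b\otimes h)m=a({}^hm)b$. The bar resolution of $A$, with terms $A^{\otimes(m+2)}$ ($m\ge0$) and differentials $a_0\otimes\cdots\otimes a_{i+1}\mapsto\sum_{j=0}^i(-1)^ja_0\otimes\cdots\otimes a_ja_{j+1}\otimes\cdots\otimes a_{i+1}$, is a complex of $\Gamma$-modules,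 where $A^e$ acts on the outer factors and $H$ acts diagonally on tensor products. The Hopf-Hochschild cohomology $\mathrm{HH}^*_{\mathrm{Hopf}}(A,M)$ of $A$ with coefficients in an $H$-equivariant $A$-bimodule $M$ is the cohomology of the cochain complex with terms $\mathrm{CH}^m_{\mathrm{Hopf}}(A,M):=\mathrm{Hom}_\Gamma(A^{\otimes(m+2)},M)$ and differentials induced from those of the bar complex. An $A\# H$-bimodule $M$ is regarded as an $H$-equivariant $A$-bimodule by restricting the $A$-bimodule structure and letting $H$ act by ${}^hm=h_1mS(h_2)$ (equivalently, $a\otimes b\otimes h\in\Gamma$ acts by $m\mapsto ah_1\,m\,S(h_2)b$). *)

theory Defs
  imports "HOL-Algebra.Module" "HOL-Algebra.AbelCoset"
begin

section \<open>Left modules over a not necessarily commutative ring\<close>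

text \<open>The locale \<^locale>\<open>module\<close> of the library requires a commutative ring of scalars; it is used
  below for vector spaces. In a record of type \<^typ>\<open>('r, 'm) module\<close> that is meant
  as a mere module, the fields \<open>mult\<close> and \<open>one\<close> carry no meaning.\<close>

locale left_module = R?: ring R + M?: abelian_group M
  for R (structure) and M (structure) +
  assumes lsmult_closed:
      "\<lbrakk>r \<in> carrier R; x \<in> carrier M\<rbrakk> \<Longrightarrow> r \<odot>\<^bsub>M\<^esub> x \<in> carrier M"
    and lsmult_l_distr:
      "\<lbrakk>r \<in> carrier R; s \<in> carrier R; x \<in> carrier M\<rbrakk>
        \<Longrightarrow> (r \<oplus> s) \<odot>\<^bsub>M\<^esub> x = r \<odot>\<^bsub>M\<^esub> x \<oplus>\<^bsub>M\<^esub> s \<odot>\<^bsub>M\<^esub> x"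
    and lsmult_r_distr:
      "\<lbrakk>r \<in> carrier R; x \<in> carrier M; y \<in> carrier M\<rbrakk>
        \<Longrightarrow> r \<odot>\<^bsub>M\<^esub> (x \<oplus>\<^bsub>M\<^esub> y) = r \<odot>\<^bsub>M\<^esub> x \<oplus>\<^bsub>M\<^esub> r \<odot>\<^bsub>M\<^esub> y"
    and lsmult_assoc:
      "\<lbrakk>r \<in> carrier R; s \<in> carrier R; x \<in> carrier M\<rbrakk>
        \<Longrightarrow> (r \<otimes> s) \<odot>\<^bsub>M\<^esub> x = r \<odot>\<^bsub>M\<^esub> (s \<odot>\<^bsub>M\<^esub> x)"
    and lsmult_one: "x \<in> carrier M \<Longrightarrow> \<one> \<odot>\<^bsub>M\<^esub> x = x"

definition with_action ::
    "('k, 'm, 'z) module_scheme \<Rightarrow> ('r \<Rightarrow> 'm \<Rightarrow> 'm) \<Rightarrow> ('r, 'm) module" where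
  "with_action M act = \<lparr>carrier = carrier M, mult = mult M, one = one M,
     zero = zero M, add = add M, smult = act\<rparr>"

definition lmod_hom ::
    "('r, 's) ring_scheme \<Rightarrow> ('r, 'm, 'y) module_scheme \<Rightarrow> ('r, 'n, 'z) module_scheme
      \<Rightarrow> ('m \<Rightarrow> 'n) set" where
  "lmod_hom R M N = {f \<in> carrier M \<rightarrow> carrier N.
     (\<forall>x \<in> carrier M. \<forall>y \<in> carrier M. f (x \<oplus>\<^bsub>M\<^esub> y) = f x \<oplus>\<^bsub>N\<^esub> f y) \<and>
     (\<forall>r \<in> carrier R. \<forall>x \<in> carrier M. f (r \<odot>\<^bsub>M\<^esub> x) = r \<odot>\<^bsub>N\<^esub> f x)}"

definition lmod_iso ::
    "('r, 's) ring_scheme \<Rightarrow> ('r, 'm, 'y) module_scheme \<Rightarrow> ('r, 'n, 'z) module_scheme \<Rightarrow> bool" where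
  "lmod_iso R M N \<longleftrightarrow> (\<exists>f \<in> lmod_hom R M N. bij_betw f (carrier M) (carrier N))"

definition quotient_module ::
    "('r, 'm, 'z) module_scheme \<Rightarrow> 'm set \<Rightarrow> ('r, 'm set) module" where
  "quotient_module M N = \<lparr>carrier = a_rcosets\<^bsub>M\<^esub> N, mult = undefined, one = undefined,
     zero = N, add = set_add M, smult = (\<lambda>r C. \<Union>x\<in>C. N +>\<^bsub>M\<^esub> (r \<odot>\<^bsub>M\<^esub> x))\<rparr>"

definition submodule_span ::
    "('r, 's) ring_scheme \<Rightarrow> ('r, 'm, 'z) module_scheme \<Rightarrow> 'm set \<Rightarrow> 'm set" where
  "submodule_span R M G = \<Inter>{N. submodule N R M \<and> G \<subseteq> N}"

definition free_module :: "('r, 's) ring_scheme \<Rightarrow> 'x set \<Rightarrow> ('r, 'x \<Rightarrow> 'r) module" where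
  "free_module R X = \<lparr>carrier = {f. (\<forall>x\<in>X. f x \<in> carrier R) \<and> (\<forall>x. x \<notin> X \<longrightarrow> f x = \<zero>\<^bsub>R\<^esub>) \<and>
       finite {x. f x \<noteq> \<zero>\<^bsub>R\<^esub>}},
     mult = undefined, one = undefined, zero = (\<lambda>x. \<zero>\<^bsub>R\<^esub>),
     add = (\<lambda>f g x. f x \<oplus>\<^bsub>R\<^esub> g x), smult = (\<lambda>r f x. r \<otimes>\<^bsub>R\<^esub> f x)\<rparr>"

definition free_basis :: "('r, 's) ring_scheme \<Rightarrow> 'x \<Rightarrow> 'x \<Rightarrow> 'r" where
  "free_basis R x = (\<lambda>y. if y = x then \<one>\<^bsub>R\<^esub> else \<zero>\<^bsub>R\<^esub>)"

text \<open>A module is projective if it is a direct summand of a free module. One may take the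
  free module on the underlying set of \<open>P\<close>: it surjects onto \<open>P\<close>, and the surjection splits
  as soon as \<open>P\<close> is a summand of any free module.\<close>

definition projective_module ::
    "('r, 's) ring_scheme \<Rightarrow> ('r, 'p, 'z) module_scheme \<Rightarrow> bool" where
  "projective_module R P \<longleftrightarrow> left_module R P \<and>
     (\<exists>i \<in> lmod_hom R P (free_module R (carrier P)).
      \<exists>q \<in> lmod_hom R (free_module R (carrier P)) P.
        \<forall>x \<in> carrier P. q (i x) = x)"

text \<open>\<open>\<dots> \<rightarrow> P\<^sub>2 \<rightarrow> P\<^sub>1 \<rightarrow> P\<^sub>0 \<rightarrow> N \<rightarrow> 0\<close> is exact with projective \<open>P\<^sub>n\<close>, where
  \<open>\<delta> n : P (n + 1) \<rightarrow> P n\<close> and \<open>e : P 0 \<rightarrow> N\<close>.\<close>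

definition projective_resolution ::
    "('r, 's) ring_scheme \<Rightarrow> ('r, 'n, 'z) module_scheme
      \<Rightarrow> (nat \<Rightarrow> ('r, 'p) module) \<Rightarrow> (nat \<Rightarrow> 'p \<Rightarrow> 'p) \<Rightarrow> ('p \<Rightarrow> 'n) \<Rightarrow> bool" where
  "projective_resolution R N P \<delta> e \<longleftrightarrow>
     (\<forall>n. projective_module R (P n)) \<and>
     (\<forall>n. \<delta> n \<in> lmod_hom R (P (Suc n)) (P n)) \<and>
     e \<in> lmod_hom R (P 0) N \<and>
     e ` carrier (P 0) = carrier N \<and>
     a_kernel (P 0) N e = \<delta> 0 ` carrier (P (Suc 0)) \<and>
     (\<forall>n. a_kernel (P (Suc n)) (P n) (\<delta> n) = \<delta> (Suc n) ` carrier (P (Suc (Suc n))))"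

definition semisimple_module ::
    "('r, 's) ring_scheme \<Rightarrow> ('r, 'm, 'z) module_scheme \<Rightarrow> bool" where
  "semisimple_module R M \<longleftrightarrow> left_module R M \<and>
     (\<forall>N. submodule N R M \<longrightarrow>
        (\<exists>N'. submodule N' R M \<and> N \<inter> N' = {\<zero>\<^bsub>M\<^esub>} \<and> N <+>\<^bsub>M\<^esub> N' = carrier M))"

definition semisimple_algebra :: "('k, 'r, 'z) module_scheme \<Rightarrow> bool" where
  "semisimple_algebra R \<longleftrightarrow> semisimple_module R (with_action R (mult R))"

definition finite_dimensional ::
    "('k, 's) ring_scheme \<Rightarrow> ('k, 'v, 'z) module_scheme \<Rightarrow> bool" where
  "finite_dimensional K V \<longleftrightarrow>
     (\<exists>B. finite B \<and> B \<subseteq> carrier V \<and> submodule_span K V B = carrier V)"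


section \<open>Tensor products of vector spaces\<close>

definition tensor_relations ::
    "('k, 's) ring_scheme \<Rightarrow> ('k, 'v, 'y) module_scheme \<Rightarrow> ('k, 'w, 'z) module_scheme
      \<Rightarrow> ('v \<times> 'w \<Rightarrow> 'k) set" where
  "tensor_relations K V W =
     (let F = free_module K (carrier V \<times> carrier W); b = (\<lambda>v w. free_basis K (v, w)) in
       {b (v \<oplus>\<^bsub>V\<^esub> v') w \<ominus>\<^bsub>F\<^esub> (b v w \<oplus>\<^bsub>F\<^esub> b v' w) | v v' w.
          v \<in> carrier V \<and> v' \<in> carrier V \<and> w \<in> carrier W} \<union>
       {b v (w \<oplus>\<^bsub>W\<^esub> w') \<ominus>\<^bsub>F\<^esub> (b v w \<oplus>\<^bsub>F\<^esub> b v w') | v w w'.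
          v \<in> carrier V \<and> w \<in> carrier W \<and> w' \<in> carrier W} \<union>
       {b (c \<odot>\<^bsub>V\<^esub> v) w \<ominus>\<^bsub>F\<^esub> c \<odot>\<^bsub>F\<^esub> b v w | c v w.
          c \<in> carrier K \<and> v \<in> carrier V \<and> w \<in> carrier W} \<union>
       {b v (c \<odot>\<^bsub>W\<^esub> w) \<ominus>\<^bsub>F\<^esub> c \<odot>\<^bsub>F\<^esub> b v w | c v w.
          c \<in> carrier K \<and> v \<in> carrier V \<and> w \<in> carrier W})"

definition tensor ::
    "('k, 's) ring_scheme \<Rightarrow> ('k, 'v, 'y) module_scheme \<Rightarrow> ('k, 'w, 'z) module_scheme
      \<Rightarrow> ('k, ('v \<times> 'w \<Rightarrow> 'k) set) module" where
  "tensor K V W =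
     (let F = free_module K (carrier V \<times> carrier W) in
       quotient_module F (submodule_span K F (tensor_relations K V W)))"

definition tensor_elt ::
    "('k, 's) ring_scheme \<Rightarrow> ('k, 'v, 'y) module_scheme \<Rightarrow> ('k, 'w, 'z) module_scheme
      \<Rightarrow> 'v \<Rightarrow> 'w \<Rightarrow> ('v \<times> 'w \<Rightarrow> 'k) set" where
  "tensor_elt K V W v w =
     (let F = free_module K (carrier V \<times> carrier W) in
       submodule_span K F (tensor_relations K V W) +>\<^bsub>F\<^esub> free_basis K (v, w))"

text \<open>The \<open>n\<close>-fold tensor power, with lists of length \<open>n\<close> as \<open>n\<close>-tuples.\<close>

definition tpower_relations ::
    "('k, 's) ring_scheme \<Rightarrow> ('k, 'v, 'z) module_scheme \<Rightarrow> nat \<Rightarrow> ('v list \<Rightarrow> 'k) set" where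
  "tpower_relations K V n =
     (let X = {vs. set vs \<subseteq> carrier V \<and> length vs = n};
          F = free_module K X; b = free_basis K in
       {b (vs[i := v \<oplus>\<^bsub>V\<^esub> v']) \<ominus>\<^bsub>F\<^esub> (b (vs[i := v]) \<oplus>\<^bsub>F\<^esub> b (vs[i := v'])) | vs i v v'.
          vs \<in> X \<and> i < n \<and> v \<in> carrier V \<and> v' \<in> carrier V} \<union>
       {b (vs[i := c \<odot>\<^bsub>V\<^esub> v]) \<ominus>\<^bsub>F\<^esub> c \<odot>\<^bsub>F\<^esub> b (vs[i := v]) | c vs i v.
          c \<in> carrier K \<and> vs \<in> X \<and> i < n \<and> v \<in> carrier V})"

definition tpower ::
    "('k, 's) ring_scheme \<Rightarrow> ('k, 'v, 'z) module_scheme \<Rightarrow> nat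
      \<Rightarrow> ('k, ('v list \<Rightarrow> 'k) set) module" where
  "tpower K V n =
     (let F = free_module K {vs. set vs \<subseteq> carrier V \<and> length vs = n} in
       quotient_module F (submodule_span K F (tpower_relations K V n)))"

definition tpower_elt ::
    "('k, 's) ring_scheme \<Rightarrow> ('k, 'v, 'z) module_scheme \<Rightarrow> 'v list \<Rightarrow> ('v list \<Rightarrow> 'k) set" where
  "tpower_elt K V vs =
     (let n = length vs; F = free_module K {vs. set vs \<subseteq> carrier V \<and> length vs = n} in
       submodule_span K F (tpower_relations K V n) +>\<^bsub>F\<^esub> free_basis K vs)"

text \<open>\<open>tensor_lift K U \<phi>\<close> is the linear map into \<open>U\<close> that sends the pure tensor of \<open>x\<close> to \<open>\<phi> x\<close>,
  where \<open>x\<close> is a pair or a list and \<open>\<phi>\<close> is bilinear or multilinear. Only for such \<open>\<phi>\<close> is the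
  result independent of the representative of the coset \<open>t\<close>; every use below is of this kind.
  A sum over Sweedler components \<open>\<Sum> \<beta>(h\<^sub>1, h\<^sub>2)\<close> is
  \<open>tensor_lift K U (\<lambda>(x, y). \<beta> x y) (\<Delta> h)\<close>.\<close>

definition tensor_lift ::
    "('k, 's) ring_scheme \<Rightarrow> ('k, 'u, 'z) module_scheme \<Rightarrow> ('x \<Rightarrow> 'u) \<Rightarrow> ('x \<Rightarrow> 'k) set \<Rightarrow> 'u" where
  "tensor_lift K U \<phi> t =
     (let r = (SOME r. r \<in> t) in
       \<Oplus>\<^bsub>U\<^esub> x \<in> {x. r x \<noteq> \<zero>\<^bsub>K\<^esub>}. r x \<odot>\<^bsub>U\<^esub> \<phi> x)"


section \<open>Algebras and bimodules\<close>

locale assoc_algebra = module K A + A?: ring A for K (structure) and A (structure) +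
  assumes smult_mult_left:
      "\<lbrakk>c \<in> carrier K; a \<in> carrier A; b \<in> carrier A\<rbrakk>
        \<Longrightarrow> (c \<odot>\<^bsub>A\<^esub> a) \<otimes>\<^bsub>A\<^esub> b = c \<odot>\<^bsub>A\<^esub> (a \<otimes>\<^bsub>A\<^esub> b)"
    and smult_mult_right:
      "\<lbrakk>c \<in> carrier K; a \<in> carrier A; b \<in> carrier A\<rbrakk>
        \<Longrightarrow> a \<otimes>\<^bsub>A\<^esub> (c \<odot>\<^bsub>A\<^esub> b) = c \<odot>\<^bsub>A\<^esub> (a \<otimes>\<^bsub>A\<^esub> b)"

definition op_algebra :: "('k, 'a, 'z) module_scheme \<Rightarrow> ('k, 'a, 'z) module_scheme" where
  "op_algebra A = A\<lparr>mult := (\<lambda>a b. b \<otimes>\<^bsub>A\<^esub> a)\<rparr>"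

definition tensor_algebra ::
    "('k, 's) ring_scheme \<Rightarrow> ('k, 'a, 'y) module_scheme \<Rightarrow> ('k, 'b, 'z) module_scheme
      \<Rightarrow> ('k, ('a \<times> 'b \<Rightarrow> 'k) set) module" where
  "tensor_algebra K A B =
     (let T = tensor K A B in
       T\<lparr>mult := (\<lambda>s t.
            tensor_lift K T (\<lambda>(a, b).
              tensor_lift K T (\<lambda>(c, d). tensor_elt K A B (a \<otimes>\<^bsub>A\<^esub> c) (b \<otimes>\<^bsub>B\<^esub> d)) t) s),
          one := tensor_elt K A B \<one>\<^bsub>A\<^esub> \<one>\<^bsub>B\<^esub>\<rparr>)"

definition enveloping_algebra ::
    "('k, 's) ring_scheme \<Rightarrow> ('k, 'r, 'z) module_scheme \<Rightarrow> ('k, ('r \<times> 'r \<Rightarrow> 'k) set) module" where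
  "enveloping_algebra K R = tensor_algebra K R (op_algebra R)"

text \<open>Bimodules over a \<open>K\<close>-algebra, with \<open>K\<close> acting in the same way on both sides.\<close>

locale bimodule =
  fixes K :: "('k, 's) ring_scheme" and R :: "('k, 'r, 'y) module_scheme"
    and M :: "('k, 'm, 'z) module_scheme"
    and lact :: "'r \<Rightarrow> 'm \<Rightarrow> 'm" and ract :: "'m \<Rightarrow> 'r \<Rightarrow> 'm"
  assumes vector_space: "module K M"
    and left: "left_module R (with_action M lact)"
    and right: "left_module (op_algebra R) (with_action M (\<lambda>r m. ract m r))"
    and compatible:
      "\<lbrakk>r \<in> carrier R; s \<in> carrier R; m \<in> carrier M\<rbrakk> \<Longrightarrow> lact r (ract m s) = ract (lact r m) s"
    and lact_smult:
      "\<lbrakk>c \<in> carrier K; r \<in> carrier R; m \<in> carrier M\<rbrakk>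
        \<Longrightarrow> lact (c \<odot>\<^bsub>R\<^esub> r) m = c \<odot>\<^bsub>M\<^esub> lact r m"
    and ract_smult:
      "\<lbrakk>c \<in> carrier K; r \<in> carrier R; m \<in> carrier M\<rbrakk>
        \<Longrightarrow> ract m (c \<odot>\<^bsub>R\<^esub> r) = c \<odot>\<^bsub>M\<^esub> ract m r"

text \<open>A bimodule as a module over the enveloping algebra: \<open>(r \<otimes> s) m = r m s\<close>.\<close>

definition enveloping_module ::
    "('k, 's) ring_scheme \<Rightarrow> ('k, 'm, 'z) module_scheme \<Rightarrow> ('r \<Rightarrow> 'm \<Rightarrow> 'm) \<Rightarrow> ('m \<Rightarrow> 'r \<Rightarrow> 'm)
      \<Rightarrow> (('r \<times> 'r \<Rightarrow> 'k) set, 'm) module" where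
  "enveloping_module K M lact ract =
     with_action M (\<lambda>t m. tensor_lift K M (\<lambda>(r, s). lact r (ract m s)) t)"


section \<open>Cohomology of Hom complexes\<close>

text \<open>\<open>Hom\<^sub>R(X, N)\<close> for a \<open>K\<close>-algebra \<open>R\<close>; the scalar \<open>c\<close> acts on \<open>N\<close> as \<open>c 1\<^sub>R\<close>.\<close>

definition hom_space ::
    "('k, 'r, 'y) module_scheme \<Rightarrow> ('r, 'x, 'w) module_scheme \<Rightarrow> ('r, 'n, 'z) module_scheme
      \<Rightarrow> ('k, 'x \<Rightarrow> 'n) module" where
  "hom_space R X N = \<lparr>carrier = lmod_hom R X N \<inter> extensional (carrier X),
     mult = undefined, one = undefined,
     zero = (\<lambda>x\<in>carrier X. \<zero>\<^bsub>N\<^esub>),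
     add = (\<lambda>f g. \<lambda>x\<in>carrier X. f x \<oplus>\<^bsub>N\<^esub> g x),
     smult = (\<lambda>c f. \<lambda>x\<in>carrier X. (c \<odot>\<^bsub>R\<^esub> \<one>\<^bsub>R\<^esub>) \<odot>\<^bsub>N\<^esub> f x)\<rparr>"

definition hom_diff ::
    "(nat \<Rightarrow> ('r, 'x) module) \<Rightarrow> (nat \<Rightarrow> 'x \<Rightarrow> 'x) \<Rightarrow> nat \<Rightarrow> ('x \<Rightarrow> 'n) \<Rightarrow> 'x \<Rightarrow> 'n" where
  "hom_diff X \<delta> m f = (\<lambda>x\<in>carrier (X (Suc m)). f (\<delta> m x))"

definition hom_cohomology ::
    "('k, 'r, 'y) module_scheme \<Rightarrow> (nat \<Rightarrow> ('r, 'x) module) \<Rightarrow> (nat \<Rightarrow> 'x \<Rightarrow> 'x)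
      \<Rightarrow> ('r, 'n, 'z) module_scheme \<Rightarrow> nat \<Rightarrow> ('k, ('x \<Rightarrow> 'n) set) module" where
  "hom_cohomology R X \<delta> N m =
     (let C = (\<lambda>m. hom_space R (X m) N);
          Z = a_kernel (C m) (C (Suc m)) (hom_diff X \<delta> m);
          B = (case m of 0 \<Rightarrow> {\<zero>\<^bsub>C 0\<^esub>} | Suc n \<Rightarrow> hom_diff X \<delta> n ` carrier (C n))
      in quotient_module ((C m)\<lparr>carrier := Z\<rparr>) B)"


text \<open>Hochschild cohomology \<open>Ext\<^sup>m\<close> of \<open>R\<close> with values in \<open>M\<close> over the enveloping algebra of \<open>R\<close>,
  computed from a projective resolution \<open>(P, \<delta>)\<close> of \<open>R\<close>. The resolution is an explicit
  argument, so that statements can range over all resolutions on all types.\<close>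

definition bimodule_resolution ::
    "('k, 's) ring_scheme \<Rightarrow> ('k, 'r, 'z) module_scheme
      \<Rightarrow> (nat \<Rightarrow> (('r \<times> 'r \<Rightarrow> 'k) set, 'p) module) \<Rightarrow> (nat \<Rightarrow> 'p \<Rightarrow> 'p) \<Rightarrow> ('p \<Rightarrow> 'r) \<Rightarrow> bool" where
  "bimodule_resolution K R P \<delta> e \<longleftrightarrow>
     projective_resolution (enveloping_algebra K R)
       (enveloping_module K R (mult R) (mult R)) P \<delta> e"

definition HH ::
    "('k, 's) ring_scheme \<Rightarrow> ('k, 'r, 'z) module_scheme
      \<Rightarrow> (nat \<Rightarrow> (('r \<times> 'r \<Rightarrow> 'k) set, 'p) module) \<Rightarrow> (nat \<Rightarrow> 'p \<Rightarrow> 'p)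
      \<Rightarrow> ('k, 'm, 'w) module_scheme \<Rightarrow> ('r \<Rightarrow> 'm \<Rightarrow> 'm) \<Rightarrow> ('m \<Rightarrow> 'r \<Rightarrow> 'm)
      \<Rightarrow> nat \<Rightarrow> ('k, ('p \<Rightarrow> 'm) set) module" where
  "HH K R P \<delta> M lact ract m =
     hom_cohomology (enveloping_algebra K R) P \<delta> (enveloping_module K M lact ract) m"


section \<open>Hopf algebras, module algebras and smash products\<close>

record ('k, 'h) hopf = "('k, 'h) module" +
  comult :: "'h \<Rightarrow> ('h \<times> 'h \<Rightarrow> 'k) set"
  counit :: "'h \<Rightarrow> 'k"
  antipode :: "'h \<Rightarrow> 'h"

locale hopf_algebra =
  fixes K :: "('k, 's) ring_scheme" and H :: "('k, 'h, 'z) hopf_scheme"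
  assumes field: "field K"
    and algebra: "assoc_algebra K H"
    and comult_linear: "comult H \<in> lmod_hom K H (tensor K H H)"
    and comult_mult: "comult H \<in> ring_hom H (tensor_algebra K H H)"
    and counit_linear:
      "\<lbrakk>c \<in> carrier K; h \<in> carrier H\<rbrakk> \<Longrightarrow> counit H (c \<odot>\<^bsub>H\<^esub> h) = c \<otimes>\<^bsub>K\<^esub> counit H h"
    and counit_mult: "counit H \<in> ring_hom H K"
    and coassoc:
      "h \<in> carrier H \<Longrightarrow>
        tensor_lift K (tensor K H (tensor K H H))
          (\<lambda>(x, z). tensor_lift K (tensor K H (tensor K H H))
             (\<lambda>(x1, x2). tensor_elt K H (tensor K H H) x1 (tensor_elt K H H x2 z)) (comult H x))
          (comult H h) =
        tensor_lift K (tensor K H (tensor K H H))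
          (\<lambda>(x, y). tensor_elt K H (tensor K H H) x (comult H y)) (comult H h)"
    and counit_left:
      "h \<in> carrier H \<Longrightarrow> tensor_lift K H (\<lambda>(x, y). counit H x \<odot>\<^bsub>H\<^esub> y) (comult H h) = h"
    and counit_right:
      "h \<in> carrier H \<Longrightarrow> tensor_lift K H (\<lambda>(x, y). counit H y \<odot>\<^bsub>H\<^esub> x) (comult H h) = h"
    and antipode_linear: "antipode H \<in> lmod_hom K H H"
    and antipode_left:
      "h \<in> carrier H \<Longrightarrow>
        tensor_lift K H (\<lambda>(x, y). antipode H x \<otimes>\<^bsub>H\<^esub> y) (comult H h) = counit H h \<odot>\<^bsub>H\<^esub> \<one>\<^bsub>H\<^esub>"
    and antipode_right:
      "h \<in> carrier H \<Longrightarrow>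
        tensor_lift K H (\<lambda>(x, y). x \<otimes>\<^bsub>H\<^esub> antipode H y) (comult H h) = counit H h \<odot>\<^bsub>H\<^esub> \<one>\<^bsub>H\<^esub>"

locale module_algebra =
  fixes K :: "('k, 's) ring_scheme" and H :: "('k, 'h, 'y) hopf_scheme"
    and A :: "('k, 'a, 'z) module_scheme" and act :: "'h \<Rightarrow> 'a \<Rightarrow> 'a"
  assumes algebra: "assoc_algebra K A"
    and action: "left_module H (with_action A act)"
    and act_smult:
      "\<lbrakk>c \<in> carrier K; h \<in> carrier H; a \<in> carrier A\<rbrakk>
        \<Longrightarrow> act (c \<odot>\<^bsub>H\<^esub> h) a = c \<odot>\<^bsub>A\<^esub> act h a"
    and act_mult:
      "\<lbrakk>h \<in> carrier H; a \<in> carrier A; b \<in> carrier A\<rbrakk>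
        \<Longrightarrow> act h (a \<otimes>\<^bsub>A\<^esub> b) = tensor_lift K A (\<lambda>(x, y). act x a \<otimes>\<^bsub>A\<^esub> act y b) (comult H h)"
    and act_one: "h \<in> carrier H \<Longrightarrow> act h \<one>\<^bsub>A\<^esub> = counit H h \<odot>\<^bsub>A\<^esub> \<one>\<^bsub>A\<^esub>"

definition smash_product ::
    "('k, 's) ring_scheme \<Rightarrow> ('k, 'h, 'y) hopf_scheme \<Rightarrow> ('k, 'a, 'z) module_scheme
      \<Rightarrow> ('h \<Rightarrow> 'a \<Rightarrow> 'a) \<Rightarrow> ('k, ('a \<times> 'h \<Rightarrow> 'k) set) module" where
  "smash_product K H A act =
     (let T = tensor K A H in
       T\<lparr>mult := (\<lambda>s t.
            tensor_lift K T (\<lambda>(a, h).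
              tensor_lift K T (\<lambda>(b, l).
                tensor_lift K T (\<lambda>(h1, h2). tensor_elt K A H (a \<otimes>\<^bsub>A\<^esub> act h1 b) (h2 \<otimes>\<^bsub>H\<^esub> l))
                  (comult H h)) t) s),
          one := tensor_elt K A H \<one>\<^bsub>A\<^esub> \<one>\<^bsub>H\<^esub>\<rparr>)"


section \<open>Hopf-Hochschild cohomology\<close>

text \<open>The algebra \<open>\<Gamma> = A \<otimes> A\<^sup>o\<^sup>p \<otimes> H\<close>, with product
  \<open>(a \<otimes> b \<otimes> h) (c \<otimes> d \<otimes> l) = a (h\<^sub>1 c) \<otimes> (h\<^sub>3 d) b \<otimes> h\<^sub>2 l\<close>. In the code \<open>h'\<close> and \<open>h3\<close> are the
  components of \<open>\<Delta> h\<close>, and \<open>h1\<close>, \<open>h2\<close> those of \<open>\<Delta> h'\<close>.\<close>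

definition Gamma ::
    "('k, 's) ring_scheme \<Rightarrow> ('k, 'h, 'y) hopf_scheme \<Rightarrow> ('k, 'a, 'z) module_scheme
      \<Rightarrow> ('h \<Rightarrow> 'a \<Rightarrow> 'a) \<Rightarrow> ('k, (('a \<times> 'a \<Rightarrow> 'k) set \<times> 'h \<Rightarrow> 'k) set) module" where
  "Gamma K H A act =
     (let E = enveloping_algebra K A; T = tensor K E H;
          pure = (\<lambda>a b h. tensor_elt K E H (tensor_elt K A (op_algebra A) a b) h) in
       T\<lparr>mult := (\<lambda>s t.
            tensor_lift K T (\<lambda>(u, h). tensor_lift K T (\<lambda>(a, b).
              tensor_lift K T (\<lambda>(v, l). tensor_lift K T (\<lambda>(c, d).
                tensor_lift K T (\<lambda>(h', h3). tensor_lift K T (\<lambda>(h1, h2).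
                    pure (a \<otimes>\<^bsub>A\<^esub> act h1 c) (act h3 d \<otimes>\<^bsub>A\<^esub> b) (h2 \<otimes>\<^bsub>H\<^esub> l))
                  (comult H h')) (comult H h)) v) t) u) s),
          one := pure \<one>\<^bsub>A\<^esub> \<one>\<^bsub>A\<^esub> \<one>\<^bsub>H\<^esub>\<rparr>)"

text \<open>An \<open>H\<close>-equivariant \<open>A\<close>-bimodule as a \<open>\<Gamma>\<close>-module: \<open>(a \<otimes> b \<otimes> h) m = a (h m) b\<close>.\<close>

definition Gamma_module ::
    "('k, 's) ring_scheme \<Rightarrow> ('k, 'm, 'z) module_scheme
      \<Rightarrow> ('a \<Rightarrow> 'm \<Rightarrow> 'm) \<Rightarrow> ('m \<Rightarrow> 'a \<Rightarrow> 'm) \<Rightarrow> ('h \<Rightarrow> 'm \<Rightarrow> 'm)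
      \<Rightarrow> ((('a \<times> 'a \<Rightarrow> 'k) set \<times> 'h \<Rightarrow> 'k) set, 'm) module" where
  "Gamma_module K M lact ract hact =
     with_action M (\<lambda>t m.
       tensor_lift K M (\<lambda>(u, h). tensor_lift K M (\<lambda>(a, b). lact a (ract (hact h m) b)) u) t)"

text \<open>The diagonal action
  \<open>h (a\<^sub>1 \<otimes> \<dots> \<otimes> a\<^sub>n) = h\<^sub>1 a\<^sub>1 \<otimes> \<dots> \<otimes> h\<^sub>n a\<^sub>n\<close> on pure tensors; the empty tensor is scaled by the
  counit, so that by the counit law a single factor \<open>a\<close> is sent to \<open>h a\<close>.\<close>

primrec diagonal_action ::
    "('k, 's) ring_scheme \<Rightarrow> ('k, 'h, 'y) hopf_scheme \<Rightarrow> ('k, 'a, 'z) module_scheme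
      \<Rightarrow> ('h \<Rightarrow> 'a \<Rightarrow> 'a) \<Rightarrow> 'a list \<Rightarrow> 'h \<Rightarrow> ('a list \<Rightarrow> 'k) set" where
  "diagonal_action K H A act [] = (\<lambda>h. counit H h \<odot>\<^bsub>tpower K A 0\<^esub> tpower_elt K A [])"
| "diagonal_action K H A act (a # as) = (\<lambda>h.
     let T = tpower K A (Suc (length as)) in
       tensor_lift K T (\<lambda>(h1, h2).
         tensor_lift K T (\<lambda>bs. tpower_elt K A (act h1 a # bs)) (diagonal_action K H A act as h2))
       (comult H h))"

text \<open>The term of degree \<open>m\<close> is the tensor power of \<open>A\<close> with \<open>m + 2\<close> factors;
  \<open>bar_diff K A m\<close> maps the term of degree \<open>m + 1\<close> to the one of degree \<open>m\<close>.\<close>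

definition bar_module ::
    "('k, 's) ring_scheme \<Rightarrow> ('k, 'h, 'y) hopf_scheme \<Rightarrow> ('k, 'a, 'z) module_scheme
      \<Rightarrow> ('h \<Rightarrow> 'a \<Rightarrow> 'a) \<Rightarrow> nat
      \<Rightarrow> ((('a \<times> 'a \<Rightarrow> 'k) set \<times> 'h \<Rightarrow> 'k) set, ('a list \<Rightarrow> 'k) set) module" where
  "bar_module K H A act m =
     (let T = tpower K A (m + 2) in
       Gamma_module K T
         (\<lambda>a. tensor_lift K T (\<lambda>xs. tpower_elt K A (xs[0 := a \<otimes>\<^bsub>A\<^esub> xs ! 0])))
         (\<lambda>t b. tensor_lift K T (\<lambda>xs. tpower_elt K A (xs[m + 1 := xs ! (m + 1) \<otimes>\<^bsub>A\<^esub> b])) t)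
         (\<lambda>h. tensor_lift K T (\<lambda>xs. diagonal_action K H A act xs h)))"

definition bar_diff ::
    "('k, 's) ring_scheme \<Rightarrow> ('k, 'a, 'z) module_scheme \<Rightarrow> nat
      \<Rightarrow> ('a list \<Rightarrow> 'k) set \<Rightarrow> ('a list \<Rightarrow> 'k) set" where
  "bar_diff K A m =
     (let T = tpower K A (m + 2) in
       tensor_lift K T (\<lambda>xs. \<Oplus>\<^bsub>T\<^esub> j \<in> {0..m + 1}.
         ((\<ominus>\<^bsub>K\<^esub> \<one>\<^bsub>K\<^esub>) [^]\<^bsub>K\<^esub> j) \<odot>\<^bsub>T\<^esub>
           tpower_elt K A (take j xs @ [xs ! j \<otimes>\<^bsub>A\<^esub> xs ! Suc j] @ drop (j + 2) xs)))"

definition HH_Hopf ::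
    "('k, 's) ring_scheme \<Rightarrow> ('k, 'h, 'y) hopf_scheme \<Rightarrow> ('k, 'a, 'z) module_scheme
      \<Rightarrow> ('h \<Rightarrow> 'a \<Rightarrow> 'a) \<Rightarrow> ((('a \<times> 'a \<Rightarrow> 'k) set \<times> 'h \<Rightarrow> 'k) set, 'm, 'w) module_scheme \<Rightarrow> nat
      \<Rightarrow> ('k, (('a list \<Rightarrow> 'k) set \<Rightarrow> 'm) set) module" where
  "HH_Hopf K H A act N m =
     hom_cohomology (Gamma K H A act) (bar_module K H A act) (bar_diff K A) N m"

text \<open>The \<open>\<Gamma>\<close>-module underlying a bimodule \<open>M\<close> over the smash product: the \<open>A\<close>-actions are
  restricted along \<open>a \<mapsto> a \<otimes> 1\<close>, and \<open>h\<close> acts by \<open>m \<mapsto> h\<^sub>1 m S(h\<^sub>2)\<close>.\<close>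

definition smash_Gamma_module ::
    "('k, 's) ring_scheme \<Rightarrow> ('k, 'h, 'y) hopf_scheme \<Rightarrow> ('k, 'a, 'z) module_scheme
      \<Rightarrow> ('k, 'm, 'w) module_scheme \<Rightarrow> (('a \<times> 'h \<Rightarrow> 'k) set \<Rightarrow> 'm \<Rightarrow> 'm)
      \<Rightarrow> ('m \<Rightarrow> ('a \<times> 'h \<Rightarrow> 'k) set \<Rightarrow> 'm)
      \<Rightarrow> ((('a \<times> 'a \<Rightarrow> 'k) set \<times> 'h \<Rightarrow> 'k) set, 'm) module" where
  "smash_Gamma_module K H A M lact ract =
     Gamma_module K M
       (\<lambda>a. lact (tensor_elt K A H a \<one>\<^bsub>H\<^esub>))
       (\<lambda>m b. ract m (tensor_elt K A H b \<one>\<^bsub>H\<^esub>))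
       (\<lambda>h m. tensor_lift K M
          (\<lambda>(h1, h2). lact (tensor_elt K A H \<one>\<^bsub>A\<^esub> h1)
             (ract m (tensor_elt K A H \<one>\<^bsub>A\<^esub> (antipode H h2))))
          (comult H h))"

end

theory Submission
  imports Defs
begin

text \<open>An \<open>H\<close>-equivariant \<open>A\<close>-bimodule \<open>N\<close> induces a bimodule \<open>N \<otimes> H\<close> over \<open>R = A # H\<close>, and \<open>N \<mapsto> N \<otimes> H\<close> is
  left adjoint to the restriction of \<open>R\<close>-bimodules along \<open>h m = h\<^sub>1 m S(h\<^sub>2)\<close>. So the Hopf-Hochschild
  complex consists of the bimodule maps from \<open>B \<otimes> H\<close> to \<open>M\<close>, where \<open>B\<close> is the bar resolution of \<open>A\<close>.
  The complex \<open>B \<otimes> H\<close> resolves \<open>R\<close>, because \<open>B\<close> is contractible over \<open>K\<close>. Instead of proving that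
  its terms are projective one shows that maps out of them lift: since \<open>A\<^sup>n\<^sup>+\<^sup>2\<close> is free over the enveloping algebra of \<open>A\<close>
  on \<open>A\<^sup>n\<close>, a bimodule map out of \<open>A\<^sup>n\<^sup>+\<^sup>2 \<otimes> H\<close> is an \<open>H\<close>-linear map out of \<open>A\<^sup>n\<close>. The latter lifts linearly over
  the field \<open>K\<close>, and averaging over an integral \<open>t\<close> with \<open>\<epsilon>(t) = 1\<close>, which exists because \<open>H\<close> is
  semisimple, makes the lift \<open>H\<close>-linear. Hence \<open>B \<otimes> H\<close> is homotopy equivalent to any projective
  resolution of \<open>R\<close>.\<close>

text \<open>The adjunction rests on the identity h1 x S(h2) h3 = h x. In a bimodule over R the left
  action of H is thus determined by the adjoint action h1 x S(h2) and the right action of H, so an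
  equivariant map g on N extends by n \<otimes> h \<mapsto> g(n) h to a map that respects
  multiplication from both sides. The averaged lift is v \<mapsto> t1 g0(S(t2) v). Its H-linearity
  is h t1 \<otimes> S(t2) = t1 \<otimes> S(t2) h, a consequence of h t = \<epsilon>(h) t, and it
  remains a lift because t1 S(t2) = \<epsilon>(t) 1 = 1. Lifting can replace projectivity because
  the comparison of two resolutions only ever lifts maps through the differentials and augmentations
  of these two, whereas exhibiting the terms as summands of free modules would call for explicit
  splittings. The contraction v \<mapsto> 1 \<otimes> v of the bar resolution is in general not left
  A-linear, yet it stays a linear contraction after tensoring with H, and exactness asks for no
  more.\<close>

lemma module_imp_left_module: "module K V \<Longrightarrow> left_module K V"
  unfolding module_def module_axioms_def left_module_def left_module_axioms_def
  by (auto dest: cring.axioms(1))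

lemma left_module_imp_module: "cring K \<Longrightarrow> left_module K V \<Longrightarrow> module K V"
  unfolding module_def module_axioms_def left_module_def left_module_axioms_def
  by auto

lemma left_moduleI:
  assumes "ring R" "abelian_group M"
    and "\<And>r x. \<lbrakk>r \<in> carrier R; x \<in> carrier M\<rbrakk> \<Longrightarrow> r \<odot>\<^bsub>M\<^esub> x \<in> carrier M"
    and "\<And>r s x. \<lbrakk>r \<in> carrier R; s \<in> carrier R; x \<in> carrier M\<rbrakk>
        \<Longrightarrow> (r \<oplus>\<^bsub>R\<^esub> s) \<odot>\<^bsub>M\<^esub> x = r \<odot>\<^bsub>M\<^esub> x \<oplus>\<^bsub>M\<^esub> s \<odot>\<^bsub>M\<^esub> x"
    and "\<And>r x y. \<lbrakk>r \<in> carrier R; x \<in> carrier M; y \<in> carrier M\<rbrakk>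
        \<Longrightarrow> r \<odot>\<^bsub>M\<^esub> (x \<oplus>\<^bsub>M\<^esub> y) = r \<odot>\<^bsub>M\<^esub> x \<oplus>\<^bsub>M\<^esub> r \<odot>\<^bsub>M\<^esub> y"
    and "\<And>r s x. \<lbrakk>r \<in> carrier R; s \<in> carrier R; x \<in> carrier M\<rbrakk>
        \<Longrightarrow> (r \<otimes>\<^bsub>R\<^esub> s) \<odot>\<^bsub>M\<^esub> x = r \<odot>\<^bsub>M\<^esub> (s \<odot>\<^bsub>M\<^esub> x)"
    and "\<And>x. x \<in> carrier M \<Longrightarrow> \<one>\<^bsub>R\<^esub> \<odot>\<^bsub>M\<^esub> x = x"
  shows "left_module R M"
  using assms unfolding left_module_def left_module_axioms_def by auto

lemma (in left_module) left_module: "left_module R M" ..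

lemma (in left_module) lsmult_l_null: "x \<in> carrier M \<Longrightarrow> \<zero> \<odot>\<^bsub>M\<^esub> x = \<zero>\<^bsub>M\<^esub>"
proof -
  assume x: "x \<in> carrier M"
  have "\<zero> \<odot>\<^bsub>M\<^esub> x \<oplus>\<^bsub>M\<^esub> \<zero> \<odot>\<^bsub>M\<^esub> x = \<zero> \<odot>\<^bsub>M\<^esub> x"
    using x lsmult_l_distr[of \<zero> \<zero> x] lsmult_closed[of \<zero> x] by simp
  then show ?thesis using x lsmult_closed[of \<zero> x] by (simp del: M.r_zero add: M.add.l_cancel_one')
qed

lemma (in left_module) lsmult_r_null: "r \<in> carrier R \<Longrightarrow> r \<odot>\<^bsub>M\<^esub> \<zero>\<^bsub>M\<^esub> = \<zero>\<^bsub>M\<^esub>"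
proof -
  assume r: "r \<in> carrier R"
  have "r \<odot>\<^bsub>M\<^esub> \<zero>\<^bsub>M\<^esub> \<oplus>\<^bsub>M\<^esub> r \<odot>\<^bsub>M\<^esub> \<zero>\<^bsub>M\<^esub> = r \<odot>\<^bsub>M\<^esub> \<zero>\<^bsub>M\<^esub>"
    using r lsmult_r_distr[of r "\<zero>\<^bsub>M\<^esub>" "\<zero>\<^bsub>M\<^esub>"] lsmult_closed[of r "\<zero>\<^bsub>M\<^esub>"] by simp
  then show ?thesis using r lsmult_closed[of r "\<zero>\<^bsub>M\<^esub>"]
    by (simp del: M.r_zero add: M.add.l_cancel_one')
qed

lemma (in left_module) lsmult_r_minus:
  assumes "r \<in> carrier R" "x \<in> carrier M"
  shows "r \<odot>\<^bsub>M\<^esub> (\<ominus>\<^bsub>M\<^esub> x) = \<ominus>\<^bsub>M\<^esub> (r \<odot>\<^bsub>M\<^esub> x)"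
proof -
  have "r \<odot>\<^bsub>M\<^esub> (\<ominus>\<^bsub>M\<^esub> x) \<oplus>\<^bsub>M\<^esub> r \<odot>\<^bsub>M\<^esub> x = \<zero>\<^bsub>M\<^esub>"
    using assms lsmult_r_distr[of r "\<ominus>\<^bsub>M\<^esub> x" x] lsmult_r_null by (simp add: M.l_neg)
  then show ?thesis using assms M.add.inv_equality lsmult_closed by (simp add: M.minus_equality)
qed

lemma (in left_module) finsum_lsmult:
  assumes "finite S" "r \<in> carrier R" "f \<in> S \<rightarrow> carrier M"
  shows "r \<odot>\<^bsub>M\<^esub> (\<Oplus>\<^bsub>M\<^esub>x\<in>S. f x) = (\<Oplus>\<^bsub>M\<^esub>x\<in>S. r \<odot>\<^bsub>M\<^esub> f x)"
  using assms
proof (induction S rule: finite_induct)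
  case empty then show ?case by (simp add: lsmult_r_null)
next
  case (insert a S)
  then have "f a \<in> carrier M" "f \<in> S \<rightarrow> carrier M" by auto
  with insert show ?case
    by (subst M.finsum_insert; (subst M.finsum_insert)?)
       (auto simp: lsmult_r_distr lsmult_closed Pi_def)
qed

subsection \<open>Homomorphisms\<close>

lemma lmod_homI:
  assumes "\<And>x. x \<in> carrier M \<Longrightarrow> f x \<in> carrier N"
    "\<And>x y. \<lbrakk>x \<in> carrier M; y \<in> carrier M\<rbrakk> \<Longrightarrow> f (x \<oplus>\<^bsub>M\<^esub> y) = f x \<oplus>\<^bsub>N\<^esub> f y"
    "\<And>r x. \<lbrakk>r \<in> carrier R; x \<in> carrier M\<rbrakk> \<Longrightarrow> f (r \<odot>\<^bsub>M\<^esub> x) = r \<odot>\<^bsub>N\<^esub> f x"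
  shows "f \<in> lmod_hom R M N"
  using assms by (auto simp: lmod_hom_def)

lemma lmod_hom_closed: "f \<in> lmod_hom R M N \<Longrightarrow> x \<in> carrier M \<Longrightarrow> f x \<in> carrier N"
  and lmod_hom_add: "f \<in> lmod_hom R M N \<Longrightarrow> x \<in> carrier M \<Longrightarrow> y \<in> carrier M
      \<Longrightarrow> f (x \<oplus>\<^bsub>M\<^esub> y) = f x \<oplus>\<^bsub>N\<^esub> f y"
  and lmod_hom_smult: "f \<in> lmod_hom R M N \<Longrightarrow> r \<in> carrier R \<Longrightarrow> x \<in> carrier M
      \<Longrightarrow> f (r \<odot>\<^bsub>M\<^esub> x) = r \<odot>\<^bsub>N\<^esub> f x"
  by (auto simp: lmod_hom_def)

lemma lmod_hom_cong:
  assumes "left_module R M" "\<And>x. x \<in> carrier M \<Longrightarrow> f x = g x"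
  shows "f \<in> lmod_hom R M N \<longleftrightarrow> g \<in> lmod_hom R M N"
proof -
  interpret left_module R M by fact
  show ?thesis using assms(2) by (auto simp: lmod_hom_def lsmult_closed Pi_def)
qed

lemma lmod_hom_abelian_group_hom:
  assumes "left_module R M" "left_module R N" "f \<in> lmod_hom R M N"
  shows "abelian_group_hom M N f"
proof -
  interpret M: left_module R M by fact
  interpret N: left_module R N by fact
  show ?thesis
    by (intro abelian_group_homI M.M.abelian_group_axioms N.M.abelian_group_axioms group_hom.intro
        M.M.a_group N.M.a_group group_hom_axioms.intro homI)
       (use assms(3) in \<open>auto simp: lmod_hom_def\<close>)
qed

lemma lmod_hom_zero:
  assumes "left_module R M" "left_module R N" "f \<in> lmod_hom R M N"
  shows "f \<zero>\<^bsub>M\<^esub> = \<zero>\<^bsub>N\<^esub>"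
  using abelian_group_hom.hom_zero[OF lmod_hom_abelian_group_hom[OF assms]] .

lemma lmod_hom_a_inv:
  assumes "left_module R M" "left_module R N" "f \<in> lmod_hom R M N" "x \<in> carrier M"
  shows "f (\<ominus>\<^bsub>M\<^esub> x) = \<ominus>\<^bsub>N\<^esub> f x"
  using abelian_group_hom.hom_a_inv[OF lmod_hom_abelian_group_hom[OF assms(1-3)] assms(4)] .

lemma lmod_hom_comp:
  "f \<in> lmod_hom R M N \<Longrightarrow> g \<in> lmod_hom R N U \<Longrightarrow> (\<lambda>x. g (f x)) \<in> lmod_hom R M U"
  by (rule lmod_homI) (simp_all add: lmod_hom_closed lmod_hom_add lmod_hom_smult)

lemma lmod_hom_id: "(\<lambda>x. x) \<in> lmod_hom R M M"
  by (auto simp: lmod_hom_def)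

lemma lmod_hom_finsum:
  assumes "left_module R M" "left_module R N" "f \<in> lmod_hom R M N"
    and "finite S" "g \<in> S \<rightarrow> carrier M"
  shows "f (\<Oplus>\<^bsub>M\<^esub>x\<in>S. g x) = (\<Oplus>\<^bsub>N\<^esub>x\<in>S. f (g x))"
proof -
  interpret M: left_module R M by fact
  interpret N: left_module R N by fact
  show ?thesis using assms(4,5)
  proof (induction S rule: finite_induct)
    case empty then show ?case by (simp add: lmod_hom_zero[OF assms(1-3)])
  next
    case (insert a S)
    then have "g a \<in> carrier M" "g \<in> S \<rightarrow> carrier M" by auto
    with insert assms(3) show ?case
      by (subst M.M.finsum_insert; (subst N.M.finsum_insert)?)
         (auto simp: Pi_def lmod_hom_closed lmod_hom_add)
  qed
qed

lemma lmod_hom_kernel_submodule: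
  assumes "left_module R M" "left_module R N" "f \<in> lmod_hom R M N"
  shows "submodule {x \<in> carrier M. f x = \<zero>\<^bsub>N\<^esub>} R M"
proof -
  interpret M: left_module R M by fact
  interpret N: left_module R N by fact
  note z = lmod_hom_zero[OF assms] and i = lmod_hom_a_inv[OF assms]
  show ?thesis
  proof (intro submodule.intro subgroup.intro submodule_axioms.intro)
    show "inv\<^bsub>add_monoid M\<^esub> x \<in> {x \<in> carrier M. f x = \<zero>\<^bsub>N\<^esub>}" if "x \<in> {x \<in> carrier M. f x = \<zero>\<^bsub>N\<^esub>}" for x
      using that i[of x] unfolding a_inv_def[symmetric] by auto
  qed (use assms(3) z in \<open>auto simp: lmod_hom_add lmod_hom_smult M.lsmult_closed N.lsmult_r_null\<close>)
qed

subsection \<open>Free modules\<close>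

text \<open>The sum inside \<open>tensor_lift\<close>, taken at a function \<open>r\<close> instead
  of at a chosen element of a coset. Properties of \<open>tensor_lift\<close> are first proved for
  this linear map on the free module and then descend to the quotient.\<close>

definition free_ext ::
    "('r, 's) ring_scheme \<Rightarrow> ('r, 'u, 'z) module_scheme \<Rightarrow> ('x \<Rightarrow> 'u) \<Rightarrow> ('x \<Rightarrow> 'r) \<Rightarrow> 'u" where
  "free_ext R U \<phi> r = (\<Oplus>\<^bsub>U\<^esub> x \<in> {x. r x \<noteq> \<zero>\<^bsub>R\<^esub>}. r x \<odot>\<^bsub>U\<^esub> \<phi> x)"

lemma free_module_sel [simp]:
  "\<zero>\<^bsub>free_module R X\<^esub> = (\<lambda>x. \<zero>\<^bsub>R\<^esub>)"
  "f \<oplus>\<^bsub>free_module R X\<^esub> g = (\<lambda>x. f x \<oplus>\<^bsub>R\<^esub> g x)"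
  "r \<odot>\<^bsub>free_module R X\<^esub> f = (\<lambda>x. r \<otimes>\<^bsub>R\<^esub> f x)"
  by (simp_all add: free_module_def)

lemma free_module_left_module:
  fixes R (structure)
  assumes "ring R" shows "left_module R (free_module R X)"
proof -
  interpret ring R by fact
  let ?F = "free_module R X"
  have ag: "abelian_group ?F"
  proof (rule abelian_groupI)
    fix f g assume "f \<in> carrier ?F" "g \<in> carrier ?F"
    then have "finite ({x. f x \<noteq> \<zero>} \<union> {x. g x \<noteq> \<zero>})" by (simp add: free_module_def)
    then have "finite {x. f x \<oplus> g x \<noteq> \<zero>}" by (rule rev_finite_subset) auto
    then show "f \<oplus>\<^bsub>?F\<^esub> g \<in> carrier ?F"
      using \<open>f \<in> _\<close> \<open>g \<in> _\<close> by (auto simp: free_module_def)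
  next
    fix f assume f: "f \<in> carrier ?F"
    have c: "f x \<in> carrier R" for x using f by (cases "x \<in> X") (auto simp: free_module_def)
    have "(\<lambda>x. \<ominus> f x) \<in> carrier ?F"
      using f by (auto simp: free_module_def elim!: rev_finite_subset)
    then show "\<exists>g\<in>carrier ?F. g \<oplus>\<^bsub>?F\<^esub> f = \<zero>\<^bsub>?F\<^esub>"
      by (intro bexI[of _ "\<lambda>x. \<ominus> f x"]) (auto simp: c l_neg)
  next
    fix f g h assume a: "f \<in> carrier ?F" "g \<in> carrier ?F" "h \<in> carrier ?F"
    have c: "f x \<in> carrier R" "g x \<in> carrier R" "h x \<in> carrier R" for x
      using a by (cases "x \<in> X"; auto simp: free_module_def)+
    show "(f \<oplus>\<^bsub>?F\<^esub> g) \<oplus>\<^bsub>?F\<^esub> h = f \<oplus>\<^bsub>?F\<^esub> (g \<oplus>\<^bsub>?F\<^esub> h)" by (simp add: c a_assoc)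
  next
    fix f g assume a: "f \<in> carrier ?F" "g \<in> carrier ?F"
    have c: "f x \<in> carrier R" "g x \<in> carrier R" for x
      using a by (cases "x \<in> X"; auto simp: free_module_def)+
    show "f \<oplus>\<^bsub>?F\<^esub> g = g \<oplus>\<^bsub>?F\<^esub> f" by (simp add: c a_comm)
  next
    fix f assume a: "f \<in> carrier ?F"
    have c: "f x \<in> carrier R" for x using a by (cases "x \<in> X"; auto simp: free_module_def)
    show "\<zero>\<^bsub>?F\<^esub> \<oplus>\<^bsub>?F\<^esub> f = f" by (simp add: c)
  qed (auto simp: free_module_def)
  have c: "f x \<in> carrier R" if "f \<in> carrier ?F" for f x
    using that by (cases "x \<in> X"; auto simp: free_module_def)
  show ?thesis
  proof (rule left_moduleI[OF assms ag])
    fix r f assume "r \<in> carrier R" "f \<in> carrier ?F"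
    then show "r \<odot>\<^bsub>?F\<^esub> f \<in> carrier ?F"
      by (auto simp: free_module_def elim!: rev_finite_subset)
  qed (auto simp: c l_distr r_distr m_assoc)
qed

lemma free_module_carrierD:
  assumes "ring R" "f \<in> carrier (free_module R X)"
  shows "f x \<in> carrier R" "finite {x. f x \<noteq> \<zero>\<^bsub>R\<^esub>}" "{x. f x \<noteq> \<zero>\<^bsub>R\<^esub>} \<subseteq> X"
proof -
  interpret ring R by fact
  show "f x \<in> carrier R" using assms(2) by (cases "x \<in> X") (auto simp: free_module_def)
qed (use assms(2) in \<open>auto simp: free_module_def\<close>)

lemma free_basis_closed: "ring R \<Longrightarrow> x \<in> X \<Longrightarrow> free_basis R x \<in> carrier (free_module R X)"
  unfolding free_module_def free_basis_def
  by (auto simp: ring.ring_simprules intro: rev_finite_subset[of "{x}"])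

text \<open>Functions with different supports have to be summed over one common finite set before
  additivity becomes visible; the extra points contribute zero scalars.\<close>

lemma free_ext_superset:
  assumes "left_module R U" "\<phi> \<in> X \<rightarrow> carrier U" "r \<in> carrier (free_module R X)"
    "finite S" "{x. r x \<noteq> \<zero>\<^bsub>R\<^esub>} \<subseteq> S" "S \<subseteq> X"
  shows "free_ext R U \<phi> r = (\<Oplus>\<^bsub>U\<^esub> x \<in> S. r x \<odot>\<^bsub>U\<^esub> \<phi> x)"
proof -
  interpret left_module R U by fact
  note r = free_module_carrierD[OF R.ring_axioms assms(3)]
  show ?thesis unfolding free_ext_def
    by (rule M.add.finprod_mono_neutral_cong_left)
       (use assms r in \<open>auto simp: Pi_def subset_eq lsmult_l_null intro!: lsmult_closed\<close>)
qed

lemma free_ext_hom: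
  assumes "left_module R U" "\<phi> \<in> X \<rightarrow> carrier U"
  shows "free_ext R U \<phi> \<in> lmod_hom R (free_module R X) U"
proof -
  interpret left_module R U by fact
  interpret F: left_module R "free_module R X" by (rule free_module_left_module) (rule R.ring_axioms)
  note D = free_module_carrierD[OF R.ring_axioms]
  have cl: "(\<lambda>x. r x \<odot>\<^bsub>U\<^esub> \<phi> x) \<in> S \<rightarrow> carrier U" if "r \<in> carrier (free_module R X)" "S \<subseteq> X" for r S
    using that assms(2) D(1)[of r X] by (auto intro!: lsmult_closed)
  show ?thesis
  proof (rule lmod_homI)
    fix r assume r: "r \<in> carrier (free_module R X)"
    show "free_ext R U \<phi> r \<in> carrier U" unfolding free_ext_def
      by (rule M.finsum_closed) (use cl[OF r D(3)[OF r]] in auto)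
  next
    fix r s assume r: "r \<in> carrier (free_module R X)" and s: "s \<in> carrier (free_module R X)"
    let ?S = "{x. r x \<noteq> \<zero>\<^bsub>R\<^esub>} \<union> {x. s x \<noteq> \<zero>\<^bsub>R\<^esub>}"
    have S: "finite ?S" "?S \<subseteq> X" using D(2,3)[OF r] D(2,3)[OF s] by auto
    have rs: "r \<oplus>\<^bsub>free_module R X\<^esub> s \<in> carrier (free_module R X)" using r s by (rule F.M.a_closed)
    have "free_ext R U \<phi> (r \<oplus>\<^bsub>free_module R X\<^esub> s)
        = (\<Oplus>\<^bsub>U\<^esub> x \<in> ?S. (r x \<oplus>\<^bsub>R\<^esub> s x) \<odot>\<^bsub>U\<^esub> \<phi> x)"
      by (subst free_ext_superset[OF assms rs S(1) _ S(2)]) auto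
    also have "\<dots> = (\<Oplus>\<^bsub>U\<^esub> x \<in> ?S. r x \<odot>\<^bsub>U\<^esub> \<phi> x \<oplus>\<^bsub>U\<^esub> s x \<odot>\<^bsub>U\<^esub> \<phi> x)"
      by (rule M.finsum_cong', rule refl)
         (use S assms(2) D(1)[OF r] D(1)[OF s] in \<open>auto simp: lsmult_l_distr lsmult_closed Pi_def subset_eq\<close>)
    also have "\<dots> = free_ext R U \<phi> r \<oplus>\<^bsub>U\<^esub> free_ext R U \<phi> s"
      using cl[OF r S(2)] cl[OF s S(2)] S
      by (simp add: M.finsum_addf free_ext_superset[OF assms r, of ?S] free_ext_superset[OF assms s, of ?S])
    finally show "free_ext R U \<phi> (r \<oplus>\<^bsub>free_module R X\<^esub> s) = free_ext R U \<phi> r \<oplus>\<^bsub>U\<^esub> free_ext R U \<phi> s" .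
  next
    fix a r assume a: "a \<in> carrier R" and r: "r \<in> carrier (free_module R X)"
    let ?S = "{x. r x \<noteq> \<zero>\<^bsub>R\<^esub>}"
    have S: "finite ?S" "?S \<subseteq> X" using D(2,3)[OF r] by auto
    have "free_ext R U \<phi> (a \<odot>\<^bsub>free_module R X\<^esub> r) = (\<Oplus>\<^bsub>U\<^esub> x \<in> ?S. (a \<otimes>\<^bsub>R\<^esub> r x) \<odot>\<^bsub>U\<^esub> \<phi> x)"
      by (subst free_ext_superset[OF assms F.lsmult_closed[OF a r] S(1) _ S(2)]) (use a in auto)
    also have "\<dots> = (\<Oplus>\<^bsub>U\<^esub> x \<in> ?S. a \<odot>\<^bsub>U\<^esub> (r x \<odot>\<^bsub>U\<^esub> \<phi> x))"
      by (rule M.finsum_cong', rule refl)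
         (use S assms(2) D(1)[OF r] a in \<open>auto simp: lsmult_assoc lsmult_closed Pi_def subset_eq\<close>)
    also have "\<dots> = a \<odot>\<^bsub>U\<^esub> free_ext R U \<phi> r"
      unfolding free_ext_def by (rule finsum_lsmult[symmetric]) (use S cl[OF r S(2)] a in auto)
    finally show "free_ext R U \<phi> (a \<odot>\<^bsub>free_module R X\<^esub> r) = a \<odot>\<^bsub>U\<^esub> free_ext R U \<phi> r" .
  qed
qed

lemma free_ext_basis:
  assumes "left_module R U" "\<phi> \<in> X \<rightarrow> carrier U" "x \<in> X"
  shows "free_ext R U \<phi> (free_basis R x) = \<phi> x"
proof -
  interpret left_module R U by fact
  have "free_ext R U \<phi> (free_basis R x) = (\<Oplus>\<^bsub>U\<^esub> y \<in> {x}. free_basis R x y \<odot>\<^bsub>U\<^esub> \<phi> y)"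
    by (rule free_ext_superset[OF assms(1,2) free_basis_closed])
       (use assms(3) in \<open>auto simp: R.ring_axioms free_basis_def\<close>)
  then show ?thesis using assms(2,3) by (auto simp: free_basis_def lsmult_one Pi_def)
qed

text \<open>Induction on the size of the support: setting \<open>r\<close> to zero at one point of
  it leaves a smaller function and splits off a multiple of a basis vector.\<close>

lemma free_module_induct [consumes 2, case_names zero add]:
  fixes R (structure)
  assumes "ring R" "r \<in> carrier (free_module R X)"
    and "P (\<lambda>x. \<zero>\<^bsub>R\<^esub>)"
    and "\<And>r a x. \<lbrakk>r \<in> carrier (free_module R X); P r; a \<in> carrier R; x \<in> X\<rbrakk>
      \<Longrightarrow> P (r \<oplus>\<^bsub>free_module R X\<^esub> a \<odot>\<^bsub>free_module R X\<^esub> free_basis R x)"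
  shows "P r"
proof -
  interpret ring R by fact
  note D = free_module_carrierD[OF assms(1)]
  show ?thesis using assms(2)
  proof (induction "card {x. r x \<noteq> \<zero>}" arbitrary: r)
    case 0
    then have "r = (\<lambda>x. \<zero>)" using D(2)[OF 0(2)] by auto
    then show ?case using assms(3) by simp
  next
    case (Suc n)
    then have "{x. r x \<noteq> \<zero>} \<noteq> {}" by (metis card.empty nat.distinct(1))
    then obtain x where x: "r x \<noteq> \<zero>" by auto
    then have xX: "x \<in> X" using D(3)[OF Suc(3)] by auto
    define s where "s = r(x := \<zero>)"
    have s: "s \<in> carrier (free_module R X)"
      using Suc(3) xX by (auto simp: s_def free_module_def elim!: rev_finite_subset)
    have e: "{x. s x \<noteq> \<zero>} = {x. r x \<noteq> \<zero>} - {x}" by (auto simp: s_def)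
    have "card {x. s x \<noteq> \<zero>} = n"
      unfolding e using Suc(2) D(2)[OF Suc(3)] x by (simp add: card_Diff_singleton)
    then have "P s" using Suc(1) s by blast
    moreover have "r = s \<oplus>\<^bsub>free_module R X\<^esub> r x \<odot>\<^bsub>free_module R X\<^esub> free_basis R x"
      using D(1)[OF Suc(3)] by (auto simp: s_def free_basis_def fun_eq_iff)
    ultimately show ?case using assms(4)[OF s _ D(1)[OF Suc(3)] xX] by metis
  qed
qed

lemma free_module_hom_ext:
  assumes "left_module R U" "f \<in> lmod_hom R (free_module R X) U" "g \<in> lmod_hom R (free_module R X) U"
    and eq: "\<And>x. x \<in> X \<Longrightarrow> f (free_basis R x) = g (free_basis R x)"
    and r: "r \<in> carrier (free_module R X)"
  shows "f r = g r"
proof -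
  interpret left_module R U by fact
  interpret F: left_module R "free_module R X" by (rule free_module_left_module) (rule R.ring_axioms)
  show ?thesis using R.ring_axioms r
  proof (induction r rule: free_module_induct)
    case zero
    then show ?case using lmod_hom_zero[OF F.left_module left_module assms(2)]
        lmod_hom_zero[OF F.left_module left_module assms(3)] by simp
  next
    case (add r a x)
    then have "free_basis R x \<in> carrier (free_module R X)"
      by (simp add: free_basis_closed R.ring_axioms)
    then show ?case using add assms(2,3) eq
      by (simp only: lmod_hom_add lmod_hom_smult F.lsmult_closed)
  qed
qed

lemma hom_free_ext:
  assumes "left_module R U" "left_module R U'" "g \<in> lmod_hom R U U'" "\<phi> \<in> X \<rightarrow> carrier U"
    "r \<in> carrier (free_module R X)"
  shows "g (free_ext R U \<phi> r) = free_ext R U' (\<lambda>x. g (\<phi> x)) r"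
proof -
  have c: "(\<lambda>x. g (\<phi> x)) \<in> X \<rightarrow> carrier U'" using assms by (auto simp: lmod_hom_closed Pi_def)
  show ?thesis
    by (rule free_module_hom_ext[OF assms(2) lmod_hom_comp[OF free_ext_hom[OF assms(1,4)] assms(3)]
          free_ext_hom[OF assms(2) c] _ assms(5)])
       (simp add: free_ext_basis[OF assms(1,4)] free_ext_basis[OF assms(2) c])
qed

lemma free_ext_cong:
  assumes "left_module R U" "\<phi> \<in> X \<rightarrow> carrier U" "\<And>x. x \<in> X \<Longrightarrow> \<phi> x = \<psi> x"
    "r \<in> carrier (free_module R X)"
  shows "free_ext R U \<phi> r = free_ext R U \<psi> r"
proof -
  have c: "\<psi> \<in> X \<rightarrow> carrier U" using assms by (auto simp: Pi_def)
  show ?thesis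
    by (rule free_module_hom_ext[OF assms(1) free_ext_hom[OF assms(1,2)] free_ext_hom[OF assms(1) c] _ assms(4)])
       (simp add: free_ext_basis[OF assms(1,2)] free_ext_basis[OF assms(1) c] assms(3))
qed

subsection \<open>Quotients\<close>

lemma submodule_abelian_subgroup:
  assumes "left_module R V" "submodule N R V" shows "abelian_subgroup N V"
proof -
  interpret left_module R V by fact
  interpret submodule N R V by fact
  show ?thesis
    by (intro abelian_subgroupI3 additive_subgroupI subgroup_axioms M.abelian_group_axioms)
qed

lemma quotient_module_sel:
  "\<zero>\<^bsub>quotient_module V N\<^esub> = N"
  "C \<oplus>\<^bsub>quotient_module V N\<^esub> D = C <+>\<^bsub>V\<^esub> D"
  "carrier (quotient_module V N) = a_rcosets\<^bsub>V\<^esub> N"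
  "r \<odot>\<^bsub>quotient_module V N\<^esub> C = (\<Union>x\<in>C. N +>\<^bsub>V\<^esub> (r \<odot>\<^bsub>V\<^esub> x))"
  by (simp_all add: quotient_module_def)

lemma quotient_module_carrierE:
  assumes "C \<in> carrier (quotient_module V N)"
  obtains x where "x \<in> carrier V" "C = N +>\<^bsub>V\<^esub> x"
  using assms by (auto simp: quotient_module_def A_RCOSETS_def')

lemma quotient_module_carrierI: "x \<in> carrier V \<Longrightarrow> N +>\<^bsub>V\<^esub> x \<in> carrier (quotient_module V N)"
  by (auto simp: quotient_module_def A_RCOSETS_def')

lemma quotient_module_eq_iff:
  assumes "left_module R V" "submodule N R V" "x \<in> carrier V" "y \<in> carrier V"
  shows "N +>\<^bsub>V\<^esub> x = N +>\<^bsub>V\<^esub> y \<longleftrightarrow> x \<ominus>\<^bsub>V\<^esub> y \<in> N"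
proof -
  interpret abelian_subgroup N V by (rule submodule_abelian_subgroup) fact+
  have "N +>\<^bsub>V\<^esub> x = N +>\<^bsub>V\<^esub> y \<longleftrightarrow> x \<in> N +>\<^bsub>V\<^esub> y"
    using a_repr_independence' a_rcos_self assms(3,4) by metis
  then show ?thesis using a_rcos_module[OF assms(4,3)] by (simp add: a_minus_def)
qed

text \<open>The action on cosets is defined as a union over all representatives. This union is a
  single coset, because two representatives differ by an element of \<open>N\<close> and
  \<open>r\<close> maps \<open>N\<close> into itself.\<close>

lemma quotient_module_smult:
  assumes "left_module R V" "submodule N R V" "x \<in> carrier V" "r \<in> carrier R"
  shows "r \<odot>\<^bsub>quotient_module V N\<^esub> (N +>\<^bsub>V\<^esub> x) = N +>\<^bsub>V\<^esub> (r \<odot>\<^bsub>V\<^esub> x)"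
proof -
  interpret V: left_module R V by fact
  interpret abelian_subgroup N V by (rule submodule_abelian_subgroup) fact+
  interpret N: submodule N R V by fact
  have eq: "N +>\<^bsub>V\<^esub> (r \<odot>\<^bsub>V\<^esub> y) = N +>\<^bsub>V\<^esub> (r \<odot>\<^bsub>V\<^esub> x)" if "y \<in> N +>\<^bsub>V\<^esub> x" for y
  proof -
    have y: "y \<in> carrier V" using that assms(3) by (meson a_elemrcos_carrier)
    have "y \<ominus>\<^bsub>V\<^esub> x \<in> N" using that a_rcos_module[OF assms(3) y] by (simp add: a_minus_def)
    then have "r \<odot>\<^bsub>V\<^esub> (y \<ominus>\<^bsub>V\<^esub> x) \<in> N" using assms(4) by simp
    then show ?thesis using y assms
      by (simp add: quotient_module_eq_iff V.lsmult_closed V.lsmult_r_distr V.lsmult_r_minus a_minus_def)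
  qed
  have "(\<Union>y\<in>N +>\<^bsub>V\<^esub> x. N +>\<^bsub>V\<^esub> (r \<odot>\<^bsub>V\<^esub> y)) = N +>\<^bsub>V\<^esub> (r \<odot>\<^bsub>V\<^esub> x)"
    using a_rcos_self[OF assms(3)] by (intro SUP_eq_const eq) blast+
  then show ?thesis unfolding quotient_module_sel .
qed

lemma quotient_module_add:
  assumes "left_module R V" "submodule N R V" "x \<in> carrier V" "y \<in> carrier V"
  shows "(N +>\<^bsub>V\<^esub> x) \<oplus>\<^bsub>quotient_module V N\<^esub> (N +>\<^bsub>V\<^esub> y) = N +>\<^bsub>V\<^esub> (x \<oplus>\<^bsub>V\<^esub> y)"
  unfolding quotient_module_sel
  by (rule abelian_subgroup.a_rcos_sum[OF submodule_abelian_subgroup[OF assms(1,2)] assms(3,4)])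

lemma quotient_module_zero:
  assumes "left_module R V" "submodule N R V"
  shows "N +>\<^bsub>V\<^esub> \<zero>\<^bsub>V\<^esub> = N"
proof -
  interpret abelian_subgroup N V by (rule submodule_abelian_subgroup) fact+
  show ?thesis by (simp add: a_subset)
qed

lemma quotient_module_left_module:
  assumes "left_module R V" "submodule N R V"
  shows "left_module R (quotient_module V N)"
proof -
  interpret V: left_module R V by fact
  interpret abelian_subgroup N V by (rule submodule_abelian_subgroup) fact+
  let ?Q = "quotient_module V N"
  note q = quotient_module_add[OF assms] quotient_module_smult[OF assms]
  note I = quotient_module_carrierI[of _ V N] and z = quotient_module_zero[OF assms]
  have zero: "\<zero>\<^bsub>?Q\<^esub> = N +>\<^bsub>V\<^esub> \<zero>\<^bsub>V\<^esub>" unfolding quotient_module_sel by (rule z[symmetric])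
  have ag: "abelian_group ?Q"
  proof (rule abelian_groupI)
    show "\<zero>\<^bsub>?Q\<^esub> \<in> carrier ?Q" unfolding zero by (rule I) simp
  next
    fix x assume "x \<in> carrier ?Q"
    then obtain u where u: "u \<in> carrier V" "x = N +>\<^bsub>V\<^esub> u" by (rule quotient_module_carrierE)
    have "(N +>\<^bsub>V\<^esub> (\<ominus>\<^bsub>V\<^esub> u)) \<oplus>\<^bsub>?Q\<^esub> x = \<zero>\<^bsub>?Q\<^esub>"
      unfolding zero using u by (simp only: q V.M.a_inv_closed V.M.l_neg)
    then show "\<exists>y\<in>carrier ?Q. y \<oplus>\<^bsub>?Q\<^esub> x = \<zero>\<^bsub>?Q\<^esub>"
      using I[OF V.M.a_inv_closed[OF u(1)]] by (rule bexI)
    show "\<zero>\<^bsub>?Q\<^esub> \<oplus>\<^bsub>?Q\<^esub> x = x"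
      unfolding zero using u by (simp only: q V.M.zero_closed V.M.l_zero)
  next
    fix x y assume "x \<in> carrier ?Q" "y \<in> carrier ?Q"
    then obtain u v where "u \<in> carrier V" "x = N +>\<^bsub>V\<^esub> u" "v \<in> carrier V" "y = N +>\<^bsub>V\<^esub> v"
      by (elim quotient_module_carrierE) blast
    then show "x \<oplus>\<^bsub>?Q\<^esub> y \<in> carrier ?Q" "x \<oplus>\<^bsub>?Q\<^esub> y = y \<oplus>\<^bsub>?Q\<^esub> x"
      by (simp_all only: q I V.M.a_closed V.M.a_comm)
  next
    fix x y z assume "x \<in> carrier ?Q" "y \<in> carrier ?Q" "z \<in> carrier ?Q"
    then obtain u v w where "u \<in> carrier V" "x = N +>\<^bsub>V\<^esub> u" "v \<in> carrier V" "y = N +>\<^bsub>V\<^esub> v"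
      "w \<in> carrier V" "z = N +>\<^bsub>V\<^esub> w"
      by (elim quotient_module_carrierE) blast
    then show "x \<oplus>\<^bsub>?Q\<^esub> y \<oplus>\<^bsub>?Q\<^esub> z = x \<oplus>\<^bsub>?Q\<^esub> (y \<oplus>\<^bsub>?Q\<^esub> z)"
      by (simp only: q V.M.a_assoc V.M.a_closed)
  qed
  show ?thesis
  proof (rule left_moduleI[OF V.R.ring_axioms ag])
    fix r x assume r: "r \<in> carrier R" "x \<in> carrier ?Q"
    then obtain u where u: "u \<in> carrier V" "x = N +>\<^bsub>V\<^esub> u" by (auto elim: quotient_module_carrierE)
    then show "r \<odot>\<^bsub>?Q\<^esub> x \<in> carrier ?Q" using r by (simp only: q I V.lsmult_closed)
  next
    fix x assume "x \<in> carrier ?Q"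
    then obtain u where u: "u \<in> carrier V" "x = N +>\<^bsub>V\<^esub> u" by (rule quotient_module_carrierE)
    then show "\<one>\<^bsub>R\<^esub> \<odot>\<^bsub>?Q\<^esub> x = x" by (simp only: q V.R.one_closed V.lsmult_one)
  next
    fix r x y assume r: "r \<in> carrier R" and "x \<in> carrier ?Q" "y \<in> carrier ?Q"
    then obtain u v where "u \<in> carrier V" "x = N +>\<^bsub>V\<^esub> u" "v \<in> carrier V" "y = N +>\<^bsub>V\<^esub> v"
      by (elim quotient_module_carrierE) blast
    with r show "r \<odot>\<^bsub>?Q\<^esub> (x \<oplus>\<^bsub>?Q\<^esub> y) = r \<odot>\<^bsub>?Q\<^esub> x \<oplus>\<^bsub>?Q\<^esub> r \<odot>\<^bsub>?Q\<^esub> y"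
      by (simp only: q V.lsmult_closed V.M.a_closed V.lsmult_r_distr)
  next
    fix r s x assume r: "r \<in> carrier R" "s \<in> carrier R" and "x \<in> carrier ?Q"
    then obtain u where u: "u \<in> carrier V" "x = N +>\<^bsub>V\<^esub> u" by (elim quotient_module_carrierE)
    with r show "(r \<oplus>\<^bsub>R\<^esub> s) \<odot>\<^bsub>?Q\<^esub> x = r \<odot>\<^bsub>?Q\<^esub> x \<oplus>\<^bsub>?Q\<^esub> s \<odot>\<^bsub>?Q\<^esub> x"
      "(r \<otimes>\<^bsub>R\<^esub> s) \<odot>\<^bsub>?Q\<^esub> x = r \<odot>\<^bsub>?Q\<^esub> (s \<odot>\<^bsub>?Q\<^esub> x)"
      by (simp_all only: q V.lsmult_closed V.M.a_closed V.R.a_closed V.R.m_closed V.lsmult_l_distr V.lsmult_assoc)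
  qed
qed

lemma quotient_proj_hom:
  assumes "left_module R V" "submodule N R V"
  shows "(\<lambda>x. N +>\<^bsub>V\<^esub> x) \<in> lmod_hom R V (quotient_module V N)"
  by (rule lmod_homI)
     (simp_all only: quotient_module_carrierI quotient_module_smult[OF assms] quotient_module_add[OF assms])

text \<open>The whole module is a submodule containing \<open>G\<close>, so the intersection runs
  over a nonempty family; an empty one would give the whole type.\<close>

lemma submodule_span_submodule:
  assumes "left_module R V" "G \<subseteq> carrier V"
  shows "submodule (submodule_span R V G) R V"
proof -
  interpret V: left_module R V by fact
  have "submodule (carrier V) R V"
    by (intro submodule.intro submodule_axioms.intro V.M.add.subgroup_self V.lsmult_closed)
  then have ne: "carrier V \<in> {N. submodule N R V \<and> G \<subseteq> N}" using assms by auto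
  have sg: "subgroup N (add_monoid V)" "\<And>r x. r \<in> carrier R \<Longrightarrow> x \<in> N \<Longrightarrow> r \<odot>\<^bsub>V\<^esub> x \<in> N"
    if "submodule N R V" for N
    using submodule.axioms(1)[OF that] submodule.smult_closed[OF that] by auto
  show ?thesis unfolding submodule_span_def
  proof (intro submodule.intro submodule_axioms.intro)
    show "subgroup (\<Inter> {N. submodule N R V \<and> G \<subseteq> N}) (add_monoid V)"
      by (rule V.M.add.subgroups_Inter) (use ne sg in auto)
  qed (use sg in auto)
qed

lemma submodule_span_least: "submodule N R V \<Longrightarrow> G \<subseteq> N \<Longrightarrow> submodule_span R V G \<subseteq> N"
  by (auto simp: submodule_span_def)

lemma submodule_span_incl: "G \<subseteq> submodule_span R V G"
  by (auto simp: submodule_span_def)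

subsection \<open>Tensor products\<close>

lemma (in abelian_group) eq_if_minus_zero:
  assumes "x \<ominus> y = \<zero>" "x \<in> carrier G" "y \<in> carrier G" shows "x = y"
  using minus_equality[of x "\<ominus> y"] assms by (simp add: a_minus_def)

definition bilin where
  "bilin K V W U \<beta> \<longleftrightarrow> (\<forall>v\<in>carrier V. \<beta> v \<in> lmod_hom K W U) \<and>
     (\<forall>w\<in>carrier W. (\<lambda>v. \<beta> v w) \<in> lmod_hom K V U)"

definition "tuples V n = {vs. set vs \<subseteq> carrier V \<and> length vs = n}"

text \<open>The varying slot is described by a splitting \<open>ys @ v # zs\<close> and not by an
  index and a list update as in \<open>tpower_relations\<close>: splittings behave well when tuples
  grow at either end. \<open>multilin_upd\<close> translates.\<close>

definition multilin where
  "multilin K V n U \<phi> \<longleftrightarrow> (\<forall>vs. set vs \<subseteq> carrier V \<longrightarrow> length vs = n \<longrightarrow> \<phi> vs \<in> carrier U) \<and>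
     (\<forall>ys zs. set ys \<subseteq> carrier V \<longrightarrow> set zs \<subseteq> carrier V \<longrightarrow> Suc (length ys + length zs) = n
        \<longrightarrow> (\<lambda>v. \<phi> (ys @ v # zs)) \<in> lmod_hom K V U)"

lemma bilinI:
  assumes "\<And>v. v \<in> carrier V \<Longrightarrow> (\<lambda>w. \<beta> v w) \<in> lmod_hom K W U"
    "\<And>w. w \<in> carrier W \<Longrightarrow> (\<lambda>v. \<beta> v w) \<in> lmod_hom K V U"
  shows "bilin K V W U \<beta>"
  using assms by (simp add: bilin_def)

lemma bilinD:
  assumes "bilin K V W U \<beta>"
  shows "v \<in> carrier V \<Longrightarrow> (\<lambda>w. \<beta> v w) \<in> lmod_hom K W U"
    "w \<in> carrier W \<Longrightarrow> (\<lambda>v. \<beta> v w) \<in> lmod_hom K V U"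
    "v \<in> carrier V \<Longrightarrow> w \<in> carrier W \<Longrightarrow> \<beta> v w \<in> carrier U"
  using assms by (auto simp: bilin_def dest: lmod_hom_closed)

text \<open>Binary tensor products and tensor powers are both quotients of a free module by the span
  of some relations \<open>G\<close>. The universal property is proved once at this level and
  specialised through \<open>tensor_fquot\<close> and \<open>tpower_fquot\<close>.\<close>

definition fquot where
  "fquot K X G = quotient_module (free_module K X) (submodule_span K (free_module K X) G)"

definition fclass where
  "fclass K X G r = submodule_span K (free_module K X) G +>\<^bsub>free_module K X\<^esub> r"

text \<open>The Sweedler sum of \<beta>(h1, h2). The space \<open>U\<close> of values is an argument
  because the addition that forms the sum is taken from its record.\<close>

definition sw where
  "sw K H U \<beta> h = tensor_lift K U (\<lambda>(x, y). \<beta> x y) (comult H h)"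

text \<open>Rules that read off linearity in one variable from the shape of an expression. They
  allow linear maps \<open>g\<close> in the inner positions, so that nested expressions decompose by
  resolution. Rewriting with the Hopf algebra laws under a Sweedler sum produces such side
  conditions.\<close>

named_theorems lin_intros

locale lin_alg =
  fixes K :: "('k, 's) ring_scheme"
  assumes K_cring: "cring K"
begin

lemma K_ring: "ring K" using K_cring by (rule cring.axioms(1))

lemma lmodule: "module K V \<Longrightarrow> left_module K V" by (rule module_imp_left_module)
lemma vmodule: "left_module K V \<Longrightarrow> module K V" by (rule left_module_imp_module[OF K_cring])

abbreviation "lin \<equiv> lmod_hom K"

lemma lin_id [lin_intros]: "(\<lambda>x. x) \<in> lin V V" by (rule lmod_hom_id)

lemma lin_smult [lin_intros]:
  assumes "module K U" "c \<in> carrier K" "g \<in> lin V U"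
  shows "(\<lambda>v. c \<odot>\<^bsub>U\<^esub> g v) \<in> lin V U"
proof -
  interpret module K U by fact
  show ?thesis
    by (rule lmod_homI)
       (use assms(2,3) in \<open>simp_all add: lmod_hom_closed lmod_hom_add lmod_hom_smult smult_r_distr R.m_comm
          flip: smult_assoc1\<close>)
qed

lemma lin_add:
  assumes "module K U" "f \<in> lin V U" "g \<in> lin V U"
  shows "(\<lambda>v. f v \<oplus>\<^bsub>U\<^esub> g v) \<in> lin V U"
proof -
  interpret module K U by fact
  show ?thesis
    by (rule lmod_homI)
       (use assms(2,3) in \<open>simp_all add: lmod_hom_closed lmod_hom_add lmod_hom_smult smult_r_distr M.a_ac\<close>)
qed

lemma lin_minus:
  assumes "module K U" "f \<in> lin V U" "g \<in> lin V U"
  shows "(\<lambda>v. f v \<ominus>\<^bsub>U\<^esub> g v) \<in> lin V U"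
proof -
  interpret module K U by fact
  have m: "(\<lambda>v. \<ominus>\<^bsub>U\<^esub> g v) \<in> lin V U"
    by (rule lmod_homI)
       (use assms(2,3) in \<open>simp_all add: lmod_hom_closed lmod_hom_add lmod_hom_smult smult_r_minus M.minus_add\<close>)
  show ?thesis using lin_add[OF assms(1,2) m] by (simp add: a_minus_def)
qed

lemma lin_zero:
  assumes "module K U" shows "(\<lambda>v. \<zero>\<^bsub>U\<^esub>) \<in> lin V U"
proof -
  interpret module K U by fact
  show ?thesis by (rule lmod_homI) simp_all
qed

subsubsection \<open>Quotients of free modules\<close>

context
  fixes X :: "'x set" and G :: "('x \<Rightarrow> 'k) set"
  assumes G: "G \<subseteq> carrier (free_module K X)"
begin

abbreviation (input) "FX \<equiv> free_module K X"
abbreviation (input) "SX \<equiv> submodule_span K FX G"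

lemma F_left_module: "left_module K FX" by (rule free_module_left_module[OF K_ring])
lemma S_submodule: "submodule SX K FX" by (rule submodule_span_submodule[OF F_left_module G])

lemma fquot_left_module: "left_module K (fquot K X G)"
  unfolding fquot_def by (rule quotient_module_left_module[OF F_left_module S_submodule])

lemma fquot_module: "module K (fquot K X G)" by (rule vmodule[OF fquot_left_module])

lemma fclass_hom: "fclass K X G \<in> lin FX (fquot K X G)"
  unfolding fquot_def fclass_def by (rule quotient_proj_hom[OF F_left_module S_submodule])

lemma fquot_carrierE:
  assumes "t \<in> carrier (fquot K X G)"
  obtains r where "r \<in> carrier FX" "t = fclass K X G r"
  using quotient_module_carrierE[of t FX SX] assms unfolding fquot_def fclass_def by blast

lemma fclass_self: "r \<in> carrier FX \<Longrightarrow> r \<in> fclass K X G r"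
  unfolding fclass_def
  by (rule abelian_subgroup.a_rcos_self[OF submodule_abelian_subgroup[OF F_left_module S_submodule]])

lemma fclass_mem:
  assumes "r \<in> carrier FX" "s \<in> fclass K X G r"
  shows "s \<in> carrier FX" "fclass K X G s = fclass K X G r"
proof -
  interpret abelian_subgroup SX FX by (rule submodule_abelian_subgroup[OF F_left_module S_submodule])
  show "s \<in> carrier FX" using assms a_elemrcos_carrier unfolding fclass_def by blast
  show "fclass K X G s = fclass K X G r"
    using a_repr_independence'[of s r] assms unfolding fclass_def by metis
qed

text \<open>Certifies the element that \<open>tensor_lift\<close> picks by \<open>SOME\<close> as a
  representative of the coset \<open>t\<close>.\<close>

lemma fquot_some:
  assumes "t \<in> carrier (fquot K X G)"
  shows "(SOME r. r \<in> t) \<in> carrier FX" "fclass K X G (SOME r. r \<in> t) = t"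
proof -
  obtain r where r: "r \<in> carrier FX" "t = fclass K X G r" using assms by (rule fquot_carrierE)
  then have "(SOME r. r \<in> t) \<in> t" using fclass_self by (metis someI)
  then show "(SOME r. r \<in> t) \<in> carrier FX" "fclass K X G (SOME r. r \<in> t) = t"
    using fclass_mem[OF r(1)] r(2) by metis+
qed

lemma tensor_lift_free_ext: "tensor_lift K U \<phi> t = free_ext K U \<phi> (SOME r. r \<in> t)"
  by (simp add: tensor_lift_def free_ext_def Let_def)

lemma fquot_hom_ext:
  assumes "module K U" "f \<in> lin (fquot K X G) U" "g \<in> lin (fquot K X G) U"
    "\<And>x. x \<in> X \<Longrightarrow> f (fclass K X G (free_basis K x)) = g (fclass K X G (free_basis K x))"
    "t \<in> carrier (fquot K X G)"
  shows "f t = g t"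
proof -
  obtain r where r: "r \<in> carrier FX" "t = fclass K X G r" using assms(5) by (rule fquot_carrierE)
  show ?thesis unfolding r(2)
    by (rule free_module_hom_ext[OF lmodule[OF assms(1)] lmod_hom_comp[OF fclass_hom assms(2)]
          lmod_hom_comp[OF fclass_hom assms(3)] assms(4) r(1)])
qed

lemma fquot_lift_closed:
  assumes "module K U" "\<phi> \<in> X \<rightarrow> carrier U" "t \<in> carrier (fquot K X G)"
  shows "tensor_lift K U \<phi> t \<in> carrier U"
  unfolding tensor_lift_free_ext
  by (rule lmod_hom_closed[OF free_ext_hom[OF lmodule[OF assms(1)] assms(2)] fquot_some(1)[OF assms(3)]])

lemma fquot_lift_comp:
  assumes "module K U" "module K U'" "g \<in> lin U U'" "\<phi> \<in> X \<rightarrow> carrier U" "t \<in> carrier (fquot K X G)"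
  shows "g (tensor_lift K U \<phi> t) = tensor_lift K U' (\<lambda>x. g (\<phi> x)) t"
  unfolding tensor_lift_free_ext
  by (rule hom_free_ext[OF assms(1,2)[THEN lmodule] assms(3,4) fquot_some(1)[OF assms(5)]])

text \<open>The kernel of \<open>free_ext K U \<phi>\<close> is a submodule containing the
  generators \<open>G\<close>, hence it contains their span. Two representatives of a class
  therefore have the same image, and the choice in \<open>tensor_lift\<close> does not
  matter.\<close>

lemma fquot_lift_class:
  assumes "module K U" "\<phi> \<in> X \<rightarrow> carrier U" "\<And>g. g \<in> G \<Longrightarrow> free_ext K U \<phi> g = \<zero>\<^bsub>U\<^esub>" "r \<in> carrier FX"
  shows "tensor_lift K U \<phi> (fclass K X G r) = free_ext K U \<phi> r"
proof -
  note U = lmodule[OF assms(1)]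
  interpret U: left_module K U by (rule U)
  interpret FF: left_module K FX by (rule F_left_module)
  note hom = free_ext_hom[OF U assms(2)]
  have "SX \<subseteq> {x \<in> carrier FX. free_ext K U \<phi> x = \<zero>\<^bsub>U\<^esub>}"
    by (rule submodule_span_least[OF lmod_hom_kernel_submodule[OF F_left_module U hom]])
       (use assms(3) G in auto)
  define s where "s = (SOME s. s \<in> fclass K X G r)"
  have c: "fclass K X G r \<in> carrier (fquot K X G)" using fclass_hom assms(4) by (rule lmod_hom_closed)
  have s: "s \<in> carrier FX" "fclass K X G s = fclass K X G r" unfolding s_def using fquot_some[OF c] by auto
  then have "s \<ominus>\<^bsub>FX\<^esub> r \<in> SX"
    using quotient_module_eq_iff[OF F_left_module S_submodule s(1) assms(4)] by (simp add: fclass_def)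
  then have "free_ext K U \<phi> (s \<ominus>\<^bsub>FX\<^esub> r) = \<zero>\<^bsub>U\<^esub>" using \<open>SX \<subseteq> _\<close> by auto
  then have "free_ext K U \<phi> s \<ominus>\<^bsub>U\<^esub> free_ext K U \<phi> r = \<zero>\<^bsub>U\<^esub>"
    using s assms(4) hom by (simp add: a_minus_def lmod_hom_add lmod_hom_a_inv[OF F_left_module U hom]
        FF.M.a_inv_closed del: free_module_sel)
  then have "free_ext K U \<phi> s = free_ext K U \<phi> r"
    using lmod_hom_closed[OF hom] s(1) assms(4) by (auto intro: U.M.eq_if_minus_zero)
  then show ?thesis unfolding tensor_lift_free_ext s_def .
qed

lemma fquot_lift_hom:
  assumes "module K U" "\<phi> \<in> X \<rightarrow> carrier U" "\<And>g. g \<in> G \<Longrightarrow> free_ext K U \<phi> g = \<zero>\<^bsub>U\<^esub>"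
  shows "tensor_lift K U \<phi> \<in> lin (fquot K X G) U"
proof -
  note hom = free_ext_hom[OF lmodule[OF assms(1)] assms(2)] and c = fquot_lift_class[OF assms]
  interpret F: left_module K FX by (rule F_left_module)
  show ?thesis
  proof (rule lmod_homI)
    fix t assume "t \<in> carrier (fquot K X G)"
    then show "tensor_lift K U \<phi> t \<in> carrier U" by (rule fquot_lift_closed[OF assms(1,2)])
  next
    fix s t assume "s \<in> carrier (fquot K X G)" "t \<in> carrier (fquot K X G)"
    then obtain q r where qr: "q \<in> carrier FX" "s = fclass K X G q" "r \<in> carrier FX" "t = fclass K X G r"
      by (elim fquot_carrierE) blast
    then show "tensor_lift K U \<phi> (s \<oplus>\<^bsub>fquot K X G\<^esub> t) = tensor_lift K U \<phi> s \<oplus>\<^bsub>U\<^esub> tensor_lift K U \<phi> t"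
      by (simp add: c lmod_hom_add[OF hom] F.M.a_closed flip: lmod_hom_add[OF fclass_hom] del: free_module_sel)
  next
    fix a t assume a: "a \<in> carrier K" "t \<in> carrier (fquot K X G)"
    then obtain r where qr: "r \<in> carrier FX" "t = fclass K X G r"
      by (elim fquot_carrierE) blast
    then show "tensor_lift K U \<phi> (a \<odot>\<^bsub>fquot K X G\<^esub> t) = a \<odot>\<^bsub>U\<^esub> tensor_lift K U \<phi> t"
      using a(1) by (simp add: c lmod_hom_smult[OF hom] F.lsmult_closed flip: lmod_hom_smult[OF fclass_hom]
          del: free_module_sel)
  qed
qed

end

text \<open>For fixed \<open>r\<close> this is a finite linear combination of the linear maps
  \<open>\<lambda>v. \<phi> v x\<close>; the induction adds one term of the combination at a
  time.\<close>

lemma free_ext_param_lin: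
  assumes "module K U" "module K V" "\<And>x. x \<in> X \<Longrightarrow> (\<lambda>v. \<phi> v x) \<in> lin V U" "r \<in> carrier (free_module K X)"
  shows "(\<lambda>v. free_ext K U (\<phi> v) r) \<in> lin V U"
proof -
  interpret F: left_module K "free_module K X" by (rule free_module_left_module[OF K_ring])
  note U = lmodule[OF assms(1)] and V = lmodule[OF assms(2)]
  interpret U: left_module K U by (rule U)
  have fe: "\<And>v. v \<in> carrier V \<Longrightarrow> free_ext K U (\<phi> v) \<in> lin (free_module K X) U"
    by (rule free_ext_hom[OF U]) (use assms(3) in \<open>auto dest: lmod_hom_closed\<close>)
  show ?thesis using K_ring assms(4)
  proof (induction r rule: free_module_induct)
    case zero
    have "(\<lambda>v. free_ext K U (\<phi> v) (\<lambda>x. \<zero>\<^bsub>K\<^esub>)) = (\<lambda>v. \<zero>\<^bsub>U\<^esub>)"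
      by (simp add: free_ext_def)
    then show ?case using lin_zero[OF assms(1)] by simp
  next
    case (add r a x)
    note b = free_basis_closed[OF K_ring add.hyps(3)]
    have "(\<lambda>v. free_ext K U (\<phi> v) r \<oplus>\<^bsub>U\<^esub> a \<odot>\<^bsub>U\<^esub> \<phi> v x) \<in> lin V U"
      by (intro lin_add lin_smult assms(1,3) add.hyps add.IH)
    moreover have "free_ext K U (\<phi> v) (r \<oplus>\<^bsub>free_module K X\<^esub> a \<odot>\<^bsub>free_module K X\<^esub> free_basis K x)
        = free_ext K U (\<phi> v) r \<oplus>\<^bsub>U\<^esub> a \<odot>\<^bsub>U\<^esub> \<phi> v x" if v: "v \<in> carrier V" for v
    proof -
      have "\<phi> v \<in> X \<rightarrow> carrier U" using assms(3) v by (auto dest: lmod_hom_closed)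
      then show ?thesis using free_ext_basis[OF U _ add.hyps(3), of "\<phi> v"] add.hyps b v
        by (simp only: lmod_hom_add[OF fe[OF v]] lmod_hom_smult[OF fe[OF v]] F.lsmult_closed)
    qed
    ultimately show ?case using lmod_hom_cong[OF V] by (metis (no_types, lifting))
  qed
qed

text \<open>The representative of \<open>t\<close> is chosen independently of \<open>v\<close>, so
  linearity in the parameter is a statement about one fixed finite sum.\<close>

lemma fquot_lift_param:
  assumes "G \<subseteq> carrier (free_module K X)"
    "module K U" "module K V" "\<And>x. x \<in> X \<Longrightarrow> (\<lambda>v. \<phi> v x) \<in> lin V U" "t \<in> carrier (fquot K X G)"
  shows "(\<lambda>v. tensor_lift K U (\<phi> v) t) \<in> lin V U"
  unfolding tensor_lift_free_ext[OF assms(1)]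
  by (rule free_ext_param_lin[OF assms(2-4) fquot_some(1)[OF assms(1,5)]])

text \<open>Interchange of two finite sums over independent tensors. Both sides are linear in the
  representative \<open>q\<close> of \<open>s\<close>, so it suffices to compare them on basis
  vectors, where the sum over \<open>y\<close> disappears.\<close>

lemma fquot_lift_swap:
  assumes "G \<subseteq> carrier (free_module K X)" "G' \<subseteq> carrier (free_module K Y)"
    "module K U" "\<And>x y. x \<in> X \<Longrightarrow> y \<in> Y \<Longrightarrow> \<beta> x y \<in> carrier U"
    "t \<in> carrier (fquot K X G)" "s \<in> carrier (fquot K Y G')"
  shows "tensor_lift K U (\<lambda>x. tensor_lift K U (\<lambda>y. \<beta> x y) s) t
       = tensor_lift K U (\<lambda>y. tensor_lift K U (\<lambda>x. \<beta> x y) t) s"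
proof -
  note U = lmodule[OF assms(3)]
  note FY = free_module_left_module[OF K_ring, of Y]
  define r where "r = (SOME r. r \<in> t)"
  define q where "q = (SOME r. r \<in> s)"
  have r: "r \<in> carrier (free_module K X)" unfolding r_def by (rule fquot_some(1)[OF assms(1,5)])
  have q: "q \<in> carrier (free_module K Y)" unfolding q_def by (rule fquot_some(1)[OF assms(2,6)])
  have 1: "(\<lambda>q. free_ext K U (\<lambda>x. free_ext K U (\<beta> x) q) r) \<in> lin (free_module K Y) U"
    by (rule free_ext_param_lin[OF assms(3) vmodule[OF FY] _ r])
       (rule free_ext_hom[OF U], use assms(4) in auto)
  have c: "(\<lambda>y. free_ext K U (\<lambda>x. \<beta> x y) r) \<in> Y \<rightarrow> carrier U"
    by (intro Pi_I lmod_hom_closed[OF free_ext_hom[OF U] r]) (use assms(4) in auto)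
  have "free_ext K U (\<lambda>x. free_ext K U (\<beta> x) q) r = free_ext K U (\<lambda>y. free_ext K U (\<lambda>x. \<beta> x y) r) q"
  proof (rule free_module_hom_ext[OF U 1 free_ext_hom[OF U c] _ q])
    fix y assume y: "y \<in> Y"
    have fb: "free_ext K U (\<beta> x) (free_basis K y) = \<beta> x y" if "x \<in> X" for x
      by (rule free_ext_basis[OF U _ y]) (use assms(4) that in auto)
    have "free_ext K U (\<lambda>x. free_ext K U (\<beta> x) (free_basis K y)) r = free_ext K U (\<lambda>x. \<beta> x y) r"
      by (rule free_ext_cong[OF U _ _ r]) (use assms(4) y in \<open>auto simp: fb\<close>)
    then show "free_ext K U (\<lambda>x. free_ext K U (\<beta> x) (free_basis K y)) r
        = free_ext K U (\<lambda>y. free_ext K U (\<lambda>x. \<beta> x y) r) (free_basis K y)"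
      by (simp add: free_ext_basis[OF U c y])
  qed
  then show ?thesis unfolding tensor_lift_free_ext[OF assms(1)] tensor_lift_free_ext[OF assms(2)] r_def q_def .
qed

subsubsection \<open>Binary tensor products\<close>

lemma tensor_fquot: "tensor K V W = fquot K (carrier V \<times> carrier W) (tensor_relations K V W)"
  by (simp add: tensor_def fquot_def Let_def)

lemma tensor_elt_fclass:
  "tensor_elt K V W v w = fclass K (carrier V \<times> carrier W) (tensor_relations K V W) (free_basis K (v, w))"
  by (simp add: tensor_elt_def fclass_def Let_def)

context
  fixes V :: "('k, 'v, 'y) module_scheme" and W :: "('k, 'w, 'z) module_scheme"
  assumes V: "module K V" and W: "module K W"
begin

abbreviation (input) "FT \<equiv> free_module K (carrier V \<times> carrier W)"

interpretation V: module K V by (rule V)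
interpretation W: module K W by (rule W)
interpretation F: left_module K FT by (rule free_module_left_module[OF K_ring])

lemma tensor_basis_closed: "v \<in> carrier V \<Longrightarrow> w \<in> carrier W \<Longrightarrow> free_basis K (v, w) \<in> carrier FT"
  by (rule free_basis_closed[OF K_ring]) auto

lemma tensor_relations_subset: "tensor_relations K V W \<subseteq> carrier FT"
  unfolding tensor_relations_def Let_def
  by (auto simp del: free_module_sel intro!: F.M.minus_closed F.M.a_closed F.lsmult_closed tensor_basis_closed)

lemma tensor_module: "module K (tensor K V W)"
  unfolding tensor_fquot by (rule fquot_module[OF tensor_relations_subset])

text \<open>Every relation is a difference of two elements with the same image; \<open>m\<close>
  isolates this, and bilinearity supplies the equality of images for each of the four kinds of
  relations.\<close>

lemma bilin_kills_relations:
  assumes "module K U" "bilin K V W U \<beta>" "g \<in> tensor_relations K V W"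
  shows "free_ext K U (\<lambda>(x, y). \<beta> x y) g = \<zero>\<^bsub>U\<^esub>"
proof -
  note U = lmodule[OF assms(1)]
  interpret U: left_module K U by (rule U)
  note b = bilinD[OF assms(2)]
  have c: "(\<lambda>(x, y). \<beta> x y) \<in> carrier V \<times> carrier W \<rightarrow> carrier U" using b by auto
  note hom = free_ext_hom[OF U c]
  note e = free_ext_basis[OF U c]
  have m: "free_ext K U (\<lambda>(x, y). \<beta> x y) (p \<ominus>\<^bsub>FT\<^esub> q) = \<zero>\<^bsub>U\<^esub>"
    if "p \<in> carrier FT" "q \<in> carrier FT" "free_ext K U (\<lambda>(x, y). \<beta> x y) p = free_ext K U (\<lambda>(x, y). \<beta> x y) q" for p q
    using that by (simp add: a_minus_def lmod_hom_add[OF hom] lmod_hom_a_inv[OF F.left_module U hom]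
        lmod_hom_closed[OF hom] U.M.r_neg del: free_module_sel)
  show ?thesis
    using assms(3) unfolding tensor_relations_def Let_def
    by (auto simp del: free_module_sel intro!: m F.M.a_closed F.lsmult_closed tensor_basis_closed
        simp: lmod_hom_add[OF hom] lmod_hom_smult[OF hom] tensor_basis_closed F.lsmult_closed e
        lmod_hom_add[OF b(1)] lmod_hom_add[OF b(2)] lmod_hom_smult[OF b(1)] lmod_hom_smult[OF b(2)])
qed

lemma tensor_lift_pure:
  assumes "module K U" "bilin K V W U \<beta>" "v \<in> carrier V" "w \<in> carrier W"
  shows "tensor_lift K U (\<lambda>(x, y). \<beta> x y) (tensor_elt K V W v w) = \<beta> v w"
proof -
  have c: "(\<lambda>(x, y). \<beta> x y) \<in> carrier V \<times> carrier W \<rightarrow> carrier U" using bilinD[OF assms(2)] by auto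
  show ?thesis unfolding tensor_elt_fclass
    by (subst fquot_lift_class[OF tensor_relations_subset assms(1) c bilin_kills_relations[OF assms(1,2)]])
       (use assms(3,4) free_ext_basis[OF lmodule[OF assms(1)] c, of "(v, w)"] tensor_basis_closed in auto)
qed

lemma tensor_lift_lin:
  assumes "module K U" "bilin K V W U \<beta>"
  shows "(\<lambda>t. tensor_lift K U (\<lambda>(x, y). \<beta> x y) t) \<in> lin (tensor K V W) U"
  unfolding tensor_fquot
  by (rule fquot_lift_hom[OF tensor_relations_subset assms(1) _ bilin_kills_relations[OF assms]])
     (use bilinD[OF assms(2)] in auto)

lemma tensor_hom_ext:
  assumes "module K U" "f \<in> lin (tensor K V W) U" "g \<in> lin (tensor K V W) U"
    "\<And>v w. v \<in> carrier V \<Longrightarrow> w \<in> carrier W \<Longrightarrow> f (tensor_elt K V W v w) = g (tensor_elt K V W v w)"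
    "t \<in> carrier (tensor K V W)"
  shows "f t = g t"
  by (rule fquot_hom_ext[OF tensor_relations_subset assms(1) assms(2,3)[unfolded tensor_fquot] _ assms(5)[unfolded tensor_fquot]])
     (use assms(4) in \<open>auto simp: tensor_elt_fclass\<close>)

text \<open>Each law of bilinearity equates the classes of two elements whose difference is one of
  the generating relations.\<close>

lemma tensor_elt_bilin: "bilin K V W (tensor K V W) (tensor_elt K V W)"
proof -
  note hom = fclass_hom[OF tensor_relations_subset]
  have z: "fclass K (carrier V \<times> carrier W) (tensor_relations K V W) p
      = fclass K (carrier V \<times> carrier W) (tensor_relations K V W) q"
    if "p \<in> carrier FT" "q \<in> carrier FT" "p \<ominus>\<^bsub>FT\<^esub> q \<in> tensor_relations K V W" for p q
  proof -
    have "p \<ominus>\<^bsub>FT\<^esub> q \<in> submodule_span K FT (tensor_relations K V W)"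
      by (rule subsetD[OF submodule_span_incl that(3)])
    then show ?thesis unfolding fclass_def
      using quotient_module_eq_iff[OF F.left_module S_submodule[OF tensor_relations_subset] that(1,2)] by simp
  qed
  have mem:
    "\<And>v v' w. v \<in> carrier V \<Longrightarrow> v' \<in> carrier V \<Longrightarrow> w \<in> carrier W \<Longrightarrow>
      free_basis K (v \<oplus>\<^bsub>V\<^esub> v', w) \<ominus>\<^bsub>FT\<^esub> (free_basis K (v, w) \<oplus>\<^bsub>FT\<^esub> free_basis K (v', w)) \<in> tensor_relations K V W"
    "\<And>v w w'. v \<in> carrier V \<Longrightarrow> w \<in> carrier W \<Longrightarrow> w' \<in> carrier W \<Longrightarrow>
      free_basis K (v, w \<oplus>\<^bsub>W\<^esub> w') \<ominus>\<^bsub>FT\<^esub> (free_basis K (v, w) \<oplus>\<^bsub>FT\<^esub> free_basis K (v, w')) \<in> tensor_relations K V W"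
    "\<And>c v w. c \<in> carrier K \<Longrightarrow> v \<in> carrier V \<Longrightarrow> w \<in> carrier W \<Longrightarrow>
      free_basis K (c \<odot>\<^bsub>V\<^esub> v, w) \<ominus>\<^bsub>FT\<^esub> c \<odot>\<^bsub>FT\<^esub> free_basis K (v, w) \<in> tensor_relations K V W"
    "\<And>c v w. c \<in> carrier K \<Longrightarrow> v \<in> carrier V \<Longrightarrow> w \<in> carrier W \<Longrightarrow>
      free_basis K (v, c \<odot>\<^bsub>W\<^esub> w) \<ominus>\<^bsub>FT\<^esub> c \<odot>\<^bsub>FT\<^esub> free_basis K (v, w) \<in> tensor_relations K V W"
    unfolding tensor_relations_def Let_def by blast+
  have cl: "tensor_elt K V W v w \<in> carrier (tensor K V W)" if "v \<in> carrier V" "w \<in> carrier W" for v w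
    unfolding tensor_elt_fclass tensor_fquot using that by (intro lmod_hom_closed[OF hom] tensor_basis_closed)
  show ?thesis
  proof (rule bilinI; rule lmod_homI)
    fix v w w' assume a: "v \<in> carrier V" "w \<in> carrier W" "w' \<in> carrier W"
    show "tensor_elt K V W v (w \<oplus>\<^bsub>W\<^esub> w') = tensor_elt K V W v w \<oplus>\<^bsub>tensor K V W\<^esub> tensor_elt K V W v w'"
      unfolding tensor_elt_fclass tensor_fquot
      by (subst lmod_hom_add[OF hom, symmetric], (intro tensor_basis_closed a)+,
          intro z mem F.M.a_closed tensor_basis_closed W.M.a_closed a)
  next
    fix v v' w assume a: "w \<in> carrier W" "v \<in> carrier V" "v' \<in> carrier V"
    show "tensor_elt K V W (v \<oplus>\<^bsub>V\<^esub> v') w = tensor_elt K V W v w \<oplus>\<^bsub>tensor K V W\<^esub> tensor_elt K V W v' w"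
      unfolding tensor_elt_fclass tensor_fquot
      by (subst lmod_hom_add[OF hom, symmetric], (intro tensor_basis_closed a)+,
          intro z mem F.M.a_closed tensor_basis_closed V.M.a_closed a)
  next
    fix v c w assume a: "v \<in> carrier V" "c \<in> carrier K" "w \<in> carrier W"
    show "tensor_elt K V W v (c \<odot>\<^bsub>W\<^esub> w) = c \<odot>\<^bsub>tensor K V W\<^esub> tensor_elt K V W v w"
      unfolding tensor_elt_fclass tensor_fquot
      by (subst lmod_hom_smult[OF hom, symmetric], (intro tensor_basis_closed a)+,
          intro z mem F.lsmult_closed tensor_basis_closed W.smult_closed a)
  next
    fix v c w assume a: "w \<in> carrier W" "c \<in> carrier K" "v \<in> carrier V"
    show "tensor_elt K V W (c \<odot>\<^bsub>V\<^esub> v) w = c \<odot>\<^bsub>tensor K V W\<^esub> tensor_elt K V W v w"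
      unfolding tensor_elt_fclass tensor_fquot
      by (subst lmod_hom_smult[OF hom, symmetric], (intro tensor_basis_closed a)+,
          intro z mem F.lsmult_closed tensor_basis_closed V.smult_closed a)
  qed (rule cl; assumption)+
qed

lemma tensor_elt_closed: "v \<in> carrier V \<Longrightarrow> w \<in> carrier W \<Longrightarrow> tensor_elt K V W v w \<in> carrier (tensor K V W)"
  using tensor_elt_bilin by (rule bilinD(3))

lemma tensor_lift_closed:
  assumes "module K U" "\<And>x y. x \<in> carrier V \<Longrightarrow> y \<in> carrier W \<Longrightarrow> \<beta> x y \<in> carrier U" "t \<in> carrier (tensor K V W)"
  shows "tensor_lift K U (\<lambda>(x, y). \<beta> x y) t \<in> carrier U"
  by (rule fquot_lift_closed[OF tensor_relations_subset assms(1) _ assms(3)[unfolded tensor_fquot]])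
     (use assms(2) in auto)

lemma tensor_lift_comp:
  assumes "module K U" "module K U'" "g \<in> lin U U'"
    "\<And>x y. x \<in> carrier V \<Longrightarrow> y \<in> carrier W \<Longrightarrow> \<beta> x y \<in> carrier U" "t \<in> carrier (tensor K V W)"
  shows "g (tensor_lift K U (\<lambda>(x, y). \<beta> x y) t) = tensor_lift K U' (\<lambda>(x, y). g (\<beta> x y)) t"
  by (subst fquot_lift_comp[OF tensor_relations_subset assms(1-3) _ assms(5)[unfolded tensor_fquot]])
     (use assms(4) in \<open>auto simp: case_prod_unfold\<close>)

lemma tensor_lift_param:
  assumes "module K U" "module K V'"
    "\<And>x y. x \<in> carrier V \<Longrightarrow> y \<in> carrier W \<Longrightarrow> (\<lambda>v. \<beta> v x y) \<in> lin V' U" "t \<in> carrier (tensor K V W)"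
  shows "(\<lambda>v. tensor_lift K U (\<lambda>(x, y). \<beta> v x y) t) \<in> lin V' U"
  by (rule fquot_lift_param[OF tensor_relations_subset assms(1,2) _ assms(4)[unfolded tensor_fquot]])
     (use assms(3) in auto)

end

lemma tensor_lift_swap:
  assumes "module K V" "module K W" "module K V'" "module K W'" "module K U"
    "\<And>x y x' y'. x \<in> carrier V \<Longrightarrow> y \<in> carrier W \<Longrightarrow> x' \<in> carrier V' \<Longrightarrow> y' \<in> carrier W' \<Longrightarrow> \<beta> x y x' y' \<in> carrier U"
    "t \<in> carrier (tensor K V W)" "s \<in> carrier (tensor K V' W')"
  shows "tensor_lift K U (\<lambda>(x, y). tensor_lift K U (\<lambda>(x', y'). \<beta> x y x' y') s) t
       = tensor_lift K U (\<lambda>(x', y'). tensor_lift K U (\<lambda>(x, y). \<beta> x y x' y') t) s"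
  using fquot_lift_swap[OF tensor_relations_subset[OF assms(1,2)] tensor_relations_subset[OF assms(3,4)] assms(5) _
      assms(7,8)[unfolded tensor_fquot], of "\<lambda>x y. \<beta> (fst x) (snd x) (fst y) (snd y)"] assms(6)
  by (auto simp: case_prod_unfold)

subsubsection \<open>Tensor powers\<close>

lemma tpower_fquot: "tpower K V n = fquot K (tuples V n) (tpower_relations K V n)"
  by (simp add: tpower_def fquot_def Let_def tuples_def)

lemma tpower_elt_fclass:
  "tpower_elt K V vs = fclass K (tuples V (length vs)) (tpower_relations K V (length vs)) (free_basis K vs)"
  by (simp add: tpower_elt_def fclass_def Let_def tuples_def)

context
  fixes V :: "('k, 'v, 'y) module_scheme"
  assumes V: "module K V"
begin

interpretation V: module K V by (rule V)

lemma tuples_upd: "vs \<in> tuples V n \<Longrightarrow> v \<in> carrier V \<Longrightarrow> vs[i := v] \<in> tuples V n"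
  unfolding tuples_def using set_update_subset_insert by fastforce

context
  fixes n :: nat
begin

abbreviation (input) "FP \<equiv> free_module K (tuples V n)"
interpretation F: left_module K FP by (rule free_module_left_module[OF K_ring])

lemma tpower_basis_closed: "vs \<in> tuples V n \<Longrightarrow> free_basis K vs \<in> carrier FP"
  by (rule free_basis_closed[OF K_ring])

lemma tpower_relations_subset: "tpower_relations K V n \<subseteq> carrier FP"
  unfolding tpower_relations_def Let_def tuples_def[symmetric]
  by (auto simp del: free_module_sel intro!: F.M.minus_closed F.M.a_closed F.lsmult_closed tpower_basis_closed tuples_upd)

lemma tpower_module: "module K (tpower K V n)"
  unfolding tpower_fquot by (rule fquot_module[OF tpower_relations_subset])

lemma multilin_upd:
  assumes "multilin K V n U \<phi>" "vs \<in> tuples V n" "i < n"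
  shows "(\<lambda>v. \<phi> (vs[i := v])) \<in> lin V U"
proof -
  have l: "length vs = n" "set vs \<subseteq> carrier V" using assms(2) by (auto simp: tuples_def)
  have "set (take i vs) \<subseteq> carrier V" "set (drop (Suc i) vs) \<subseteq> carrier V"
    using l set_take_subset set_drop_subset by fast+
  moreover have "Suc (length (take i vs) + length (drop (Suc i) vs)) = n" using l assms(3) by simp
  ultimately have "(\<lambda>v. \<phi> (take i vs @ v # drop (Suc i) vs)) \<in> lin V U"
    using assms(1) unfolding multilin_def by blast
  then show ?thesis using l assms(3) by (simp add: upd_conv_take_nth_drop)
qed

lemma multilin_closed: "multilin K V n U \<phi> \<Longrightarrow> \<phi> \<in> tuples V n \<rightarrow> carrier U"
  by (auto simp: multilin_def tuples_def)

lemma multilin_kills_relations: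
  assumes "module K U" "multilin K V n U \<phi>" "g \<in> tpower_relations K V n"
  shows "free_ext K U \<phi> g = \<zero>\<^bsub>U\<^esub>"
proof -
  note U = lmodule[OF assms(1)]
  interpret U: left_module K U by (rule U)
  note c = multilin_closed[OF assms(2)]
  note hom = free_ext_hom[OF U c]
  note e = free_ext_basis[OF U c]
  have m: "free_ext K U \<phi> (p \<ominus>\<^bsub>FP\<^esub> q) = \<zero>\<^bsub>U\<^esub>"
    if "p \<in> carrier FP" "q \<in> carrier FP" "free_ext K U \<phi> p = free_ext K U \<phi> q" for p q
    using that by (simp add: a_minus_def lmod_hom_add[OF hom] lmod_hom_a_inv[OF F.left_module U hom]
        lmod_hom_closed[OF hom] U.M.r_neg del: free_module_sel)
  note b = multilin_upd[OF assms(2)]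
  show ?thesis
    using assms(3) unfolding tpower_relations_def Let_def tuples_def[symmetric]
    by (auto simp del: free_module_sel intro!: m F.M.a_closed F.lsmult_closed tpower_basis_closed tuples_upd
        simp: lmod_hom_add[OF hom] lmod_hom_smult[OF hom] tpower_basis_closed F.lsmult_closed e tuples_upd
        lmod_hom_add[OF b] lmod_hom_smult[OF b])
qed

lemma tpower_lift_pure:
  assumes "module K U" "multilin K V n U \<phi>" "vs \<in> tuples V n"
  shows "tensor_lift K U \<phi> (tpower_elt K V vs) = \<phi> vs"
proof -
  have l: "length vs = n" using assms(3) by (simp add: tuples_def)
  show ?thesis unfolding tpower_elt_fclass l
    by (subst fquot_lift_class[OF tpower_relations_subset assms(1) multilin_closed[OF assms(2)] multilin_kills_relations[OF assms(1,2)]])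
       (use assms(3) free_ext_basis[OF lmodule[OF assms(1)] multilin_closed[OF assms(2)]] tpower_basis_closed in auto)
qed

lemma tpower_lift_lin:
  assumes "module K U" "multilin K V n U \<phi>"
  shows "tensor_lift K U \<phi> \<in> lin (tpower K V n) U"
  unfolding tpower_fquot
  by (rule fquot_lift_hom[OF tpower_relations_subset assms(1) multilin_closed[OF assms(2)] multilin_kills_relations[OF assms]])

lemma tpower_hom_ext:
  assumes "module K U" "f \<in> lin (tpower K V n) U" "g \<in> lin (tpower K V n) U"
    "\<And>vs. vs \<in> tuples V n \<Longrightarrow> f (tpower_elt K V vs) = g (tpower_elt K V vs)"
    "t \<in> carrier (tpower K V n)"
  shows "f t = g t"
  by (rule fquot_hom_ext[OF tpower_relations_subset assms(1) assms(2,3)[unfolded tpower_fquot] _ assms(5)[unfolded tpower_fquot]])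
     (use assms(4) in \<open>auto simp: tpower_elt_fclass tuples_def\<close>)

lemma tpower_elt_closed: "vs \<in> tuples V n \<Longrightarrow> tpower_elt K V vs \<in> carrier (tpower K V n)"
  using lmod_hom_closed[OF fclass_hom[OF tpower_relations_subset] tpower_basis_closed, of vs]
  by (auto simp: tpower_elt_fclass tpower_fquot tuples_def)

lemma tpower_elt_multilin: "multilin K V n (tpower K V n) (tpower_elt K V)"
proof -
  note hom = fclass_hom[OF tpower_relations_subset]
  have z: "fclass K (tuples V n) (tpower_relations K V n) p = fclass K (tuples V n) (tpower_relations K V n) q"
    if "p \<in> carrier FP" "q \<in> carrier FP" "p \<ominus>\<^bsub>FP\<^esub> q \<in> tpower_relations K V n" for p q
  proof -
    have "p \<ominus>\<^bsub>FP\<^esub> q \<in> submodule_span K FP (tpower_relations K V n)"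
      by (rule subsetD[OF submodule_span_incl that(3)])
    then show ?thesis unfolding fclass_def
      using quotient_module_eq_iff[OF F.left_module S_submodule[OF tpower_relations_subset] that(1,2)] by simp
  qed
  show ?thesis unfolding multilin_def
  proof (intro conjI allI impI)
    fix vs assume "set vs \<subseteq> carrier V" "length vs = n"
    then show "tpower_elt K V vs \<in> carrier (tpower K V n)" by (intro tpower_elt_closed) (simp add: tuples_def)
  next
    fix ys zs assume a: "set ys \<subseteq> carrier V" "set zs \<subseteq> carrier V" "Suc (length ys + length zs) = n"
    have t: "ys @ v # zs \<in> tuples V n" if "v \<in> carrier V" for v using a that by (auto simp: tuples_def)
    have u: "(ys @ v # zs)[length ys := w] = ys @ w # zs" for v w by simp
    have i: "length ys < n" using a by simp
    have l: "length (ys @ v # zs) = n" for v using a by simp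
    have mem1: "free_basis K (ys @ (v \<oplus>\<^bsub>V\<^esub> v') # zs) \<ominus>\<^bsub>FP\<^esub>
       (free_basis K (ys @ v # zs) \<oplus>\<^bsub>FP\<^esub> free_basis K (ys @ v' # zs)) \<in> tpower_relations K V n"
      if "v \<in> carrier V" "v' \<in> carrier V" for v v'
      unfolding tpower_relations_def Let_def tuples_def[symmetric]
      using t[OF that(1)] i that u[of v] by (intro UnI1 CollectI exI[of _ "ys @ v # zs"] exI[of _ "length ys"] exI[of _ v] exI[of _ v']) simp
    have mem2: "free_basis K (ys @ (c \<odot>\<^bsub>V\<^esub> v) # zs) \<ominus>\<^bsub>FP\<^esub>
       c \<odot>\<^bsub>FP\<^esub> free_basis K (ys @ v # zs) \<in> tpower_relations K V n"
      if "v \<in> carrier V" "c \<in> carrier K" for v c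
      unfolding tpower_relations_def Let_def tuples_def[symmetric]
      using t[OF that(1)] i that u[of v] by (intro UnI2 CollectI exI[of _ "ys @ v # zs"] exI[of _ "length ys"] exI[of _ v] exI[of _ c]) simp
    show "(\<lambda>v. tpower_elt K V (ys @ v # zs)) \<in> lin V (tpower K V n)"
    proof (rule lmod_homI)
      show "tpower_elt K V (ys @ v # zs) \<in> carrier (tpower K V n)" if "v \<in> carrier V" for v
        using t[OF that] by (rule tpower_elt_closed)
    next
      fix v v' assume v: "v \<in> carrier V" "v' \<in> carrier V"
      show "tpower_elt K V (ys @ (v \<oplus>\<^bsub>V\<^esub> v') # zs)
         = tpower_elt K V (ys @ v # zs) \<oplus>\<^bsub>tpower K V n\<^esub> tpower_elt K V (ys @ v' # zs)"
        unfolding tpower_elt_fclass tpower_fquot l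
        by (subst lmod_hom_add[OF hom, symmetric], (intro tpower_basis_closed t v)+,
            intro z mem1 F.M.a_closed tpower_basis_closed t V.M.a_closed v)
    next
      fix c v assume v: "c \<in> carrier K" "v \<in> carrier V"
      show "tpower_elt K V (ys @ (c \<odot>\<^bsub>V\<^esub> v) # zs) = c \<odot>\<^bsub>tpower K V n\<^esub> tpower_elt K V (ys @ v # zs)"
        unfolding tpower_elt_fclass tpower_fquot l
        by (subst lmod_hom_smult[OF hom, symmetric], (intro tpower_basis_closed t v)+,
            intro z mem2 F.lsmult_closed tpower_basis_closed t V.smult_closed v)
    qed
  qed
qed

end
end
end

subsection \<open>Sweedler calculus\<close>

lemma foldSetD_cong:
  assumes "(A, x) \<in> foldSetD D f e" "\<And>a. a \<in> A \<Longrightarrow> f a = g a"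
  shows "(A, x) \<in> foldSetD D g e"
  using assms
proof (induction rule: foldSetD.induct)
  case (insertI x A y)
  have "(insert x A, g x y) \<in> foldSetD D g e"
    by (rule foldSetD.insertI) (use insertI in auto)
  then show ?case using insertI by simp
qed (auto intro: foldSetD.emptyI)

text \<open>The underlying fold sees \<open>f\<close> only at points of \<open>A\<close>, so
  equality there is enough in any structure \<open>G\<close>. Consequently
  \<open>fquot_lift_cong\<close> and \<open>SW_cong\<close> can rewrite a summand before its values
  are known to lie in the target space.\<close>

lemma finsum_cong_weak:
  fixes f g :: "'a \<Rightarrow> 'b"
  assumes "\<And>x. x \<in> A \<Longrightarrow> f x = g x" shows "finsum G f A = finsum G g A"
proof -
  have "foldD D (\<lambda>x. m (f x)) e A = foldD D (\<lambda>x. m (g x)) e A" for D e and m :: "'b \<Rightarrow> 'b \<Rightarrow> 'b"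
    unfolding foldD_def
    using foldSetD_cong[of A _ D "\<lambda>x. m (f x)" e "\<lambda>x. m (g x)"]
      foldSetD_cong[of A _ D "\<lambda>x. m (g x)" e "\<lambda>x. m (f x)"] assms
    by (intro arg_cong[of _ _ The]) (auto simp: fun_eq_iff)
  then show ?thesis unfolding finsum_def finprod_def comp_def by simp
qed

lemma (in lin_alg) fquot_lift_cong:
  assumes "G \<subseteq> carrier (free_module K X)" "t \<in> carrier (fquot K X G)" "\<And>x. x \<in> X \<Longrightarrow> \<phi> x = \<psi> x"
  shows "tensor_lift K U \<phi> t = tensor_lift K U \<psi> t"
  unfolding tensor_lift_free_ext[OF assms(1)] free_ext_def
  by (rule finsum_cong_weak)
     (use free_module_carrierD(3)[OF K_ring fquot_some(1)[OF assms(1,2)]] assms(3) in auto)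

context lin_alg
begin

declare tensor_module [simp, intro] tensor_elt_closed [simp, intro]

lemma vsmult_closed [simp, intro]: "module K V \<Longrightarrow> c \<in> carrier K \<Longrightarrow> v \<in> carrier V \<Longrightarrow> c \<odot>\<^bsub>V\<^esub> v \<in> carrier V"
  by (rule module.smult_closed)

lemma lin_comp: "g \<in> lin V W \<Longrightarrow> f \<in> lin W U \<Longrightarrow> (\<lambda>v. f (g v)) \<in> lin V U"
  by (rule lmod_hom_comp)

lemma bilin_left: "bilin K V W U \<beta> \<Longrightarrow> w \<in> carrier W \<Longrightarrow> g \<in> lin X V \<Longrightarrow> (\<lambda>v. \<beta> (g v) w) \<in> lin X U"
  by (rule lin_comp[of g]) (auto dest: bilinD(2))
lemma bilin_right: "bilin K V W U \<beta> \<Longrightarrow> v \<in> carrier V \<Longrightarrow> g \<in> lin X W \<Longrightarrow> (\<lambda>w. \<beta> v (g w)) \<in> lin X U"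
  by (rule lin_comp[of g]) (auto dest: bilinD(1))

lemmas tensor_elt_lin [lin_intros] = bilin_left[OF tensor_elt_bilin] bilin_right[OF tensor_elt_bilin]
declare bilinI [lin_intros]

text \<open>Products on tensor products are nested lifts of an expression in four variables.
  Bilinearity in \<open>c\<close>, \<open>d\<close> makes the inner lift meaningful; bilinearity in
  \<open>a\<close>, \<open>b\<close> survives the inner lift and makes the outer one
  meaningful.\<close>

lemma tensor_lift2_bilin:
  assumes m: "module K V" "module K W" "module K V'" "module K W'" "module K U"
    and b1: "\<And>a b. a \<in> carrier V \<Longrightarrow> b \<in> carrier W \<Longrightarrow> bilin K V' W' U (\<beta> a b)"
    and b2: "\<And>c d. c \<in> carrier V' \<Longrightarrow> d \<in> carrier W' \<Longrightarrow> bilin K V W U (\<lambda>a b. \<beta> a b c d)"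
  defines "f \<equiv> \<lambda>s t. tensor_lift K U (\<lambda>(a, b). tensor_lift K U (\<lambda>(c, d). \<beta> a b c d) t) s"
  shows "bilin K (tensor K V W) (tensor K V' W') U f"
    and "a \<in> carrier V \<Longrightarrow> b \<in> carrier W \<Longrightarrow> c \<in> carrier V' \<Longrightarrow> d \<in> carrier W' \<Longrightarrow>
      f (tensor_elt K V W a b) (tensor_elt K V' W' c d) = \<beta> a b c d"
proof -
  have bb: "bilin K V W U (\<lambda>a b. tensor_lift K U (\<lambda>(c, d). \<beta> a b c d) t)" if "t \<in> carrier (tensor K V' W')" for t
    by (rule bilinI; rule tensor_lift_param[OF m(3,4,5) _ _ that])
       (auto simp: m intro: bilinD(1)[OF b2] bilinD(2)[OF b2])
  show "bilin K (tensor K V W) (tensor K V' W') U f"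
    unfolding f_def
    by (rule bilinI)
       (auto intro!: tensor_lift_lin[OF m(1,2,5)] bb tensor_lift_param[OF m(1,2,5)] tensor_lift_lin[OF m(3,4,5)] b1 simp: m)
  show "f (tensor_elt K V W a b) (tensor_elt K V' W' c d) = \<beta> a b c d"
    if "a \<in> carrier V" "b \<in> carrier W" "c \<in> carrier V'" "d \<in> carrier W'"
    unfolding f_def using that
    by (simp add: tensor_lift_pure[OF m(1,2,5) bb] tensor_elt_closed[OF m(3,4)] tensor_lift_pure[OF m(3,4,5) b1])
qed

end

locale hopf_calc = hopf_algebra K H for K :: "('k, 's) ring_scheme" and H :: "('k, 'h, 'z) hopf_scheme"
begin

sublocale lin_alg K
  by (rule lin_alg.intro) (use field in \<open>simp add: field_def domain_def\<close>)

abbreviation "SW \<equiv> sw K H"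
abbreviation hmult (infixl "\<star>" 70) where "x \<star> y \<equiv> x \<otimes>\<^bsub>H\<^esub> y"
abbreviation "HH2 \<equiv> tensor K H H"

lemma H_module [simp, intro]: "module K H" using algebra by (simp add: assoc_algebra_def)
lemma H_ring: "ring H" using algebra by (simp add: assoc_algebra_def)
lemma hmult_closed [simp, intro]: "x \<in> carrier H \<Longrightarrow> y \<in> carrier H \<Longrightarrow> x \<star> y \<in> carrier H"
  and hone_closed [simp, intro]: "\<one>\<^bsub>H\<^esub> \<in> carrier H"
  and hmult_assoc: "x \<in> carrier H \<Longrightarrow> y \<in> carrier H \<Longrightarrow> z \<in> carrier H \<Longrightarrow> x \<star> y \<star> z = x \<star> (y \<star> z)"
  and hmult_one [simp]: "x \<in> carrier H \<Longrightarrow> \<one>\<^bsub>H\<^esub> \<star> x = x" "x \<in> carrier H \<Longrightarrow> x \<star> \<one>\<^bsub>H\<^esub> = x"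
  using ring.ring_simprules[OF H_ring] monoid.r_one[OF ring.is_monoid[OF H_ring]] by simp_all

lemma antipode_closed [simp, intro]: "x \<in> carrier H \<Longrightarrow> antipode H x \<in> carrier H"
  using antipode_linear by (rule lmod_hom_closed)
lemma counit_closed [simp, intro]: "x \<in> carrier H \<Longrightarrow> counit H x \<in> carrier K"
  using counit_mult by (rule ring_hom_closed)
lemma comult_closed [simp, intro]: "x \<in> carrier H \<Longrightarrow> comult H x \<in> carrier HH2"
  using comult_linear by (rule lmod_hom_closed)

lemma hmult_bilin: "bilin K H H H (\<lambda>x y. x \<star> y)"
proof -
  interpret assoc_algebra K H by (rule algebra)
  show ?thesis by (intro bilinI lmod_homI) (auto simp: A.l_distr A.r_distr smult_mult_left smult_mult_right)
qed

lemma counit_bilin: "module K U \<Longrightarrow> bilin K H U U (\<lambda>h u. counit H h \<odot>\<^bsub>U\<^esub> u)"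
proof -
  assume "module K U"
  then interpret module K U .
  show ?thesis
  proof (rule bilinI)
    show "(\<lambda>v. counit H v \<odot>\<^bsub>U\<^esub> w) \<in> lin H U" if "w \<in> carrier U" for w
      by (rule lmod_homI)
        (use that in \<open>auto simp: counit_linear smult_assoc1 ring_hom_add[OF counit_mult] smult_l_distr\<close>)
  qed (auto intro!: lin_smult lin_id \<open>module K U\<close>)
qed

lemmas lin_ops [lin_intros] = bilin_left[OF hmult_bilin] bilin_right[OF hmult_bilin]
  bilin_left[OF counit_bilin] bilin_right[OF counit_bilin]
  lin_comp[OF _ antipode_linear]

lemma SW_closed [simp, intro]:
  "module K U \<Longrightarrow> (\<And>x y. x \<in> carrier H \<Longrightarrow> y \<in> carrier H \<Longrightarrow> \<beta> x y \<in> carrier U) \<Longrightarrow> h \<in> carrier H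
    \<Longrightarrow> SW U \<beta> h \<in> carrier U"
  unfolding sw_def by (rule tensor_lift_closed) auto

text \<open>As a congruence rule this lets the simplifier assume that both components lie in
  \<open>carrier H\<close> while it rewrites the summand. The premise with \<open>= True\<close>
  makes it establish membership of \<open>h'\<close> beforehand.\<close>

lemma SW_cong [cong]:
  "h = h' \<Longrightarrow> (h' \<in> carrier H) = True \<Longrightarrow>
   (\<And>x y. x \<in> carrier H =simp=> y \<in> carrier H =simp=> \<beta> x y = \<gamma> x y) \<Longrightarrow> SW U \<beta> h = SW U \<gamma> h'"
  unfolding sw_def
  by (simp, rule fquot_lift_cong[OF tensor_relations_subset[OF H_module H_module]])
     (auto simp: tensor_fquot[symmetric] simp_implies_def)

lemma SW_eqI:
  "h \<in> carrier H \<Longrightarrow> (\<And>x y. x \<in> carrier H \<Longrightarrow> y \<in> carrier H \<Longrightarrow> \<beta> x y = \<gamma> x y) \<Longrightarrow> SW U \<beta> h = SW U \<gamma> h"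
  by (rule SW_cong) (auto simp: simp_implies_def)

lemma SW_comp:
  "module K U \<Longrightarrow> module K U' \<Longrightarrow> g \<in> lin U U' \<Longrightarrow> (\<And>x y. x \<in> carrier H \<Longrightarrow> y \<in> carrier H \<Longrightarrow> \<beta> x y \<in> carrier U)
    \<Longrightarrow> h \<in> carrier H \<Longrightarrow> g (SW U \<beta> h) = SW U' (\<lambda>x y. g (\<beta> x y)) h"
  unfolding sw_def by (rule tensor_lift_comp) auto

lemma SW_param [lin_intros]:
  "module K V \<Longrightarrow> module K U \<Longrightarrow> h \<in> carrier H \<Longrightarrow>
    (\<And>x y. x \<in> carrier H \<Longrightarrow> y \<in> carrier H \<Longrightarrow> (\<lambda>v. \<beta> v x y) \<in> lin V U) \<Longrightarrow> (\<lambda>v. SW U (\<beta> v) h) \<in> lin V U"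
  unfolding sw_def by (rule tensor_lift_param) auto

lemma SW_lin [lin_intros]:
  "module K U \<Longrightarrow> bilin K H H U \<beta> \<Longrightarrow> g \<in> lin V H \<Longrightarrow> (\<lambda>v. SW U \<beta> (g v)) \<in> lin V U"
  unfolding sw_def
  by (rule lin_comp[OF _ tensor_lift_lin, of _ _ H H]) (auto intro: lin_comp comult_linear)

lemma SW_swap:
  "module K U \<Longrightarrow> h \<in> carrier H \<Longrightarrow> l \<in> carrier H \<Longrightarrow>
   (\<And>x y u v. x \<in> carrier H \<Longrightarrow> y \<in> carrier H \<Longrightarrow> u \<in> carrier H \<Longrightarrow> v \<in> carrier H \<Longrightarrow> \<beta> x y u v \<in> carrier U) \<Longrightarrow>
   SW U (\<lambda>x y. SW U (\<lambda>u v. \<beta> x y u v) l) h = SW U (\<lambda>u v. SW U (\<lambda>x y. \<beta> x y u v) h) l"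
  unfolding sw_def by (rule tensor_lift_swap) auto

text \<open>A trilinear \<open>\<beta>\<close> factors through a linear map \<open>?L\<close> on H
  \<otimes> (H \<otimes> H). Applying \<open>?L\<close> to both sides of the axiom
  \<open>coassoc\<close> gives the two double sums.\<close>

lemma SW_coassoc:
  assumes U: "module K U" and h: "h \<in> carrier H"
    and b1: "\<And>y z. y \<in> carrier H \<Longrightarrow> z \<in> carrier H \<Longrightarrow> (\<lambda>x. \<beta> x y z) \<in> lin H U"
    and b2: "\<And>x z. x \<in> carrier H \<Longrightarrow> z \<in> carrier H \<Longrightarrow> (\<lambda>y. \<beta> x y z) \<in> lin H U"
    and b3: "\<And>x y. x \<in> carrier H \<Longrightarrow> y \<in> carrier H \<Longrightarrow> (\<lambda>z. \<beta> x y z) \<in> lin H U"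
  shows "SW U (\<lambda>x z. SW U (\<lambda>x1 x2. \<beta> x1 x2 z) x) h = SW U (\<lambda>x y. SW U (\<lambda>y1 y2. \<beta> x y1 y2) y) h"
proof -
  let ?T = "tensor K H HH2"
  let ?b = "\<lambda>x t. tensor_lift K U (\<lambda>(y, z). \<beta> x y z) t"
  let ?L = "\<lambda>s. tensor_lift K U (\<lambda>(x, t). ?b x t) s"
  have cl: "\<beta> x y z \<in> carrier U" if "x \<in> carrier H" "y \<in> carrier H" "z \<in> carrier H" for x y z
    using lmod_hom_closed[OF b1] that by blast
  have bb: "bilin K H H U (\<beta> x)" if "x \<in> carrier H" for x by (rule bilinI) (use b2 b3 that in auto)
  have bl: "bilin K H HH2 U ?b"
    by (rule bilinI) (auto intro!: tensor_lift_lin tensor_lift_param U bb b1)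
  have L: "?L \<in> lin ?T U" by (rule tensor_lift_lin) (auto simp: U bl)
  have p: "?L (tensor_elt K H HH2 x t) = ?b x t" if "x \<in> carrier H" "t \<in> carrier HH2" for x t
    by (rule tensor_lift_pure[OF _ _ U bl]) (use that in auto)
  have pp: "?b x (tensor_elt K H H y z) = \<beta> x y z" if "x \<in> carrier H" "y \<in> carrier H" "z \<in> carrier H" for x y z
    by (rule tensor_lift_pure[OF _ _ U bb]) (use that in auto)
  have "?L (SW ?T (\<lambda>x z. SW ?T (\<lambda>x1 x2. tensor_elt K H HH2 x1 (tensor_elt K H H x2 z)) x) h)
      = SW U (\<lambda>x z. SW U (\<lambda>x1 x2. ?L (tensor_elt K H HH2 x1 (tensor_elt K H H x2 z))) x) h"
    by (subst SW_comp[OF _ U L]; (simp add: h)?) (rule SW_eqI[OF h], rule SW_comp[OF _ U L], auto)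
  also have "\<dots> = SW U (\<lambda>x z. SW U (\<lambda>x1 x2. \<beta> x1 x2 z) x) h"
    by (simp add: h p pp)
  finally have 1: "?L (SW ?T (\<lambda>x z. SW ?T (\<lambda>x1 x2. tensor_elt K H HH2 x1 (tensor_elt K H H x2 z)) x) h)
      = SW U (\<lambda>x z. SW U (\<lambda>x1 x2. \<beta> x1 x2 z) x) h" .
  have "?L (SW ?T (\<lambda>x y. tensor_elt K H HH2 x (comult H y)) h) = SW U (\<lambda>x y. ?L (tensor_elt K H HH2 x (comult H y))) h"
    by (rule SW_comp[OF _ U L]) (auto simp: h)
  also have "\<dots> = SW U (\<lambda>x y. SW U (\<lambda>y1 y2. \<beta> x y1 y2) y) h"
    by (simp add: h p) (simp add: sw_def)
  finally show ?thesis using 1 coassoc[OF h] unfolding sw_def by simp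
qed

text \<open>The axiom is an identity between elements of \<open>H\<close>; the linear map
  \<open>g\<close> carries it to a sum with values in \<open>U\<close>. The next three lemmas arise
  in the same way, and this is the form in which the axioms are applied inside larger
  expressions.\<close>

lemma SW_counit_left:
  assumes U: "module K U" and g: "g \<in> lin H U" and h: "h \<in> carrier H"
  shows "SW U (\<lambda>x y. counit H x \<odot>\<^bsub>U\<^esub> g y) h = g h"
proof -
  have "g (SW H (\<lambda>x y. counit H x \<odot>\<^bsub>H\<^esub> y) h) = SW U (\<lambda>x y. g (counit H x \<odot>\<^bsub>H\<^esub> y)) h"
    by (rule SW_comp[OF _ U g]) (auto simp: h)
  then show ?thesis using counit_left[OF h, folded sw_def]
    by (simp add: h lmod_hom_smult[OF g])
qed

lemma SW_counit_right:
  assumes U: "module K U" and g: "g \<in> lin H U" and h: "h \<in> carrier H"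
  shows "SW U (\<lambda>x y. counit H y \<odot>\<^bsub>U\<^esub> g x) h = g h"
proof -
  have "g (SW H (\<lambda>x y. counit H y \<odot>\<^bsub>H\<^esub> x) h) = SW U (\<lambda>x y. g (counit H y \<odot>\<^bsub>H\<^esub> x)) h"
    by (rule SW_comp[OF _ U g]) (auto simp: h)
  then show ?thesis using counit_right[OF h, folded sw_def]
    by (simp add: h lmod_hom_smult[OF g])
qed

lemma SW_antipode_left:
  assumes U: "module K U" and g: "g \<in> lin H U" and h: "h \<in> carrier H"
  shows "SW U (\<lambda>x y. g (antipode H x \<star> y)) h = counit H h \<odot>\<^bsub>U\<^esub> g \<one>\<^bsub>H\<^esub>"
proof -
  have "g (SW H (\<lambda>x y. antipode H x \<star> y) h) = SW U (\<lambda>x y. g (antipode H x \<star> y)) h"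
    by (rule SW_comp[OF _ U g]) (auto simp: h)
  then show ?thesis using antipode_left[OF h, folded sw_def]
    by (simp add: h lmod_hom_smult[OF g])
qed

lemma SW_antipode_right:
  assumes U: "module K U" and g: "g \<in> lin H U" and h: "h \<in> carrier H"
  shows "SW U (\<lambda>x y. g (x \<star> antipode H y)) h = counit H h \<odot>\<^bsub>U\<^esub> g \<one>\<^bsub>H\<^esub>"
proof -
  have "g (SW H (\<lambda>x y. x \<star> antipode H y) h) = SW U (\<lambda>x y. g (x \<star> antipode H y)) h"
    by (rule SW_comp[OF _ U g]) (auto simp: h)
  then show ?thesis using antipode_right[OF h, folded sw_def]
    by (simp add: h lmod_hom_smult[OF g])
qed

lemma SW_pure:
  assumes U: "module K U" and b: "bilin K H H U \<beta>" and "comult H h = tensor_elt K H H x y" "x \<in> carrier H" "y \<in> carrier H"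
  shows "SW U \<beta> h = \<beta> x y"
  unfolding sw_def assms(3) by (rule tensor_lift_pure) (auto simp: assms)

lemma SW_one:
  assumes U: "module K U" and b: "bilin K H H U \<beta>"
  shows "SW U \<beta> \<one>\<^bsub>H\<^esub> = \<beta> \<one>\<^bsub>H\<^esub> \<one>\<^bsub>H\<^esub>"
  by (rule SW_pure[OF U b]) (use ring_hom_one[OF comult_mult] in \<open>auto simp: tensor_algebra_def Let_def\<close>)

text \<open>Multiplicativity of the comultiplication says that the components of
  \<open>h \<star> l\<close> are h1 l1 and h2 l2; the linear extension of \<open>\<beta>\<close> is
  applied to that identity.\<close>

lemma SW_mult:
  assumes U: "module K U" and b: "bilin K H H U \<beta>" and h: "h \<in> carrier H" and l: "l \<in> carrier H"
  shows "SW U \<beta> (h \<star> l) = SW U (\<lambda>x y. SW U (\<lambda>u v. \<beta> (x \<star> u) (y \<star> v)) l) h"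
proof -
  let ?L = "\<lambda>t. tensor_lift K U (\<lambda>(x, y). \<beta> x y) t"
  have L: "?L \<in> lin HH2 U" by (rule tensor_lift_lin) (auto simp: U b)
  have p: "?L (tensor_elt K H H x y) = \<beta> x y" if "x \<in> carrier H" "y \<in> carrier H" for x y
    by (rule tensor_lift_pure[OF _ _ U b]) (use that in auto)
  have "comult H (h \<star> l) = SW HH2 (\<lambda>a b. SW HH2 (\<lambda>c d. tensor_elt K H H (a \<star> c) (b \<star> d)) l) h"
    using ring_hom_mult[OF comult_mult h l] by (simp add: tensor_algebra_def Let_def sw_def)
  then have "SW U \<beta> (h \<star> l) = ?L (SW HH2 (\<lambda>a b. SW HH2 (\<lambda>c d. tensor_elt K H H (a \<star> c) (b \<star> d)) l) h)"
    unfolding sw_def by simp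
  also have "\<dots> = SW U (\<lambda>a b. ?L (SW HH2 (\<lambda>c d. tensor_elt K H H (a \<star> c) (b \<star> d)) l)) h"
    by (rule SW_comp[OF _ U L]) (auto simp: h l)
  also have "\<dots> = SW U (\<lambda>x y. SW U (\<lambda>u v. ?L (tensor_elt K H H (x \<star> u) (y \<star> v))) l) h"
    by (rule SW_eqI[OF h], rule SW_comp[OF _ U L]) (auto simp: l)
  finally show ?thesis by (simp add: p h l)
qed

section \<open>The antipode as an antihomomorphism, and the normalised integral\<close>

lemma counit_one: "counit H \<one>\<^bsub>H\<^esub> = \<one>\<^bsub>K\<^esub>" using counit_mult by (rule ring_hom_one)
lemma counit_hmult: "x \<in> carrier H \<Longrightarrow> y \<in> carrier H \<Longrightarrow> counit H (x \<star> y) = counit H x \<otimes>\<^bsub>K\<^esub> counit H y"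
  using counit_mult by (rule ring_hom_mult)

lemma antipode_one: "antipode H \<one>\<^bsub>H\<^esub> = \<one>\<^bsub>H\<^esub>"
proof -
  have "SW H (\<lambda>x y. antipode H x \<star> y) \<one>\<^bsub>H\<^esub> = \<one>\<^bsub>H\<^esub>"
    using antipode_left[OF hone_closed, folded sw_def] by (simp add: counit_one module.smult_one)
  then show ?thesis by (subst (asm) SW_one) (auto intro!: lin_intros)
qed

text \<open>Both sides are evaluations of the sum of \<open>S (h\<^sub>1 l\<^sub>1) h\<^sub>2 l\<^sub>2 S l\<^sub>3 S h\<^sub>3\<close>.\<close>

lemma antipode_mult:
  assumes h: "h \<in> carrier H" and l: "l \<in> carrier H"
  shows "antipode H (h \<star> l) = antipode H l \<star> antipode H h"
proof -
  let ?S = "antipode H"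
  \<comment> \<open>The sum over the components of \<open>l\<close> alone: the second and third
    component cancel as l2 S(l3), which leaves S(p l) q S(z).\<close>
  have A: "SW H (\<lambda>l1 l2. SW H (\<lambda>r s. ?S (p \<star> r) \<star> (q \<star> (s \<star> ?S l2)) \<star> ?S z) l1) l = ?S (p \<star> l) \<star> (q \<star> ?S z)"
    if pq: "p \<in> carrier H" "q \<in> carrier H" "z \<in> carrier H" for p q z
  proof -
    have "SW H (\<lambda>l1 l2. SW H (\<lambda>r s. ?S (p \<star> r) \<star> (q \<star> (s \<star> ?S l2)) \<star> ?S z) l1) l
        = SW H (\<lambda>r y. SW H (\<lambda>s l2. ?S (p \<star> r) \<star> (q \<star> (s \<star> ?S l2)) \<star> ?S z) y) l"
      by (rule SW_coassoc) (auto simp: l pq intro!: lin_intros)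
    also have "\<dots> = SW H (\<lambda>r y. counit H y \<odot>\<^bsub>H\<^esub> (?S (p \<star> r) \<star> (q \<star> \<one>\<^bsub>H\<^esub>) \<star> ?S z)) l"
      by (rule SW_eqI[OF l], rule SW_antipode_right) (auto simp: pq intro!: lin_intros)
    also have "\<dots> = ?S (p \<star> l) \<star> (q \<star> \<one>\<^bsub>H\<^esub>) \<star> ?S z"
      by (rule SW_counit_right) (auto simp: l pq intro!: lin_intros)
    finally show ?thesis using pq l by (simp add: hmult_assoc)
  qed
  have "?S l \<star> ?S h = SW H (\<lambda>h1 h2. counit H h1 \<odot>\<^bsub>H\<^esub> (?S l \<star> ?S h2)) h"
    by (rule SW_counit_left[symmetric]) (auto simp: h l intro!: lin_intros)
  also have "\<dots> = SW H (\<lambda>h1 h2. SW H (\<lambda>l1 l2. counit H l1 \<odot>\<^bsub>H\<^esub> (counit H h1 \<odot>\<^bsub>H\<^esub> (?S l2 \<star> ?S h2))) l) h"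
    by (rule SW_eqI[OF h], rule SW_counit_left[symmetric]) (auto simp: h l intro!: lin_intros)
  \<comment> \<open>The two counits merge into \<epsilon>(h1 l1), so that the antipode axiom can be
    inserted backwards for the product h1 l1.\<close>
  also have "\<dots> = SW H (\<lambda>h1 h2. SW H (\<lambda>l1 l2. counit H (h1 \<star> l1) \<odot>\<^bsub>H\<^esub> (\<one>\<^bsub>H\<^esub> \<star> (?S l2 \<star> ?S h2))) l) h"
    by (intro SW_eqI h l) (simp add: counit_hmult module.smult_assoc1[OF H_module, symmetric] cring.cring_simprules(14)[OF K_cring])
  also have "\<dots> = SW H (\<lambda>h1 h2. SW H (\<lambda>l1 l2. SW H (\<lambda>u v. ?S u \<star> v \<star> (?S l2 \<star> ?S h2)) (h1 \<star> l1)) l) h"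
    by (intro SW_eqI h l, rule SW_antipode_left[symmetric]) (auto simp: h l intro!: lin_intros)
  also have "\<dots> = SW H (\<lambda>h1 h2. SW H (\<lambda>l1 l2. SW H (\<lambda>p q. SW H (\<lambda>r s. ?S (p \<star> r) \<star> (q \<star> s) \<star> (?S l2 \<star> ?S h2)) l1) h1) l) h"
    by (intro SW_eqI h l, rule SW_mult) (auto simp: h l intro!: lin_intros)
  also have "\<dots> = SW H (\<lambda>h1 h2. SW H (\<lambda>l1 l2. SW H (\<lambda>p q. SW H (\<lambda>r s. ?S (p \<star> r) \<star> (q \<star> (s \<star> ?S l2)) \<star> ?S h2) l1) h1) l) h"
    by (intro SW_eqI h l; simp add: hmult_assoc)
  also have "\<dots> = SW H (\<lambda>h1 h2. SW H (\<lambda>p q. SW H (\<lambda>l1 l2. SW H (\<lambda>r s. ?S (p \<star> r) \<star> (q \<star> (s \<star> ?S l2)) \<star> ?S h2) l1) l) h1) h"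
    by (intro SW_eqI h l, rule SW_swap) (auto simp: h l)
  also have "\<dots> = SW H (\<lambda>h1 h2. SW H (\<lambda>p q. ?S (p \<star> l) \<star> (q \<star> ?S h2)) h1) h"
    by (intro SW_eqI h l; (assumption | rule A))
  also have "\<dots> = SW H (\<lambda>p y. SW H (\<lambda>q h2. ?S (p \<star> l) \<star> (q \<star> ?S h2)) y) h"
    by (rule SW_coassoc) (auto simp: h l intro!: lin_intros)
  also have "\<dots> = SW H (\<lambda>p y. counit H y \<odot>\<^bsub>H\<^esub> (?S (p \<star> l) \<star> \<one>\<^bsub>H\<^esub>)) h"
    by (rule SW_eqI[OF h], rule SW_antipode_right) (auto simp: l intro!: lin_intros)
  also have "\<dots> = ?S (h \<star> l) \<star> \<one>\<^bsub>H\<^esub>"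
    by (rule SW_counit_right) (auto simp: h l intro!: lin_intros)
  finally show ?thesis using h l by simp
qed

text \<open>The kernel of the counit is a left ideal, so semisimplicity gives a complementary left
  ideal \<open>N'\<close>, and \<open>t\<close> is the component of 1 in it. For every
  \<open>h\<close> the element (h - \<epsilon>(h) 1) t lies in the kernel and in \<open>N'\<close>,
  hence vanishes; applying \<epsilon> to 1 = u + t gives \<epsilon>(t) = 1.\<close>

lemma integral_exists:
  assumes "semisimple_algebra H"
  obtains t where "t \<in> carrier H" "counit H t = \<one>\<^bsub>K\<^esub>"
    "\<And>h. h \<in> carrier H \<Longrightarrow> h \<star> t = counit H h \<odot>\<^bsub>H\<^esub> t"
proof -
  interpret H: ring H by (rule H_ring)
  interpret HK: module K H by (rule H_module)
  interpret A: assoc_algebra K H by (rule algebra)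
  let ?H = "with_action H (mult H)"
  have sel: "carrier ?H = carrier H" "add ?H = add H" "zero ?H = zero H" "smult ?H = mult H"
    by (simp_all add: with_action_def)
  have ai: "\<ominus>\<^bsub>?H\<^esub> x = \<ominus>\<^bsub>H\<^esub> x" for x by (simp add: a_inv_def m_inv_def sel)
  let ?N = "{x \<in> carrier H. counit H x = \<zero>\<^bsub>K\<^esub>}"
  have e0: "counit H \<zero>\<^bsub>H\<^esub> = \<zero>\<^bsub>K\<^esub>" by (rule ring_hom_zero[OF counit_mult H_ring K_ring])
  interpret K: cring K by (rule K_cring)
  have eadd: "counit H (x \<oplus>\<^bsub>H\<^esub> y) = counit H x \<oplus>\<^bsub>K\<^esub> counit H y" if "x \<in> carrier H" "y \<in> carrier H" for x y
    using ring_hom_add[OF counit_mult that] .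
  have einv: "counit H (\<ominus>\<^bsub>H\<^esub> x) = \<ominus>\<^bsub>K\<^esub> counit H x" if x: "x \<in> carrier H" for x
  proof -
    have "counit H (\<ominus>\<^bsub>H\<^esub> x) \<oplus>\<^bsub>K\<^esub> counit H x = \<zero>\<^bsub>K\<^esub>" using eadd[of "\<ominus>\<^bsub>H\<^esub> x" x] x e0 by (simp add: H.l_neg)
    then show ?thesis using x abelian_group.minus_equality[OF ring.axioms(1)[OF K_ring]] by (metis H.a_inv_closed counit_closed)
  qed
  have "submodule ?N H ?H"
  proof (intro submodule.intro subgroup.intro submodule_axioms.intro)
    show "inv\<^bsub>add_monoid ?H\<^esub> x \<in> ?N" if "x \<in> ?N" for x
      using that einv unfolding a_inv_def[symmetric] ai by simp
  qed (auto simp: sel e0 eadd counit_hmult)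
  then obtain N' where N': "submodule N' H ?H" "?N \<inter> N' = {\<zero>\<^bsub>H\<^esub>}" "?N <+>\<^bsub>?H\<^esub> N' = carrier H"
    using assms unfolding semisimple_algebra_def semisimple_module_def by (auto simp: sel)
  have N'sub: "N' \<subseteq> carrier H" using subgroup.subset[OF submodule.axioms(1)[OF N'(1)]] by (simp add: sel)
  have N'm: "h \<star> x \<in> N'" if "h \<in> carrier H" "x \<in> N'" for h x
    using submodule.smult_closed[OF N'(1)] that by (simp add: sel)
  have "\<one>\<^bsub>H\<^esub> \<in> ?N <+>\<^bsub>?H\<^esub> N'" using N'(3) by simp
  then obtain u t where u: "u \<in> ?N" and t: "t \<in> N'" and ut: "\<one>\<^bsub>H\<^esub> = u \<oplus>\<^bsub>H\<^esub> t"
    by (auto simp: set_add_def' sel)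
  have tc: "t \<in> carrier H" using t N'sub by auto
  have et: "counit H t = \<one>\<^bsub>K\<^esub>" using eadd[of u t] u tc ut counit_one by simp
  have "h \<star> t = counit H h \<odot>\<^bsub>H\<^esub> t" if h: "h \<in> carrier H" for h
  proof -
    let ?d = "h \<oplus>\<^bsub>H\<^esub> \<ominus>\<^bsub>H\<^esub> (counit H h \<odot>\<^bsub>H\<^esub> \<one>\<^bsub>H\<^esub>)"
    have d: "?d \<in> carrier H" using h by simp
    have "counit H ?d = \<zero>\<^bsub>K\<^esub>"
      using h by (simp add: eadd einv counit_linear counit_one abelian_group.r_neg[OF ring.axioms(1)[OF K_ring]])
    then have "?d \<star> t \<in> ?N \<inter> N'" using d t N'm tc by (simp add: counit_hmult)
    then have "?d \<star> t = \<zero>\<^bsub>H\<^esub>" using N'(2) by auto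
    then have "h \<star> t \<ominus>\<^bsub>H\<^esub> counit H h \<odot>\<^bsub>H\<^esub> t = \<zero>\<^bsub>H\<^esub>"
      using h tc by (simp add: H.l_distr H.l_minus A.smult_mult_left a_minus_def)
    then show ?thesis by (rule H.eq_if_minus_zero) (use h tc in auto)
  qed
  then show thesis using that tc et by blast
qed

end

subsection \<open>Bimodules as modules over the enveloping algebra\<close>

text \<open>Opposite algebras, tensor algebras and smash products only replace \<open>mult\<close>
  or \<open>one\<close> in the record of a vector space. This lemma and the next three transport
  linear facts between such records.\<close>

lemma module_same_ops:
  assumes "module K V" "carrier W = carrier V" "add W = add V" "zero W = zero V" "smult W = smult V"
  shows "module K W"
proof -
  interpret module K V by fact
  have ag: "abelian_group W"
    by (rule abelian_groupI)
       (auto simp: assms(2-5) M.a_assoc intro: M.a_comm bexI[of _ "\<ominus>\<^bsub>V\<^esub> x" for x] M.l_neg)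
  show ?thesis
    by (rule moduleI[OF R.is_cring ag]) (auto simp: assms(2-5) smult_l_distr smult_r_distr smult_assoc1)
qed

lemma lmod_hom_same_ops:
  assumes "carrier W = carrier V" "add W = add V" "smult W = smult V"
  shows "lmod_hom K W U = lmod_hom K V U" "lmod_hom K X W = lmod_hom K X V"
  by (simp_all add: lmod_hom_def assms)

lemma bilin_same_ops:
  assumes "carrier W = carrier V" "add W = add V" "smult W = smult V"
  shows "bilin K W X U = bilin K V X U" "bilin K X W U = bilin K X V U" "bilin K X Y W = bilin K X Y V"
  by (simp_all add: fun_eq_iff bilin_def lmod_hom_same_ops[OF assms] assms)

lemma tensor_same_ops:
  assumes "carrier W = carrier V" "add W = add V" "smult W = smult V"
  shows "tensor K X W = tensor K X V" "tensor K W X = tensor K V X"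
    "tensor_elt K X W = tensor_elt K X V" "tensor_elt K W X = tensor_elt K V X"
proof -
  have r: "tensor_relations K X W = tensor_relations K X V" "tensor_relations K W X = tensor_relations K V X"
    by (simp_all add: tensor_relations_def assms)
  show "tensor K X W = tensor K X V" "tensor K W X = tensor K V X"
    "tensor_elt K X W = tensor_elt K X V" "tensor_elt K W X = tensor_elt K V X"
    by (simp_all add: fun_eq_iff tensor_def tensor_elt_def r assms)
qed

lemma op_algebra_sel [simp]:
  "carrier (op_algebra R) = carrier R" "add (op_algebra R) = add R" "zero (op_algebra R) = zero R"
  "one (op_algebra R) = one R" "smult (op_algebra R) = smult R" "mult (op_algebra R) = (\<lambda>a b. b \<otimes>\<^bsub>R\<^esub> a)"
  by (simp_all add: op_algebra_def)

lemma with_action_sel [simp]: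
  "carrier (with_action M act) = carrier M" "add (with_action M act) = add M" "zero (with_action M act) = zero M"
  "smult (with_action M act) = act"
  by (simp_all add: with_action_def)

lemma tensor_algebra_sel [simp]:
  "carrier (tensor_algebra K A B) = carrier (tensor K A B)" "add (tensor_algebra K A B) = add (tensor K A B)"
  "zero (tensor_algebra K A B) = zero (tensor K A B)" "smult (tensor_algebra K A B) = smult (tensor K A B)"
  "one (tensor_algebra K A B) = tensor_elt K A B \<one>\<^bsub>A\<^esub> \<one>\<^bsub>B\<^esub>"
  by (simp_all add: tensor_algebra_def Let_def)

text \<open>The one-sided actions on a module over the enveloping algebra are multiplication by r
  \<otimes> 1 and, in \<open>right_act\<close>, by 1 \<otimes> r. They recover the bimodule also
  from modules that are not built by \<open>enveloping_module\<close>, such as the terms of a given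
  resolution.\<close>

definition left_act where
  "left_act K R X r x = tensor_elt K R (op_algebra R) r \<one>\<^bsub>R\<^esub> \<odot>\<^bsub>X\<^esub> x"
definition right_act where
  "right_act K R X x r = tensor_elt K R (op_algebra R) \<one>\<^bsub>R\<^esub> r \<odot>\<^bsub>X\<^esub> x"
text \<open>The \<open>smult\<close> field of such a module holds the action of the enveloping
  algebra, so the vector space structure is recovered by letting the scalar c act as c 1, which is
  the convention of \<open>hom_space\<close>.\<close>

definition vspace where
  "vspace K R X = with_action X (\<lambda>c x. (c \<odot>\<^bsub>enveloping_algebra K R\<^esub> \<one>\<^bsub>enveloping_algebra K R\<^esub>) \<odot>\<^bsub>X\<^esub> x)"

lemma vspace_sel [simp]:
  "carrier (vspace K R X) = carrier X" "add (vspace K R X) = add X" "zero (vspace K R X) = zero X"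
  by (simp_all add: vspace_def)

locale env_alg = lin_alg K for K :: "('k, 's) ring_scheme" +
  fixes R :: "('k, 'r, 'y) module_scheme"
  assumes R_alg: "assoc_algebra K R" and E_ring: "ring (enveloping_algebra K R)"
begin

abbreviation "E \<equiv> enveloping_algebra K R"
abbreviation "RR \<equiv> tensor K R R"
abbreviation "pure \<equiv> tensor_elt K R R"

lemma R_module [simp]: "module K R" and R_ring: "ring R"
  using R_alg by (simp_all add: assoc_algebra_def)

lemma rmult_closed [simp]: "x \<in> carrier R \<Longrightarrow> y \<in> carrier R \<Longrightarrow> x \<otimes>\<^bsub>R\<^esub> y \<in> carrier R"
  and rone_closed [simp]: "\<one>\<^bsub>R\<^esub> \<in> carrier R"
  and rmult_assoc: "x \<in> carrier R \<Longrightarrow> y \<in> carrier R \<Longrightarrow> z \<in> carrier R \<Longrightarrow> x \<otimes>\<^bsub>R\<^esub> y \<otimes>\<^bsub>R\<^esub> z = x \<otimes>\<^bsub>R\<^esub> (y \<otimes>\<^bsub>R\<^esub> z)"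
  and rmult_one [simp]: "x \<in> carrier R \<Longrightarrow> \<one>\<^bsub>R\<^esub> \<otimes>\<^bsub>R\<^esub> x = x" "x \<in> carrier R \<Longrightarrow> x \<otimes>\<^bsub>R\<^esub> \<one>\<^bsub>R\<^esub> = x"
  using ring.ring_simprules[OF R_ring] monoid.r_one[OF ring.is_monoid[OF R_ring]] by simp_all

lemma rmult_bilin: "bilin K R R R (mult R)"
proof -
  interpret assoc_algebra K R by (rule R_alg)
  show ?thesis by (intro bilinI lmod_homI) (auto simp: A.l_distr A.r_distr smult_mult_left smult_mult_right)
qed

lemmas rmult_lin [lin_intros] = bilin_left[OF rmult_bilin] bilin_right[OF rmult_bilin]

lemma tensor_op [simp]: "tensor K R (op_algebra R) = RR" "tensor_elt K R (op_algebra R) = pure"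
  by (intro tensor_same_ops; simp)+

lemma E_sel [simp]: "carrier E = carrier RR" "add E = add RR" "zero E = zero RR" "smult E = smult RR"
    "one E = pure \<one>\<^bsub>R\<^esub> \<one>\<^bsub>R\<^esub>"
  by (simp_all add: enveloping_algebra_def)

lemma E_module [simp]: "module K E" "module K RR"
  by (auto intro: module_same_ops[of _ RR])

lemma E_mult_lift: "s \<otimes>\<^bsub>E\<^esub> t =
    tensor_lift K RR (\<lambda>(a, b). tensor_lift K RR (\<lambda>(c, d). pure (a \<otimes>\<^bsub>R\<^esub> c) (d \<otimes>\<^bsub>R\<^esub> b)) t) s"
  by (simp add: enveloping_algebra_def tensor_algebra_def Let_def)

lemma E_mult_bilin: "bilin K RR RR RR (mult E)"
  and E_mult_pure: "a \<in> carrier R \<Longrightarrow> b \<in> carrier R \<Longrightarrow> c \<in> carrier R \<Longrightarrow> d \<in> carrier R \<Longrightarrow>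
    pure a b \<otimes>\<^bsub>E\<^esub> pure c d = pure (a \<otimes>\<^bsub>R\<^esub> c) (d \<otimes>\<^bsub>R\<^esub> b)"
proof -
  have b1: "bilin K R R RR (\<lambda>c d. pure (a \<otimes>\<^bsub>R\<^esub> c) (d \<otimes>\<^bsub>R\<^esub> b))" if "a \<in> carrier R" "b \<in> carrier R" for a b
    using that by (auto intro!: lin_intros)
  have b2: "bilin K R R RR (\<lambda>a b. pure (a \<otimes>\<^bsub>R\<^esub> c) (d \<otimes>\<^bsub>R\<^esub> b))" if "c \<in> carrier R" "d \<in> carrier R" for c d
    using that by (auto intro!: lin_intros)
  show "bilin K RR RR RR (mult E)" unfolding E_mult_lift[abs_def]
    by (rule tensor_lift2_bilin(1)) (simp_all add: b1 b2)
  show "pure a b \<otimes>\<^bsub>E\<^esub> pure c d = pure (a \<otimes>\<^bsub>R\<^esub> c) (d \<otimes>\<^bsub>R\<^esub> b)"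
    if "a \<in> carrier R" "b \<in> carrier R" "c \<in> carrier R" "d \<in> carrier R"
    unfolding E_mult_lift using that by (intro tensor_lift2_bilin(2)) (simp_all add: b1 b2)
qed

context
  fixes X :: "(('r \<times> 'r \<Rightarrow> 'k) set, 'x, 'z) module_scheme"
  assumes X: "left_module E X"
begin

interpretation X: left_module E X by (rule X)

lemma E_closed [simp]: "t \<in> carrier RR \<Longrightarrow> x \<in> carrier X \<Longrightarrow> t \<odot>\<^bsub>X\<^esub> x \<in> carrier X"
  using X.lsmult_closed by simp

text \<open>Scalars are central in the enveloping algebra. This makes the scalars of
  \<open>vspace\<close> commute with the action of every \<open>t\<close>.\<close>

lemma E_smult_smult: "c \<in> carrier K \<Longrightarrow> t \<in> carrier RR \<Longrightarrow>
    (c \<odot>\<^bsub>RR\<^esub> t) = (c \<odot>\<^bsub>RR\<^esub> \<one>\<^bsub>E\<^esub>) \<otimes>\<^bsub>E\<^esub> t \<and> (c \<odot>\<^bsub>RR\<^esub> t) = t \<otimes>\<^bsub>E\<^esub> (c \<odot>\<^bsub>RR\<^esub> \<one>\<^bsub>E\<^esub>)"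
  using lmod_hom_smult[OF bilinD(2)[OF E_mult_bilin], of t c "\<one>\<^bsub>E\<^esub>"]
    lmod_hom_smult[OF bilinD(1)[OF E_mult_bilin], of t c "\<one>\<^bsub>E\<^esub>"] ring.ring_simprules(12)[OF E_ring, of t]
    monoid.r_one[OF ring.is_monoid[OF E_ring], of t] by simp

lemma vspace_smult: "c \<odot>\<^bsub>vspace K R X\<^esub> x = (c \<odot>\<^bsub>RR\<^esub> \<one>\<^bsub>E\<^esub>) \<odot>\<^bsub>X\<^esub> x"
  by (simp add: vspace_def)

lemma vspace_module: "module K (vspace K R X)"
proof -
  have ag: "abelian_group (vspace K R X)"
    by (rule abelian_groupI) (auto simp: X.M.a_assoc intro: X.M.a_comm bexI[of _ "\<ominus>\<^bsub>X\<^esub> x" for x] X.M.l_neg)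
  interpret RRm: module K RR by simp
  have one: "\<one>\<^bsub>E\<^esub> \<in> carrier RR" by simp
  have c: "c \<odot>\<^bsub>RR\<^esub> \<one>\<^bsub>E\<^esub> \<in> carrier RR" if "c \<in> carrier K" for c using that one by (intro RRm.smult_closed)
  show ?thesis
  proof (rule moduleI[OF K_cring ag])
    fix a b x assume ab: "a \<in> carrier K" "b \<in> carrier K" and "x \<in> carrier (vspace K R X)"
    then have x: "x \<in> carrier X" by simp
    have "(a \<oplus>\<^bsub>K\<^esub> b) \<odot>\<^bsub>RR\<^esub> \<one>\<^bsub>E\<^esub> = a \<odot>\<^bsub>RR\<^esub> \<one>\<^bsub>E\<^esub> \<oplus>\<^bsub>E\<^esub> b \<odot>\<^bsub>RR\<^esub> \<one>\<^bsub>E\<^esub>"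
      using RRm.smult_l_distr[OF ab one] by simp
    then show "(a \<oplus>\<^bsub>K\<^esub> b) \<odot>\<^bsub>vspace K R X\<^esub> x = a \<odot>\<^bsub>vspace K R X\<^esub> x \<oplus>\<^bsub>vspace K R X\<^esub> b \<odot>\<^bsub>vspace K R X\<^esub> x"
      using X.lsmult_l_distr[of "a \<odot>\<^bsub>RR\<^esub> \<one>\<^bsub>E\<^esub>" "b \<odot>\<^bsub>RR\<^esub> \<one>\<^bsub>E\<^esub>" x] c[OF ab(1)] c[OF ab(2)] x
      by (simp only: vspace_smult vspace_sel E_sel(1))
    have "(a \<otimes>\<^bsub>K\<^esub> b) \<odot>\<^bsub>RR\<^esub> \<one>\<^bsub>E\<^esub> = (a \<odot>\<^bsub>RR\<^esub> \<one>\<^bsub>E\<^esub>) \<otimes>\<^bsub>E\<^esub> (b \<odot>\<^bsub>RR\<^esub> \<one>\<^bsub>E\<^esub>)"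
      using RRm.smult_assoc1[OF ab one] conjunct1[OF E_smult_smult[OF ab(1) c[OF ab(2)]]] by simp
    then show "(a \<otimes>\<^bsub>K\<^esub> b) \<odot>\<^bsub>vspace K R X\<^esub> x = a \<odot>\<^bsub>vspace K R X\<^esub> (b \<odot>\<^bsub>vspace K R X\<^esub> x)"
      using X.lsmult_assoc[of "a \<odot>\<^bsub>RR\<^esub> \<one>\<^bsub>E\<^esub>" "b \<odot>\<^bsub>RR\<^esub> \<one>\<^bsub>E\<^esub>" x] c[OF ab(1)] c[OF ab(2)] x
      by (simp only: vspace_smult vspace_sel E_sel(1))
  next
    fix x assume "x \<in> carrier (vspace K R X)"
    then show "\<one>\<^bsub>K\<^esub> \<odot>\<^bsub>vspace K R X\<^esub> x = x"
      using X.lsmult_one[of x] RRm.smult_one[OF one] by (simp only: vspace_smult vspace_sel)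
  next
    fix a x assume "a \<in> carrier K" "x \<in> carrier (vspace K R X)"
    then show "a \<odot>\<^bsub>vspace K R X\<^esub> x \<in> carrier (vspace K R X)"
      using c X.lsmult_closed by (simp only: vspace_smult vspace_sel E_sel(1))
  next
    fix a x y assume "a \<in> carrier K" "x \<in> carrier (vspace K R X)" "y \<in> carrier (vspace K R X)"
    then show "a \<odot>\<^bsub>vspace K R X\<^esub> (x \<oplus>\<^bsub>vspace K R X\<^esub> y) = a \<odot>\<^bsub>vspace K R X\<^esub> x \<oplus>\<^bsub>vspace K R X\<^esub> a \<odot>\<^bsub>vspace K R X\<^esub> y"
      using c X.lsmult_r_distr by (simp only: vspace_smult vspace_sel E_sel(1))
  qed
qed

lemma E_act_bilin: "bilin K RR (vspace K R X) (vspace K R X) (smult X)"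
proof -
  have c: "c \<odot>\<^bsub>RR\<^esub> \<one>\<^bsub>E\<^esub> \<in> carrier RR" if "c \<in> carrier K" for c using that by simp
  have s1: "(c \<odot>\<^bsub>RR\<^esub> t) \<odot>\<^bsub>X\<^esub> x = (c \<odot>\<^bsub>RR\<^esub> \<one>\<^bsub>E\<^esub>) \<odot>\<^bsub>X\<^esub> (t \<odot>\<^bsub>X\<^esub> x)"
    if "c \<in> carrier K" "t \<in> carrier RR" "x \<in> carrier X" for c t x
    using X.lsmult_assoc[of "c \<odot>\<^bsub>RR\<^esub> \<one>\<^bsub>E\<^esub>" t x] that c[OF that(1)] conjunct1[OF E_smult_smult[OF that(1,2)]]
    by (simp only: E_sel(1))
  have s2: "(c \<odot>\<^bsub>RR\<^esub> t) \<odot>\<^bsub>X\<^esub> x = t \<odot>\<^bsub>X\<^esub> ((c \<odot>\<^bsub>RR\<^esub> \<one>\<^bsub>E\<^esub>) \<odot>\<^bsub>X\<^esub> x)"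
    if "c \<in> carrier K" "t \<in> carrier RR" "x \<in> carrier X" for c t x
    using X.lsmult_assoc[of t "c \<odot>\<^bsub>RR\<^esub> \<one>\<^bsub>E\<^esub>" x] that c[OF that(1)] conjunct2[OF E_smult_smult[OF that(1,2)]]
    by (simp only: E_sel(1))
  show ?thesis
  proof (rule bilinI; rule lmod_homI)
    fix t x y assume "t \<in> carrier RR" "x \<in> carrier (vspace K R X)" "y \<in> carrier (vspace K R X)"
    then show "t \<odot>\<^bsub>X\<^esub> (x \<oplus>\<^bsub>vspace K R X\<^esub> y) = t \<odot>\<^bsub>X\<^esub> x \<oplus>\<^bsub>vspace K R X\<^esub> t \<odot>\<^bsub>X\<^esub> y"
      using X.lsmult_r_distr by simp
  next
    fix t s x assume "x \<in> carrier (vspace K R X)" "t \<in> carrier RR" "s \<in> carrier RR"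
    then show "(t \<oplus>\<^bsub>RR\<^esub> s) \<odot>\<^bsub>X\<^esub> x = t \<odot>\<^bsub>X\<^esub> x \<oplus>\<^bsub>vspace K R X\<^esub> s \<odot>\<^bsub>X\<^esub> x"
      using X.lsmult_l_distr by simp
  qed (use s1 s2 in \<open>auto simp: vspace_smult simp del: E_sel(5)\<close>)
qed

lemmas E_act_lin = bilin_left[OF E_act_bilin] bilin_right[OF E_act_bilin]

lemma left_act_bilin: "bilin K R (vspace K R X) (vspace K R X) (left_act K R X)"
  unfolding left_act_def by (auto intro!: bilinI E_act_lin lin_intros)

lemma right_act_bilin: "bilin K (vspace K R X) R (vspace K R X) (right_act K R X)"
  unfolding right_act_def by (auto intro!: bilinI E_act_lin lin_intros)

lemma left_act_closed [simp]: "r \<in> carrier R \<Longrightarrow> x \<in> carrier X \<Longrightarrow> left_act K R X r x \<in> carrier X"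
  and right_act_closed [simp]: "r \<in> carrier R \<Longrightarrow> x \<in> carrier X \<Longrightarrow> right_act K R X x r \<in> carrier X"
  by (simp_all add: left_act_def right_act_def)

lemma E_assoc: "s \<in> carrier RR \<Longrightarrow> t \<in> carrier RR \<Longrightarrow> x \<in> carrier X \<Longrightarrow> s \<odot>\<^bsub>X\<^esub> (t \<odot>\<^bsub>X\<^esub> x) = (s \<otimes>\<^bsub>E\<^esub> t) \<odot>\<^bsub>X\<^esub> x"
  using X.lsmult_assoc by simp

lemma left_right_act: "r \<in> carrier R \<Longrightarrow> s \<in> carrier R \<Longrightarrow> x \<in> carrier X \<Longrightarrow>
    pure r s \<odot>\<^bsub>X\<^esub> x = left_act K R X r (right_act K R X x s)"
  and left_right_act_commute: "r \<in> carrier R \<Longrightarrow> s \<in> carrier R \<Longrightarrow> x \<in> carrier X \<Longrightarrow>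
    right_act K R X (left_act K R X r x) s = left_act K R X r (right_act K R X x s)"
  and left_act_assoc: "r \<in> carrier R \<Longrightarrow> s \<in> carrier R \<Longrightarrow> x \<in> carrier X \<Longrightarrow>
    left_act K R X r (left_act K R X s x) = left_act K R X (r \<otimes>\<^bsub>R\<^esub> s) x"
  and right_act_assoc: "r \<in> carrier R \<Longrightarrow> s \<in> carrier R \<Longrightarrow> x \<in> carrier X \<Longrightarrow>
    right_act K R X (right_act K R X x r) s = right_act K R X x (r \<otimes>\<^bsub>R\<^esub> s)"
  by (simp_all add: left_act_def right_act_def E_assoc E_mult_pure)

lemma left_act_one: "x \<in> carrier X \<Longrightarrow> left_act K R X \<one>\<^bsub>R\<^esub> x = x"
  and right_act_one: "x \<in> carrier X \<Longrightarrow> right_act K R X x \<one>\<^bsub>R\<^esub> = x"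
  using X.lsmult_one by (simp_all add: left_act_def right_act_def)

end

lemma E_homD:
  assumes "left_module E X" "left_module E Y" "f \<in> lmod_hom E X Y"
  shows "f \<in> lin (vspace K R X) (vspace K R Y)"
    "\<And>r x. r \<in> carrier R \<Longrightarrow> x \<in> carrier X \<Longrightarrow> f (left_act K R X r x) = left_act K R Y r (f x)"
    "\<And>r x. r \<in> carrier R \<Longrightarrow> x \<in> carrier X \<Longrightarrow> f (right_act K R X x r) = right_act K R Y (f x) r"
proof -
  have c: "c \<odot>\<^bsub>RR\<^esub> \<one>\<^bsub>E\<^esub> \<in> carrier E" if "c \<in> carrier K" for c using that by simp
  show "f \<in> lin (vspace K R X) (vspace K R Y)"
    by (rule lmod_homI)
       (use assms(3) c in \<open>auto simp: lmod_hom_add lmod_hom_closed vspace_smult[OF assms(1)] vspace_smult[OF assms(2)]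
          lmod_hom_smult simp del: E_sel\<close>)
qed (use assms(3) in \<open>simp_all add: left_act_def right_act_def lmod_hom_smult\<close>)

text \<open>Pure tensors span the enveloping algebra and act by a right multiplication followed by a
  left one, so a linear map compatible with both one-sided actions is linear over the whole
  algebra.\<close>

lemma E_homI:
  assumes X: "left_module E X" and Y: "left_module E Y" and f: "f \<in> lin (vspace K R X) (vspace K R Y)"
    and l: "\<And>r x. r \<in> carrier R \<Longrightarrow> x \<in> carrier X \<Longrightarrow> f (left_act K R X r x) = left_act K R Y r (f x)"
    and r: "\<And>r x. r \<in> carrier R \<Longrightarrow> x \<in> carrier X \<Longrightarrow> f (right_act K R X x r) = right_act K R Y (f x) r"
  shows "f \<in> lmod_hom E X Y"
proof (rule lmod_homI)
  have fc: "f x \<in> carrier Y" if "x \<in> carrier X" for x using lmod_hom_closed[OF f] that by simp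
  then show "f x \<in> carrier Y" if "x \<in> carrier X" for x using that .
  show "f (x \<oplus>\<^bsub>X\<^esub> y) = f x \<oplus>\<^bsub>Y\<^esub> f y" if "x \<in> carrier X" "y \<in> carrier X" for x y
    using lmod_hom_add[OF f] that by simp
  fix t x assume t: "t \<in> carrier E" and x: "x \<in> carrier X"
  show "f (t \<odot>\<^bsub>X\<^esub> x) = t \<odot>\<^bsub>Y\<^esub> f x"
  proof (rule tensor_hom_ext[OF R_module R_module vspace_module[OF Y]])
    show "(\<lambda>t. f (t \<odot>\<^bsub>X\<^esub> x)) \<in> lin RR (vspace K R Y)"
      by (rule lin_comp[OF _ f], rule bilinD(2)[OF E_act_bilin[OF X]]) (simp add: x)
    show "(\<lambda>t. t \<odot>\<^bsub>Y\<^esub> f x) \<in> lin RR (vspace K R Y)"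
      by (rule bilinD(2)[OF E_act_bilin[OF Y]]) (simp add: x fc)
  qed (use t x in \<open>simp_all add: left_right_act[OF X] left_right_act[OF Y] fc l r right_act_closed[OF X]\<close>)
qed

section \<open>Bimodules turned into modules over the enveloping algebra\<close>

context
  fixes M :: "('k, 'm, 'z) module_scheme" and lact ract
  assumes bim: "bimodule K R M lact ract"
begin

interpretation B: bimodule K R M lact ract by (rule bim)
interpretation L: left_module R "with_action M lact" by (rule B.left)
interpretation Rr: left_module "op_algebra R" "with_action M (\<lambda>r m. ract m r)" by (rule B.right)
interpretation M: module K M by (rule B.vector_space)

lemma lact_closed [simp]: "r \<in> carrier R \<Longrightarrow> m \<in> carrier M \<Longrightarrow> lact r m \<in> carrier M"
  and ract_closed [simp]: "r \<in> carrier R \<Longrightarrow> m \<in> carrier M \<Longrightarrow> ract m r \<in> carrier M"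
  and lact_assoc: "r \<in> carrier R \<Longrightarrow> s \<in> carrier R \<Longrightarrow> m \<in> carrier M \<Longrightarrow> lact r (lact s m) = lact (r \<otimes>\<^bsub>R\<^esub> s) m"
  and ract_assoc: "r \<in> carrier R \<Longrightarrow> s \<in> carrier R \<Longrightarrow> m \<in> carrier M \<Longrightarrow> ract (ract m r) s = ract m (r \<otimes>\<^bsub>R\<^esub> s)"
  and lact_one [simp]: "m \<in> carrier M \<Longrightarrow> lact \<one>\<^bsub>R\<^esub> m = m" and ract_one [simp]: "m \<in> carrier M \<Longrightarrow> ract m \<one>\<^bsub>R\<^esub> = m"
  using L.lsmult_closed Rr.lsmult_closed L.lsmult_assoc Rr.lsmult_assoc L.lsmult_one Rr.lsmult_one by simp_all

text \<open>Scalar multiplication on \<open>M\<close> is multiplication by c 1 from either side, and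
  c 1 commutes with \<open>r\<close> by the algebra laws.\<close>

lemma lact_smult_right:
  assumes "r \<in> carrier R" "c \<in> carrier K" "m \<in> carrier M"
  shows "lact r (c \<odot>\<^bsub>M\<^esub> m) = c \<odot>\<^bsub>M\<^esub> lact r m" "ract (c \<odot>\<^bsub>M\<^esub> m) r = c \<odot>\<^bsub>M\<^esub> ract m r"
proof -
  interpret A: assoc_algebra K R by (rule R_alg)
  have c: "c \<odot>\<^bsub>R\<^esub> \<one>\<^bsub>R\<^esub> \<in> carrier R" using assms by simp
  have e: "c \<odot>\<^bsub>M\<^esub> m = lact (c \<odot>\<^bsub>R\<^esub> \<one>\<^bsub>R\<^esub>) m" "c \<odot>\<^bsub>M\<^esub> m = ract m (c \<odot>\<^bsub>R\<^esub> \<one>\<^bsub>R\<^esub>)"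
    using assms by (simp_all add: B.lact_smult B.ract_smult)
  show "lact r (c \<odot>\<^bsub>M\<^esub> m) = c \<odot>\<^bsub>M\<^esub> lact r m"
    unfolding e(1) using assms c by (simp add: lact_assoc A.smult_mult_right flip: B.lact_smult)
  show "ract (c \<odot>\<^bsub>M\<^esub> m) r = c \<odot>\<^bsub>M\<^esub> ract m r"
    unfolding e(2) using assms c by (simp add: ract_assoc A.smult_mult_left flip: B.ract_smult)
qed

lemma lact_bilin: "bilin K R M M lact"
  by (rule bilinI; rule lmod_homI)
     (use L.lsmult_r_distr L.lsmult_l_distr B.lact_smult in \<open>auto simp: lact_smult_right\<close>)

lemma ract_bilin: "bilin K M R M ract"
  by (rule bilinI; rule lmod_homI)
     (use Rr.lsmult_r_distr Rr.lsmult_l_distr B.ract_smult in \<open>auto simp: lact_smult_right\<close>)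

abbreviation (input) "EM \<equiv> enveloping_module K M lact ract"

lemma enveloping_module_sel [simp]:
  "carrier EM = carrier M" "add EM = add M" "zero EM = zero M"
  by (simp_all add: enveloping_module_def)

lemma enveloping_module_smult: "t \<odot>\<^bsub>EM\<^esub> m = tensor_lift K M (\<lambda>(r, s). lact r (ract m s)) t"
  by (simp add: enveloping_module_def)

lemma enveloping_module_bilin: "bilin K RR M M (smult EM)"
  and enveloping_module_pure: "r \<in> carrier R \<Longrightarrow> s \<in> carrier R \<Longrightarrow> m \<in> carrier M \<Longrightarrow> pure r s \<odot>\<^bsub>EM\<^esub> m = lact r (ract m s)"
proof -
  note li = bilin_left[OF lact_bilin] bilin_right[OF lact_bilin] bilin_left[OF ract_bilin] bilin_right[OF ract_bilin]
  have b: "bilin K R R M (\<lambda>r s. lact r (ract m s))" if "m \<in> carrier M" for m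
    using that by (auto intro!: lin_intros li)
  have "bilin K RR M M (\<lambda>t m. tensor_lift K M (\<lambda>(r, s). lact r (ract m s)) t)"
    by (rule bilinI, rule tensor_lift_param[OF R_module R_module M.module_axioms M.module_axioms],
        (auto intro!: lin_intros li)[2], rule tensor_lift_lin[OF R_module R_module M.module_axioms b])
  then show "bilin K RR M M (smult EM)" by (simp add: enveloping_module_def)
  show "pure r s \<odot>\<^bsub>EM\<^esub> m = lact r (ract m s)" if "r \<in> carrier R" "s \<in> carrier R" "m \<in> carrier M"
    unfolding enveloping_module_smult using that
    by (intro tensor_lift_pure[OF R_module R_module M.module_axioms b])
qed

text \<open>Associativity (s t) m = s (t m) is linear in \<open>s\<close> and in \<open>t\<close>.
  It is reduced to pure tensors in \<open>t\<close> for pure \<open>s\<close> (\<open>as1\<close>)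
  and afterwards in \<open>s\<close> (\<open>as\<close>).\<close>

lemma enveloping_module_left_module: "left_module E EM"
proof -
  note b = enveloping_module_bilin
  note li = bilin_left[OF b] bilin_right[OF b] bilin_left[OF E_mult_bilin] bilin_right[OF E_mult_bilin]
  have ag: "abelian_group EM"
    by (rule abelian_groupI) (auto simp: M.M.a_assoc intro: M.M.a_comm bexI[of _ "\<ominus>\<^bsub>M\<^esub> x" for x] M.M.l_neg)
  have cl: "t \<odot>\<^bsub>EM\<^esub> m \<in> carrier M" if "t \<in> carrier RR" "m \<in> carrier M" for t m
    using bilinD(3)[OF b that] .
  have as1: "(pure r1 s1 \<otimes>\<^bsub>E\<^esub> t) \<odot>\<^bsub>EM\<^esub> m = pure r1 s1 \<odot>\<^bsub>EM\<^esub> (t \<odot>\<^bsub>EM\<^esub> m)"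
    if "r1 \<in> carrier R" "s1 \<in> carrier R" "t \<in> carrier RR" "m \<in> carrier M" for r1 s1 t m
    by (rule tensor_hom_ext[OF R_module R_module M.module_axioms _ _ _ that(3)])
       (use that in \<open>auto intro!: li lin_intros simp: E_mult_pure enveloping_module_pure lact_assoc ract_assoc B.compatible\<close>)
  have as: "(s \<otimes>\<^bsub>E\<^esub> t) \<odot>\<^bsub>EM\<^esub> m = s \<odot>\<^bsub>EM\<^esub> (t \<odot>\<^bsub>EM\<^esub> m)"
    if "s \<in> carrier RR" "t \<in> carrier RR" "m \<in> carrier M" for s t m
    by (rule tensor_hom_ext[OF R_module R_module M.module_axioms _ _ _ that(1)])
       (use that in \<open>auto intro!: li lin_intros simp: cl as1\<close>)
  show ?thesis
    by (rule left_moduleI[OF E_ring ag])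
       (simp_all add: cl as enveloping_module_pure lmod_hom_add[OF bilinD(1)[OF b]] lmod_hom_add[OF bilinD(2)[OF b]])
qed

lemma enveloping_module_acts:
  assumes "r \<in> carrier R" "m \<in> carrier M"
  shows "left_act K R EM r m = lact r m" "right_act K R EM m r = ract m r"
  using assms by (simp_all add: left_act_def right_act_def enveloping_module_pure)

lemma enveloping_module_vspace: "c \<in> carrier K \<Longrightarrow> m \<in> carrier M \<Longrightarrow> c \<odot>\<^bsub>vspace K R EM\<^esub> m = c \<odot>\<^bsub>M\<^esub> m"
  using lmod_hom_smult[OF bilinD(2)[OF enveloping_module_bilin]]
  by (simp add: vspace_def enveloping_module_pure)

lemma enveloping_module_lin:
  "lin (vspace K R EM) U = lin M U" "lin U (vspace K R EM) = lin U M"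
  by (auto simp: lmod_hom_def enveloping_module_vspace Pi_iff)

end

lemma bimoduleI:
  assumes V: "module K V" and l: "bilin K R V V la" and r: "bilin K V R V ra"
    and la: "\<And>r s v. r \<in> carrier R \<Longrightarrow> s \<in> carrier R \<Longrightarrow> v \<in> carrier V \<Longrightarrow> la (r \<otimes>\<^bsub>R\<^esub> s) v = la r (la s v)"
    and ra: "\<And>r s v. r \<in> carrier R \<Longrightarrow> s \<in> carrier R \<Longrightarrow> v \<in> carrier V \<Longrightarrow> ra v (r \<otimes>\<^bsub>R\<^esub> s) = ra (ra v r) s"
    and lr: "\<And>r s v. r \<in> carrier R \<Longrightarrow> s \<in> carrier R \<Longrightarrow> v \<in> carrier V \<Longrightarrow> la r (ra v s) = ra (la r v) s"
    and one: "\<And>v. v \<in> carrier V \<Longrightarrow> la \<one>\<^bsub>R\<^esub> v = v" "\<And>v. v \<in> carrier V \<Longrightarrow> ra v \<one>\<^bsub>R\<^esub> = v"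
  shows "bimodule K R V la ra"
proof -
  interpret V: module K V by (rule V)
  interpret Rr: ring R by (rule R_ring)
  have ag: "abelian_group (with_action V la)" "abelian_group (with_action V (\<lambda>r m. ra m r))"
    by (rule abelian_groupI;
        auto simp: V.M.a_assoc intro: V.M.a_comm bexI[of _ "\<ominus>\<^bsub>V\<^esub> x" for x] V.M.l_neg)+
  have op: "ring (op_algebra R)"
    by (rule ringI; (rule abelian_groupI | rule monoidI)?)
       (auto simp: Rr.a_assoc Rr.m_assoc Rr.l_distr Rr.r_distr intro: Rr.a_comm bexI[of _ "\<ominus>\<^bsub>R\<^esub> x" for x] Rr.l_neg)
  show ?thesis
    by (intro bimodule.intro V left_moduleI R_ring ag op)
       (simp_all add: la ra lr one bilinD(3)[OF l] bilinD(3)[OF r] lmod_hom_add[OF bilinD(1)[OF l]] lmod_hom_add[OF bilinD(2)[OF l]]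
         lmod_hom_add[OF bilinD(1)[OF r]] lmod_hom_add[OF bilinD(2)[OF r]]
         lmod_hom_smult[OF bilinD(2)[OF l]] lmod_hom_smult[OF bilinD(1)[OF r]])
qed

end

subsection \<open>Smash products\<close>

definition hmod where
  "hmod K H V a \<longleftrightarrow> module K V \<and> bilin K H V V a \<and>
     (\<forall>h\<in>carrier H. \<forall>l\<in>carrier H. \<forall>v\<in>carrier V. a (h \<otimes>\<^bsub>H\<^esub> l) v = a h (a l v)) \<and>
     (\<forall>v\<in>carrier V. a \<one>\<^bsub>H\<^esub> v = v)"

definition equivariant where
  "equivariant K H X aX Y aY W aW \<mu> \<longleftrightarrow> bilin K X Y W \<mu> \<and>
     (\<forall>h\<in>carrier H. \<forall>x\<in>carrier X. \<forall>y\<in>carrier Y.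
        aW h (\<mu> x y) = sw K H W (\<lambda>h1 h2. \<mu> (aX h1 x) (aY h2 y)) h)"

text \<open>The formula (x \<otimes> h)(y \<otimes> l) = \<mu>(x, h1 y) \<otimes> h2 l for an
  arbitrary pairing \<open>\<mu>\<close>, where \<open>aY\<close> is the H-action on the second
  argument. With the product of A it is the multiplication of A # H; with a left or right action of
  A on N it is the corresponding action of A # H on N \<otimes> H.\<close>

definition smash_mult where
  "smash_mult K H W \<mu> aY s t =
     tensor_lift K (tensor K W H) (\<lambda>(a, h).
       tensor_lift K (tensor K W H) (\<lambda>(b, l).
         tensor_lift K (tensor K W H) (\<lambda>(h1, h2). tensor_elt K W H (\<mu> a (aY h1 b)) (h2 \<otimes>\<^bsub>H\<^esub> l)) (comult H h)) t) s"

lemma hmodD: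
  assumes "hmod K H V a"
  shows "module K V" "bilin K H V V a"
    "h \<in> carrier H \<Longrightarrow> l \<in> carrier H \<Longrightarrow> v \<in> carrier V \<Longrightarrow> a (h \<otimes>\<^bsub>H\<^esub> l) v = a h (a l v)"
    "v \<in> carrier V \<Longrightarrow> a \<one>\<^bsub>H\<^esub> v = v"
    "h \<in> carrier H \<Longrightarrow> v \<in> carrier V \<Longrightarrow> a h v \<in> carrier V"
  using assms by (auto simp: hmod_def dest: bilinD(3))

lemma equivariantD:
  assumes "equivariant K H X aX Y aY W aW \<mu>"
  shows "bilin K X Y W \<mu>"
    "h \<in> carrier H \<Longrightarrow> x \<in> carrier X \<Longrightarrow> y \<in> carrier Y \<Longrightarrow>
       aW h (\<mu> x y) = sw K H W (\<lambda>h1 h2. \<mu> (aX h1 x) (aY h2 y)) h"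
    "x \<in> carrier X \<Longrightarrow> y \<in> carrier Y \<Longrightarrow> \<mu> x y \<in> carrier W"
  using assms by (auto simp: equivariant_def dest: bilinD(3))

context hopf_calc
begin

lemma smash_mult_bilin_pure:
  assumes m: "module K X" "module K Y" "module K W" and b: "bilin K X Y W \<mu>" "bilin K H Y Y aY"
  shows "bilin K (tensor K X H) (tensor K Y H) (tensor K W H) (smash_mult K H W \<mu> aY)"
    and "x \<in> carrier X \<Longrightarrow> h \<in> carrier H \<Longrightarrow> y \<in> carrier Y \<Longrightarrow> l \<in> carrier H \<Longrightarrow>
      smash_mult K H W \<mu> aY (tensor_elt K X H x h) (tensor_elt K Y H y l)
      = SW (tensor K W H) (\<lambda>h1 h2. tensor_elt K W H (\<mu> x (aY h1 y)) (h2 \<star> l)) h"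
proof -
  note li = bilin_left[OF b(1)] bilin_right[OF b(1)] bilin_left[OF b(2)] bilin_right[OF b(2)]
  note cl = bilinD(3)[OF b(1)] bilinD(3)[OF b(2)]
  have b1: "bilin K Y H (tensor K W H) (\<lambda>y l. SW (tensor K W H) (\<lambda>h1 h2. tensor_elt K W H (\<mu> x (aY h1 y)) (h2 \<star> l)) h)"
    if "x \<in> carrier X" "h \<in> carrier H" for x h
    using that by (auto intro!: lin_intros li simp: m cl)
  have b2: "bilin K X H (tensor K W H) (\<lambda>x h. SW (tensor K W H) (\<lambda>h1 h2. tensor_elt K W H (\<mu> x (aY h1 y)) (h2 \<star> l)) h)"
    if "y \<in> carrier Y" "l \<in> carrier H" for y l
    using that by (auto intro!: lin_intros li simp: m cl)
  show "bilin K (tensor K X H) (tensor K Y H) (tensor K W H) (smash_mult K H W \<mu> aY)"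
    unfolding smash_mult_def[abs_def] sw_def[symmetric]
    by (rule tensor_lift2_bilin(1)) (simp_all add: b1 b2 m)
  show "smash_mult K H W \<mu> aY (tensor_elt K X H x h) (tensor_elt K Y H y l)
      = SW (tensor K W H) (\<lambda>h1 h2. tensor_elt K W H (\<mu> x (aY h1 y)) (h2 \<star> l)) h"
    if "x \<in> carrier X" "h \<in> carrier H" "y \<in> carrier Y" "l \<in> carrier H"
    unfolding smash_mult_def sw_def[symmetric]
    by (rule tensor_lift2_bilin(2)) (simp_all add: b1 b2 m that)
qed

text \<open>The comultiplication of 1 is 1 \<otimes> 1, so the second argument is not
  twisted.\<close>

lemma smash_mult_unit:
  assumes m: "module K X" "hmod K H Y aY" "module K W" and b: "bilin K X Y W \<mu>"
    and e: "x \<in> carrier X" "y \<in> carrier Y" "l \<in> carrier H"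
  shows "smash_mult K H W \<mu> aY (tensor_elt K X H x \<one>\<^bsub>H\<^esub>) (tensor_elt K Y H y l) = tensor_elt K W H (\<mu> x y) l"
proof -
  note hm = hmodD[OF m(2)]
  note li = bilin_left[OF b(1)] bilin_right[OF b(1)] bilin_left[OF hm(2)] bilin_right[OF hm(2)]
  note cl = bilinD(3)[OF b] hm(5)
  have "smash_mult K H W \<mu> aY (tensor_elt K X H x \<one>\<^bsub>H\<^esub>) (tensor_elt K Y H y l)
     = SW (tensor K W H) (\<lambda>h1 h2. tensor_elt K W H (\<mu> x (aY h1 y)) (h2 \<star> l)) \<one>\<^bsub>H\<^esub>"
    by (rule smash_mult_bilin_pure(2)) (use m hm b e in auto)
  also have "\<dots> = tensor_elt K W H (\<mu> x (aY \<one>\<^bsub>H\<^esub> y)) (\<one>\<^bsub>H\<^esub> \<star> l)"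
    by (rule SW_one) (auto intro!: lin_intros li simp: m e hm cl)
  finally show ?thesis by (simp add: hm e)
qed

text \<open>On pure tensors both sides equal the sum of \<mu>2(\<mu>1(x, h1 y), h2 l1 z) \<otimes>
  h3 l2 g. Equivariance of \<open>\<nu>1\<close> is what distributes h over the pairing of y and z
  on the right-hand side. The four pairings are independent of each other, so that one lemma yields
  all three associativity laws of the bimodule N \<otimes> H.\<close>

lemma smash_mult_assoc:
  assumes m: "module K X" "module K XY" "module K W" "module K YZ"
    and Y: "hmod K H Y aY" and Z: "hmod K H Z aZ" and aYZ: "bilin K H YZ YZ aYZ"
    and \<mu>1: "bilin K X Y XY \<mu>1" and \<mu>2: "bilin K XY Z W \<mu>2" and \<nu>2: "bilin K X YZ W \<nu>2"
    and \<nu>1: "equivariant K H Y aY Z aZ YZ aYZ \<nu>1"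
    and assoc: "\<And>x y z. x \<in> carrier X \<Longrightarrow> y \<in> carrier Y \<Longrightarrow> z \<in> carrier Z \<Longrightarrow> \<mu>2 (\<mu>1 x y) z = \<nu>2 x (\<nu>1 y z)"
    and stu: "s \<in> carrier (tensor K X H)" "t \<in> carrier (tensor K Y H)" "u \<in> carrier (tensor K Z H)"
  shows "smash_mult K H W \<mu>2 aZ (smash_mult K H XY \<mu>1 aY s t) u = smash_mult K H W \<nu>2 aYZ s (smash_mult K H YZ \<nu>1 aZ t u)"
proof -
  note hY = hmodD[OF Y] and hZ = hmodD[OF Z] and e = equivariantD[OF \<nu>1]
  note mods = m hY(1) hZ(1)
  note li = bilin_left[OF \<mu>1] bilin_right[OF \<mu>1] bilin_left[OF \<mu>2] bilin_right[OF \<mu>2] bilin_left[OF \<nu>2] bilin_right[OF \<nu>2]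
    bilin_left[OF e(1)] bilin_right[OF e(1)] bilin_left[OF hY(2)] bilin_right[OF hY(2)] bilin_left[OF hZ(2)] bilin_right[OF hZ(2)]
    bilin_left[OF aYZ] bilin_right[OF aYZ]
  note cl = bilinD(3)[OF \<mu>1] bilinD(3)[OF \<mu>2] bilinD(3)[OF \<nu>2] bilinD(3)[OF aYZ] hY(5) hZ(5) e(3)
  let ?W = "tensor K W H"
  let ?M1 = "smash_mult K H XY \<mu>1 aY" and ?M2 = "smash_mult K H W \<mu>2 aZ"
  let ?N1 = "smash_mult K H YZ \<nu>1 aZ" and ?N2 = "smash_mult K H W \<nu>2 aYZ"
  note sM1 = smash_mult_bilin_pure[OF mods(1,5,2) \<mu>1 hY(2)] and sM2 = smash_mult_bilin_pure[OF mods(2,6,3) \<mu>2 hZ(2)]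
    and sN1 = smash_mult_bilin_pure[OF mods(5,6,4) e(1) hZ(2)] and sN2 = smash_mult_bilin_pure[OF mods(1,4,3) \<nu>2 aYZ]
  note ls = bilin_left[OF sM1(1)] bilin_right[OF sM1(1)] bilin_left[OF sM2(1)] bilin_right[OF sM2(1)]
    bilin_left[OF sN1(1)] bilin_right[OF sN1(1)] bilin_left[OF sN2(1)] bilin_right[OF sN2(1)]
  note cs = bilinD(3)[OF sM1(1)] bilinD(3)[OF sM2(1)] bilinD(3)[OF sN1(1)] bilinD(3)[OF sN2(1)]
  have 0: "?M2 (?M1 (tensor_elt K X H x h) (tensor_elt K Y H y l)) (tensor_elt K Z H z g)
      = ?N2 (tensor_elt K X H x h) (?N1 (tensor_elt K Y H y l) (tensor_elt K Z H z g))"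
    if a: "x \<in> carrier X" "h \<in> carrier H" "y \<in> carrier Y" "l \<in> carrier H" "z \<in> carrier Z" "g \<in> carrier H" for x h y l z g
  proof -
    \<comment> \<open>The summand in the common value of both sides: \<open>h1\<close>,
      \<open>p\<close>, \<open>q\<close> stand for the three components of \<open>h\<close>, and
      \<open>l1\<close>, \<open>l2\<close> for those of \<open>l\<close>.\<close>
    let ?T = "\<lambda>h1 p q l1 l2. tensor_elt K W H (\<mu>2 (\<mu>1 x (aY h1 y)) (aZ (p \<star> l1) z)) (q \<star> l2 \<star> g)"
    have "?M2 (?M1 (tensor_elt K X H x h) (tensor_elt K Y H y l)) (tensor_elt K Z H z g)
        = SW ?W (\<lambda>h1 h2. ?M2 (tensor_elt K XY H (\<mu>1 x (aY h1 y)) (h2 \<star> l)) (tensor_elt K Z H z g)) h"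
      unfolding sM1(2)[OF a(1-4)] by (rule SW_comp) (auto intro!: ls lin_intros simp: mods a cl)
    also have "\<dots> = SW ?W (\<lambda>h1 h2. SW ?W (\<lambda>u v. tensor_elt K W H (\<mu>2 (\<mu>1 x (aY h1 y)) (aZ u z)) (v \<star> g)) (h2 \<star> l)) h"
      by (rule SW_eqI, simp add: a, rule sM2(2)) (auto simp: a cl)
    also have "\<dots> = SW ?W (\<lambda>h1 h2. SW ?W (\<lambda>p q. SW ?W (\<lambda>l1 l2. ?T h1 p q l1 l2) l) h2) h"
      by (rule SW_eqI, simp add: a, rule SW_mult) (auto intro!: li lin_intros simp: mods a cl)
    finally have 1: "?M2 (?M1 (tensor_elt K X H x h) (tensor_elt K Y H y l)) (tensor_elt K Z H z g) = \<dots>" .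
    have T: "tensor_elt K W H (\<nu>2 x (\<nu>1 (aY p y) (aZ q (aZ l1 z)))) (h2 \<star> (l2 \<star> g)) = ?T p q h2 l1 l2"
      if "p \<in> carrier H" "q \<in> carrier H" "h2 \<in> carrier H" "l1 \<in> carrier H" "l2 \<in> carrier H" for p q h2 l1 l2
      using that a by (simp add: assoc cl hZ(3) hmult_assoc)
    have "?N2 (tensor_elt K X H x h) (?N1 (tensor_elt K Y H y l) (tensor_elt K Z H z g))
        = SW ?W (\<lambda>l1 l2. ?N2 (tensor_elt K X H x h) (tensor_elt K YZ H (\<nu>1 y (aZ l1 z)) (l2 \<star> g))) l"
      unfolding sN1(2)[OF a(3-6)] by (rule SW_comp) (auto intro!: ls lin_intros simp: mods a cl)
    also have "\<dots> = SW ?W (\<lambda>l1 l2. SW ?W (\<lambda>h1 h2. tensor_elt K W H (\<nu>2 x (aYZ h1 (\<nu>1 y (aZ l1 z)))) (h2 \<star> (l2 \<star> g))) h) l"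
      by (rule SW_eqI, simp add: a, rule sN2(2)) (auto simp: a cl)
    also have "\<dots> = SW ?W (\<lambda>l1 l2. SW ?W (\<lambda>h1 h2. SW ?W (\<lambda>p q.
        tensor_elt K W H (\<nu>2 x (\<nu>1 (aY p y) (aZ q (aZ l1 z)))) (h2 \<star> (l2 \<star> g))) h1) h) l"
      by (intro SW_eqI a(2,4), subst e(2), (simp add: a cl)+, rule SW_comp) (auto intro!: li lin_intros simp: mods a cl)
    also have "\<dots> = SW ?W (\<lambda>l1 l2. SW ?W (\<lambda>h1 h2. SW ?W (\<lambda>p q. ?T p q h2 l1 l2) h1) h) l"
      by (intro SW_eqI a(2,4); (assumption | rule T))
    also have "\<dots> = SW ?W (\<lambda>l1 l2. SW ?W (\<lambda>p y. SW ?W (\<lambda>q h2. ?T p q h2 l1 l2) y) h) l"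
      by (rule SW_eqI, simp add: a, rule SW_coassoc) (auto intro!: li lin_intros simp: mods a cl)
    also have "\<dots> = SW ?W (\<lambda>p y. SW ?W (\<lambda>l1 l2. SW ?W (\<lambda>q h2. ?T p q h2 l1 l2) y) l) h"
      by (rule SW_swap) (auto simp: mods a cl)
    also have "\<dots> = SW ?W (\<lambda>p y. SW ?W (\<lambda>q h2. SW ?W (\<lambda>l1 l2. ?T p q h2 l1 l2) l) y) h"
      by (rule SW_eqI, simp add: a, rule SW_swap) (auto simp: mods a cl)
    finally show ?thesis unfolding 1 by simp
  qed
  \<comment> \<open>Extension by linearity, one tensor at a time: \<open>u\<close> here, then
    \<open>t\<close>, then \<open>s\<close>.\<close>
  have 1: "?M2 (?M1 (tensor_elt K X H x h) (tensor_elt K Y H y l)) u = ?N2 (tensor_elt K X H x h) (?N1 (tensor_elt K Y H y l) u)"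
    if a: "x \<in> carrier X" "h \<in> carrier H" "y \<in> carrier Y" "l \<in> carrier H" for x h y l
    by (rule tensor_hom_ext[OF mods(6) H_module tensor_module[OF mods(3) H_module] _ _ _ stu(3)])
       (auto intro!: ls lin_intros simp: mods a cs 0)
  have 2: "?M2 (?M1 (tensor_elt K X H x h) t) u = ?N2 (tensor_elt K X H x h) (?N1 t u)"
    if a: "x \<in> carrier X" "h \<in> carrier H" for x h
    by (rule tensor_hom_ext[OF mods(5) H_module tensor_module[OF mods(3) H_module] _ _ _ stu(2)])
       (auto intro!: ls lin_intros simp: mods a cs 1 stu)
  show ?thesis
    by (rule tensor_hom_ext[OF mods(1) H_module tensor_module[OF mods(3) H_module] _ _ _ stu(1)])
       (auto intro!: ls lin_intros simp: mods cs 2 stu)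
qed

end

subsection \<open>Equivariant bimodules\<close>

definition equivariant_bimodule where
  "equivariant_bimodule K H A act N la ra ha \<longleftrightarrow> hmod K H N ha \<and>
     equivariant K H A act N ha N ha la \<and> equivariant K H N ha A act N ha ra \<and>
     (\<forall>a\<in>carrier A. \<forall>b\<in>carrier A. \<forall>n\<in>carrier N. la (a \<otimes>\<^bsub>A\<^esub> b) n = la a (la b n) \<and>
        ra n (a \<otimes>\<^bsub>A\<^esub> b) = ra (ra n a) b \<and> la a (ra n b) = ra (la a n) b) \<and>
     (\<forall>n\<in>carrier N. la \<one>\<^bsub>A\<^esub> n = n \<and> ra n \<one>\<^bsub>A\<^esub> = n)"

definition equivariant_hom where
  "equivariant_hom K H A N la ra ha N' la' ra' ha' f \<longleftrightarrow> f \<in> lmod_hom K N N' \<and>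
     (\<forall>a\<in>carrier A. \<forall>n\<in>carrier N. f (la a n) = la' a (f n) \<and> f (ra n a) = ra' (f n) a) \<and>
     (\<forall>h\<in>carrier H. \<forall>n\<in>carrier N. f (ha h n) = ha' h (f n))"

text \<open>The ring laws are assumed and not derived from \<open>module_algebra\<close>, because a bimodule over the smash
  product and a module over its enveloping algebra already carry them.\<close>

locale smash_calc = hopf_calc K H + MA: module_algebra K H A act
  for K :: "('k, 's) ring_scheme" and H :: "('k, 'h, 'z) hopf_scheme"
    and A :: "('k, 'a, 'y) module_scheme" and act :: "'h \<Rightarrow> 'a \<Rightarrow> 'a" +
  assumes smash_ring: "ring (smash_product K H A act)"
    and env_ring: "ring (enveloping_algebra K (smash_product K H A act))"
begin

abbreviation "AH \<equiv> tensor K A H"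
abbreviation "R \<equiv> smash_product K H A act"
abbreviation amult (infixl "\<bullet>" 70) where "a \<bullet> b \<equiv> a \<otimes>\<^bsub>A\<^esub> b"
abbreviation rmult (infixl "\<diamond>" 70) where "r \<diamond> s \<equiv> r \<otimes>\<^bsub>R\<^esub> s"

lemma A_module [simp]: "module K A" and A_ring: "ring A"
  using MA.algebra by (simp_all add: assoc_algebra_def)

lemma amult_closed [simp]: "x \<in> carrier A \<Longrightarrow> y \<in> carrier A \<Longrightarrow> x \<bullet> y \<in> carrier A"
  and aone_closed [simp]: "\<one>\<^bsub>A\<^esub> \<in> carrier A"
  and amult_assoc: "x \<in> carrier A \<Longrightarrow> y \<in> carrier A \<Longrightarrow> z \<in> carrier A \<Longrightarrow> x \<bullet> y \<bullet> z = x \<bullet> (y \<bullet> z)"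
  and amult_one [simp]: "x \<in> carrier A \<Longrightarrow> \<one>\<^bsub>A\<^esub> \<bullet> x = x" "x \<in> carrier A \<Longrightarrow> x \<bullet> \<one>\<^bsub>A\<^esub> = x"
  using ring.ring_simprules[OF A_ring] monoid.r_one[OF ring.is_monoid[OF A_ring]] by simp_all

lemma amult_bilin: "bilin K A A A (\<lambda>a b. a \<bullet> b)"
proof -
  interpret assoc_algebra K A by (rule MA.algebra)
  show ?thesis by (intro bilinI lmod_homI) (auto simp: A.l_distr A.r_distr smult_mult_left smult_mult_right)
qed

lemma act_hmod: "hmod K H A act"
proof -
  interpret L: left_module H "with_action A act" by (rule MA.action)
  interpret Hm: module K H by simp
  interpret Am: module K A by simp
  interpret HA: assoc_algebra K H by (rule algebra)
  have cl: "act h a \<in> carrier A" if "h \<in> carrier H" "a \<in> carrier A" for h a using L.lsmult_closed that by simp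
  \<comment> \<open>Multiplying \<open>a\<close> by \<open>c\<close> is the action of the element c
    1 of H, and c 1 commutes with \<open>h\<close>.\<close>
  have sm: "act h (c \<odot>\<^bsub>A\<^esub> a) = c \<odot>\<^bsub>A\<^esub> act h a" if "c \<in> carrier K" "h \<in> carrier H" "a \<in> carrier A" for c h a
  proof -
    have "c \<odot>\<^bsub>A\<^esub> a = act (c \<odot>\<^bsub>H\<^esub> \<one>\<^bsub>H\<^esub>) a" using that L.lsmult_one by (simp add: MA.act_smult)
    then have "act h (c \<odot>\<^bsub>A\<^esub> a) = act (h \<star> (c \<odot>\<^bsub>H\<^esub> \<one>\<^bsub>H\<^esub>)) a" using L.lsmult_assoc that by simp
    also have "h \<star> (c \<odot>\<^bsub>H\<^esub> \<one>\<^bsub>H\<^esub>) = c \<odot>\<^bsub>H\<^esub> h" using that by (simp add: HA.smult_mult_right)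
    finally show ?thesis using that by (simp add: MA.act_smult)
  qed
  have "bilin K H A A act"
    by (rule bilinI; rule lmod_homI)
       (use L.lsmult_l_distr L.lsmult_r_distr in \<open>auto simp: cl sm MA.act_smult\<close>)
  then show ?thesis unfolding hmod_def using L.lsmult_assoc L.lsmult_one by simp
qed

lemmas act_closed [simp] = hmodD(5)[OF act_hmod] and act_act = hmodD(3)[OF act_hmod] and act_one_left [simp] = hmodD(4)[OF act_hmod]
  and act_bilin = hmodD(2)[OF act_hmod]

lemmas amult_lin [lin_intros] = bilin_left[OF amult_bilin] bilin_right[OF amult_bilin]
  bilin_left[OF act_bilin] bilin_right[OF act_bilin]

lemma amult_equivariant: "equivariant K H A act A act A act (\<lambda>a b. a \<bullet> b)"
  unfolding equivariant_def using MA.act_mult by (simp add: amult_bilin sw_def)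

lemma R_sel [simp]: "carrier R = carrier AH" "add R = add AH" "zero R = zero AH" "smult R = smult AH"
  "one R = tensor_elt K A H \<one>\<^bsub>A\<^esub> \<one>\<^bsub>H\<^esub>"
  by (simp_all add: smash_product_def Let_def)

lemma R_mult: "s \<diamond> t = smash_mult K H A (\<lambda>a b. a \<bullet> b) act s t"
  by (simp add: smash_product_def Let_def smash_mult_def)

lemma R_mult_bilin: "bilin K AH AH AH (\<lambda>r s. r \<diamond> s)"
  unfolding R_mult by (rule smash_mult_bilin_pure(1)) (simp_all add: amult_bilin act_bilin)

lemma R_assoc_algebra: "assoc_algebra K R"
proof -
  have m: "module K R" by (rule module_same_ops[of _ AH]) auto
  show ?thesis
    by (intro assoc_algebra.intro m smash_ring assoc_algebra_axioms.intro)
       (use lmod_hom_smult[OF bilinD(1)[OF R_mult_bilin]] lmod_hom_smult[OF bilinD(2)[OF R_mult_bilin]] in auto)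
qed

sublocale env_alg K R
  by (intro env_alg.intro env_alg_axioms.intro lin_alg_axioms R_assoc_algebra env_ring)

definition "inA a = tensor_elt K A H a \<one>\<^bsub>H\<^esub>"
definition "inH h = tensor_elt K A H \<one>\<^bsub>A\<^esub> h"

lemma inA_closed [simp]: "a \<in> carrier A \<Longrightarrow> inA a \<in> carrier AH"
  and inH_closed [simp]: "h \<in> carrier H \<Longrightarrow> inH h \<in> carrier AH"
  by (simp_all add: inA_def inH_def)

lemma inA_lin [lin_intros]: "g \<in> lin V A \<Longrightarrow> (\<lambda>v. inA (g v)) \<in> lin V AH"
  and inH_lin [lin_intros]: "g' \<in> lin V H \<Longrightarrow> (\<lambda>v. inH (g' v)) \<in> lin V AH"
  unfolding inA_def inH_def by (auto intro!: lin_intros)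

lemmas R_mult_lin [lin_intros] = bilin_left[OF R_mult_bilin] bilin_right[OF R_mult_bilin]

lemma R_mult_closed' [simp]: "r \<in> carrier AH \<Longrightarrow> s \<in> carrier AH \<Longrightarrow> r \<diamond> s \<in> carrier AH"
  using rmult_closed by simp

lemma R_assoc: "r \<in> carrier AH \<Longrightarrow> s \<in> carrier AH \<Longrightarrow> t \<in> carrier AH \<Longrightarrow> r \<diamond> s \<diamond> t = r \<diamond> (s \<diamond> t)"
  using rmult_assoc by simp

lemma R_one_mult: "r \<in> carrier AH \<Longrightarrow> inH \<one>\<^bsub>H\<^esub> \<diamond> r = r" "r \<in> carrier AH \<Longrightarrow> r \<diamond> inH \<one>\<^bsub>H\<^esub> = r"
  using rmult_one by (simp_all add: inH_def)

lemma R_mult_pure: "a \<in> carrier A \<Longrightarrow> h \<in> carrier H \<Longrightarrow> b \<in> carrier A \<Longrightarrow> l \<in> carrier H \<Longrightarrow>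
    tensor_elt K A H a h \<diamond> tensor_elt K A H b l = SW AH (\<lambda>h1 h2. tensor_elt K A H (a \<bullet> act h1 b) (h2 \<star> l)) h"
  unfolding R_mult by (rule smash_mult_bilin_pure(2)) (simp_all add: amult_bilin act_bilin)

lemma inA_mult_pure: "a \<in> carrier A \<Longrightarrow> b \<in> carrier A \<Longrightarrow> l \<in> carrier H \<Longrightarrow>
    inA a \<diamond> tensor_elt K A H b l = tensor_elt K A H (a \<bullet> b) l"
  unfolding R_mult inA_def by (rule smash_mult_unit) (simp_all add: amult_bilin act_hmod)

lemma inA_inH: "a \<in> carrier A \<Longrightarrow> h \<in> carrier H \<Longrightarrow> inA a \<diamond> inH h = tensor_elt K A H a h"
  using inA_mult_pure[of a "\<one>\<^bsub>A\<^esub>" h] by (simp add: inH_def)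

lemma inA_inA: "a \<in> carrier A \<Longrightarrow> b \<in> carrier A \<Longrightarrow> inA a \<diamond> inA b = inA (a \<bullet> b)"
  using inA_mult_pure[of a b "\<one>\<^bsub>H\<^esub>"] by (simp add: inA_def)

lemma inH_inA: "h \<in> carrier H \<Longrightarrow> b \<in> carrier A \<Longrightarrow> inH h \<diamond> inA b = SW AH (\<lambda>h1 h2. inA (act h1 b) \<diamond> inH h2) h"
  using R_mult_pure[of "\<one>\<^bsub>A\<^esub>" h b "\<one>\<^bsub>H\<^esub>"] by (simp add: inA_inH) (simp add: inA_def inH_def)

text \<open>The product of 1 \<otimes> h and 1 \<otimes> l contains the factor h1 1 = \<epsilon>(h1)
  1 from A, which the counit law absorbs.\<close>

lemma inH_inH: "h \<in> carrier H \<Longrightarrow> l \<in> carrier H \<Longrightarrow> inH h \<diamond> inH l = inH (h \<star> l)"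
proof -
  assume a: "h \<in> carrier H" "l \<in> carrier H"
  have "inH h \<diamond> inH l = SW AH (\<lambda>h1 h2. tensor_elt K A H (\<one>\<^bsub>A\<^esub> \<bullet> act h1 \<one>\<^bsub>A\<^esub>) (h2 \<star> l)) h"
    unfolding inH_def using a by (intro R_mult_pure) auto
  also have "\<dots> = SW AH (\<lambda>h1 h2. counit H h1 \<odot>\<^bsub>AH\<^esub> inH (h2 \<star> l)) h"
    by (rule SW_eqI)
       (use a lmod_hom_smult[OF bilinD(2)[OF tensor_elt_bilin[OF A_module H_module]]] in \<open>auto simp: MA.act_one inH_def\<close>)
  also have "\<dots> = inH (h \<star> l)" by (rule SW_counit_left) (use a in \<open>auto intro!: lin_intros\<close>)
  finally show ?thesis .
qed

lemma inH_one: "inH \<one>\<^bsub>H\<^esub> = \<one>\<^bsub>R\<^esub>" and inA_one: "inA \<one>\<^bsub>A\<^esub> = \<one>\<^bsub>R\<^esub>"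
  by (simp_all add: inH_def inA_def)

text \<open>Inside the smash product the action of H on A becomes inner: moving \<open>b\<close> to
  the left gives (h1 b) h2 S(h3), and the last two factors cancel.\<close>

lemma inA_act:
  assumes h: "h \<in> carrier H" and b: "b \<in> carrier A"
  shows "SW AH (\<lambda>h1 h2. inH h1 \<diamond> inA b \<diamond> inH (antipode H h2)) h = inA (act h b)"
proof -
  have "SW AH (\<lambda>h1 h2. inH h1 \<diamond> inA b \<diamond> inH (antipode H h2)) h
      = SW AH (\<lambda>h1 h2. SW AH (\<lambda>p q. inA (act p b) \<diamond> inH q \<diamond> inH (antipode H h2)) h1) h"
    by (rule SW_eqI, simp add: h, simp add: inH_inA b, rule SW_comp) (auto intro!: lin_intros simp: b)
  also have "\<dots> = SW AH (\<lambda>h1 h2. SW AH (\<lambda>p q. inA (act p b) \<diamond> inH (q \<star> antipode H h2)) h1) h"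
    by (intro SW_eqI h; simp add: R_assoc inH_inH b)
  also have "\<dots> = SW AH (\<lambda>p y. SW AH (\<lambda>q h2. inA (act p b) \<diamond> inH (q \<star> antipode H h2)) y) h"
    by (rule SW_coassoc) (auto intro!: lin_intros simp: b h)
  also have "\<dots> = SW AH (\<lambda>p y. counit H y \<odot>\<^bsub>AH\<^esub> (inA (act p b) \<diamond> inH \<one>\<^bsub>H\<^esub>)) h"
    by (rule SW_eqI, simp add: h, rule SW_antipode_right) (auto intro!: lin_intros simp: b)
  also have "\<dots> = inA (act h b) \<diamond> inH \<one>\<^bsub>H\<^esub>"
    by (rule SW_counit_right) (auto intro!: lin_intros simp: b h)
  finally show ?thesis using h b by (simp add: R_one_mult)
qed

text \<open>Writing the action of h2 on b as the product h2 b S(h3) by \<open>inA_act\<close> lets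
  S(h1) h2 cancel. The identity moves elements of A past the antipode in
  \<open>adj_right\<close>.\<close>

lemma inH_antipode_inA:
  assumes h: "h \<in> carrier H" and b: "b \<in> carrier A"
  shows "SW AH (\<lambda>q r. inH (antipode H q) \<diamond> inA (act r b)) h = inA b \<diamond> inH (antipode H h)"
proof -
  have "SW AH (\<lambda>q r. inH (antipode H q) \<diamond> inA (act r b)) h
     = SW AH (\<lambda>q r. SW AH (\<lambda>r1 r2. inH (antipode H q) \<diamond> (inH r1 \<diamond> inA b \<diamond> inH (antipode H r2))) r) h"
    by (rule SW_eqI, simp add: h, simp only: inA_act[OF _ b, symmetric], rule SW_comp) (auto intro!: lin_intros simp: b)
  also have "\<dots> = SW AH (\<lambda>q r. SW AH (\<lambda>r1 r2. inH (antipode H q \<star> r1) \<diamond> (inA b \<diamond> inH (antipode H r2))) r) h"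
    by (intro SW_eqI h; simp add: b R_assoc flip: inH_inH)
  also have "\<dots> = SW AH (\<lambda>w r2. SW AH (\<lambda>q r1. inH (antipode H q \<star> r1) \<diamond> (inA b \<diamond> inH (antipode H r2))) w) h"
    by (rule SW_coassoc[symmetric]) (auto intro!: lin_intros simp: b h)
  also have "\<dots> = SW AH (\<lambda>w r2. counit H w \<odot>\<^bsub>AH\<^esub> (inH \<one>\<^bsub>H\<^esub> \<diamond> (inA b \<diamond> inH (antipode H r2)))) h"
    by (rule SW_eqI, simp add: h, rule SW_antipode_left) (auto intro!: lin_intros simp: b)
  also have "\<dots> = inH \<one>\<^bsub>H\<^esub> \<diamond> (inA b \<diamond> inH (antipode H h))"
    by (rule SW_counit_left) (auto intro!: lin_intros simp: b h)
  finally show ?thesis using h b by (simp add: R_one_mult)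
qed

end

section \<open>The adjoint action of H on bimodules over the smash product\<close>

context smash_calc
begin

definition adj where
  "adj X h x = SW (vspace K R X)
     (\<lambda>h1 h2. left_act K R X (inH h1) (right_act K R X x (inH (antipode H h2)))) h"

abbreviation ebim where "ebim \<equiv> equivariant_bimodule K H A act"
abbreviation ehom where "ehom \<equiv> equivariant_hom K H A"
abbreviation xl where "xl X a x \<equiv> left_act K R X (inA a) x"
abbreviation xr where "xr X x a \<equiv> right_act K R X x (inA a)"

context
  fixes X :: "((('a \<times> 'h \<Rightarrow> 'k) set \<times> ('a \<times> 'h \<Rightarrow> 'k) set \<Rightarrow> 'k) set, 'x, 'w) module_scheme"
  assumes X: "left_module E X"
begin

abbreviation (input) "XV \<equiv> vspace K R X"
abbreviation (input) "L \<equiv> left_act K R X"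
abbreviation (input) "Rt \<equiv> right_act K R X"

lemma XV_module [simp]: "module K XV" by (rule vspace_module[OF X])

lemma L_bilin: "bilin K AH XV XV L" and Rt_bilin: "bilin K XV AH XV Rt"
  using left_act_bilin[OF X] right_act_bilin[OF X] by (simp_all add: bilin_same_ops[of R AH])

lemmas XL_lin = bilin_left[OF L_bilin] bilin_right[OF L_bilin] bilin_left[OF Rt_bilin] bilin_right[OF Rt_bilin]

lemma XL_closed: "r \<in> carrier AH \<Longrightarrow> x \<in> carrier X \<Longrightarrow> L r x \<in> carrier X"
  "r \<in> carrier AH \<Longrightarrow> x \<in> carrier X \<Longrightarrow> Rt x r \<in> carrier X"
  using bilinD(3)[OF L_bilin] bilinD(3)[OF Rt_bilin] by simp_all

lemma XL_act: "r \<in> carrier AH \<Longrightarrow> s \<in> carrier AH \<Longrightarrow> x \<in> carrier X \<Longrightarrow> L r (L s x) = L (r \<diamond> s) x"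
  "r \<in> carrier AH \<Longrightarrow> s \<in> carrier AH \<Longrightarrow> x \<in> carrier X \<Longrightarrow> Rt (Rt x r) s = Rt x (r \<diamond> s)"
  "r \<in> carrier AH \<Longrightarrow> s \<in> carrier AH \<Longrightarrow> x \<in> carrier X \<Longrightarrow> Rt (L r x) s = L r (Rt x s)"
  using left_act_assoc[OF X] right_act_assoc[OF X] left_right_act_commute[OF X] by simp_all

lemma XL_one: "x \<in> carrier X \<Longrightarrow> L (inH \<one>\<^bsub>H\<^esub>) x = x" "x \<in> carrier X \<Longrightarrow> Rt x (inH \<one>\<^bsub>H\<^esub>) = x"
  "x \<in> carrier X \<Longrightarrow> L (inA \<one>\<^bsub>A\<^esub>) x = x" "x \<in> carrier X \<Longrightarrow> Rt x (inA \<one>\<^bsub>A\<^esub>) = x"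
  unfolding inH_one inA_one using left_act_one[OF X] right_act_one[OF X] by simp_all

lemma adj_bilin: "bilin K H XV XV (adj X)"
  unfolding adj_def[abs_def] by (auto intro!: lin_intros XL_lin simp: XL_closed)

lemma adj_closed: "h \<in> carrier H \<Longrightarrow> x \<in> carrier X \<Longrightarrow> adj X h x \<in> carrier X"
  using bilinD(3)[OF adj_bilin] by simp

text \<open>Multiplicativity uses that the antipode reverses products: h1 l1 x S(h2 l2) = h1 (l1 x
  S(l2)) S(h2).\<close>

lemma adj_hmod: "hmod K H XV (adj X)"
  unfolding hmod_def
proof (intro conjI ballI adj_bilin XV_module)
  fix x assume "x \<in> carrier XV"
  then have x: "x \<in> carrier X" by simp
  show "adj X \<one>\<^bsub>H\<^esub> x = x" unfolding adj_def
    by (subst SW_one) (auto intro!: lin_intros XL_lin simp: x antipode_one XL_closed XL_one)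
next
  fix h l x assume h: "h \<in> carrier H" and l: "l \<in> carrier H" and "x \<in> carrier XV"
  then have x: "x \<in> carrier X" by simp
  have "adj X (h \<star> l) x = SW XV (\<lambda>h1 h2. SW XV (\<lambda>l1 l2. L (inH (h1 \<star> l1)) (Rt x (inH (antipode H (h2 \<star> l2))))) l) h"
    unfolding adj_def by (rule SW_mult) (auto intro!: lin_intros XL_lin simp: x h l XL_closed)
  also have "\<dots> = SW XV (\<lambda>h1 h2. SW XV (\<lambda>l1 l2. L (inH h1) (Rt (L (inH l1) (Rt x (inH (antipode H l2)))) (inH (antipode H h2)))) l) h"
    by (intro SW_eqI h l) (simp add: x XL_closed XL_act inH_inH antipode_mult)
  also have "\<dots> = SW XV (\<lambda>h1 h2. L (inH h1) (Rt (adj X l x) (inH (antipode H h2)))) h"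
    unfolding adj_def by (rule SW_eqI[OF h], rule SW_comp[symmetric]) (auto intro!: lin_intros XL_lin simp: x l XL_closed)
  finally show "adj X (h \<star> l) x = adj X h (adj X l x)" unfolding adj_def[of _ h "adj X l x"] .
qed

lemma adj_left:
  assumes h: "h \<in> carrier H" and a: "a \<in> carrier A" and x: "x \<in> carrier X"
  shows "adj X h (xl X a x) = SW XV (\<lambda>h1 h2. xl X (act h1 a) (adj X h2 x)) h"
proof -
  have "adj X h (xl X a x) = SW XV (\<lambda>h1 h2. L (inH h1 \<diamond> inA a) (Rt x (inH (antipode H h2)))) h"
    unfolding adj_def by (intro SW_eqI h) (simp add: a x XL_closed XL_act)
  also have "\<dots> = SW XV (\<lambda>h1 h2. SW XV (\<lambda>p q. L (inA (act p a)) (L (inH q) (Rt x (inH (antipode H h2))))) h1) h"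
    by (rule SW_eqI[OF h], simp only: inH_inA a, subst SW_comp[where g = "\<lambda>r. L r _"])
       (auto intro!: lin_intros XL_lin simp: a x XL_closed XL_act)
  also have "\<dots> = SW XV (\<lambda>p y. SW XV (\<lambda>q h2. L (inA (act p a)) (L (inH q) (Rt x (inH (antipode H h2))))) y) h"
    by (rule SW_coassoc) (auto intro!: lin_intros XL_lin simp: a x h XL_closed)
  also have "\<dots> = SW XV (\<lambda>p y. xl X (act p a) (adj X y x)) h"
    unfolding adj_def by (rule SW_eqI[OF h], rule SW_comp[symmetric]) (auto intro!: lin_intros XL_lin simp: a x XL_closed)
  finally show ?thesis .
qed

text \<open>In h1 x a S(h2) the factor \<open>a\<close> has to pass the antipode;
  \<open>inH_antipode_inA\<close> replaces a S(h2) by S(h2) (h3 a), with h3 acting on a.\<close>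

lemma adj_right:
  assumes h: "h \<in> carrier H" and a: "a \<in> carrier A" and x: "x \<in> carrier X"
  shows "adj X h (xr X x a) = SW XV (\<lambda>h1 h2. xr X (adj X h1 x) (act h2 a)) h"
proof -
  have "adj X h (xr X x a) = SW XV (\<lambda>p y. L (inH p) (Rt x (inA a \<diamond> inH (antipode H y)))) h"
    unfolding adj_def by (intro SW_eqI h) (simp add: a x XL_closed XL_act)
  also have "\<dots> = SW XV (\<lambda>p y. SW XV (\<lambda>q r. L (inH p) (Rt x (inH (antipode H q) \<diamond> inA (act r a)))) y) h"
    by (rule SW_eqI[OF h], simp only: inH_antipode_inA[OF _ a, symmetric],
        subst SW_comp[where g = "\<lambda>r. L (inH _) (Rt x r)"])
       (auto intro!: lin_intros XL_lin simp: a x XL_closed)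
  also have "\<dots> = SW XV (\<lambda>w r. SW XV (\<lambda>p q. L (inH p) (Rt x (inH (antipode H q) \<diamond> inA (act r a)))) w) h"
    by (rule SW_coassoc[symmetric]) (auto intro!: lin_intros XL_lin simp: a x h XL_closed)
  also have "\<dots> = SW XV (\<lambda>w r. SW XV (\<lambda>p q. Rt (L (inH p) (Rt x (inH (antipode H q)))) (inA (act r a))) w) h"
    by (intro SW_eqI h; simp add: a x XL_closed XL_act)
  also have "\<dots> = SW XV (\<lambda>w r. xr X (adj X w x) (act r a)) h"
    unfolding adj_def by (rule SW_eqI[OF h], rule SW_comp[symmetric]) (auto intro!: lin_intros XL_lin simp: a x XL_closed)
  finally show ?thesis .
qed

lemma adj_ebim: "ebim XV (xl X) (xr X) (adj X)"
  unfolding equivariant_bimodule_def equivariant_def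
  by (auto intro!: adj_hmod lin_intros XL_lin simp: adj_left adj_right XL_closed XL_act XL_one inA_inA)

text \<open>In h1 x S(h2) h3 the last two factors cancel. This is the step that turns equivariance
  of a map into compatibility with left multiplication in \<open>sharp_hom\<close>.\<close>

lemma adj_inH:
  assumes h: "h \<in> carrier H" and x: "x \<in> carrier X"
  shows "SW XV (\<lambda>h1 h2. Rt (adj X h1 x) (inH h2)) h = L (inH h) x"
proof -
  have "SW XV (\<lambda>h1 h2. Rt (adj X h1 x) (inH h2)) h
      = SW XV (\<lambda>h1 h2. SW XV (\<lambda>p q. Rt (L (inH p) (Rt x (inH (antipode H q)))) (inH h2)) h1) h"
    unfolding adj_def by (rule SW_eqI[OF h], rule SW_comp) (auto intro!: lin_intros XL_lin simp: x XL_closed)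
  also have "\<dots> = SW XV (\<lambda>h1 h2. SW XV (\<lambda>p q. L (inH p) (Rt x (inH (antipode H q \<star> h2)))) h1) h"
    by (intro SW_eqI h; simp add: x XL_closed XL_act inH_inH)
  also have "\<dots> = SW XV (\<lambda>p y. SW XV (\<lambda>q h2. L (inH p) (Rt x (inH (antipode H q \<star> h2)))) y) h"
    by (rule SW_coassoc) (auto intro!: lin_intros XL_lin simp: x h XL_closed)
  also have "\<dots> = SW XV (\<lambda>p y. counit H y \<odot>\<^bsub>XV\<^esub> L (inH p) (Rt x (inH \<one>\<^bsub>H\<^esub>))) h"
    by (rule SW_eqI[OF h], rule SW_antipode_left) (auto intro!: lin_intros XL_lin simp: x XL_closed)
  also have "\<dots> = L (inH h) (Rt x (inH \<one>\<^bsub>H\<^esub>))"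
    by (rule SW_counit_right) (auto intro!: lin_intros XL_lin simp: x h XL_closed)
  finally show ?thesis by (simp add: x XL_one)
qed

end

subsection \<open>The adjunction between equivariant bimodules and bimodules over the smash product\<close>

text \<open>The induced bimodule on N \<otimes> H. The twisting action belongs to the second
  argument of the pairing, hence \<open>ha\<close> on N for the left action of A # H and
  \<open>act\<close> on A for the right one.\<close>

definition smash_module where
  "smash_module N la ra ha =
     enveloping_module K (tensor K N H) (smash_mult K H N la ha) (smash_mult K H N ra act)"

text \<open>The transpose n \<otimes> h \<mapsto> g(n) h of a map g from N to X. Precomposition with
  n \<mapsto> n \<otimes> 1 is the way back (\<open>flat_ehom\<close>,
  \<open>sharp_unit\<close>).\<close>

definition sharp where
  "sharp X g t = tensor_lift K (vspace K R X) (\<lambda>(n, h). right_act K R X (g n) (inH h)) t"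

lemma ebimD:
  assumes "ebim N la ra ha"
  shows "hmod K H N ha" "module K N" "equivariant K H A act N ha N ha la" "equivariant K H N ha A act N ha ra"
    "bilin K A N N la" "bilin K N A N ra" "bilin K H N N ha"
    "a \<in> carrier A \<Longrightarrow> n \<in> carrier N \<Longrightarrow> la a n \<in> carrier N"
    "a \<in> carrier A \<Longrightarrow> n \<in> carrier N \<Longrightarrow> ra n a \<in> carrier N"
    "h \<in> carrier H \<Longrightarrow> n \<in> carrier N \<Longrightarrow> ha h n \<in> carrier N"
    "a \<in> carrier A \<Longrightarrow> b \<in> carrier A \<Longrightarrow> n \<in> carrier N \<Longrightarrow> la (a \<bullet> b) n = la a (la b n)"
    "a \<in> carrier A \<Longrightarrow> b \<in> carrier A \<Longrightarrow> n \<in> carrier N \<Longrightarrow> ra n (a \<bullet> b) = ra (ra n a) b"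
    "a \<in> carrier A \<Longrightarrow> b \<in> carrier A \<Longrightarrow> n \<in> carrier N \<Longrightarrow> la a (ra n b) = ra (la a n) b"
    "n \<in> carrier N \<Longrightarrow> la \<one>\<^bsub>A\<^esub> n = n" "n \<in> carrier N \<Longrightarrow> ra n \<one>\<^bsub>A\<^esub> = n"
  using assms unfolding equivariant_bimodule_def
  by (auto dest: equivariantD(1) equivariantD(3) hmodD)

lemma ehomD:
  assumes "ehom N la ra ha N' la' ra' ha' f"
  shows "f \<in> lin N N'"
    "a \<in> carrier A \<Longrightarrow> n \<in> carrier N \<Longrightarrow> f (la a n) = la' a (f n)"
    "a \<in> carrier A \<Longrightarrow> n \<in> carrier N \<Longrightarrow> f (ra n a) = ra' (f n) a"
    "h \<in> carrier H \<Longrightarrow> n \<in> carrier N \<Longrightarrow> f (ha h n) = ha' h (f n)"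
    "n \<in> carrier N \<Longrightarrow> f n \<in> carrier N'"
  using assms unfolding equivariant_hom_def by (auto dest: lmod_hom_closed)

lemma ehom_comp:
  assumes "ehom N la ra ha N' la' ra' ha' f" "ehom N' la' ra' ha' N'' la'' ra'' ha'' g"
  shows "ehom N la ra ha N'' la'' ra'' ha'' (\<lambda>x. g (f x))"
  using ehomD[OF assms(1)] ehomD[OF assms(2)] lin_comp unfolding equivariant_hom_def by auto

text \<open>The adjoint action is composed of the two one-sided actions, so every map that is linear
  over the enveloping algebra preserves it.\<close>

lemma E_hom_ehom:
  assumes "left_module E X" "left_module E Y" "f \<in> lmod_hom E X Y"
  shows "ehom (vspace K R X) (xl X) (xr X) (adj X) (vspace K R Y) (xl Y) (xr Y) (adj Y) f"
proof -
  note f = E_homD[OF assms]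
  note c = XL_closed[OF assms(1)]
  have "f (adj X h x) = adj Y h (f x)" if h: "h \<in> carrier H" and x: "x \<in> carrier X" for h x
    unfolding adj_def by (subst SW_comp[OF vspace_module[OF assms(1)] vspace_module[OF assms(2)] f(1)])
      (auto simp: h x c f)
  then show ?thesis unfolding equivariant_hom_def using f by auto
qed

context
  fixes N :: "('k, 'n, 'w) module_scheme" and la :: "'a \<Rightarrow> 'n \<Rightarrow> 'n" and ra :: "'n \<Rightarrow> 'a \<Rightarrow> 'n" and ha :: "'h \<Rightarrow> 'n \<Rightarrow> 'n"
  assumes N: "ebim N la ra ha"
begin

abbreviation (input) "NH \<equiv> tensor K N H"
abbreviation (input) "SL \<equiv> smash_mult K H N la ha"
abbreviation (input) "SR \<equiv> smash_mult K H N ra act"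
abbreviation (input) "SN \<equiv> smash_module N la ra ha"

lemmas N_facts = ebimD(2,8,9,10)[OF N]
lemmas N_lin = bilin_left[OF ebimD(5)[OF N]] bilin_right[OF ebimD(5)[OF N]] bilin_left[OF ebimD(6)[OF N]] bilin_right[OF ebimD(6)[OF N]]
  bilin_left[OF ebimD(7)[OF N]] bilin_right[OF ebimD(7)[OF N]]

lemma NH_module [simp]: "module K NH" by (simp add: N_facts)

lemma SL_bilin: "bilin K AH NH NH SL" and SR_bilin: "bilin K NH AH NH SR"
  by (rule smash_mult_bilin_pure(1); simp add: ebimD[OF N] act_bilin)+

lemma SL_pure: "a \<in> carrier A \<Longrightarrow> h \<in> carrier H \<Longrightarrow> n \<in> carrier N \<Longrightarrow> l \<in> carrier H \<Longrightarrow>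
    SL (tensor_elt K A H a h) (tensor_elt K N H n l) = SW NH (\<lambda>h1 h2. tensor_elt K N H (la a (ha h1 n)) (h2 \<star> l)) h"
  and SR_pure: "a \<in> carrier A \<Longrightarrow> h \<in> carrier H \<Longrightarrow> n \<in> carrier N \<Longrightarrow> l \<in> carrier H \<Longrightarrow>
    SR (tensor_elt K N H n l) (tensor_elt K A H a h) = SW NH (\<lambda>h1 h2. tensor_elt K N H (ra n (act h1 a)) (h2 \<star> h)) l"
  by (rule smash_mult_bilin_pure(2); simp add: ebimD[OF N] act_bilin)+

lemma SL_unit: "a \<in> carrier A \<Longrightarrow> n \<in> carrier N \<Longrightarrow> l \<in> carrier H \<Longrightarrow>
    SL (tensor_elt K A H a \<one>\<^bsub>H\<^esub>) (tensor_elt K N H n l) = tensor_elt K N H (la a n) l"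
  and SR_unit: "a \<in> carrier A \<Longrightarrow> n \<in> carrier N \<Longrightarrow> h \<in> carrier H \<Longrightarrow>
    SR (tensor_elt K N H n \<one>\<^bsub>H\<^esub>) (tensor_elt K A H a h) = tensor_elt K N H (ra n a) h"
  by (rule smash_mult_unit; simp add: ebimD[OF N] act_hmod)+

lemma NH_ext:
  "module K U \<Longrightarrow> f \<in> lin NH U \<Longrightarrow> g \<in> lin NH U \<Longrightarrow>
   (\<And>n h. n \<in> carrier N \<Longrightarrow> h \<in> carrier H \<Longrightarrow> f (tensor_elt K N H n h) = g (tensor_elt K N H n h)) \<Longrightarrow>
   t \<in> carrier NH \<Longrightarrow> f t = g t"
  by (rule tensor_hom_ext[OF N_facts(1) H_module])

text \<open>The three associativity laws are instances of \<open>smash_mult_assoc\<close> with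
  products and actions in the slots. For the right unit law, (n \<otimes> l)(1 \<otimes> 1) contains
  l1 1 = \<epsilon>(l1) 1, and the counit law absorbs the scalar.\<close>

lemma smash_bimodule: "bimodule K R NH SL SR"
proof (rule bimoduleI)
  show "bilin K R NH NH SL" "bilin K NH R NH SR"
    using SL_bilin SR_bilin by (simp_all add: bilin_same_ops[of R AH])
next
  fix r s v assume "r \<in> carrier R" "s \<in> carrier R" and v: "v \<in> carrier NH"
  then have r: "r \<in> carrier AH" and s: "s \<in> carrier AH" by simp_all
  note e = ebimD[OF N]
  show "SL (r \<diamond> s) v = SL r (SL s v)"
    unfolding R_mult
    by (rule smash_mult_assoc[OF A_module A_module e(2) e(2) act_hmod e(1) e(7) amult_bilin e(5) e(5) e(3) _ r s v])
       (simp add: e)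
  show "SR v (r \<diamond> s) = SR (SR v r) s"
    unfolding R_mult
    by (rule smash_mult_assoc[OF e(2) e(2) e(2) A_module act_hmod act_hmod act_bilin e(6) e(6) e(6) amult_equivariant _ v r s, symmetric])
       (simp add: e)
  show "SL r (SR v s) = SR (SL r v) s"
    by (rule smash_mult_assoc[OF A_module e(2) e(2) e(2) e(1) act_hmod e(7) e(5) e(6) e(5) e(4) _ r v s, symmetric])
       (simp add: e)
next
  note ls = bilin_left[OF SL_bilin] bilin_right[OF SL_bilin] bilin_left[OF SR_bilin] bilin_right[OF SR_bilin]
  show "SL \<one>\<^bsub>R\<^esub> v = v" if "v \<in> carrier NH" for v
    by (rule NH_ext[OF NH_module _ _ _ that])
       (auto intro!: ls lin_intros simp: SL_unit ebimD[OF N])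
  show "SR v \<one>\<^bsub>R\<^esub> = v" if "v \<in> carrier NH" for v
  proof (rule NH_ext[OF NH_module _ _ _ that])
    fix n l assume a: "n \<in> carrier N" "l \<in> carrier H"
    have "SR (tensor_elt K N H n l) \<one>\<^bsub>R\<^esub> = SW NH (\<lambda>h1 h2. tensor_elt K N H (ra n (act h1 \<one>\<^bsub>A\<^esub>)) (h2 \<star> \<one>\<^bsub>H\<^esub>)) l"
      unfolding R_sel using a by (intro SR_pure) auto
    also have "\<dots> = SW NH (\<lambda>h1 h2. counit H h1 \<odot>\<^bsub>NH\<^esub> tensor_elt K N H n h2) l"
      by (rule SW_eqI) (use a lmod_hom_smult[OF bilinD(2)[OF tensor_elt_bilin[OF N_facts(1) H_module]]]
           lmod_hom_smult[OF bilinD(1)[OF ebimD(6)[OF N]]] in \<open>auto simp: MA.act_one ebimD[OF N]\<close>)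
    also have "\<dots> = tensor_elt K N H n l" by (rule SW_counit_left) (use a in \<open>auto intro!: lin_intros simp: N_facts\<close>)
    finally show "SR (tensor_elt K N H n l) \<one>\<^bsub>R\<^esub> = tensor_elt K N H n l" .
  qed (auto intro!: ls lin_intros)
qed simp

lemma SN_left_module: "left_module E SN"
  unfolding smash_module_def by (rule enveloping_module_left_module[OF smash_bimodule])

lemma SN_sel: "carrier SN = carrier NH" "add SN = add NH" "zero SN = zero NH"
  by (simp_all add: smash_module_def enveloping_module_sel[OF smash_bimodule])

lemma SN_acts: "r \<in> carrier AH \<Longrightarrow> t \<in> carrier NH \<Longrightarrow> left_act K R SN r t = SL r t"
  "r \<in> carrier AH \<Longrightarrow> t \<in> carrier NH \<Longrightarrow> right_act K R SN t r = SR t r"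
  unfolding smash_module_def using enveloping_module_acts[OF smash_bimodule] by simp_all

lemma SN_lin: "lin (vspace K R SN) U = lin NH U" "lin U (vspace K R SN) = lin U NH"
  unfolding smash_module_def by (rule enveloping_module_lin[OF smash_bimodule])+

lemma SN_right_inH: "n \<in> carrier N \<Longrightarrow> h \<in> carrier H \<Longrightarrow>
    right_act K R SN (tensor_elt K N H n \<one>\<^bsub>H\<^esub>) (inH h) = tensor_elt K N H n h"
  by (simp add: SN_acts N_facts inH_def SR_unit ebimD[OF N])

text \<open>The unit of the adjunction. Its H-linearity is the computation h1 (n \<otimes> 1) S(h2)
  = h1 n \<otimes> h2 S(h3) = h n \<otimes> 1.\<close>

lemma smash_unit_ehom:
  "ehom N la ra ha (vspace K R SN) (xl SN) (xr SN) (adj SN) (\<lambda>n. tensor_elt K N H n \<one>\<^bsub>H\<^esub>)"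
proof -
  let ?V = "vspace K R SN"
  note V = vspace_module[OF SN_left_module]
  have "tensor_elt K N H (ha h n) \<one>\<^bsub>H\<^esub> = adj SN h (tensor_elt K N H n \<one>\<^bsub>H\<^esub>)"
    if h: "h \<in> carrier H" and n: "n \<in> carrier N" for h n
  proof -
    have "adj SN h (tensor_elt K N H n \<one>\<^bsub>H\<^esub>)
        = SW ?V (\<lambda>h1 h2. SW NH (\<lambda>p q. tensor_elt K N H (ha p n) (q \<star> antipode H h2)) h1) h"
      unfolding adj_def
    proof (rule SW_eqI[OF h])
      fix h1 h2 assume a: "h1 \<in> carrier H" "h2 \<in> carrier H"
      have "left_act K R SN (inH h1) (tensor_elt K N H n (antipode H h2)) =
          SW NH (\<lambda>p q. tensor_elt K N H (la \<one>\<^bsub>A\<^esub> (ha p n)) (q \<star> antipode H h2)) h1"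
        using a n SL_pure[of "\<one>\<^bsub>A\<^esub>" h1 n "antipode H h2"] by (simp add: SN_acts N_facts inH_def)
      then show "left_act K R SN (inH h1) (right_act K R SN (tensor_elt K N H n \<one>\<^bsub>H\<^esub>) (inH (antipode H h2)))
          = SW NH (\<lambda>p q. tensor_elt K N H (ha p n) (q \<star> antipode H h2)) h1"
        using a n by (simp add: SN_right_inH N_facts ebimD[OF N])
    qed
    \<comment> \<open>The spaces \<open>?V\<close> and \<open>NH\<close> agree but are different
      records. The identity is linear from one to the other, and passing it through the sum changes
      the record in which the sum is formed.\<close>
    also have "\<dots> = SW NH (\<lambda>h1 h2. SW NH (\<lambda>p q. tensor_elt K N H (ha p n) (q \<star> antipode H h2)) h1) h"
      using SW_comp[OF NH_module V, of "\<lambda>x. x" "\<lambda>h1 h2. SW NH (\<lambda>p q. tensor_elt K N H (ha p n) (q \<star> antipode H h2)) h1" h] h n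
      by (auto simp: SN_lin lin_id N_facts)
    also have "\<dots> = SW NH (\<lambda>p y. SW NH (\<lambda>q h2. tensor_elt K N H (ha p n) (q \<star> antipode H h2)) y) h"
      by (rule SW_coassoc) (auto intro!: lin_intros N_lin simp: N_facts h n)
    also have "\<dots> = SW NH (\<lambda>p y. counit H y \<odot>\<^bsub>NH\<^esub> tensor_elt K N H (ha p n) \<one>\<^bsub>H\<^esub>) h"
      by (rule SW_eqI[OF h], rule SW_antipode_right) (auto intro!: lin_intros N_lin simp: N_facts n)
    also have "\<dots> = tensor_elt K N H (ha h n) \<one>\<^bsub>H\<^esub>"
      by (rule SW_counit_right) (auto intro!: lin_intros N_lin simp: N_facts n h)
    finally show ?thesis by simp
  qed
  then show ?thesis unfolding equivariant_hom_def
    by (auto simp: SN_lin SN_acts N_facts SL_unit SR_unit inA_def intro!: lin_intros)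
qed

context
  fixes X :: "((('a \<times> 'h \<Rightarrow> 'k) set \<times> ('a \<times> 'h \<Rightarrow> 'k) set \<Rightarrow> 'k) set, 'x, 'v) module_scheme"
  assumes X: "left_module E X"
begin

lemma sharp_bilin:
  assumes "g \<in> lin N (vspace K R X)"
  shows "bilin K N H (vspace K R X) (\<lambda>n h. right_act K R X (g n) (inH h))"
  using lmod_hom_closed[OF assms] assms by (auto intro!: lin_intros XL_lin[OF X])

lemma sharp_lin: "g \<in> lin N (vspace K R X) \<Longrightarrow> sharp X g \<in> lin NH (vspace K R X)"
  unfolding sharp_def[abs_def] by (rule tensor_lift_lin) (simp_all add: N_facts sharp_bilin XV_module[OF X])

lemma sharp_pure: "g \<in> lin N (vspace K R X) \<Longrightarrow> n \<in> carrier N \<Longrightarrow> h \<in> carrier H \<Longrightarrow>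
    sharp X g (tensor_elt K N H n h) = right_act K R X (g n) (inH h)"
  unfolding sharp_def by (rule tensor_lift_pure) (simp_all add: N_facts sharp_bilin XV_module[OF X])

lemma sharp_unit: "g \<in> lin N (vspace K R X) \<Longrightarrow> n \<in> carrier N \<Longrightarrow> sharp X g (tensor_elt K N H n \<one>\<^bsub>H\<^esub>) = g n"
  using lmod_hom_closed[of g K N "vspace K R X" n] by (simp add: sharp_pure XL_one[OF X])

text \<open>On pure tensors, a (h1 n) \<otimes> h2 k goes to a h1 g(n) S(h2) h3 k = a h g(n) k by
  \<open>adj_inH\<close>, and n (k1 a) \<otimes> k2 h goes to g(n) (k1 a) k2 h = g(n) k a h by the
  commutation rule \<open>inH_inA\<close>. The general case follows by linearity in both
  arguments.\<close>

lemma sharp_hom: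
  assumes g: "ehom N la ra ha (vspace K R X) (xl X) (xr X) (adj X) g"
  shows "sharp X g \<in> lmod_hom E SN X"
proof (rule E_homI[OF SN_left_module X])
  note gD = ehomD[OF g]
  have gc: "g n \<in> carrier X" if "n \<in> carrier N" for n using gD(5) that by simp
  let ?V = "vspace K R X"
  note V = XV_module[OF X] and c = XL_closed[OF X] and l = XL_lin[OF X] and ac = XL_act[OF X]
  have hom: "sharp X g \<in> lin NH ?V" by (rule sharp_lin[OF gD(1)])
  then show "sharp X g \<in> lin (vspace K R SN) ?V" by (simp add: SN_lin)
  note pure = sharp_pure[OF gD(1)]
  note hl = lin_comp[OF _ hom]
  have sc: "sharp X g t \<in> carrier X" if "t \<in> carrier NH" for t using lmod_hom_closed[OF hom that] by simp
  note ls = bilin_left[OF SL_bilin] bilin_right[OF SL_bilin] bilin_left[OF SR_bilin] bilin_right[OF SR_bilin]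
  fix r t assume "r \<in> carrier R" and "t \<in> carrier SN"
  then have r: "r \<in> carrier AH" and t: "t \<in> carrier NH" by (simp_all add: SN_sel)
  have L0: "sharp X g (SL (tensor_elt K A H a h) (tensor_elt K N H n k))
      = left_act K R X (tensor_elt K A H a h) (sharp X g (tensor_elt K N H n k))"
    if a: "a \<in> carrier A" "h \<in> carrier H" "n \<in> carrier N" "k \<in> carrier H" for a h n k
  proof -
    have "sharp X g (SL (tensor_elt K A H a h) (tensor_elt K N H n k))
        = SW ?V (\<lambda>h1 h2. sharp X g (tensor_elt K N H (la a (ha h1 n)) (h2 \<star> k))) h"
      unfolding SL_pure[OF a] by (rule SW_comp[OF NH_module V hom]) (auto simp: N_facts a)
    also have "\<dots> = SW ?V (\<lambda>h1 h2. left_act K R X (inA a) (right_act K R X (right_act K R X (adj X h1 (g n)) (inH h2)) (inH k))) h"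
      by (rule SW_eqI) (use a in \<open>auto simp: pure N_facts gD gc adj_closed[OF X] c ac inH_inH\<close>)
    also have "\<dots> = left_act K R X (inA a) (right_act K R X (SW ?V (\<lambda>h1 h2. right_act K R X (adj X h1 (g n)) (inH h2)) h) (inH k))"
      by (rule SW_comp[symmetric]) (use a in \<open>auto intro!: l lin_intros simp: V c gc adj_closed[OF X]\<close>)
    also have "\<dots> = left_act K R X (tensor_elt K A H a h) (sharp X g (tensor_elt K N H n k))"
      using a by (simp add: adj_inH[OF X] gc c ac pure inA_inH)
    finally show ?thesis .
  qed
  have L1: "sharp X g (SL (tensor_elt K A H a h) t) = left_act K R X (tensor_elt K A H a h) (sharp X g t)"
    if "a \<in> carrier A" "h \<in> carrier H" for a h
    by (rule NH_ext[OF V _ _ _ t]) (use that in \<open>auto intro!: hl l ls hom lin_intros simp: L0\<close>)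
  have L2: "sharp X g (SL r t) = left_act K R X r (sharp X g t)"
    by (rule tensor_hom_ext[OF A_module H_module V _ _ _ r])
       (use t in \<open>auto intro!: hl l ls hom lin_intros simp: L1 sc\<close>)
  then show "sharp X g (left_act K R SN r t) = left_act K R X r (sharp X g t)" using r t by (simp add: SN_acts)
  have R0: "sharp X g (SR (tensor_elt K N H n k) (tensor_elt K A H a h))
      = right_act K R X (sharp X g (tensor_elt K N H n k)) (tensor_elt K A H a h)"
    if a: "a \<in> carrier A" "h \<in> carrier H" "n \<in> carrier N" "k \<in> carrier H" for a h n k
  proof -
    have "sharp X g (SR (tensor_elt K N H n k) (tensor_elt K A H a h))
        = SW ?V (\<lambda>h1 h2. sharp X g (tensor_elt K N H (ra n (act h1 a)) (h2 \<star> h))) k"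
      unfolding SR_pure[OF a] by (rule SW_comp[OF NH_module V hom]) (auto simp: N_facts a)
    also have "\<dots> = SW ?V (\<lambda>h1 h2. right_act K R X (g n) (inA (act h1 a) \<diamond> inH h2 \<diamond> inH h)) k"
      by (rule SW_eqI) (use a in \<open>auto simp: pure N_facts gD gc c ac inH_inH R_assoc\<close>)
    also have "\<dots> = right_act K R X (g n) (SW AH (\<lambda>h1 h2. inA (act h1 a) \<diamond> inH h2) k \<diamond> inH h)"
      by (rule SW_comp[symmetric]) (use a in \<open>auto intro!: l lin_intros simp: V gc\<close>)
    also have "\<dots> = right_act K R X (sharp X g (tensor_elt K N H n k)) (tensor_elt K A H a h)"
      using a unfolding inH_inA[OF a(4,1), symmetric] by (simp add: gc c ac pure R_assoc inA_inH)
    finally show ?thesis .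
  qed
  have R1: "sharp X g (SR t (tensor_elt K A H a h)) = right_act K R X (sharp X g t) (tensor_elt K A H a h)"
    if "a \<in> carrier A" "h \<in> carrier H" for a h
    by (rule NH_ext[OF V _ _ _ t]) (use that in \<open>auto intro!: hl l ls hom lin_intros simp: R0\<close>)
  have R2: "sharp X g (SR t r) = right_act K R X (sharp X g t) r"
    by (rule tensor_hom_ext[OF A_module H_module V _ _ _ r])
       (use t in \<open>auto intro!: hl l ls hom lin_intros simp: R1 sc\<close>)
  then show "sharp X g (right_act K R SN t r) = right_act K R X (sharp X g t) r" using r t by (simp add: SN_acts)
qed

lemma flat_ehom:
  assumes "f \<in> lmod_hom E SN X"
  shows "ehom N la ra ha (vspace K R X) (xl X) (xr X) (adj X) (\<lambda>n. f (tensor_elt K N H n \<one>\<^bsub>H\<^esub>))"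
  by (rule ehom_comp[OF smash_unit_ehom E_hom_ehom[OF SN_left_module X assms]])

text \<open>Since n \<otimes> h = (n \<otimes> 1) h, the elements n \<otimes> 1 generate N \<otimes>
  H already under right multiplication by H.\<close>

lemma E_hom_eqI:
  assumes f: "f \<in> lmod_hom E SN X" and g: "g \<in> lmod_hom E SN X"
    and eq: "\<And>n. n \<in> carrier N \<Longrightarrow> f (tensor_elt K N H n \<one>\<^bsub>H\<^esub>) = g (tensor_elt K N H n \<one>\<^bsub>H\<^esub>)"
    and t: "t \<in> carrier NH"
  shows "f t = g t"
proof (rule NH_ext[OF XV_module[OF X] _ _ _ t])
  show "f \<in> lin NH (vspace K R X)" "g \<in> lin NH (vspace K R X)"
    using E_homD(1)[OF SN_left_module X f] E_homD(1)[OF SN_left_module X g] by (simp_all add: SN_lin)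
  fix n h assume a: "n \<in> carrier N" "h \<in> carrier H"
  have c: "tensor_elt K N H n \<one>\<^bsub>H\<^esub> \<in> carrier SN" using a by (simp add: SN_sel N_facts)
  show "f (tensor_elt K N H n h) = g (tensor_elt K N H n h)"
    using E_homD(3)[OF SN_left_module X f _ c, of "inH h"] E_homD(3)[OF SN_left_module X g _ c, of "inH h"] a
    by (simp add: SN_right_inH eq)
qed

end
end
end

subsection \<open>Multilinear maps on tuples\<close>

lemma tuples_Nil [simp]: "vs \<in> tuples V 0 \<longleftrightarrow> vs = []"
  and tuples_Cons [simp]: "x # xs \<in> tuples V (Suc n) \<longleftrightarrow> x \<in> carrier V \<and> xs \<in> tuples V n"
  and tuples_snoc [simp]: "xs @ [x] \<in> tuples V (Suc n) \<longleftrightarrow> x \<in> carrier V \<and> xs \<in> tuples V n"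
  by (auto simp: tuples_def)

lemma tuples_ConsE:
  assumes "vs \<in> tuples V (Suc n)"
  obtains x xs where "vs = x # xs" "x \<in> carrier V" "xs \<in> tuples V n"
  using assms by (cases vs) (auto simp: tuples_def)

lemma tuples_snocE:
  assumes "vs \<in> tuples V (Suc n)"
  obtains x xs where "vs = xs @ [x]" "x \<in> carrier V" "xs \<in> tuples V n"
  using assms by (cases vs rule: rev_cases) (auto simp: tuples_def)

lemma tuples_length: "vs \<in> tuples V n \<Longrightarrow> length vs = n" by (simp add: tuples_def)

lemma multilin_iff:
  "multilin K V n U \<phi> \<longleftrightarrow> (\<forall>vs \<in> tuples V n. \<phi> vs \<in> carrier U) \<and>
     (\<forall>i j ys zs. ys \<in> tuples V i \<longrightarrow> zs \<in> tuples V j \<longrightarrow> Suc (i + j) = n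
        \<longrightarrow> (\<lambda>v. \<phi> (ys @ v # zs)) \<in> lmod_hom K V U)"
  unfolding multilin_def tuples_def by blast

lemma multilinI:
  assumes "\<And>vs. vs \<in> tuples V n \<Longrightarrow> \<phi> vs \<in> carrier U"
    and "\<And>i j ys zs. ys \<in> tuples V i \<Longrightarrow> zs \<in> tuples V j \<Longrightarrow> Suc (i + j) = n
        \<Longrightarrow> (\<lambda>v. \<phi> (ys @ v # zs)) \<in> lmod_hom K V U"
  shows "multilin K V n U \<phi>"
  using assms unfolding multilin_iff by blast

lemma multilinD:
  assumes "multilin K V n U \<phi>"
  shows "vs \<in> tuples V n \<Longrightarrow> \<phi> vs \<in> carrier U"
    and "ys \<in> tuples V i \<Longrightarrow> zs \<in> tuples V j \<Longrightarrow> Suc (i + j) = n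
        \<Longrightarrow> (\<lambda>v. \<phi> (ys @ v # zs)) \<in> lmod_hom K V U"
  using assms unfolding multilin_iff by blast+

text \<open>Multilinearity by peeling off one entry. There is a version for the last entry as well,
  \<open>multilin_snocI\<close>, because the right action of A changes the last factor of a tensor
  power.\<close>

lemma multilin_ConsI:
  assumes 1: "\<And>x. x \<in> carrier V \<Longrightarrow> multilin K V n U (\<lambda>xs. \<phi> (x # xs))"
    and 2: "\<And>xs. xs \<in> tuples V n \<Longrightarrow> (\<lambda>x. \<phi> (x # xs)) \<in> lmod_hom K V U"
  shows "multilin K V (Suc n) U \<phi>"
  unfolding multilin_iff
proof (intro conjI ballI allI impI)
  fix vs assume "vs \<in> tuples V (Suc n)"
  then show "\<phi> vs \<in> carrier U" by (rule tuples_ConsE) (use lmod_hom_closed[OF 2] in auto)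
next
  fix i j ys zs assume a: "ys \<in> tuples V i" "zs \<in> tuples V j" "Suc (i + j) = Suc n"
  show "(\<lambda>v. \<phi> (ys @ v # zs)) \<in> lmod_hom K V U"
  proof (cases ys)
    case Nil then show ?thesis using a 2[of zs] by (auto simp: tuples_def)
  next
    case (Cons y ys')
    then obtain i' where i: "i = Suc i'" "y \<in> carrier V" "ys' \<in> tuples V i'" using a(1) by (cases i) (auto simp: tuples_def)
    have "(\<lambda>v. \<phi> (y # ys' @ v # zs)) \<in> lmod_hom K V U"
      using 1[OF i(2)] i(1,3) a(2,3) unfolding multilin_iff by auto
    then show ?thesis by (simp add: Cons)
  qed
qed

lemma multilin_snocI:
  assumes 1: "\<And>x. x \<in> carrier V \<Longrightarrow> multilin K V n U (\<lambda>xs. \<phi> (xs @ [x]))"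
    and 2: "\<And>xs. xs \<in> tuples V n \<Longrightarrow> (\<lambda>x. \<phi> (xs @ [x])) \<in> lmod_hom K V U"
  shows "multilin K V (Suc n) U \<phi>"
  unfolding multilin_iff
proof (intro conjI ballI allI impI)
  fix vs assume "vs \<in> tuples V (Suc n)"
  then show "\<phi> vs \<in> carrier U" by (rule tuples_snocE) (use lmod_hom_closed[OF 2] in auto)
next
  fix i j ys zs assume a: "ys \<in> tuples V i" "zs \<in> tuples V j" "Suc (i + j) = Suc n"
  show "(\<lambda>v. \<phi> (ys @ v # zs)) \<in> lmod_hom K V U"
  proof (cases zs rule: rev_cases)
    case Nil then show ?thesis using a 2[of ys] by (auto simp: tuples_def)
  next
    case (snoc zs' z)
    then obtain j' where j: "j = Suc j'" "z \<in> carrier V" "zs' \<in> tuples V j'" using a(2) by (cases j) (auto simp: tuples_def)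
    have "(\<lambda>v. \<phi> ((ys @ v # zs') @ [z])) \<in> lmod_hom K V U"
      using 1[OF j(2)] j(1,3) a(1,3) unfolding multilin_iff by auto
    then show ?thesis by (simp add: snoc)
  qed
qed

lemma multilin_ConsD:
  assumes "multilin K V (Suc n) U \<phi>"
  shows "x \<in> carrier V \<Longrightarrow> multilin K V n U (\<lambda>xs. \<phi> (x # xs))"
    and "xs \<in> tuples V n \<Longrightarrow> (\<lambda>x. \<phi> (x # xs)) \<in> lmod_hom K V U"
proof -
  note a = assms[unfolded multilin_iff]
  show "(\<lambda>x. \<phi> (x # xs)) \<in> lmod_hom K V U" if "xs \<in> tuples V n"
    using conjunct2[OF a, rule_format, of "[]" 0 xs n] that by simp
  show "multilin K V n U (\<lambda>xs. \<phi> (x # xs))" if x: "x \<in> carrier V"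
    unfolding multilin_iff
  proof (intro conjI ballI allI impI)
    fix i j ys zs assume b: "ys \<in> tuples V i" "zs \<in> tuples V j" "Suc (i + j) = n"
    show "(\<lambda>v. \<phi> (x # ys @ v # zs)) \<in> lmod_hom K V U"
      using conjunct2[OF a, rule_format, of "x # ys" "Suc i" zs j] b x by simp
  qed (use a x in auto)
qed

lemma multilin_snocD:
  assumes "multilin K V (Suc n) U \<phi>"
  shows "x \<in> carrier V \<Longrightarrow> multilin K V n U (\<lambda>xs. \<phi> (xs @ [x]))"
    and "xs \<in> tuples V n \<Longrightarrow> (\<lambda>x. \<phi> (xs @ [x])) \<in> lmod_hom K V U"
proof -
  note a = assms[unfolded multilin_iff]
  show "(\<lambda>x. \<phi> (xs @ [x])) \<in> lmod_hom K V U" if "xs \<in> tuples V n"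
    using conjunct2[OF a, rule_format, of xs n "[]" 0] that by simp
  show "multilin K V n U (\<lambda>xs. \<phi> (xs @ [x]))" if x: "x \<in> carrier V"
    unfolding multilin_iff
  proof (intro conjI ballI allI impI)
    fix i j ys zs assume b: "ys \<in> tuples V i" "zs \<in> tuples V j" "Suc (i + j) = n"
    show "(\<lambda>v. \<phi> ((ys @ v # zs) @ [x])) \<in> lmod_hom K V U"
      using conjunct2[OF a, rule_format, of ys i "zs @ [x]" "Suc j"] b x by simp
  qed (use a x in auto)
qed

context lin_alg
begin

lemma multilin_comp: "multilin K V n U \<phi> \<Longrightarrow> f \<in> lin U U' \<Longrightarrow> multilin K V n U' (\<lambda>xs. f (\<phi> xs))"
  by (rule multilinI, erule lmod_hom_closed, erule (1) multilinD(1), rule lin_comp, rule multilinD(2)) auto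

lemma multilin_zero: "module K U \<Longrightarrow> multilin K V n U (\<lambda>xs. \<zero>\<^bsub>U\<^esub>)"
  by (rule multilinI, rule abelian_monoid.zero_closed, simp add: module_def abelian_group_def, rule lin_zero)

lemma multilin_Nil: "u \<in> carrier U \<Longrightarrow> multilin K V 0 U (\<lambda>xs. u)"
  unfolding multilin_iff by auto

lemma multilin_add:
  assumes "module K U" "multilin K V n U \<phi>" "multilin K V n U \<psi>"
  shows "multilin K V n U (\<lambda>xs. \<phi> xs \<oplus>\<^bsub>U\<^esub> \<psi> xs)"
proof -
  interpret module K U by fact
  show ?thesis
    by (rule multilinI, intro M.a_closed multilinD(1)[OF assms(2)] multilinD(1)[OF assms(3)], assumption+,
        rule lin_add[OF assms(1) multilinD(2)[OF assms(2)] multilinD(2)[OF assms(3)]])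
qed

lemma tuples_append_Cons:
  "ys \<in> tuples V i \<Longrightarrow> zs \<in> tuples V j \<Longrightarrow> Suc (i + j) = n \<Longrightarrow> v \<in> carrier V \<Longrightarrow> ys @ v # zs \<in> tuples V n"
  by (auto simp: tuples_def)

lemma multilin_cong:
  assumes "module K V" "\<And>xs. xs \<in> tuples V n \<Longrightarrow> \<phi> xs = \<psi> xs" "multilin K V n U \<phi>"
  shows "multilin K V n U \<psi>"
  unfolding multilin_iff
proof (intro conjI ballI allI impI)
  show "\<psi> vs \<in> carrier U" if "vs \<in> tuples V n" for vs using assms that unfolding multilin_iff by auto
  fix i j ys zs assume b: "ys \<in> tuples V i" "zs \<in> tuples V j" "Suc (i + j) = n"
  have "(\<lambda>v. \<phi> (ys @ v # zs)) \<in> lin V U" using assms(3) b unfolding multilin_iff by blast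
  moreover have "\<phi> (ys @ v # zs) = \<psi> (ys @ v # zs)" if "v \<in> carrier V" for v
    using assms(2) tuples_append_Cons[OF b that] by blast
  ultimately show "(\<lambda>v. \<psi> (ys @ v # zs)) \<in> lin V U"
    using lmod_hom_cong[OF lmodule[OF assms(1)], of "\<lambda>v. \<phi> (ys @ v # zs)" "\<lambda>v. \<psi> (ys @ v # zs)"] by blast
qed

lemma multilin_finsum:
  assumes "module K V" "module K U" "finite I" "\<And>i. i \<in> I \<Longrightarrow> multilin K V n U (\<phi> i)"
  shows "multilin K V n U (\<lambda>xs. \<Oplus>\<^bsub>U\<^esub>i\<in>I. \<phi> i xs)"
proof -
  interpret U: module K U by fact
  show ?thesis using assms(3,4)
  proof (induction I rule: finite_induct)
    case empty then show ?case using multilin_zero[OF assms(2)] by simp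
  next
    case (insert a I)
    have cl: "\<phi> i xs \<in> carrier U" if "i \<in> insert a I" "xs \<in> tuples V n" for i xs
      using insert(4)[OF that(1)] that(2) unfolding multilin_iff by auto
    have e: "\<phi> a xs \<oplus>\<^bsub>U\<^esub> (\<Oplus>\<^bsub>U\<^esub>i\<in>I. \<phi> i xs) = (\<Oplus>\<^bsub>U\<^esub>i\<in>insert a I. \<phi> i xs)" if "xs \<in> tuples V n" for xs
      using cl that insert(1,2) by (subst U.M.finsum_insert) auto
    show ?case
      by (rule multilin_cong[OF assms(1) e multilin_add[OF assms(2)]]) (use insert in auto)
  qed
qed

lemma tpower_lift_bilin:
  assumes m: "module K V" "module K U" "module K X"
    and 1: "\<And>x. x \<in> carrier X \<Longrightarrow> multilin K V n U (\<phi> x)"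
    and 2: "\<And>xs. xs \<in> tuples V n \<Longrightarrow> (\<lambda>x. \<phi> x xs) \<in> lin X U"
  shows "bilin K X (tpower K V n) U (\<lambda>x t. tensor_lift K U (\<phi> x) t)"
proof (rule bilinI)
  show "(\<lambda>t. tensor_lift K U (\<phi> x) t) \<in> lin (tpower K V n) U" if "x \<in> carrier X" for x
    by (rule tpower_lift_lin[OF m(1,2) 1[OF that]])
  show "(\<lambda>x. tensor_lift K U (\<phi> x) t) \<in> lin X U" if "t \<in> carrier (tpower K V n)" for t
    by (rule fquot_lift_param[OF tpower_relations_subset[OF m(1)] m(2,3) 2 that[unfolded tpower_fquot]])
qed

end

subsection \<open>The bar resolution\<close>

context smash_calc
begin

abbreviation "T \<equiv> tpower K A"
abbreviation "el \<equiv> tpower_elt K A"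

lemma T_module [simp]: "module K (T n)" by (rule tpower_module[OF A_module])

lemma el_closed [simp]: "vs \<in> tuples A n \<Longrightarrow> el vs \<in> carrier (T n)"
  by (rule tpower_elt_closed[OF A_module])

lemma el_multilin: "multilin K A n (T n) el" by (rule tpower_elt_multilin[OF A_module])

lemmas el_ConsD = multilin_ConsD[OF el_multilin] and el_snocD = multilin_snocD[OF el_multilin]

text \<open>Tensors a factor of A onto the front of a tensor power; \<open>tsnoc\<close> does so at
  the back. Identities on n + 1 factors are checked on x \<otimes> v with \<open>v\<close>
  arbitrary, which replaces computations with positions in lists by recursion.\<close>

definition "tcons n x v = tensor_lift K (T (Suc n)) (\<lambda>xs. el (x # xs)) v"
definition "tsnoc n v y = tensor_lift K (T (Suc n)) (\<lambda>xs. el (xs @ [y])) v"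

lemma tcons_bilin: "bilin K A (T n) (T (Suc n)) (tcons n)"
  unfolding tcons_def[abs_def] by (rule tpower_lift_bilin) (simp_all add: el_ConsD)

lemma tsnoc_bilin: "bilin K (T n) A (T (Suc n)) (tsnoc n)"
proof -
  have "bilin K A (T n) (T (Suc n)) (\<lambda>y v. tsnoc n v y)"
    unfolding tsnoc_def[abs_def] by (rule tpower_lift_bilin) (simp_all add: el_snocD)
  then show ?thesis unfolding bilin_def by blast
qed

lemma tcons_el: "x \<in> carrier A \<Longrightarrow> xs \<in> tuples A n \<Longrightarrow> tcons n x (el xs) = el (x # xs)"
  unfolding tcons_def by (rule tpower_lift_pure) (simp_all add: el_ConsD)

lemma tsnoc_el: "x \<in> carrier A \<Longrightarrow> xs \<in> tuples A n \<Longrightarrow> tsnoc n (el xs) x = el (xs @ [x])"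
  unfolding tsnoc_def by (rule tpower_lift_pure) (simp_all add: el_snocD)

lemmas T_lin = bilin_left[OF tcons_bilin] bilin_right[OF tcons_bilin] bilin_left[OF tsnoc_bilin] bilin_right[OF tsnoc_bilin]

lemma tcons_closed [simp]: "x \<in> carrier A \<Longrightarrow> v \<in> carrier (T n) \<Longrightarrow> tcons n x v \<in> carrier (T (Suc n))"
  and tsnoc_closed [simp]: "x \<in> carrier A \<Longrightarrow> v \<in> carrier (T n) \<Longrightarrow> tsnoc n v x \<in> carrier (T (Suc n))"
  by (rule bilinD(3)[OF tcons_bilin] bilinD(3)[OF tsnoc_bilin]; assumption)+

lemma T_ext:
  "module K U \<Longrightarrow> f \<in> lin (T n) U \<Longrightarrow> g \<in> lin (T n) U \<Longrightarrow>
   (\<And>vs. vs \<in> tuples A n \<Longrightarrow> f (el vs) = g (el vs)) \<Longrightarrow> t \<in> carrier (T n) \<Longrightarrow> f t = g t"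
  by (rule tpower_hom_ext[OF A_module])

text \<open>The elements x \<otimes> v include the pure tensors, and these determine a linear
  map.\<close>

lemma T_cons_ext:
  assumes "module K U" "f \<in> lin (T (Suc n)) U" "g \<in> lin (T (Suc n)) U"
    and eq: "\<And>x v. x \<in> carrier A \<Longrightarrow> v \<in> carrier (T n) \<Longrightarrow> f (tcons n x v) = g (tcons n x v)"
    and t: "t \<in> carrier (T (Suc n))"
  shows "f t = g t"
proof (rule T_ext[OF assms(1-3) _ t])
  fix vs assume "vs \<in> tuples A (Suc n)"
  then obtain x xs where v: "vs = x # xs" "x \<in> carrier A" "xs \<in> tuples A n" by (rule tuples_ConsE)
  then show "f (el vs) = g (el vs)" using eq[of x "el xs"] by (simp add: tcons_el)
qed

lemma T_snoc_ext:
  assumes "module K U" "f \<in> lin (T (Suc n)) U" "g \<in> lin (T (Suc n)) U"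
    and eq: "\<And>x v. x \<in> carrier A \<Longrightarrow> v \<in> carrier (T n) \<Longrightarrow> f (tsnoc n v x) = g (tsnoc n v x)"
    and t: "t \<in> carrier (T (Suc n))"
  shows "f t = g t"
proof (rule T_ext[OF assms(1-3) _ t])
  fix vs assume "vs \<in> tuples A (Suc n)"
  then obtain x xs where v: "vs = xs @ [x]" "x \<in> carrier A" "xs \<in> tuples A n" by (rule tuples_snocE)
  then show "f (el vs) = g (el vs)" using eq[of x "el xs"] by (simp add: tsnoc_el)
qed

lemma tcons_tsnoc:
  assumes "x \<in> carrier A" "y \<in> carrier A" "v \<in> carrier (T n)"
  shows "tsnoc (Suc n) (tcons n x v) y = tcons (Suc n) x (tsnoc n v y)"
  by (rule T_ext[OF T_module _ _ _ assms(3)])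
     (use assms in \<open>auto intro!: T_lin lin_intros simp: tcons_el tsnoc_el\<close>)

lemma T_cons_snoc_ext:
  assumes "module K U" "f \<in> lin (T (Suc (Suc n))) U" "g \<in> lin (T (Suc (Suc n))) U"
    and eq: "\<And>x v y. x \<in> carrier A \<Longrightarrow> v \<in> carrier (T n) \<Longrightarrow> y \<in> carrier A \<Longrightarrow>
      f (tcons (Suc n) x (tsnoc n v y)) = g (tcons (Suc n) x (tsnoc n v y))"
    and t: "t \<in> carrier (T (Suc (Suc n)))"
  shows "f t = g t"
proof (rule T_cons_ext[OF assms(1-3) _ t])
  fix x u assume x: "x \<in> carrier A" and u: "u \<in> carrier (T (Suc n))"
  show "f (tcons (Suc n) x u) = g (tcons (Suc n) x u)"
    by (rule T_snoc_ext[OF assms(1) lin_comp[OF _ assms(2)] lin_comp[OF _ assms(3)] _ u])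
       (use x eq in \<open>auto intro!: T_lin lin_intros\<close>)
qed

text \<open>The three actions that occur in \<open>bar_module\<close>, for any number n of factors.
  There n = m + 2, so \<open>n - 1\<close> is the last position m + 1, and
  \<open>bar_module_eq\<close> holds by unfolding.\<close>

definition "Tl n a t = tensor_lift K (T n) (\<lambda>xs. el (xs[0 := a \<bullet> xs ! 0])) t"
definition "Tr n t b = tensor_lift K (T n) (\<lambda>xs. el (xs[n - 1 := xs ! (n - 1) \<bullet> b])) t"
definition "Th n h t = tensor_lift K (T n) (\<lambda>xs. diagonal_action K H A act xs h) t"

lemma Tl_bilin: "bilin K A (T (Suc n)) (T (Suc n)) (Tl (Suc n))"
  and Tl_tcons: "a \<in> carrier A \<Longrightarrow> x \<in> carrier A \<Longrightarrow> v \<in> carrier (T n) \<Longrightarrow> Tl (Suc n) a (tcons n x v) = tcons n (a \<bullet> x) v"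
proof -
  have m: "multilin K A (Suc n) (T (Suc n)) (\<lambda>xs. el (xs[0 := a \<bullet> xs ! 0]))" if "a \<in> carrier A" for a
    by (rule multilin_ConsI) (use that in \<open>auto intro!: el_ConsD lin_comp[OF _ el_ConsD(2)] lin_intros\<close>)
  show b: "bilin K A (T (Suc n)) (T (Suc n)) (Tl (Suc n))"
    unfolding Tl_def[abs_def]
    by (rule tpower_lift_bilin) (auto elim!: tuples_ConsE intro!: m lin_comp[OF _ el_ConsD(2)] lin_intros)
  show "Tl (Suc n) a (tcons n x v) = tcons n (a \<bullet> x) v" if a: "a \<in> carrier A" "x \<in> carrier A" "v \<in> carrier (T n)"
  proof (rule T_ext[OF T_module _ _ _ a(3)])
    fix vs assume v: "vs \<in> tuples A n"
    have "Tl (Suc n) a (el (x # vs)) = el ((x # vs)[0 := a \<bullet> (x # vs) ! 0])"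
      unfolding Tl_def by (rule tpower_lift_pure[OF A_module T_module m]) (use a v in auto)
    then show "Tl (Suc n) a (tcons n x (el vs)) = tcons n (a \<bullet> x) (el vs)" using a v by (simp add: tcons_el)
  qed (use a in \<open>auto intro!: bilin_right[OF b] T_lin lin_intros\<close>)
qed

lemma Tr_bilin: "bilin K (T (Suc n)) A (T (Suc n)) (Tr (Suc n))"
  and Tr_tsnoc: "a \<in> carrier A \<Longrightarrow> x \<in> carrier A \<Longrightarrow> v \<in> carrier (T n) \<Longrightarrow> Tr (Suc n) (tsnoc n v x) a = tsnoc n v (x \<bullet> a)"
proof -
  have e: "(xs @ [x])[Suc n - 1 := (xs @ [x]) ! (Suc n - 1) \<bullet> a] = xs @ [x \<bullet> a]" if "xs \<in> tuples A n" for xs x a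
    using tuples_length[OF that] by auto
  have m: "multilin K A (Suc n) (T (Suc n)) (\<lambda>xs. el (xs[Suc n - 1 := xs ! (Suc n - 1) \<bullet> a]))" if "a \<in> carrier A" for a
    by (rule multilin_snocI, rule multilin_cong[OF A_module, of _ "\<lambda>xs. el (xs @ [x \<bullet> a])" for x], simp only: e)
       (use that in \<open>auto simp only: e intro!: el_snocD lin_comp[OF _ el_snocD(2)] lin_intros amult_closed\<close>)
  have b': "bilin K A (T (Suc n)) (T (Suc n)) (\<lambda>a t. Tr (Suc n) t a)"
    unfolding Tr_def[abs_def]
    by (rule tpower_lift_bilin) (auto simp only: e A_module T_module elim!: tuples_snocE intro!: m lin_comp[OF _ el_snocD(2)] lin_intros)
  then show b: "bilin K (T (Suc n)) A (T (Suc n)) (Tr (Suc n))" unfolding bilin_def by blast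
  show "Tr (Suc n) (tsnoc n v x) a = tsnoc n v (x \<bullet> a)" if a: "a \<in> carrier A" "x \<in> carrier A" "v \<in> carrier (T n)"
  proof (rule T_ext[OF T_module _ _ _ a(3)])
    fix vs assume v: "vs \<in> tuples A n"
    have "Tr (Suc n) (el (vs @ [x])) a = el ((vs @ [x])[Suc n - 1 := (vs @ [x]) ! (Suc n - 1) \<bullet> a])"
      unfolding Tr_def by (rule tpower_lift_pure[OF A_module T_module m]) (use a v in auto)
    then show "Tr (Suc n) (tsnoc n (el vs) x) a = tsnoc n (el vs) (x \<bullet> a)" using a v by (simp only: e tsnoc_el amult_closed)
  qed (use a in \<open>auto intro!: bilin_left[OF b] T_lin lin_intros\<close>)
qed

section \<open>The diagonal action of H on tensor powers\<close>

lemma diagonal_action_Cons: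
  "xs \<in> tuples A n \<Longrightarrow> diagonal_action K H A act (x # xs) h
     = SW (T (Suc n)) (\<lambda>h1 h2. tcons n (act h1 x) (diagonal_action K H A act xs h2)) h"
  by (simp add: Let_def sw_def tcons_def tuples_length)

text \<open>Both properties go through one induction. The Sweedler sum in the step is linear in
  \<open>h\<close> because its summand is bilinear in h1 and h2, which includes linearity in the
  Hopf element for the shorter tuple.\<close>

lemma diagonal_action_multilin:
  "(h \<in> carrier H \<longrightarrow> multilin K A n (T n) (\<lambda>xs. diagonal_action K H A act xs h)) \<and>
   (xs \<in> tuples A n \<longrightarrow> (\<lambda>h. diagonal_action K H A act xs h) \<in> lin H (T n))"
proof (induction n arbitrary: h xs)
  case 0
  have "\<And>h. h \<in> carrier H \<Longrightarrow> counit H h \<odot>\<^bsub>T 0\<^esub> el [] \<in> carrier (T 0)" by simp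
  then show ?case unfolding multilin_iff by (auto intro!: lin_intros)
next
  case (Suc n)
  note IH1 = Suc[THEN conjunct1, rule_format] and IH2 = Suc[THEN conjunct2, rule_format]
  have cl [simp]: "diagonal_action K H A act xs h \<in> carrier (T n)" if "h \<in> carrier H" "xs \<in> tuples A n" for h xs
    using lmod_hom_closed[OF IH2] that by blast
  have l2: "(\<lambda>v. diagonal_action K H A act xs (g v)) \<in> lin V (T n)" if "g \<in> lin V H" "xs \<in> tuples A n" for g xs and V :: "('k, 'h, 'z) hopf_scheme"
    by (rule lin_comp[OF that(1) IH2[OF that(2)]])
  have bl: "bilin K H H (T (Suc n)) (\<lambda>h1 h2. tcons n (act h1 x) (diagonal_action K H A act xs h2))"
    if "x \<in> carrier A" "xs \<in> tuples A n" for x xs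
    using that by (auto intro!: T_lin lin_intros l2)
  have 2: "(\<lambda>h. diagonal_action K H A act xs h) \<in> lin H (T (Suc n))" if xs: "xs \<in> tuples A (Suc n)" for xs
    using xs
  proof (rule tuples_ConsE)
    fix x ys assume a: "xs = x # ys" "x \<in> carrier A" "ys \<in> tuples A n"
    show ?thesis unfolding a(1) diagonal_action_Cons[OF a(3)]
      by (rule SW_lin[OF T_module bl lin_id]) (use a in auto)
  qed
  have 1: "multilin K A (Suc n) (T (Suc n)) (\<lambda>xs. diagonal_action K H A act xs h)" if h: "h \<in> carrier H" for h
  proof (rule multilin_ConsI)
    fix xs assume xs: "xs \<in> tuples A n"
    show "(\<lambda>x. diagonal_action K H A act (x # xs) h) \<in> lin A (T (Suc n))"
      unfolding diagonal_action_Cons[OF xs] by (auto intro!: T_lin lin_intros simp: h xs)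
  next
    fix x assume x: "x \<in> carrier A"
    have "multilin K A n (T (Suc n)) (\<lambda>xs. SW (T (Suc n)) (\<lambda>h1 h2. tcons n (act h1 x) (diagonal_action K H A act xs h2)) h)"
      unfolding multilin_iff
    proof (intro conjI ballI allI impI)
      fix i j ys zs assume b: "ys \<in> tuples A i" "zs \<in> tuples A j" "Suc (i + j) = n"
      show "(\<lambda>v. SW (T (Suc n)) (\<lambda>h1 h2. tcons n (act h1 x) (diagonal_action K H A act (ys @ v # zs) h2)) h) \<in> lin A (T (Suc n))"
        by (rule SW_param, simp, simp, rule h, rule T_lin(2))
           (use x b IH1 in \<open>auto simp: multilin_iff\<close>)
    qed (use h x in auto)
    then show "multilin K A n (T (Suc n)) (\<lambda>xs. diagonal_action K H A act (x # xs) h)"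
      by (rule multilin_cong[OF A_module, rotated]) (simp add: diagonal_action_Cons del: diagonal_action.simps)
  qed
  show ?case using 1 2 by blast
qed

lemma Th_bilin: "bilin K H (T n) (T n) (Th n)"
  unfolding Th_def[abs_def] by (rule tpower_lift_bilin) (use diagonal_action_multilin in auto)

lemma Th_closed [simp]: "h \<in> carrier H \<Longrightarrow> v \<in> carrier (T n) \<Longrightarrow> Th n h v \<in> carrier (T n)"
  by (rule bilinD(3)[OF Th_bilin])

lemma Th_el: "h \<in> carrier H \<Longrightarrow> vs \<in> tuples A n \<Longrightarrow> Th n h (el vs) = diagonal_action K H A act vs h"
  unfolding Th_def by (rule tpower_lift_pure) (use diagonal_action_multilin in auto)

lemmas TT_lin = T_lin bilin_left[OF Th_bilin] bilin_right[OF Th_bilin]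
  bilin_left[OF Tl_bilin] bilin_right[OF Tl_bilin] bilin_left[OF Tr_bilin] bilin_right[OF Tr_bilin]

lemma Th_Nil: "h \<in> carrier H \<Longrightarrow> Th 0 h (el []) = counit H h \<odot>\<^bsub>T 0\<^esub> el []"
  by (simp add: Th_el)

lemma Th_tcons:
  assumes "h \<in> carrier H" "x \<in> carrier A" "v \<in> carrier (T n)"
  shows "Th (Suc n) h (tcons n x v) = SW (T (Suc n)) (\<lambda>h1 h2. tcons n (act h1 x) (Th n h2 v)) h"
  by (rule T_ext[OF T_module _ _ _ assms(3)])
     (use assms in \<open>auto intro!: TT_lin lin_intros simp: tcons_el Th_el diagonal_action_Cons simp del: diagonal_action.simps\<close>)

lemma T0_ext:
  "module K U \<Longrightarrow> f \<in> lin (T 0) U \<Longrightarrow> g \<in> lin (T 0) U \<Longrightarrow> f (el []) = g (el []) \<Longrightarrow> t \<in> carrier (T 0) \<Longrightarrow> f t = g t"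
  by (rule T_ext[of U f 0 g t]) auto

text \<open>The diagonal action is defined by splitting off the first factor; coassociativity allows
  the last factor to be split off instead. In the base case both splittings of a single factor
  reduce to h x by the two counit laws, because H acts on the empty tensor by \<epsilon>.\<close>

lemma Th_tsnoc:
  assumes "h \<in> carrier H" "x \<in> carrier A" "v \<in> carrier (T n)"
  shows "Th (Suc n) h (tsnoc n v x) = SW (T (Suc n)) (\<lambda>h1 h2. tsnoc n (Th n h1 v) (act h2 x)) h"
  using assms
proof (induction n arbitrary: h x v)
  case 0
  have s: "tsnoc 0 (el []) y = tcons 0 y (el [])" if "y \<in> carrier A" for y using that by (simp add: tsnoc_el tcons_el)
  have "Th (Suc 0) h (tsnoc 0 (el []) x) = SW (T (Suc 0)) (\<lambda>h1 h2. tcons 0 (act h1 x) (Th 0 h2 (el []))) h"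
    using 0 by (simp add: s Th_tcons)
  also have "\<dots> = SW (T (Suc 0)) (\<lambda>h1 h2. counit H h2 \<odot>\<^bsub>T (Suc 0)\<^esub> tcons 0 (act h1 x) (el [])) h"
    using 0 by (simp add: Th_Nil lmod_hom_smult[OF bilinD(1)[OF tcons_bilin]])
  also have "\<dots> = tcons 0 (act h x) (el [])"
    by (rule SW_counit_right) (use 0 in \<open>auto intro!: TT_lin lin_intros\<close>)
  also have "\<dots> = SW (T (Suc 0)) (\<lambda>h1 h2. counit H h1 \<odot>\<^bsub>T (Suc 0)\<^esub> tcons 0 (act h2 x) (el [])) h"
    by (rule SW_counit_left[symmetric]) (use 0 in \<open>auto intro!: TT_lin lin_intros\<close>)
  also have "\<dots> = SW (T (Suc 0)) (\<lambda>h1 h2. tsnoc 0 (Th 0 h1 (el [])) (act h2 x)) h"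
    using 0 by (simp add: s Th_Nil lmod_hom_smult[OF bilinD(2)[OF tsnoc_bilin]])
  finally have e: "Th (Suc 0) h (tsnoc 0 (el []) x) = \<dots>" .
  show ?case
    by (rule T0_ext[OF T_module _ _ _ 0(3)]) (use 0 e in \<open>auto intro!: TT_lin lin_intros\<close>)
next
  case (Suc n)
  show ?case
  proof (rule T_cons_ext[OF T_module _ _ _ Suc(4)])
    fix y w assume a: "y \<in> carrier A" "w \<in> carrier (T n)"
    have "Th (Suc (Suc n)) h (tsnoc (Suc n) (tcons n y w) x)
        = SW (T (Suc (Suc n))) (\<lambda>h1 h2. tcons (Suc n) (act h1 y) (SW (T (Suc n)) (\<lambda>p q. tsnoc n (Th n p w) (act q x)) h2)) h"
      using a Suc by (simp add: tcons_tsnoc Th_tcons)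
    also have "\<dots> = SW (T (Suc (Suc n))) (\<lambda>h1 h2. SW (T (Suc (Suc n))) (\<lambda>p q. tcons (Suc n) (act h1 y) (tsnoc n (Th n p w) (act q x))) h2) h"
      by (rule SW_eqI[OF Suc(2)], rule SW_comp) (use a Suc(3) in \<open>auto intro!: TT_lin lin_intros\<close>)
    also have "\<dots> = SW (T (Suc (Suc n))) (\<lambda>h1 h2. SW (T (Suc (Suc n))) (\<lambda>p q. tcons (Suc n) (act p y) (tsnoc n (Th n q w) (act h2 x))) h1) h"
      by (rule SW_coassoc[symmetric]) (use a Suc(2,3) in \<open>auto intro!: TT_lin lin_intros\<close>)
    also have "\<dots> = SW (T (Suc (Suc n))) (\<lambda>h1 h2. SW (T (Suc (Suc n))) (\<lambda>p q. tsnoc (Suc n) (tcons n (act p y) (Th n q w)) (act h2 x)) h1) h"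
      by (intro SW_eqI Suc(2); simp add: tcons_tsnoc a Suc(3))
    also have "\<dots> = SW (T (Suc (Suc n))) (\<lambda>h1 h2. tsnoc (Suc n) (Th (Suc n) h1 (tcons n y w)) (act h2 x)) h"
      unfolding Th_tcons[OF _ a(1,2)]
      by (rule SW_eqI[OF Suc(2)], subst Th_tcons[OF _ a(1,2)], assumption, rule SW_comp[symmetric]) (use a Suc(3) in \<open>auto intro!: TT_lin lin_intros\<close>)
    finally show "Th (Suc (Suc n)) h (tsnoc (Suc n) (tcons n y w) x) = \<dots>" .
  qed (use Suc(2,3) in \<open>auto intro!: TT_lin lin_intros\<close>)
qed

text \<open>In the induction step the components of h l are h1 l1 and h2 l2, and the sums over h and
  l are interchanged so that the action of l becomes the inner one.\<close>

lemma Th_hmod: "hmod K H (T n) (Th n)"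
proof -
  have "(\<forall>h\<in>carrier H. \<forall>l\<in>carrier H. \<forall>v\<in>carrier (T n). Th n (h \<star> l) v = Th n h (Th n l v)) \<and>
     (\<forall>v\<in>carrier (T n). Th n \<one>\<^bsub>H\<^esub> v = v)"
  proof (induction n)
    case 0
    have "Th 0 (h \<star> l) v = Th 0 h (Th 0 l v)" if "h \<in> carrier H" "l \<in> carrier H" "v \<in> carrier (T 0)" for h l v
      by (rule T0_ext[OF T_module _ _ _ that(3)])
         (use that in \<open>auto intro!: TT_lin lin_intros simp: Th_Nil counit_hmult lmod_hom_smult[OF bilinD(1)[OF Th_bilin]]
            module.smult_assoc1[OF T_module, symmetric] cring.cring_simprules(14)[OF K_cring]\<close>)
    moreover have "Th 0 \<one>\<^bsub>H\<^esub> v = v" if "v \<in> carrier (T 0)" for v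
      by (rule T0_ext[OF T_module _ _ _ that])
         (auto intro!: TT_lin lin_intros simp: Th_Nil counit_one module.smult_one[OF T_module])
    ultimately show ?case by blast
  next
    case (Suc n)
    then have IH: "\<And>h l v. h \<in> carrier H \<Longrightarrow> l \<in> carrier H \<Longrightarrow> v \<in> carrier (T n) \<Longrightarrow> Th n (h \<star> l) v = Th n h (Th n l v)"
      "\<And>v. v \<in> carrier (T n) \<Longrightarrow> Th n \<one>\<^bsub>H\<^esub> v = v" by blast+
    have "Th (Suc n) (h \<star> l) v = Th (Suc n) h (Th (Suc n) l v)"
      if h: "h \<in> carrier H" and l: "l \<in> carrier H" and v: "v \<in> carrier (T (Suc n))" for h l v
    proof (rule T_cons_ext[OF T_module _ _ _ v])
      fix x w assume a: "x \<in> carrier A" "w \<in> carrier (T n)"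
      let ?U = "T (Suc n)"
      have "Th (Suc n) (h \<star> l) (tcons n x w) = SW ?U (\<lambda>h1 h2. tcons n (act h1 x) (Th n h2 w)) (h \<star> l)"
        using a h l by (simp add: Th_tcons)
      also have "\<dots> = SW ?U (\<lambda>h1 h2. SW ?U (\<lambda>l1 l2. tcons n (act (h1 \<star> l1) x) (Th n (h2 \<star> l2) w)) l) h"
        by (rule SW_mult) (use a h l in \<open>auto intro!: TT_lin lin_intros\<close>)
      also have "\<dots> = SW ?U (\<lambda>h1 h2. SW ?U (\<lambda>l1 l2. tcons n (act h1 (act l1 x)) (Th n h2 (Th n l2 w))) l) h"
        by (intro SW_eqI h l; simp add: a IH act_act)
      also have "\<dots> = SW ?U (\<lambda>l1 l2. SW ?U (\<lambda>h1 h2. tcons n (act h1 (act l1 x)) (Th n h2 (Th n l2 w))) h) l"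
        by (rule SW_swap) (use a h l in auto)
      also have "\<dots> = SW ?U (\<lambda>l1 l2. Th (Suc n) h (tcons n (act l1 x) (Th n l2 w))) l"
        by (intro SW_eqI l; simp add: a h Th_tcons)
      also have "\<dots> = Th (Suc n) h (Th (Suc n) l (tcons n x w))"
        unfolding Th_tcons[OF l a] by (rule SW_comp[symmetric]) (use a h l in \<open>auto intro!: TT_lin lin_intros\<close>)
      finally show "Th (Suc n) (h \<star> l) (tcons n x w) = Th (Suc n) h (Th (Suc n) l (tcons n x w))" .
    qed (use h l in \<open>auto intro!: TT_lin lin_intros\<close>)
    moreover have "Th (Suc n) \<one>\<^bsub>H\<^esub> v = v" if v: "v \<in> carrier (T (Suc n))" for v
    proof (rule T_cons_ext[OF T_module _ _ _ v])
      fix x w assume a: "x \<in> carrier A" "w \<in> carrier (T n)"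
      show "Th (Suc n) \<one>\<^bsub>H\<^esub> (tcons n x w) = tcons n x w"
        unfolding Th_tcons[OF hone_closed a]
        by (subst SW_one) (use a in \<open>auto intro!: TT_lin lin_intros simp: IH\<close>)
    qed (auto intro!: TT_lin lin_intros)
    ultimately show ?case by blast
  qed
  then show ?thesis unfolding hmod_def using Th_bilin T_module by blast
qed

text \<open>Here \<open>v\<close> has at least one factor of its own, so the right action does not
  reach \<open>x\<close>.\<close>

lemma Tr_tcons:
  assumes "x \<in> carrier A" "v \<in> carrier (T (Suc n))" "b \<in> carrier A"
  shows "Tr (Suc (Suc n)) (tcons (Suc n) x v) b = tcons (Suc n) x (Tr (Suc n) v b)"
proof (rule T_snoc_ext[OF T_module _ _ _ assms(2)])
  fix y w assume a: "y \<in> carrier A" "w \<in> carrier (T n)"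
  have "Tr (Suc (Suc n)) (tsnoc (Suc n) (tcons n x w) y) b = tsnoc (Suc n) (tcons n x w) (y \<bullet> b)"
    using a assms by (intro Tr_tsnoc) auto
  then show "Tr (Suc (Suc n)) (tcons (Suc n) x (tsnoc n w y)) b = tcons (Suc n) x (Tr (Suc n) (tsnoc n w y) b)"
    using a assms by (simp add: tcons_tsnoc Tr_tsnoc)
qed (use assms in \<open>auto intro!: TT_lin lin_intros\<close>)

lemma Tl_closed [simp]: "a \<in> carrier A \<Longrightarrow> v \<in> carrier (T (Suc n)) \<Longrightarrow> Tl (Suc n) a v \<in> carrier (T (Suc n))"
  and Tr_closed [simp]: "a \<in> carrier A \<Longrightarrow> v \<in> carrier (T (Suc n)) \<Longrightarrow> Tr (Suc n) v a \<in> carrier (T (Suc n))"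
  by (rule bilinD(3)[OF Tl_bilin] bilinD(3)[OF Tr_bilin]; assumption)+

text \<open>The left action involves the first factor only. The product of A is equivariant there,
  and coassociativity regroups h1 a, h2 x and the action of h3 on the remaining factors.\<close>

lemma Tl_equivariant: "equivariant K H A act (T (Suc n)) (Th (Suc n)) (T (Suc n)) (Th (Suc n)) (Tl (Suc n))"
  unfolding equivariant_def
proof (intro conjI Tl_bilin ballI)
  fix h a v assume h: "h \<in> carrier H" and a: "a \<in> carrier A" and v: "v \<in> carrier (T (Suc n))"
  let ?U = "T (Suc n)"
  show "Th (Suc n) h (Tl (Suc n) a v) = SW ?U (\<lambda>h1 h2. Tl (Suc n) (act h1 a) (Th (Suc n) h2 v)) h"
  proof (rule T_cons_ext[OF T_module _ _ _ v])
    fix x w assume x: "x \<in> carrier A" and w: "w \<in> carrier (T n)"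
    have "Th (Suc n) h (Tl (Suc n) a (tcons n x w)) = SW ?U (\<lambda>h1 h2. tcons n (act h1 (a \<bullet> x)) (Th n h2 w)) h"
      using a x w h by (simp add: Tl_tcons Th_tcons)
    also have "\<dots> = SW ?U (\<lambda>h1 h2. SW ?U (\<lambda>p q. tcons n (act p a \<bullet> act q x) (Th n h2 w)) h1) h"
      by (rule SW_eqI[OF h], subst equivariantD(2)[OF amult_equivariant _ a x], assumption, rule SW_comp)
         (use a x w in \<open>auto intro!: TT_lin lin_intros\<close>)
    also have "\<dots> = SW ?U (\<lambda>p y. SW ?U (\<lambda>q h2. tcons n (act p a \<bullet> act q x) (Th n h2 w)) y) h"
      by (rule SW_coassoc) (use a x w h in \<open>auto intro!: TT_lin lin_intros\<close>)
    also have "\<dots> = SW ?U (\<lambda>p y. SW ?U (\<lambda>q h2. Tl (Suc n) (act p a) (tcons n (act q x) (Th n h2 w))) y) h"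
      by (intro SW_eqI h; simp add: Tl_tcons a x w)
    also have "\<dots> = SW ?U (\<lambda>p y. Tl (Suc n) (act p a) (Th (Suc n) y (tcons n x w))) h"
      by (rule SW_eqI[OF h], subst Th_tcons[OF _ x w], assumption, rule SW_comp[symmetric]) (use a x w in \<open>auto intro!: TT_lin lin_intros\<close>)
    finally show "Th (Suc n) h (Tl (Suc n) a (tcons n x w)) = \<dots>" .
  qed (use a h in \<open>auto intro!: TT_lin lin_intros\<close>)
qed

text \<open>The mirror image of \<open>Tl_equivariant\<close>; it depends on splitting off the last
  factor by \<open>Th_tsnoc\<close>.\<close>

lemma Tr_equivariant: "equivariant K H (T (Suc n)) (Th (Suc n)) A act (T (Suc n)) (Th (Suc n)) (Tr (Suc n))"
  unfolding equivariant_def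
proof (intro conjI Tr_bilin ballI)
  fix h a v assume h: "h \<in> carrier H" and a: "a \<in> carrier A" and v: "v \<in> carrier (T (Suc n))"
  let ?U = "T (Suc n)"
  show "Th (Suc n) h (Tr (Suc n) v a) = SW ?U (\<lambda>h1 h2. Tr (Suc n) (Th (Suc n) h1 v) (act h2 a)) h"
  proof (rule T_snoc_ext[OF T_module _ _ _ v])
    fix x w assume x: "x \<in> carrier A" and w: "w \<in> carrier (T n)"
    have "Th (Suc n) h (Tr (Suc n) (tsnoc n w x) a) = SW ?U (\<lambda>h1 h2. tsnoc n (Th n h1 w) (act h2 (x \<bullet> a))) h"
      using a x w h by (simp add: Tr_tsnoc Th_tsnoc)
    also have "\<dots> = SW ?U (\<lambda>p y. SW ?U (\<lambda>q h2. tsnoc n (Th n p w) (act q x \<bullet> act h2 a)) y) h"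
      by (rule SW_eqI[OF h], subst equivariantD(2)[OF amult_equivariant _ x a], assumption, rule SW_comp)
         (use a x w in \<open>auto intro!: TT_lin lin_intros\<close>)
    also have "\<dots> = SW ?U (\<lambda>h1 h2. SW ?U (\<lambda>p q. tsnoc n (Th n p w) (act q x \<bullet> act h2 a)) h1) h"
      by (rule SW_coassoc[symmetric]) (use a x w h in \<open>auto intro!: TT_lin lin_intros\<close>)
    also have "\<dots> = SW ?U (\<lambda>h1 h2. SW ?U (\<lambda>p q. Tr (Suc n) (tsnoc n (Th n p w) (act q x)) (act h2 a)) h1) h"
      by (intro SW_eqI h; simp add: Tr_tsnoc a x w)
    also have "\<dots> = SW ?U (\<lambda>h1 h2. Tr (Suc n) (Th (Suc n) h1 (tsnoc n w x)) (act h2 a)) h"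
      by (rule SW_eqI[OF h], subst Th_tsnoc[OF _ x w], assumption, rule SW_comp[symmetric]) (use a x w in \<open>auto intro!: TT_lin lin_intros\<close>)
    finally show "Th (Suc n) h (Tr (Suc n) (tsnoc n w x) a) = \<dots>" .
  qed (use a h in \<open>auto intro!: TT_lin lin_intros\<close>)
qed

text \<open>With at least two factors the left and the right action of A change different factors,
  which gives their commutation at once.\<close>

lemma T_ebim: "ebim (T (Suc (Suc n))) (Tl (Suc (Suc n))) (Tr (Suc (Suc n))) (Th (Suc (Suc n)))"
proof -
  let ?n = "Suc (Suc n)"
  have 1: "Tl ?n (a \<bullet> b) v = Tl ?n a (Tl ?n b v)" if "a \<in> carrier A" "b \<in> carrier A" "v \<in> carrier (T ?n)" for a b v
    by (rule T_cons_ext[OF T_module _ _ _ that(3)])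
       (use that in \<open>auto intro!: TT_lin lin_intros simp: Tl_tcons amult_assoc\<close>)
  have 2: "Tr ?n v (a \<bullet> b) = Tr ?n (Tr ?n v a) b" if "a \<in> carrier A" "b \<in> carrier A" "v \<in> carrier (T ?n)" for a b v
    by (rule T_snoc_ext[OF T_module _ _ _ that(3)])
       (use that in \<open>auto intro!: TT_lin lin_intros simp: Tr_tsnoc amult_assoc\<close>)
  have 3: "Tl ?n a (Tr ?n v b) = Tr ?n (Tl ?n a v) b" if "a \<in> carrier A" "b \<in> carrier A" "v \<in> carrier (T ?n)" for a b v
    by (rule T_cons_ext[OF T_module _ _ _ that(3)])
       (use that in \<open>auto intro!: TT_lin lin_intros simp: Tl_tcons Tr_tcons\<close>)
  have 4: "Tl ?n \<one>\<^bsub>A\<^esub> v = v" if "v \<in> carrier (T ?n)" for v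
    by (rule T_cons_ext[OF T_module _ _ _ that]) (auto intro!: TT_lin lin_intros simp: Tl_tcons)
  have 5: "Tr ?n v \<one>\<^bsub>A\<^esub> = v" if "v \<in> carrier (T ?n)" for v
    by (rule T_snoc_ext[OF T_module _ _ _ that]) (auto intro!: TT_lin lin_intros simp: Tr_tsnoc)
  show ?thesis unfolding equivariant_bimodule_def
    by (intro conjI ballI Th_hmod Tl_equivariant Tr_equivariant; (rule 1 2 3 4 5; assumption))
qed

end

subsection \<open>Linear lifting over a field\<close>

text \<open>Graphs of linear lifts of f through p that are defined on a subspace of V. A linear
  subspace of V \<times> X is a graph as soon as it has a single value over zero. Inclusion of
  graphs is the order to which Zorn's lemma is applied.\<close>

definition partial_lifts where
  "partial_lifts K V X p f = {G. G \<subseteq> carrier V \<times> carrier X \<and> (\<zero>\<^bsub>V\<^esub>, \<zero>\<^bsub>X\<^esub>) \<in> G \<and>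
     (\<forall>v x w y. (v, x) \<in> G \<longrightarrow> (w, y) \<in> G \<longrightarrow> (v \<oplus>\<^bsub>V\<^esub> w, x \<oplus>\<^bsub>X\<^esub> y) \<in> G) \<and>
     (\<forall>c\<in>carrier K. \<forall>v x. (v, x) \<in> G \<longrightarrow> (c \<odot>\<^bsub>V\<^esub> v, c \<odot>\<^bsub>X\<^esub> x) \<in> G) \<and>
     (\<forall>v x. (v, x) \<in> G \<longrightarrow> p x = f v) \<and> (\<forall>x. (\<zero>\<^bsub>V\<^esub>, x) \<in> G \<longrightarrow> x = \<zero>\<^bsub>X\<^esub>)}"

lemma partial_liftsD:
  assumes "G \<in> partial_lifts K V X p f"
  shows "(v, x) \<in> G \<Longrightarrow> v \<in> carrier V" "(v, x) \<in> G \<Longrightarrow> x \<in> carrier X" "(\<zero>\<^bsub>V\<^esub>, \<zero>\<^bsub>X\<^esub>) \<in> G"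
    "(v, x) \<in> G \<Longrightarrow> (w, y) \<in> G \<Longrightarrow> (v \<oplus>\<^bsub>V\<^esub> w, x \<oplus>\<^bsub>X\<^esub> y) \<in> G"
    "c \<in> carrier K \<Longrightarrow> (v, x) \<in> G \<Longrightarrow> (c \<odot>\<^bsub>V\<^esub> v, c \<odot>\<^bsub>X\<^esub> x) \<in> G"
    "(v, x) \<in> G \<Longrightarrow> p x = f v" "(\<zero>\<^bsub>V\<^esub>, x) \<in> G \<Longrightarrow> x = \<zero>\<^bsub>X\<^esub>"
  using assms unfolding partial_lifts_def by blast+

context lin_alg
begin

text \<open>Only closure under addition involves two members of the chain, and the larger of the two
  contains both pairs.\<close>

lemma partial_lifts_Union:
  assumes "\<C> \<noteq> {}" "subset.chain (partial_lifts K V X p f) \<C>"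
  shows "\<Union>\<C> \<in> partial_lifts K V X p f"
proof -
  have sub: "G \<in> partial_lifts K V X p f" if "G \<in> \<C>" for G
    using assms(2) that unfolding subset.chain_def by blast
  have lin: "G \<subseteq> G' \<or> G' \<subseteq> G" if "G \<in> \<C>" "G' \<in> \<C>" for G G'
    using assms(2) that unfolding subset.chain_def by blast
  note D = partial_liftsD[OF sub]
  have add: "(v \<oplus>\<^bsub>V\<^esub> w, x \<oplus>\<^bsub>X\<^esub> y) \<in> \<Union>\<C>" if "(v, x) \<in> \<Union>\<C>" "(w, y) \<in> \<Union>\<C>" for v x w y
  proof -
    from that obtain G G' where g: "G \<in> \<C>" "G' \<in> \<C>" "(v, x) \<in> G" "(w, y) \<in> G'" by blast
    from lin[OF g(1,2)] show ?thesis
    proof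
      assume "G \<subseteq> G'" then show ?thesis using D(4)[OF g(2), of v x w y] g by blast
    next
      assume "G' \<subseteq> G" then show ?thesis using D(4)[OF g(1), of v x w y] g by blast
    qed
  qed
  show ?thesis unfolding partial_lifts_def
  proof (rule CollectI, intro conjI allI impI ballI)
    show "\<Union>\<C> \<subseteq> carrier V \<times> carrier X" by (rule subrelI) (use D(1,2) in blast)
    show "(\<zero>\<^bsub>V\<^esub>, \<zero>\<^bsub>X\<^esub>) \<in> \<Union>\<C>" using assms(1) D(3) by blast
  qed (use add D(5,6,7) in blast)+
qed

text \<open>A maximal partial lift is total: if it were undefined at \<open>v0\<close>, its sum with
  the line through (v0, x0), where p x0 = f v0, would be a larger one. That this sum is still
  single-valued is where division in the field enters.\<close>

lemma lin_lift:
  assumes K: "field K" and m: "module K V" "module K X" "module K Y"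
    and p: "p \<in> lin X Y" and f: "f \<in> lin V Y" and im: "\<And>v. v \<in> carrier V \<Longrightarrow> f v \<in> p ` carrier X"
  shows "\<exists>g \<in> lin V X. \<forall>v\<in>carrier V. p (g v) = f v"
proof -
  interpret K: field K by (rule K)
  interpret V: module K V by (rule m)
  interpret X: module K X by (rule m)
  interpret Y: module K Y by (rule m)
  note L = lmodule[OF m(1)] lmodule[OF m(2)] lmodule[OF m(3)]
  have p0: "p \<zero>\<^bsub>X\<^esub> = \<zero>\<^bsub>Y\<^esub>" and f0: "f \<zero>\<^bsub>V\<^esub> = \<zero>\<^bsub>Y\<^esub>"
    using lmod_hom_zero[OF L(2,3) p] lmod_hom_zero[OF L(1,3) f] .
  have "{(\<zero>\<^bsub>V\<^esub>, \<zero>\<^bsub>X\<^esub>)} \<in> partial_lifts K V X p f"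
    unfolding partial_lifts_def by (auto simp: p0 f0)
  then have "\<exists>G \<in> partial_lifts K V X p f. \<forall>G' \<in> partial_lifts K V X p f. G \<subseteq> G' \<longrightarrow> G' = G"
    by (intro subset_Zorn_nonempty partial_lifts_Union) blast+
  then obtain G where G: "G \<in> partial_lifts K V X p f"
    and max: "\<And>G'. G' \<in> partial_lifts K V X p f \<Longrightarrow> G \<subseteq> G' \<Longrightarrow> G' = G" by blast
  note D = partial_liftsD[OF G]
  have ex: "\<exists>x. (v0, x) \<in> G" if v0: "v0 \<in> carrier V" for v0
  proof (rule ccontr)
    assume no: "\<nexists>x. (v0, x) \<in> G"
    obtain x0 where x0: "x0 \<in> carrier X" "p x0 = f v0" using im[OF v0] by auto
    let ?G = "{(v \<oplus>\<^bsub>V\<^esub> c \<odot>\<^bsub>V\<^esub> v0, x \<oplus>\<^bsub>X\<^esub> c \<odot>\<^bsub>X\<^esub> x0) | v x c. (v, x) \<in> G \<and> c \<in> carrier K}"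
    have mem: "(v \<oplus>\<^bsub>V\<^esub> c \<odot>\<^bsub>V\<^esub> v0, x \<oplus>\<^bsub>X\<^esub> c \<odot>\<^bsub>X\<^esub> x0) \<in> ?G" if "(v, x) \<in> G" "c \<in> carrier K" for v x c
      using that by blast
    have sub: "(v, x) \<in> ?G" if "(v, x) \<in> G" for v x
      using mem[OF that K.zero_closed] D(1,2)[OF that] v0 x0 by simp
    have new: "(v0, x0) \<in> ?G" using mem[OF D(3) K.one_closed] v0 x0 by simp
    have "?G \<in> partial_lifts K V X p f"
      unfolding partial_lifts_def
    proof (rule CollectI, intro conjI allI impI ballI)
      show "?G \<subseteq> carrier V \<times> carrier X" using D(1,2) v0 x0 by auto
      show "(\<zero>\<^bsub>V\<^esub>, \<zero>\<^bsub>X\<^esub>) \<in> ?G" using sub[OF D(3)] .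
    next
      fix v x w y assume "(v, x) \<in> ?G" "(w, y) \<in> ?G"
      then obtain v' x' c w' y' d where e: "v = v' \<oplus>\<^bsub>V\<^esub> c \<odot>\<^bsub>V\<^esub> v0" "x = x' \<oplus>\<^bsub>X\<^esub> c \<odot>\<^bsub>X\<^esub> x0" "(v', x') \<in> G" "c \<in> carrier K"
        "w = w' \<oplus>\<^bsub>V\<^esub> d \<odot>\<^bsub>V\<^esub> v0" "y = y' \<oplus>\<^bsub>X\<^esub> d \<odot>\<^bsub>X\<^esub> x0" "(w', y') \<in> G" "d \<in> carrier K" by blast
      have 1: "v \<oplus>\<^bsub>V\<^esub> w = (v' \<oplus>\<^bsub>V\<^esub> w') \<oplus>\<^bsub>V\<^esub> (c \<oplus>\<^bsub>K\<^esub> d) \<odot>\<^bsub>V\<^esub> v0"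
        using e v0 D(1)[OF e(3)] D(1)[OF e(7)] by (simp add: V.smult_l_distr V.M.a_ac)
      have 2: "x \<oplus>\<^bsub>X\<^esub> y = (x' \<oplus>\<^bsub>X\<^esub> y') \<oplus>\<^bsub>X\<^esub> (c \<oplus>\<^bsub>K\<^esub> d) \<odot>\<^bsub>X\<^esub> x0"
        using e x0 D(2)[OF e(3)] D(2)[OF e(7)] by (simp add: X.smult_l_distr X.M.a_ac)
      show "(v \<oplus>\<^bsub>V\<^esub> w, x \<oplus>\<^bsub>X\<^esub> y) \<in> ?G"
        unfolding 1 2 by (rule mem[OF D(4)[OF e(3,7)]]) (use e in auto)
    next
      fix d v x assume d: "d \<in> carrier K" and "(v, x) \<in> ?G"
      then obtain v' x' c where e: "v = v' \<oplus>\<^bsub>V\<^esub> c \<odot>\<^bsub>V\<^esub> v0" "x = x' \<oplus>\<^bsub>X\<^esub> c \<odot>\<^bsub>X\<^esub> x0" "(v', x') \<in> G" "c \<in> carrier K" by blast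
      have 1: "d \<odot>\<^bsub>V\<^esub> v = d \<odot>\<^bsub>V\<^esub> v' \<oplus>\<^bsub>V\<^esub> (d \<otimes>\<^bsub>K\<^esub> c) \<odot>\<^bsub>V\<^esub> v0"
        using e v0 d D(1)[OF e(3)] by (simp add: V.smult_r_distr V.smult_assoc1)
      have 2: "d \<odot>\<^bsub>X\<^esub> x = d \<odot>\<^bsub>X\<^esub> x' \<oplus>\<^bsub>X\<^esub> (d \<otimes>\<^bsub>K\<^esub> c) \<odot>\<^bsub>X\<^esub> x0"
        using e x0 d D(2)[OF e(3)] by (simp add: X.smult_r_distr X.smult_assoc1)
      show "(d \<odot>\<^bsub>V\<^esub> v, d \<odot>\<^bsub>X\<^esub> x) \<in> ?G"
        unfolding 1 2 by (rule mem[OF D(5)[OF d e(3)]]) (use e d in auto)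
    next
      fix v x assume "(v, x) \<in> ?G"
      then obtain v' x' c where e: "v = v' \<oplus>\<^bsub>V\<^esub> c \<odot>\<^bsub>V\<^esub> v0" "x = x' \<oplus>\<^bsub>X\<^esub> c \<odot>\<^bsub>X\<^esub> x0" "(v', x') \<in> G" "c \<in> carrier K" by blast
      show "p x = f v"
        using e v0 x0 D(1)[OF e(3)] D(2)[OF e(3)] D(6)[OF e(3)]
        by (simp add: lmod_hom_add[OF p] lmod_hom_add[OF f] lmod_hom_smult[OF p] lmod_hom_smult[OF f])
    next
      fix x assume "(\<zero>\<^bsub>V\<^esub>, x) \<in> ?G"
      then obtain v' x' c where e: "\<zero>\<^bsub>V\<^esub> = v' \<oplus>\<^bsub>V\<^esub> c \<odot>\<^bsub>V\<^esub> v0" "x = x' \<oplus>\<^bsub>X\<^esub> c \<odot>\<^bsub>X\<^esub> x0" "(v', x') \<in> G" "c \<in> carrier K" by blast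
      note v' = D(1)[OF e(3)]
      show "x = \<zero>\<^bsub>X\<^esub>"
      proof (cases "c = \<zero>\<^bsub>K\<^esub>")
        case True
        then have "v' = \<zero>\<^bsub>V\<^esub>" "x = x'" using e v' v0 x0 D(2)[OF e(3)] by simp_all
        then show ?thesis using D(7) e(3) by simp
      next
        \<comment> \<open>If c is invertible, then v' + c v0 = 0 expresses v0 as a multiple of v',
          and v0 would lie in the domain of \<open>G\<close> after all.\<close>
        case False
        then have c: "c \<in> Units K" using e(4) K.field_Units by auto
        have i: "inv\<^bsub>K\<^esub> c \<in> carrier K" using c by simp
        have "c \<odot>\<^bsub>V\<^esub> v0 = \<ominus>\<^bsub>V\<^esub> v'"
          using e(1,4) v' v0 by (metis V.M.add.m_comm V.M.minus_equality V.smult_closed)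
        then have "inv\<^bsub>K\<^esub> c \<odot>\<^bsub>V\<^esub> (c \<odot>\<^bsub>V\<^esub> v0) = (\<ominus>\<^bsub>K\<^esub> (inv\<^bsub>K\<^esub> c)) \<odot>\<^bsub>V\<^esub> v'"
          using i v' by (simp add: V.smult_l_minus V.smult_r_minus)
        then have "v0 = (\<ominus>\<^bsub>K\<^esub> (inv\<^bsub>K\<^esub> c)) \<odot>\<^bsub>V\<^esub> v'"
          using i e(4) v0 c by (simp add: V.smult_assoc1[symmetric])
        moreover have "((\<ominus>\<^bsub>K\<^esub> (inv\<^bsub>K\<^esub> c)) \<odot>\<^bsub>V\<^esub> v', (\<ominus>\<^bsub>K\<^esub> (inv\<^bsub>K\<^esub> c)) \<odot>\<^bsub>X\<^esub> x') \<in> G"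
          by (rule D(5)[OF _ e(3)]) (use i in simp)
        ultimately show ?thesis using no by metis
      qed
    qed
    then have "?G = G" by (rule max) (use sub in auto)
    then show False using new no by blast
  qed
  \<comment> \<open>Subtracting the two pairs shows that \<open>G\<close> contains (0, x - y), and
    over zero only zero is allowed.\<close>
  have uniq: "x = y" if "(v, x) \<in> G" "(v, y) \<in> G" for v x y
  proof -
    have c: "v \<in> carrier V" "x \<in> carrier X" "y \<in> carrier X" using D(1,2) that by blast+
    have "(v \<oplus>\<^bsub>V\<^esub> (\<ominus>\<^bsub>K\<^esub> \<one>\<^bsub>K\<^esub>) \<odot>\<^bsub>V\<^esub> v, x \<oplus>\<^bsub>X\<^esub> (\<ominus>\<^bsub>K\<^esub> \<one>\<^bsub>K\<^esub>) \<odot>\<^bsub>X\<^esub> y) \<in> G"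
      by (intro D(4) D(5) that) simp
    then have "(\<zero>\<^bsub>V\<^esub>, x \<ominus>\<^bsub>X\<^esub> y) \<in> G"
      using c by (simp add: V.smult_l_minus X.smult_l_minus V.M.r_neg a_minus_def)
    then show ?thesis using D(7) c by (blast intro: X.M.eq_if_minus_zero)
  qed
  define g where "g v = (SOME x. (v, x) \<in> G)" for v
  have g: "(v, g v) \<in> G" if "v \<in> carrier V" for v unfolding g_def by (rule someI_ex[OF ex[OF that]])
  have "g \<in> lin V X"
    by (rule lmod_homI) (use g D(2) in \<open>blast intro: uniq D(4,5) V.M.a_closed V.smult_closed\<close>)+
  then show ?thesis using g D(6) by blast
qed

end


context lin_alg
begin

lemma free_ext_minus:
  assumes "module K U" "\<phi> \<in> X \<rightarrow> carrier U" "\<psi> \<in> X \<rightarrow> carrier U" "r \<in> carrier (free_module K X)"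
  shows "free_ext K U (\<lambda>x. \<phi> x \<ominus>\<^bsub>U\<^esub> \<psi> x) r = free_ext K U \<phi> r \<ominus>\<^bsub>U\<^esub> free_ext K U \<psi> r"
proof -
  note U = lmodule[OF assms(1)]
  interpret U: module K U by fact
  have c: "(\<lambda>x. \<phi> x \<ominus>\<^bsub>U\<^esub> \<psi> x) \<in> X \<rightarrow> carrier U" using assms by (auto intro!: U.M.minus_closed)
  show ?thesis
    by (rule free_module_hom_ext[OF U free_ext_hom[OF U c]
          lin_minus[OF assms(1) free_ext_hom[OF U assms(2)] free_ext_hom[OF U assms(3)]] _ assms(4)])
       (simp add: free_ext_basis[OF U c] free_ext_basis[OF U assms(2)] free_ext_basis[OF U assms(3)])
qed

text \<open>The map f \<otimes> id for a map f that is merely linear. The contractions of the bar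
  complex are used in this form, whereas \<open>smap\<close> is made from equivariant maps.\<close>

definition "tmap W Y f t = tensor_lift K (tensor K W Y) (\<lambda>(v, h). tensor_elt K W Y (f v) h) t"

lemma tmap_lin_pure:
  assumes m: "module K V" "module K W" "module K Y" and f: "f \<in> lin V W"
  shows "tmap W Y f \<in> lin (tensor K V Y) (tensor K W Y)"
    "v \<in> carrier V \<Longrightarrow> h \<in> carrier Y \<Longrightarrow> tmap W Y f (tensor_elt K V Y v h) = tensor_elt K W Y (f v) h"
proof -
  have b: "bilin K V Y (tensor K W Y) (\<lambda>v h. tensor_elt K W Y (f v) h)"
    by (auto intro!: lin_intros f lmod_hom_closed[OF f] simp: m)
  show "tmap W Y f \<in> lin (tensor K V Y) (tensor K W Y)"
    unfolding tmap_def[abs_def] by (rule tensor_lift_lin) (auto simp: m b)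
  show "tmap W Y f (tensor_elt K V Y v h) = tensor_elt K W Y (f v) h" if "v \<in> carrier V" "h \<in> carrier Y"
    unfolding tmap_def by (rule tensor_lift_pure) (auto simp: m b that)
qed

end

section \<open>The differential of the bar complex\<close>

context smash_calc
begin

text \<open>The lift depends additively on the summand, since one fixed representative of the
  comultiplication of \<open>h\<close> is used throughout.\<close>

lemma SW_minus:
  assumes "module K U" "h \<in> carrier H"
    "\<And>x y. x \<in> carrier H \<Longrightarrow> y \<in> carrier H \<Longrightarrow> \<beta> x y \<in> carrier U"
    "\<And>x y. x \<in> carrier H \<Longrightarrow> y \<in> carrier H \<Longrightarrow> \<gamma> x y \<in> carrier U"
  shows "SW U (\<lambda>x y. \<beta> x y \<ominus>\<^bsub>U\<^esub> \<gamma> x y) h = SW U \<beta> h \<ominus>\<^bsub>U\<^esub> SW U \<gamma> h"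
proof -
  note t = tensor_relations_subset[OF H_module H_module]
  have h: "comult H h \<in> carrier (fquot K (carrier H \<times> carrier H) (tensor_relations K H H))"
    using comult_closed[OF assms(2)] by (simp add: tensor_fquot)
  have "free_ext K U (\<lambda>z. (\<lambda>(x, y). \<beta> x y) z \<ominus>\<^bsub>U\<^esub> (\<lambda>(x, y). \<gamma> x y) z) (SOME r. r \<in> comult H h)
      = SW U \<beta> h \<ominus>\<^bsub>U\<^esub> SW U \<gamma> h"
    unfolding sw_def tensor_lift_free_ext[OF t]
    by (rule free_ext_minus[OF assms(1) _ _ fquot_some(1)[OF t h]]) (use assms(3,4) in auto)
  then show ?thesis unfolding sw_def tensor_lift_free_ext[OF t] by (simp add: case_prod_unfold)
qed

definition "face j xs = take j xs @ [xs ! j \<bullet> xs ! Suc j] @ drop (j + 2) xs"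

text \<open>The index is shifted against the bar complex: \<open>D n\<close> goes from n + 2 to n +
  1 factors, so \<open>bar_diff K A m\<close> is \<open>D (Suc m)\<close>. The additional map
  \<open>D 0\<close> is the multiplication of A up to the identification \<open>sg\<close>, and it
  serves as the base of inductions below.\<close>

definition "D n t = tensor_lift K (T (Suc n)) (\<lambda>xs. \<Oplus>\<^bsub>T (Suc n)\<^esub> j \<in> {..n}.
    ((\<ominus>\<^bsub>K\<^esub> \<one>\<^bsub>K\<^esub>) [^]\<^bsub>K\<^esub> j) \<odot>\<^bsub>T (Suc n)\<^esub> el (face j xs)) t"

lemma bar_diff_D: "bar_diff K A m = D (Suc m)"
  by (rule ext) (simp add: bar_diff_def D_def face_def Let_def atLeast0AtMost)

lemma face_Suc [simp]: "face (Suc j) (x # xs) = x # face j xs"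
  and face_0 [simp]: "face 0 (x # y # xs) = (x \<bullet> y) # xs"
  by (simp_all add: face_def)

lemma face_tuples: "j \<le> n \<Longrightarrow> xs \<in> tuples A (Suc (Suc n)) \<Longrightarrow> face j xs \<in> tuples A (Suc n)"
proof (induction j arbitrary: n xs)
  case 0 then show ?case by (auto elim!: tuples_ConsE)
next
  case (Suc j)
  then obtain n' where n: "n = Suc n'" "j \<le> n'" by (cases n) auto
  obtain x ys where "xs = x # ys" "x \<in> carrier A" "ys \<in> tuples A (Suc n)" using Suc(3) by (rule tuples_ConsE)
  then show ?case using Suc(1)[OF n(2)] n by simp
qed

lemma face_multilin: "j \<le> n \<Longrightarrow> multilin K A (Suc (Suc n)) (T (Suc n)) (\<lambda>xs. el (face j xs))"
proof (induction j arbitrary: n)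
  case 0
  show ?case
  proof (rule multilin_ConsI)
    fix x assume x: "x \<in> carrier A"
    show "multilin K A (Suc n) (T (Suc n)) (\<lambda>xs. el (face 0 (x # xs)))"
      by (rule multilin_ConsI) (use x in \<open>auto intro!: el_ConsD lin_comp[OF _ el_ConsD(2)] lin_intros\<close>)
  next
    fix xs assume "xs \<in> tuples A (Suc n)"
    then show "(\<lambda>x. el (face 0 (x # xs))) \<in> lin A (T (Suc n))"
      by (auto elim!: tuples_ConsE intro!: lin_comp[OF _ el_ConsD(2)] lin_intros)
  qed
next
  case (Suc j)
  then obtain n' where n: "n = Suc n'" "j \<le> n'" by (cases n) auto
  note IH = Suc(1)[OF n(2)]
  show ?case unfolding n(1)
  proof (rule multilin_ConsI)
    fix x assume x: "x \<in> carrier A"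
    show "multilin K A (Suc (Suc n')) (T (Suc (Suc n'))) (\<lambda>xs. el (face (Suc j) (x # xs)))"
      by (rule multilin_cong[OF A_module _ multilin_comp[OF IH bilinD(1)[OF tcons_bilin x]]])
         (simp add: tcons_el x face_tuples n)
  next
    fix xs assume "xs \<in> tuples A (Suc (Suc n'))"
    then show "(\<lambda>x. el (face (Suc j) (x # xs))) \<in> lin A (T (Suc (Suc n')))"
      using face_tuples[OF n(2)] by (auto intro!: el_ConsD(2))
  qed
qed

lemma sign_closed [simp]: "(\<ominus>\<^bsub>K\<^esub> \<one>\<^bsub>K\<^esub>) [^]\<^bsub>K\<^esub> (j :: nat) \<in> carrier K"
proof -
  interpret cring K by (rule K_cring)
  show ?thesis by simp
qed

lemma D_multilin: "multilin K A (Suc (Suc n)) (T (Suc n)) (\<lambda>xs. \<Oplus>\<^bsub>T (Suc n)\<^esub> j \<in> {..n}.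
    ((\<ominus>\<^bsub>K\<^esub> \<one>\<^bsub>K\<^esub>) [^]\<^bsub>K\<^esub> j) \<odot>\<^bsub>T (Suc n)\<^esub> el (face j xs))"
  by (rule multilin_finsum)
     (auto intro!: multilin_comp[OF face_multilin, of _ _ "\<lambda>u. _ \<odot>\<^bsub>T (Suc n)\<^esub> u"] lin_smult lin_id)

lemma D_lin: "D n \<in> lin (T (Suc (Suc n))) (T (Suc n))"
  unfolding D_def[abs_def] by (rule tpower_lift_lin[OF A_module T_module D_multilin])

lemma D_el: "xs \<in> tuples A (Suc (Suc n)) \<Longrightarrow> D n (el xs) = (\<Oplus>\<^bsub>T (Suc n)\<^esub> j \<in> {..n}.
    ((\<ominus>\<^bsub>K\<^esub> \<one>\<^bsub>K\<^esub>) [^]\<^bsub>K\<^esub> j) \<odot>\<^bsub>T (Suc n)\<^esub> el (face j xs))"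
  unfolding D_def by (rule tpower_lift_pure[OF A_module T_module D_multilin])

lemma D_closed [simp]: "v \<in> carrier (T (Suc (Suc n))) \<Longrightarrow> D n v \<in> carrier (T (Suc n))"
  by (rule lmod_hom_closed[OF D_lin])

text \<open>Face 0 multiplies x into the first factor of v, and face j + 1 of x \<otimes> v is x
  tensored with face j of v, with the opposite sign. Compatibility of D with the actions, D D = 0
  and the contraction are derived from this recursion and from \<open>D_0\<close>, without returning
  to the alternating sum.\<close>

lemma D_tcons:
  assumes x: "x \<in> carrier A" and v: "v \<in> carrier (T (Suc (Suc n)))"
  shows "D (Suc n) (tcons (Suc (Suc n)) x v) = Tl (Suc (Suc n)) x v \<ominus>\<^bsub>T (Suc (Suc n))\<^esub> tcons (Suc n) x (D n v)"
proof (rule T_ext[OF T_module _ _ _ v])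
  let ?U = "T (Suc (Suc n))" and ?s = "\<lambda>j. (\<ominus>\<^bsub>K\<^esub> \<one>\<^bsub>K\<^esub>) [^]\<^bsub>K\<^esub> (j :: nat)"
  interpret K: cring K by (rule K_cring)
  interpret U: module K ?U by simp
  interpret U': module K "T (Suc n)" by simp
  fix vs assume vs: "vs \<in> tuples A (Suc (Suc n))"
  have ft: "face j vs \<in> tuples A (Suc n)" if "j \<le> n" for j using face_tuples[OF that vs] .
  let ?L = "\<lambda>u. \<ominus>\<^bsub>?U\<^esub> tcons (Suc n) x u"
  note tl = bilinD(1)[OF tcons_bilin x, of "Suc n"]
  have L: "?L \<in> lin (T (Suc n)) ?U"
    by (rule lmod_homI)
       (simp_all add: x lmod_hom_add[OF tl] lmod_hom_smult[OF tl] U.M.minus_add U.smult_r_minus)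
  have c: "x # vs \<in> tuples A (Suc (Suc (Suc n)))" using x vs by simp
  have "D (Suc n) (tcons (Suc (Suc n)) x (el vs)) = (\<Oplus>\<^bsub>?U\<^esub> j \<in> {..Suc n}. ?s j \<odot>\<^bsub>?U\<^esub> el (face j (x # vs)))"
    using x vs by (simp only: tcons_el D_el[OF c])
  also have "\<dots> = (\<Oplus>\<^bsub>?U\<^esub> j \<in> {..n}. ?s (Suc j) \<odot>\<^bsub>?U\<^esub> el (face (Suc j) (x # vs))) \<oplus>\<^bsub>?U\<^esub> ?s 0 \<odot>\<^bsub>?U\<^esub> el (face 0 (x # vs))"
    by (rule U.M.finsum_Suc2) (use face_tuples[OF _ c] in auto)
  also have "(\<Oplus>\<^bsub>?U\<^esub> j \<in> {..n}. ?s (Suc j) \<odot>\<^bsub>?U\<^esub> el (face (Suc j) (x # vs)))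
      = (\<Oplus>\<^bsub>?U\<^esub> j \<in> {..n}. ?L (?s j \<odot>\<^bsub>T (Suc n)\<^esub> el (face j vs)))"
  proof (rule finsum_cong_weak)
    fix j assume "j \<in> {..n}"
    then have j: "face j vs \<in> tuples A (Suc n)" using ft by simp
    have "?s (Suc j) \<odot>\<^bsub>?U\<^esub> el (x # face j vs) = ?s j \<odot>\<^bsub>?U\<^esub> ((\<ominus>\<^bsub>K\<^esub> \<one>\<^bsub>K\<^esub>) \<odot>\<^bsub>?U\<^esub> el (x # face j vs))"
      using x j by (simp add: U.smult_assoc1)
    also have "\<dots> = \<ominus>\<^bsub>?U\<^esub> (?s j \<odot>\<^bsub>?U\<^esub> el (x # face j vs))"
      using x j by (simp add: U.smult_l_minus U.smult_r_minus)
    also have "\<dots> = ?L (?s j \<odot>\<^bsub>T (Suc n)\<^esub> el (face j vs))"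
      using x j lmod_hom_smult[OF bilinD(1)[OF tcons_bilin x], of "?s j" "el (face j vs)"] by (simp add: tcons_el)
    finally show "?s (Suc j) \<odot>\<^bsub>?U\<^esub> el (face (Suc j) (x # vs)) = ?L (?s j \<odot>\<^bsub>T (Suc n)\<^esub> el (face j vs))" by simp
  qed
  also have "\<dots> = ?L (D n (el vs))"
    unfolding D_el[OF vs] by (rule lmod_hom_finsum[OF lmodule lmodule L, symmetric]) (use ft in auto)
  also have "?s 0 \<odot>\<^bsub>?U\<^esub> el (face 0 (x # vs)) = Tl (Suc (Suc n)) x (el vs)"
    using vs
  proof (rule tuples_ConsE)
    fix y ys assume a: "vs = y # ys" "y \<in> carrier A" "ys \<in> tuples A (Suc n)"
    have "Tl (Suc (Suc n)) x (el (y # ys)) = el ((x \<bullet> y) # ys)"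
      using Tl_tcons[OF x a(2), of "el ys" "Suc n"] a x by (simp add: tcons_el)
    then show ?thesis using a x by simp
  qed
  finally show "D (Suc n) (tcons (Suc (Suc n)) x (el vs)) = Tl (Suc (Suc n)) x (el vs) \<ominus>\<^bsub>?U\<^esub> tcons (Suc n) x (D n (el vs))"
    using x vs by (simp add: a_minus_def U.M.a_comm)
qed (use x in \<open>auto intro!: TT_lin lin_intros lin_minus lin_comp[OF _ D_lin]\<close>)

subsubsection \<open>The augmentation\<close>

text \<open>\<open>mu\<close> augments the bar complex onto A itself, while \<open>sg\<close> below
  identifies A with the tensor power of one factor, where \<open>D 0\<close> takes its
  values.\<close>

definition "mu t = tensor_lift K A (\<lambda>xs. xs ! 0 \<bullet> xs ! 1) t"
definition "sg a = tcons 0 a (el [])"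

lemma el_Nil_closed [simp]: "el [] \<in> carrier (T 0)" by simp

lemma sg_lin: "g \<in> lin V A \<Longrightarrow> (\<lambda>v. sg (g v)) \<in> lin V (T (Suc 0))"
  unfolding sg_def by (auto intro!: T_lin)

lemma sg_closed [simp]: "a \<in> carrier A \<Longrightarrow> sg a \<in> carrier (T (Suc 0))" by (simp add: sg_def)

lemma T2_ext:
  assumes "module K U" "f \<in> lin (T (Suc (Suc 0))) U" "g \<in> lin (T (Suc (Suc 0))) U"
    "\<And>x y. x \<in> carrier A \<Longrightarrow> y \<in> carrier A \<Longrightarrow> f (tcons (Suc 0) x (sg y)) = g (tcons (Suc 0) x (sg y))"
    "t \<in> carrier (T (Suc (Suc 0)))"
  shows "f t = g t"
proof (rule T_ext[OF assms(1-3) _ assms(5)])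
  fix vs assume "vs \<in> tuples A (Suc (Suc 0))"
  then obtain x y where "vs = [x, y]" "x \<in> carrier A" "y \<in> carrier A" by (auto elim!: tuples_ConsE)
  then show "f (el vs) = g (el vs)" using assms(4)[of x y] by (simp add: sg_def tcons_el)
qed

lemma mu_lin: "mu \<in> lin (T (Suc (Suc 0))) A"
  and mu_tcons: "x \<in> carrier A \<Longrightarrow> y \<in> carrier A \<Longrightarrow> mu (tcons (Suc 0) x (sg y)) = x \<bullet> y"
proof -
  have m: "multilin K A (Suc (Suc 0)) A (\<lambda>xs. xs ! 0 \<bullet> xs ! 1)"
    by (intro multilin_ConsI) (auto elim!: tuples_ConsE intro!: lin_intros multilin_Nil multilinI)
  show "mu \<in> lin (T (Suc (Suc 0))) A" unfolding mu_def[abs_def] by (rule tpower_lift_lin[OF A_module A_module m])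
  show "mu (tcons (Suc 0) x (sg y)) = x \<bullet> y" if "x \<in> carrier A" "y \<in> carrier A"
    using tpower_lift_pure[OF A_module A_module m, of "[x, y]"] that by (simp add: sg_def tcons_el mu_def)
qed

lemma mu_closed [simp]: "v \<in> carrier (T (Suc (Suc 0))) \<Longrightarrow> mu v \<in> carrier A"
  by (rule lmod_hom_closed[OF mu_lin])

lemma D_0:
  assumes v: "v \<in> carrier (T (Suc (Suc 0)))" shows "D 0 v = sg (mu v)"
proof (rule T2_ext[OF T_module _ _ _ v])
  fix x y assume a: "x \<in> carrier A" "y \<in> carrier A"
  interpret U: module K "T (Suc 0)" by simp
  have "D 0 (el [x, y]) = el [x \<bullet> y]" using a by (subst D_el) (simp_all add: U.M.finsum_0)
  then show "D 0 (tcons (Suc 0) x (sg y)) = sg (mu (tcons (Suc 0) x (sg y)))"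
    using a by (simp add: mu_tcons) (simp add: sg_def tcons_el)
qed (auto intro!: D_lin sg_lin mu_lin)

lemma Th_sg:
  assumes "h \<in> carrier H" "x \<in> carrier A" shows "Th (Suc 0) h (sg x) = sg (act h x)"
proof -
  have "Th (Suc 0) h (sg x) = SW (T (Suc 0)) (\<lambda>h1 h2. counit H h2 \<odot>\<^bsub>T (Suc 0)\<^esub> sg (act h1 x)) h"
    using assms unfolding sg_def by (simp add: Th_tcons Th_Nil lmod_hom_smult[OF bilinD(1)[OF tcons_bilin]])
  also have "\<dots> = sg (act h x)"
    by (rule SW_counit_right) (use assms in \<open>auto intro!: sg_lin TT_lin lin_intros\<close>)
  finally show ?thesis .
qed

lemma Tr_sg: "x \<in> carrier A \<Longrightarrow> b \<in> carrier A \<Longrightarrow> Tr (Suc 0) (sg x) b = sg (x \<bullet> b)"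
  using Tr_tsnoc[of b x "el []" 0] by (simp add: sg_def tsnoc_el tcons_el)

lemma mu_ehom: "ehom (T (Suc (Suc 0))) (Tl (Suc (Suc 0))) (Tr (Suc (Suc 0))) (Th (Suc (Suc 0))) A (mult A) (mult A) act mu"
proof -
  have 1: "mu (Tl (Suc (Suc 0)) a v) = a \<bullet> mu v" if "a \<in> carrier A" "v \<in> carrier (T (Suc (Suc 0)))" for a v
    by (rule T2_ext[OF A_module _ _ _ that(2)])
       (use that in \<open>auto intro!: TT_lin lin_intros lin_comp[OF _ mu_lin] mu_lin simp: Tl_tcons mu_tcons amult_assoc\<close>)
  have 2: "mu (Tr (Suc (Suc 0)) v a) = mu v \<bullet> a" if "a \<in> carrier A" "v \<in> carrier (T (Suc (Suc 0)))" for a v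
    by (rule T2_ext[OF A_module _ _ _ that(2)])
       (use that in \<open>auto intro!: TT_lin lin_intros lin_comp[OF _ mu_lin] mu_lin simp: Tr_tcons Tr_sg mu_tcons amult_assoc\<close>)
  have 3: "mu (Th (Suc (Suc 0)) h v) = act h (mu v)" if h: "h \<in> carrier H" and v: "v \<in> carrier (T (Suc (Suc 0)))" for h v
  proof (rule T2_ext[OF A_module _ _ _ v])
    fix x y assume a: "x \<in> carrier A" "y \<in> carrier A"
    have "mu (Th (Suc (Suc 0)) h (tcons (Suc 0) x (sg y))) = SW A (\<lambda>h1 h2. mu (tcons (Suc 0) (act h1 x) (Th (Suc 0) h2 (sg y)))) h"
      unfolding Th_tcons[OF h a(1) sg_closed[OF a(2)]] by (rule SW_comp[OF T_module A_module mu_lin]) (use h a in auto)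
    also have "\<dots> = act h (x \<bullet> y)"
      using equivariantD(2)[OF amult_equivariant h a] h a by (simp add: Th_sg mu_tcons)
    finally show "mu (Th (Suc (Suc 0)) h (tcons (Suc 0) x (sg y))) = act h (mu (tcons (Suc 0) x (sg y)))"
      using a by (simp add: mu_tcons)
  qed (use h in \<open>auto intro!: TT_lin lin_intros lin_comp[OF _ mu_lin] mu_lin\<close>)
  show ?thesis unfolding equivariant_hom_def using 1 2 3 mu_lin by blast
qed

lemma D_Tl:
  assumes "a \<in> carrier A" "w \<in> carrier (T (Suc (Suc (Suc n))))"
  shows "D (Suc n) (Tl (Suc (Suc (Suc n))) a w) = Tl (Suc (Suc n)) a (D (Suc n) w)"
proof (rule T_cons_ext[OF T_module _ _ _ assms(2)])
  interpret U: module K "T (Suc (Suc n))" by simp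
  note l = bilinD(1)[OF Tl_bilin assms(1), of "Suc n"]
  fix x v assume x: "x \<in> carrier A" and v: "v \<in> carrier (T (Suc (Suc n)))"
  have "D (Suc n) (Tl (Suc (Suc (Suc n))) a (tcons (Suc (Suc n)) x v))
      = Tl (Suc (Suc n)) (a \<bullet> x) v \<ominus>\<^bsub>T (Suc (Suc n))\<^esub> tcons (Suc n) (a \<bullet> x) (D n v)"
    using x v assms(1) by (simp add: Tl_tcons D_tcons)
  also have "\<dots> = Tl (Suc (Suc n)) a (Tl (Suc (Suc n)) x v) \<ominus>\<^bsub>T (Suc (Suc n))\<^esub> Tl (Suc (Suc n)) a (tcons (Suc n) x (D n v))"
    using ebimD(11)[OF T_ebim, of a x v n] x v assms(1) by (simp add: Tl_tcons)
  also have "\<dots> = Tl (Suc (Suc n)) a (D (Suc n) (tcons (Suc (Suc n)) x v))"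
    using x v assms(1) by (simp add: D_tcons a_minus_def lmod_hom_add[OF l] lmod_hom_a_inv[OF lmodule lmodule l])
  finally show "D (Suc n) (Tl (Suc (Suc (Suc n))) a (tcons (Suc (Suc n)) x v)) = \<dots>" .
qed (use assms in \<open>auto intro!: TT_lin lin_intros lin_comp[OF _ D_lin] D_lin\<close>)

lemma D_Tr:
  assumes "b \<in> carrier A" "w \<in> carrier (T (Suc (Suc n)))"
  shows "D n (Tr (Suc (Suc n)) w b) = Tr (Suc n) (D n w) b"
  using assms(2)
proof (induction n arbitrary: w)
  case 0
  then show ?case using assms(1) ehomD(3)[OF mu_ehom, of b w] by (simp add: D_0 Tr_sg)
next
  case (Suc n)
  show ?case
  proof (rule T_cons_ext[OF T_module _ _ _ Suc(2)])
    interpret U: module K "T (Suc (Suc n))" by simp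
    note l = bilinD(2)[OF Tr_bilin assms(1), of "Suc n"]
    fix x v assume x: "x \<in> carrier A" and v: "v \<in> carrier (T (Suc (Suc n)))"
    have "D (Suc n) (Tr (Suc (Suc (Suc n))) (tcons (Suc (Suc n)) x v) b)
        = Tl (Suc (Suc n)) x (Tr (Suc (Suc n)) v b) \<ominus>\<^bsub>T (Suc (Suc n))\<^esub> tcons (Suc n) x (Tr (Suc n) (D n v) b)"
      using x v assms(1) by (simp add: Tr_tcons D_tcons Suc(1))
    also have "\<dots> = Tr (Suc (Suc n)) (Tl (Suc (Suc n)) x v) b \<ominus>\<^bsub>T (Suc (Suc n))\<^esub> Tr (Suc (Suc n)) (tcons (Suc n) x (D n v)) b"
      using ebimD(13)[OF T_ebim, of x b v n] x v assms(1) by (simp add: Tr_tcons)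
    also have "\<dots> = Tr (Suc (Suc n)) (D (Suc n) (tcons (Suc (Suc n)) x v)) b"
      using x v assms(1) by (simp add: D_tcons a_minus_def lmod_hom_add[OF l] lmod_hom_a_inv[OF lmodule lmodule l])
    finally show "D (Suc n) (Tr (Suc (Suc (Suc n))) (tcons (Suc (Suc n)) x v) b) = \<dots>" .
  qed (use assms in \<open>auto intro!: TT_lin lin_intros lin_comp[OF _ D_lin] D_lin\<close>)
qed

text \<open>For D(h1 x \<otimes> h2 v) the recursion gives (h1 x)(h2 v) - h1 x \<otimes> D(h2 v).
  The first term sums to h (x v) by equivariance of the left action, and the second to h (x
  \<otimes> D v) by induction.\<close>

lemma D_Th:
  assumes h: "h \<in> carrier H" and w: "w \<in> carrier (T (Suc (Suc n)))"
  shows "D n (Th (Suc (Suc n)) h w) = Th (Suc n) h (D n w)"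
  using w h
proof (induction n arbitrary: w h)
  case 0
  then show ?case using ehomD(4)[OF mu_ehom, of h w] by (simp add: D_0 Th_sg)
next
  case (Suc n)
  note h = Suc(3)
  show ?case
  proof (rule T_cons_ext[OF T_module _ _ _ Suc(2)])
    let ?U = "T (Suc (Suc n))"
    interpret U: module K ?U by simp
    note l = bilinD(1)[OF Th_bilin h, of "Suc (Suc n)"]
    fix x v assume x: "x \<in> carrier A" and v: "v \<in> carrier ?U"
    have "D (Suc n) (Th (Suc (Suc (Suc n))) h (tcons (Suc (Suc n)) x v))
        = SW ?U (\<lambda>h1 h2. D (Suc n) (tcons (Suc (Suc n)) (act h1 x) (Th (Suc (Suc n)) h2 v))) h"
      unfolding Th_tcons[OF h x v] by (rule SW_comp[OF T_module T_module D_lin]) (use x v h in auto)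
    also have "\<dots> = SW ?U (\<lambda>h1 h2. Tl (Suc (Suc n)) (act h1 x) (Th (Suc (Suc n)) h2 v)
         \<ominus>\<^bsub>?U\<^esub> tcons (Suc n) (act h1 x) (Th (Suc n) h2 (D n v))) h"
      by (rule SW_eqI[OF h]) (use x v in \<open>simp add: D_tcons Suc(1)\<close>)
    also have "\<dots> = SW ?U (\<lambda>h1 h2. Tl (Suc (Suc n)) (act h1 x) (Th (Suc (Suc n)) h2 v)) h
        \<ominus>\<^bsub>?U\<^esub> SW ?U (\<lambda>h1 h2. tcons (Suc n) (act h1 x) (Th (Suc n) h2 (D n v))) h"
      by (rule SW_minus) (use x v h in auto)
    also have "\<dots> = Th (Suc (Suc n)) h (Tl (Suc (Suc n)) x v) \<ominus>\<^bsub>?U\<^esub> Th (Suc (Suc n)) h (tcons (Suc n) x (D n v))"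
      using equivariantD(2)[OF Tl_equivariant h x v] x v h by (simp add: Th_tcons)
    also have "\<dots> = Th (Suc (Suc n)) h (D (Suc n) (tcons (Suc (Suc n)) x v))"
      using x v h by (simp add: D_tcons a_minus_def lmod_hom_add[OF l] lmod_hom_a_inv[OF lmodule lmodule l])
    finally show "D (Suc n) (Th (Suc (Suc (Suc n))) h (tcons (Suc (Suc n)) x v)) = \<dots>" .
  qed (use h in \<open>auto intro!: TT_lin lin_intros lin_comp[OF _ D_lin] D_lin\<close>)
qed

lemma D_ehom: "ehom (T (Suc (Suc (Suc n)))) (Tl (Suc (Suc (Suc n)))) (Tr (Suc (Suc (Suc n)))) (Th (Suc (Suc (Suc n))))
   (T (Suc (Suc n))) (Tl (Suc (Suc n))) (Tr (Suc (Suc n))) (Th (Suc (Suc n))) (D (Suc n))"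
  unfolding equivariant_hom_def using D_lin D_Tl D_Tr D_Th by blast

text \<open>The case x = 1 of the recursion: tensoring with 1 on the left is a contracting
  homotopy.\<close>

lemma D_contract: "v \<in> carrier (T (Suc (Suc n))) \<Longrightarrow>
    D (Suc n) (tcons (Suc (Suc n)) \<one>\<^bsub>A\<^esub> v) = v \<ominus>\<^bsub>T (Suc (Suc n))\<^esub> tcons (Suc n) \<one>\<^bsub>A\<^esub> (D n v)"
  using ebimD(14)[OF T_ebim] by (simp add: D_tcons)

lemma mu_D: 
  assumes "w \<in> carrier (T (Suc (Suc (Suc 0))))" shows "mu (D (Suc 0) w) = \<zero>\<^bsub>A\<^esub>"
proof (rule T_cons_ext[OF A_module _ lin_zero[OF A_module] _ assms])
  interpret A: module K A by simp
  interpret U: module K "T (Suc (Suc 0))" by simp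
  fix x v assume x: "x \<in> carrier A" and v: "v \<in> carrier (T (Suc (Suc 0)))"
  show "mu (D (Suc 0) (tcons (Suc (Suc 0)) x v)) = \<zero>\<^bsub>A\<^esub>"
    using x v by (simp add: D_tcons a_minus_def lmod_hom_add[OF mu_lin] lmod_hom_a_inv[OF lmodule lmodule mu_lin]
        ehomD(2)[OF mu_ehom] D_0 mu_tcons A.M.r_neg)
qed (auto intro!: lin_comp[OF D_lin mu_lin])

text \<open>By the recursion D D(x \<otimes> v) = D(x v) - x D v + x \<otimes> D D v. The first two
  terms cancel because D is left A-linear, and the last one vanishes by induction.\<close>

lemma D_D:
  assumes "w \<in> carrier (T (Suc (Suc (Suc n))))" shows "D n (D (Suc n) w) = \<zero>\<^bsub>T (Suc n)\<^esub>"
  using assms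
proof (induction n arbitrary: w)
  case 0
  then show ?case using lmod_hom_zero[OF lmodule lmodule sg_lin[OF lin_id]] by (simp add: D_0 mu_D)
next
  case (Suc n)
  show ?case
  proof (rule T_cons_ext[OF T_module _ lin_zero[OF T_module] _ Suc(2)])
    let ?U = "T (Suc (Suc n))"
    interpret U: module K ?U by simp
    interpret U': module K "T (Suc (Suc (Suc n)))" by simp
    fix x v assume x: "x \<in> carrier A" and v: "v \<in> carrier (T (Suc (Suc (Suc n))))"
    have mz: "\<ominus>\<^bsub>?U\<^esub> \<zero>\<^bsub>?U\<^esub> = \<zero>\<^bsub>?U\<^esub>" using U.M.minus_equality[of "\<zero>\<^bsub>?U\<^esub>" "\<zero>\<^bsub>?U\<^esub>"] by simp
    have z: "tcons (Suc n) x \<zero>\<^bsub>T (Suc n)\<^esub> = \<zero>\<^bsub>?U\<^esub>" by (rule lmod_hom_zero[OF lmodule lmodule bilinD(1)[OF tcons_bilin x]]) auto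
    show "D (Suc n) (D (Suc (Suc n)) (tcons (Suc (Suc (Suc n))) x v)) = \<zero>\<^bsub>?U\<^esub>"
      using x v by (simp add: D_tcons a_minus_def lmod_hom_add[OF D_lin] lmod_hom_a_inv[OF lmodule lmodule D_lin]
        ehomD(2)[OF D_ehom] Suc(1) z mz U.M.r_neg)
  qed (auto intro!: lin_comp[OF D_lin D_lin])
qed

end

context smash_calc
begin

subsection \<open>The induced resolution of the smash product\<close>

text \<open>The map f \<otimes> id between induced bimodules, obtained as the transpose of n
  \<mapsto> f(n) \<otimes> 1 so that \<open>sharp_hom\<close> makes it a map of bimodules.\<close>

definition "smap N' la' ra' ha' f = sharp (smash_module N' la' ra' ha') (\<lambda>n. tensor_elt K N' H (f n) \<one>\<^bsub>H\<^esub>)"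

lemma smap_hom_pure:
  assumes N: "ebim N la ra ha" and N': "ebim N' la' ra' ha'" and f: "ehom N la ra ha N' la' ra' ha' f"
  shows "smap N' la' ra' ha' f \<in> lmod_hom E (smash_module N la ra ha) (smash_module N' la' ra' ha')"
    and "smap N' la' ra' ha' f \<in> lin (tensor K N H) (tensor K N' H)"
    and "n \<in> carrier N \<Longrightarrow> h \<in> carrier H \<Longrightarrow> smap N' la' ra' ha' f (tensor_elt K N H n h) = tensor_elt K N' H (f n) h"
proof -
  note e = ehom_comp[OF f smash_unit_ehom[OF N']]
  show h: "smap N' la' ra' ha' f \<in> lmod_hom E (smash_module N la ra ha) (smash_module N' la' ra' ha')"
    unfolding smap_def by (rule sharp_hom[OF N SN_left_module[OF N'] e])
  show "smap N' la' ra' ha' f \<in> lin (tensor K N H) (tensor K N' H)"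
    using E_homD(1)[OF SN_left_module[OF N] SN_left_module[OF N'] h] by (simp add: SN_lin[OF N] SN_lin[OF N'])
  show "smap N' la' ra' ha' f (tensor_elt K N H n h) = tensor_elt K N' H (f n) h"
    if "n \<in> carrier N" "h \<in> carrier H"
    unfolding smap_def using that ehomD(5)[OF f]
    by (simp add: sharp_pure[OF N SN_left_module[OF N'] ehomD(1)[OF e]] SN_right_inH[OF N'])
qed

definition "Q n = smash_module (T (Suc (Suc n))) (Tl (Suc (Suc n))) (Tr (Suc (Suc n))) (Th (Suc (Suc n)))"
definition "dQ n = smap (T (Suc (Suc n))) (Tl (Suc (Suc n))) (Tr (Suc (Suc n))) (Th (Suc (Suc n))) (D (Suc n))"
definition "RM = enveloping_module K R (mult R) (mult R)"
text \<open>The transpose of the multiplication of A followed by the inclusion of A in A # H; on A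
  \<otimes> A \<otimes> H it is \<open>mu\<close> tensored with the identity of H.\<close>

definition "eQ = sharp RM (\<lambda>v. inA (mu v))"

lemma R_bimodule: "bimodule K R R (mult R) (mult R)"
  by (rule bimoduleI) (use rmult_bilin rmult_assoc rmult_one in \<open>auto simp del: R_sel\<close>)

lemma RM_left_module: "left_module E RM"
  unfolding RM_def by (rule enveloping_module_left_module[OF R_bimodule])

lemma RM_sel: "carrier RM = carrier AH" "zero RM = zero AH" "add RM = add AH"
  unfolding RM_def by (simp_all add: enveloping_module_sel[OF R_bimodule])

lemma RM_acts: "r \<in> carrier AH \<Longrightarrow> x \<in> carrier AH \<Longrightarrow> left_act K R RM r x = r \<diamond> x"
  "r \<in> carrier AH \<Longrightarrow> x \<in> carrier AH \<Longrightarrow> right_act K R RM x r = x \<diamond> r"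
  unfolding RM_def using enveloping_module_acts[OF R_bimodule] by simp_all

lemma RM_lin: "lin (vspace K R RM) U = lin AH U" "lin U (vspace K R RM) = lin U AH"
proof -
  have "lin (vspace K R RM) U = lin R U" "lin U (vspace K R RM) = lin U R"
    unfolding RM_def by (rule enveloping_module_lin[OF R_bimodule])+
  then show "lin (vspace K R RM) U = lin AH U" "lin U (vspace K R RM) = lin U AH"
    by (simp_all add: lmod_hom_def)
qed

lemma Q_left_module: "left_module E (Q n)"
  unfolding Q_def by (rule SN_left_module[OF T_ebim])

lemma Q_sel: "carrier (Q n) = carrier (tensor K (T (Suc (Suc n))) H)" "add (Q n) = add (tensor K (T (Suc (Suc n))) H)"
   "zero (Q n) = zero (tensor K (T (Suc (Suc n))) H)"
  unfolding Q_def by (simp_all add: SN_sel[OF T_ebim])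

lemmas dQ_hom = smap_hom_pure(1)[OF T_ebim T_ebim D_ehom, folded Q_def dQ_def]
  and dQ_lin = smap_hom_pure(2)[OF T_ebim T_ebim D_ehom, folded dQ_def]
  and dQ_pure = smap_hom_pure(3)[OF T_ebim T_ebim D_ehom, folded dQ_def]

text \<open>The adjoint action on the bimodule A # H restricts to the given action on A, because the
  latter is inner by \<open>inA_act\<close>.\<close>

lemma inA_ehom: "ehom A (mult A) (mult A) act (vspace K R RM) (xl RM) (xr RM) (adj RM) inA"
proof -
  have "inA (act h a) = adj RM h (inA a)" if h: "h \<in> carrier H" and a: "a \<in> carrier A" for h a
  proof -
    have "adj RM h (inA a) = SW (vspace K R RM) (\<lambda>h1 h2. inH h1 \<diamond> inA a \<diamond> inH (antipode H h2)) h"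
      unfolding adj_def by (rule SW_eqI[OF h]) (simp add: RM_acts a R_assoc)
    also have "\<dots> = SW AH (\<lambda>h1 h2. inH h1 \<diamond> inA a \<diamond> inH (antipode H h2)) h"
      using SW_comp[OF tensor_module[OF A_module H_module] vspace_module[OF RM_left_module], of "\<lambda>x. x" "\<lambda>h1 h2. inH h1 \<diamond> inA a \<diamond> inH (antipode H h2)" h] h a
      by (simp add: RM_lin lin_id)
    finally show ?thesis using inA_act[OF h a] by simp
  qed
  then show ?thesis unfolding equivariant_hom_def
    by (auto simp: RM_lin RM_acts inA_inA intro!: inA_lin lin_id)
qed

lemmas eQ_ehom = ehom_comp[OF mu_ehom inA_ehom]

lemma eQ_hom: "eQ \<in> lmod_hom E (Q 0) RM"
  unfolding eQ_def Q_def by (rule sharp_hom[OF T_ebim RM_left_module eQ_ehom])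

lemma eQ_lin: "eQ \<in> lin (tensor K (T (Suc (Suc 0))) H) AH"
  using E_homD(1)[OF Q_left_module RM_left_module eQ_hom] by (simp add: Q_def SN_lin[OF T_ebim] RM_lin)

lemma eQ_pure: "v \<in> carrier (T (Suc (Suc 0))) \<Longrightarrow> h \<in> carrier H \<Longrightarrow> eQ (tensor_elt K (T (Suc (Suc 0))) H v h) = tensor_elt K A H (mu v) h"
  unfolding eQ_def
  by (simp add: sharp_pure[OF T_ebim RM_left_module ehomD(1)[OF eQ_ehom]] RM_acts inA_inH)

text \<open>The map a \<otimes> h \<mapsto> (1 \<otimes> a) \<otimes> h is a linear section.\<close>

lemma eQ_surj: "eQ ` carrier (Q 0) = carrier RM"
proof
  show "eQ ` carrier (Q 0) \<subseteq> carrier RM" using lmod_hom_closed[OF eQ_hom] by blast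
  let ?s = "\<lambda>a. tcons (Suc 0) \<one>\<^bsub>A\<^esub> (sg a)"
  have s: "?s \<in> lin A (T (Suc (Suc 0)))" by (auto intro!: T_lin sg_lin lin_id)
  note t = tmap_lin_pure[OF A_module T_module H_module s]
  have "eQ (tmap (T (Suc (Suc 0))) H ?s r) = r" if "r \<in> carrier AH" for r
    by (rule tensor_hom_ext[OF A_module H_module _ lin_comp[OF t(1) eQ_lin] lin_id _ that])
       (simp_all add: t(2) eQ_pure mu_tcons)
  then show "carrier RM \<subseteq> eQ ` carrier (Q 0)"
    using lmod_hom_closed[OF t(1)] by (force simp: RM_sel Q_sel)
qed

lemma dQ_eQ: "t \<in> carrier (Q (Suc 0)) \<Longrightarrow> eQ (dQ 0 t) = \<zero>\<^bsub>RM\<^esub>"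
proof -
  assume "t \<in> carrier (Q (Suc 0))"
  then have t: "t \<in> carrier (tensor K (T (Suc (Suc (Suc 0)))) H)" by (simp add: Q_sel)
  have z: "tensor_elt K A H \<zero>\<^bsub>A\<^esub> h = \<zero>\<^bsub>AH\<^esub>" if "h \<in> carrier H" for h
    by (rule lmod_hom_zero[OF lmodule lmodule bilinD(2)[OF tensor_elt_bilin that]]) auto
  show ?thesis unfolding RM_sel
    by (rule tensor_hom_ext[OF T_module H_module _ lin_comp[OF dQ_lin eQ_lin] lin_zero _ t])
       (simp_all add: dQ_pure eQ_pure mu_D z)
qed

lemma dQ_dQ: "t \<in> carrier (Q (Suc (Suc n))) \<Longrightarrow> dQ n (dQ (Suc n) t) = \<zero>\<^bsub>Q n\<^esub>"
proof -
  assume "t \<in> carrier (Q (Suc (Suc n)))"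
  then have t: "t \<in> carrier (tensor K (T (Suc (Suc (Suc (Suc n))))) H)" by (simp add: Q_sel)
  have z: "tensor_elt K (T (Suc (Suc n))) H \<zero>\<^bsub>T (Suc (Suc n))\<^esub> h = \<zero>\<^bsub>tensor K (T (Suc (Suc n))) H\<^esub>" if "h \<in> carrier H" for h
    by (rule lmod_hom_zero[OF lmodule lmodule bilinD(2)[OF tensor_elt_bilin that]]) auto
  show ?thesis unfolding Q_sel
    by (rule tensor_hom_ext[OF T_module H_module _ lin_comp[OF dQ_lin dQ_lin] lin_zero _ t])
       (simp_all add: dQ_pure D_D z)
qed

text \<open>A splitting f g + l k = id on W stays a splitting after tensoring with H, as one sees on
  pure tensors. If G t = 0, then t is the image under F of (g \<otimes> id) t.\<close>

lemma smap_contract: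
  assumes m: "module K V" "module K W" "module K Y" and f: "f \<in> lin V W" and g: "g \<in> lin W V"
    and k: "k \<in> lin W Y" and l: "l \<in> lin Y W"
    and F: "F \<in> lin (tensor K V H) (tensor K W H)" "\<And>v h. v \<in> carrier V \<Longrightarrow> h \<in> carrier H \<Longrightarrow> F (tensor_elt K V H v h) = tensor_elt K W H (f v) h"
    and G: "G \<in> lin (tensor K W H) (tensor K Y H)" "\<And>w h. w \<in> carrier W \<Longrightarrow> h \<in> carrier H \<Longrightarrow> G (tensor_elt K W H w h) = tensor_elt K Y H (k w) h"
    and eq: "\<And>w. w \<in> carrier W \<Longrightarrow> f (g w) = w \<ominus>\<^bsub>W\<^esub> l (k w)"
    and t: "t \<in> carrier (tensor K W H)" and 0: "G t = \<zero>\<^bsub>tensor K Y H\<^esub>"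
  shows "t \<in> F ` carrier (tensor K V H)"
proof -
  note tg = tmap_lin_pure[OF m(2,1) H_module g] and tl = tmap_lin_pure[OF m(3,2) H_module l]
  let ?W = "tensor K W H"
  have W: "module K ?W" by (simp add: m)
  interpret W: module K ?W by (rule W)
  note c = lmod_hom_closed[OF g] lmod_hom_closed[OF l] lmod_hom_closed[OF k]
  have "F (tmap V H g t) = t \<ominus>\<^bsub>?W\<^esub> tmap W H l (G t)"
  proof (rule tensor_hom_ext[OF m(2) H_module W _ _ _ t])
    fix w h assume a: "w \<in> carrier W" "h \<in> carrier H"
    note b = bilinD(2)[OF tensor_elt_bilin[OF m(2) H_module] a(2)]
    interpret V: module K W by (rule m)
    have "tensor_elt K W H (w \<ominus>\<^bsub>W\<^esub> l (k w)) h = tensor_elt K W H w h \<ominus>\<^bsub>?W\<^esub> tensor_elt K W H (l (k w)) h"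
      using a c by (simp add: a_minus_def lmod_hom_add[OF b] lmod_hom_a_inv[OF lmodule[OF m(2)] lmodule[OF W] b])
    then show "F (tmap V H g (tensor_elt K W H w h)) = tensor_elt K W H w h \<ominus>\<^bsub>?W\<^esub> tmap W H l (G (tensor_elt K W H w h))"
      using a c by (simp add: tg(2) tl(2) F(2) G(2) eq)
  qed (auto intro!: lin_comp[OF tg(1) F(1)] lin_minus[OF W] lin_comp[OF _ tl(1)] G(1) lin_id)
  also have "tmap W H l (G t) = \<zero>\<^bsub>?W\<^esub>"
    unfolding 0 by (rule lmod_hom_zero[OF lmodule lmodule tl(1)]) (auto simp: m)
  finally have "F (tmap V H g t) = t" using t W.M.minus_equality[of "\<zero>\<^bsub>?W\<^esub>" "\<zero>\<^bsub>?W\<^esub>"] by (simp add: a_minus_def)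
  then show ?thesis using lmod_hom_closed[OF tg(1) t] by (metis image_eqI)
qed

text \<open>At the end of the complex the contraction is completed by a \<mapsto> 1 \<otimes> a for
  \<open>l\<close>: since D 0 v is \<open>mu v\<close> in the one-factor power, 1 \<otimes> D 0 v
  equals \<open>l\<close> applied to \<open>mu v\<close>.\<close>

lemma eQ_exact:
  assumes "t \<in> carrier (Q 0)" "eQ t = \<zero>\<^bsub>RM\<^esub>" shows "t \<in> dQ 0 ` carrier (Q (Suc 0))"
  unfolding Q_sel
  by (rule smap_contract[OF T_module T_module A_module D_lin bilinD(1)[OF tcons_bilin aone_closed] mu_lin _ dQ_lin dQ_pure eQ_lin eQ_pure,
        where l = "\<lambda>a. tcons (Suc 0) \<one>\<^bsub>A\<^esub> (sg a)"])
     (use assms in \<open>auto intro!: T_lin sg_lin lin_id simp: D_contract D_0 Q_sel RM_sel\<close>)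

lemma dQ_exact:
  assumes "t \<in> carrier (Q (Suc n))" "dQ n t = \<zero>\<^bsub>Q n\<^esub>" shows "t \<in> dQ (Suc n) ` carrier (Q (Suc (Suc n)))"
  unfolding Q_sel
  by (rule smap_contract[OF T_module T_module T_module D_lin bilinD(1)[OF tcons_bilin aone_closed] D_lin
        bilinD(1)[OF tcons_bilin aone_closed] dQ_lin dQ_pure dQ_lin dQ_pure])
     (use assms in \<open>auto simp: D_contract Q_sel\<close>)

subsection \<open>Lifting\<close>

text \<open>The Casimir property of an integral, evaluated under a bilinear map. On the right-hand
  side h is written as \<epsilon>(h1) h2 and \<epsilon>(h1) t as h1 t; then S(h2 t2) h3 = S(t2)
  S(h2) h3, in which the last two factors cancel.\<close>

lemma integral_shift:
  assumes U: "module K U" and b: "bilin K H H U \<beta>"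
    and t: "t \<in> carrier H" "\<And>h. h \<in> carrier H \<Longrightarrow> h \<star> t = counit H h \<odot>\<^bsub>H\<^esub> t" and h: "h \<in> carrier H"
  shows "SW U (\<lambda>t1 t2. \<beta> (h \<star> t1) (antipode H t2)) t = SW U (\<lambda>t1 t2. \<beta> t1 (antipode H t2 \<star> h)) t"
proof -
  let ?S = "antipode H"
  note li = bilin_left[OF b] bilin_right[OF b] and c = bilinD(3)[OF b]
  have bl: "(\<lambda>s. SW U (\<lambda>t1 t2. \<beta> t1 (?S t2 \<star> k)) s) \<in> lin H U" if "k \<in> carrier H" for k
    using that by (auto intro!: li lin_intros simp: U c)
  have "SW U (\<lambda>t1 t2. \<beta> t1 (?S t2 \<star> h)) t
      = SW U (\<lambda>h1 h2. counit H h1 \<odot>\<^bsub>U\<^esub> SW U (\<lambda>t1 t2. \<beta> t1 (?S t2 \<star> h2)) t) h"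
    by (rule SW_counit_left[symmetric]) (auto intro!: li lin_intros simp: U c t h)
  also have "\<dots> = SW U (\<lambda>h1 h2. SW U (\<lambda>t1 t2. \<beta> t1 (?S t2 \<star> h2)) (h1 \<star> t)) h"
    by (rule SW_eqI[OF h]) (simp add: t lmod_hom_smult[OF bl])
  also have "\<dots> = SW U (\<lambda>h1 h2. SW U (\<lambda>p q. SW U (\<lambda>t1 t2. \<beta> (p \<star> t1) (?S (q \<star> t2) \<star> h2)) t) h1) h"
    by (rule SW_eqI[OF h], rule SW_mult) (auto intro!: li lin_intros simp: U c t)
  also have "\<dots> = SW U (\<lambda>h1 h2. SW U (\<lambda>p q. SW U (\<lambda>t1 t2. \<beta> (p \<star> t1) (?S t2 \<star> (?S q \<star> h2))) t) h1) h"
    by (intro SW_eqI h t(1); simp add: antipode_mult hmult_assoc)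
  also have "\<dots> = SW U (\<lambda>p y. SW U (\<lambda>q h2. SW U (\<lambda>t1 t2. \<beta> (p \<star> t1) (?S t2 \<star> (?S q \<star> h2))) t) y) h"
    by (rule SW_coassoc) (auto intro!: li lin_intros simp: U c t h)
  also have "\<dots> = SW U (\<lambda>p y. counit H y \<odot>\<^bsub>U\<^esub> SW U (\<lambda>t1 t2. \<beta> (p \<star> t1) (?S t2 \<star> \<one>\<^bsub>H\<^esub>)) t) h"
    by (rule SW_eqI[OF h], rule SW_antipode_left) (auto intro!: li lin_intros simp: U c t)
  also have "\<dots> = SW U (\<lambda>t1 t2. \<beta> (h \<star> t1) (?S t2 \<star> \<one>\<^bsub>H\<^esub>)) t"
    by (rule SW_counit_right) (auto intro!: li lin_intros simp: U c t h)
  finally show ?thesis using t(1) by simp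
qed

text \<open>Averaging of the linear lift \<open>g0\<close>. \<open>integral_shift\<close> makes the
  average commute with H, and H-linearity of p and f turns its image under p into t1 S(t2) f(v) =
  \<epsilon>(t) f(v).\<close>

lemma H_linear_lift:
  assumes ss: "semisimple_algebra H" and V: "hmod K H V aV" and X: "hmod K H X aX" and Y: "hmod K H Y aY"
    and p: "p \<in> lin X Y" "\<And>h x. h \<in> carrier H \<Longrightarrow> x \<in> carrier X \<Longrightarrow> p (aX h x) = aY h (p x)"
    and f: "f \<in> lin V Y" "\<And>h v. h \<in> carrier H \<Longrightarrow> v \<in> carrier V \<Longrightarrow> f (aV h v) = aY h (f v)"
    and im: "\<And>v. v \<in> carrier V \<Longrightarrow> f v \<in> p ` carrier X"
  shows "\<exists>g \<in> lin V X. (\<forall>h\<in>carrier H. \<forall>v\<in>carrier V. g (aV h v) = aX h (g v)) \<and> (\<forall>v\<in>carrier V. p (g v) = f v)"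
proof -
  note V' = hmodD[OF V] and X' = hmodD[OF X] and Y' = hmodD[OF Y]
  obtain t where t: "t \<in> carrier H" "counit H t = \<one>\<^bsub>K\<^esub>" "\<And>h. h \<in> carrier H \<Longrightarrow> h \<star> t = counit H h \<odot>\<^bsub>H\<^esub> t"
    using integral_exists[OF ss] by blast
  obtain g0 where g0: "g0 \<in> lin V X" "\<And>v. v \<in> carrier V \<Longrightarrow> p (g0 v) = f v"
    using lin_lift[OF field V'(1) X'(1) Y'(1) p(1) f(1) im] by blast
  define g where "g v = SW X (\<lambda>t1 t2. aX t1 (g0 (aV (antipode H t2) v))) t" for v
  note c = lmod_hom_closed[OF g0(1)] V'(5) X'(5) Y'(5) lmod_hom_closed[OF f(1)] lmod_hom_closed[OF p(1)]
  note li = bilin_left[OF V'(2)] bilin_right[OF V'(2)] bilin_left[OF X'(2)] bilin_right[OF X'(2)]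
    bilin_left[OF Y'(2)] bilin_right[OF Y'(2)] lin_comp[OF _ g0(1)]
  have "g \<in> lin V X" unfolding g_def[abs_def]
    by (auto intro!: li lin_intros simp: V' X' t c)
  moreover have "g (aV h v) = aX h (g v)" if h: "h \<in> carrier H" and v: "v \<in> carrier V" for h v
  proof -
    have b: "bilin K H H X (\<lambda>x y. aX x (g0 (aV y v)))"
      by (auto intro!: li lin_intros simp: V' X' v c)
    have "aX h (g v) = SW X (\<lambda>t1 t2. aX h (aX t1 (g0 (aV (antipode H t2) v)))) t"
      unfolding g_def by (rule SW_comp) (auto intro!: li lin_intros simp: V' X' t c h v)
    also have "\<dots> = SW X (\<lambda>t1 t2. aX (h \<star> t1) (g0 (aV (antipode H t2) v))) t"
      by (rule SW_eqI[OF t(1)]) (simp add: X' c v h)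
    also have "\<dots> = SW X (\<lambda>t1 t2. aX t1 (g0 (aV (antipode H t2 \<star> h) v))) t"
      by (rule integral_shift[OF X'(1) b t(1,3) h])
    also have "\<dots> = g (aV h v)"
      unfolding g_def by (rule SW_eqI[OF t(1)]) (simp add: V' c v h)
    finally show ?thesis by simp
  qed
  moreover have "p (g v) = f v" if v: "v \<in> carrier V" for v
  proof -
    have "p (g v) = SW Y (\<lambda>t1 t2. p (aX t1 (g0 (aV (antipode H t2) v)))) t"
      unfolding g_def by (rule SW_comp[OF X'(1) Y'(1) p(1)]) (auto simp: t c v)
    also have "\<dots> = SW Y (\<lambda>t1 t2. aY (t1 \<star> antipode H t2) (f v)) t"
      by (rule SW_eqI[OF t(1)]) (simp add: p g0 f c v Y')
    also have "\<dots> = counit H t \<odot>\<^bsub>Y\<^esub> aY \<one>\<^bsub>H\<^esub> (f v)"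
      by (rule SW_antipode_right) (auto intro!: li lin_intros simp: Y' t c v)
    also have "\<dots> = f v" using v by (simp add: t c Y' module.smult_one[OF Y'(1)])
    finally show ?thesis .
  qed
  ultimately show ?thesis by blast
qed

text \<open>The power with n + 2 factors as A \<otimes> T n \<otimes> A: a trilinear map becomes
  multilinear on tuples by taking the first entry, the tensor of the middle entries and the last
  entry.\<close>

lemma T_univ:
  assumes U: "module K U"
    and 1: "\<And>v y. v \<in> carrier (T n) \<Longrightarrow> y \<in> carrier A \<Longrightarrow> (\<lambda>x. \<psi> x v y) \<in> lin A U"
    and 2: "\<And>x y. x \<in> carrier A \<Longrightarrow> y \<in> carrier A \<Longrightarrow> (\<lambda>v. \<psi> x v y) \<in> lin (T n) U"
    and 3: "\<And>x v. x \<in> carrier A \<Longrightarrow> v \<in> carrier (T n) \<Longrightarrow> (\<lambda>y. \<psi> x v y) \<in> lin A U"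
  shows "\<exists>g \<in> lin (T (Suc (Suc n))) U. \<forall>x\<in>carrier A. \<forall>v\<in>carrier (T n). \<forall>y\<in>carrier A.
     g (tcons (Suc n) x (tsnoc n v y)) = \<psi> x v y"
proof -
  let ?\<phi> = "\<lambda>xs. \<psi> (hd xs) (el (butlast (tl xs))) (last (tl xs))"
  have m: "multilin K A (Suc (Suc n)) U ?\<phi>"
  proof (rule multilin_ConsI)
    fix x assume x: "x \<in> carrier A"
    show "multilin K A (Suc n) U (\<lambda>xs. ?\<phi> (x # xs))"
    proof (rule multilin_snocI)
      show "multilin K A n U (\<lambda>xs. ?\<phi> (x # xs @ [y]))" if "y \<in> carrier A" for y
        using multilin_comp[OF el_multilin 2[OF x that]] by simp
      show "(\<lambda>y. ?\<phi> (x # xs @ [y])) \<in> lin A U" if "xs \<in> tuples A n" for xs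
        using 3[OF x el_closed[OF that]] by simp
    qed
  next
    fix xs assume "xs \<in> tuples A (Suc n)"
    then show "(\<lambda>x. ?\<phi> (x # xs)) \<in> lin A U"
      by (rule tuples_snocE) (use 1 in simp)
  qed
  let ?g = "tensor_lift K U ?\<phi>"
  have g: "?g \<in> lin (T (Suc (Suc n))) U" by (rule tpower_lift_lin[OF A_module U m])
  have "?g (tcons (Suc n) x (tsnoc n v y)) = \<psi> x v y"
    if a: "x \<in> carrier A" "v \<in> carrier (T n)" "y \<in> carrier A" for x v y
  proof (rule T_ext[OF U _ 2[OF a(1,3)] _ a(2)])
    fix vs assume vs: "vs \<in> tuples A n"
    have "?g (el (x # vs @ [y])) = ?\<phi> (x # vs @ [y])"
      by (rule tpower_lift_pure[OF A_module U m]) (use a vs in auto)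
    then show "?g (tcons (Suc n) x (tsnoc n (el vs) y)) = \<psi> x (el vs) y" using a vs by (simp add: tcons_el tsnoc_el)
  qed (use a in \<open>auto intro!: lin_comp[OF _ g] T_lin lin_intros\<close>)
  then show ?thesis using g by blast
qed

text \<open>Restricting f to the elements 1 \<otimes> v \<otimes> 1 gives a lifting problem for
  H-linear maps on T n. Its solution \<open>G\<close> extends by x \<otimes> v \<otimes> y \<mapsto>
  x G(v) y.\<close>

lemma T_lift:
  fixes n :: nat
  defines "N \<equiv> T (Suc (Suc n))" and "la \<equiv> Tl (Suc (Suc n))" and "ra \<equiv> Tr (Suc (Suc n))" and "ha \<equiv> Th (Suc (Suc n))"
  assumes ss: "semisimple_algebra H" and X: "ebim X lX rX hX" and Y: "ebim Y lY rY hY"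
    and p: "ehom X lX rX hX Y lY rY hY p" and f: "ehom N la ra ha Y lY rY hY f"
    and im: "\<And>v. v \<in> carrier N \<Longrightarrow> f v \<in> p ` carrier X"
  shows "\<exists>g. ehom N la ra ha X lX rX hX g \<and> (\<forall>v\<in>carrier N. p (g v) = f v)"
proof -
  note defs = N_def la_def ra_def ha_def
  note X' = ebimD[OF X] and Y' = ebimD[OF Y] and p' = ehomD[OF p] and f' = ehomD[OF f, unfolded defs]
  let ?w = "\<lambda>v. tcons (Suc n) \<one>\<^bsub>A\<^esub> (tsnoc n v \<one>\<^bsub>A\<^esub>)"
  have w: "?w \<in> lin (T n) (T (Suc (Suc n)))" by (auto intro!: T_lin lin_intros)
  \<comment> \<open>The inclusion of the generators is H-linear because H acts on both outer units
    by \<epsilon>, which the counit laws absorb.\<close>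
  have wh: "?w (Th n h v) = Th (Suc (Suc n)) h (?w v)" if h: "h \<in> carrier H" and v: "v \<in> carrier (T n)" for h v
  proof -
    have "Th (Suc (Suc n)) h (?w v) = SW (T (Suc (Suc n))) (\<lambda>h1 h2. counit H h1 \<odot>\<^bsub>T (Suc (Suc n))\<^esub>
        tcons (Suc n) \<one>\<^bsub>A\<^esub> (Th (Suc n) h2 (tsnoc n v \<one>\<^bsub>A\<^esub>))) h"
      using h v by (simp add: Th_tcons MA.act_one lmod_hom_smult[OF bilinD(2)[OF tcons_bilin]])
    also have "\<dots> = tcons (Suc n) \<one>\<^bsub>A\<^esub> (Th (Suc n) h (tsnoc n v \<one>\<^bsub>A\<^esub>))"
      by (rule SW_counit_left) (use h v in \<open>auto intro!: TT_lin lin_intros\<close>)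
    also have "Th (Suc n) h (tsnoc n v \<one>\<^bsub>A\<^esub>) = SW (T (Suc n)) (\<lambda>h1 h2. counit H h2 \<odot>\<^bsub>T (Suc n)\<^esub> tsnoc n (Th n h1 v) \<one>\<^bsub>A\<^esub>) h"
      using h v by (simp add: Th_tsnoc MA.act_one lmod_hom_smult[OF bilinD(1)[OF tsnoc_bilin]])
    also have "\<dots> = tsnoc n (Th n h v) \<one>\<^bsub>A\<^esub>"
      by (rule SW_counit_right) (use h v in \<open>auto intro!: TT_lin lin_intros\<close>)
    finally show ?thesis by simp
  qed
  have "\<exists>g \<in> lin (T n) X. (\<forall>h\<in>carrier H. \<forall>v\<in>carrier (T n). g (Th n h v) = hX h (g v)) \<and> (\<forall>v\<in>carrier (T n). p (g v) = f (?w v))"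
  proof -
    have 1: "f (?w (Th n h v)) = hY h (f (?w v))" if "h \<in> carrier H" "v \<in> carrier (T n)" for h v
      unfolding wh[OF that] using that by (intro f'(4)) auto
    have 2: "f (?w v) \<in> p ` carrier X" if "v \<in> carrier (T n)" for v
      using im[unfolded defs] that by simp
    show ?thesis
      by (rule H_linear_lift[where f = "\<lambda>v. f (?w v)", OF ss Th_hmod X'(1) Y'(1) p'(1) p'(4) lin_comp[OF w f'(1)] 1 2])
  qed
  then obtain G where G: "G \<in> lin (T n) X" "\<And>h v. h \<in> carrier H \<Longrightarrow> v \<in> carrier (T n) \<Longrightarrow> G (Th n h v) = hX h (G v)"
    "\<And>v. v \<in> carrier (T n) \<Longrightarrow> p (G v) = f (?w v)" by blast
  have Gc: "G v \<in> carrier X" if "v \<in> carrier (T n)" for v using lmod_hom_closed[OF G(1) that] .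
  note li = bilin_left[OF X'(5)] bilin_right[OF X'(5)] bilin_left[OF X'(6)] bilin_right[OF X'(6)]
    bilin_left[OF X'(7)] bilin_right[OF X'(7)] lin_comp[OF _ G(1)]
  have "\<exists>g \<in> lin (T (Suc (Suc n))) X. \<forall>x\<in>carrier A. \<forall>v\<in>carrier (T n). \<forall>y\<in>carrier A.
     g (tcons (Suc n) x (tsnoc n v y)) = lX x (rX (G v) y)"
    by (rule T_univ[OF X'(2)]) (auto intro!: li lin_intros simp: X' Gc)
  then obtain g where g: "g \<in> lin (T (Suc (Suc n))) X"
    and gp: "\<And>x v y. x \<in> carrier A \<Longrightarrow> v \<in> carrier (T n) \<Longrightarrow> y \<in> carrier A \<Longrightarrow>
      g (tcons (Suc n) x (tsnoc n v y)) = lX x (rX (G v) y)" by blast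
  note lg = lin_comp[OF _ g]
  have "g (Tl (Suc (Suc n)) a v) = lX a (g v)" if a: "a \<in> carrier A" and v: "v \<in> carrier (T (Suc (Suc n)))" for a v
    by (rule T_cons_snoc_ext[OF X'(2) _ _ _ v])
       (use a in \<open>auto intro!: li lg g TT_lin lin_intros simp: Tl_tcons gp X' Gc\<close>)
  moreover have "g (Tr (Suc (Suc n)) v a) = rX (g v) a" if a: "a \<in> carrier A" and v: "v \<in> carrier (T (Suc (Suc n)))" for a v
    by (rule T_cons_snoc_ext[OF X'(2) _ _ _ v])
       (use a in \<open>auto intro!: li lg g TT_lin lin_intros simp: Tr_tcons Tr_tsnoc gp X' Gc\<close>)
  \<comment> \<open>The components h1, h2, h3 land on x, G(v) and y, and equivariance of the two
    actions of A on X gathers them again into one action of h.\<close>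
  moreover have "g (Th (Suc (Suc n)) h v) = hX h (g v)" if h: "h \<in> carrier H" and v: "v \<in> carrier (T (Suc (Suc n)))" for h v
  proof (rule T_cons_snoc_ext[OF X'(2) _ _ _ v])
    fix x v y assume a: "x \<in> carrier A" "v \<in> carrier (T n)" "y \<in> carrier A"
    have "g (Th (Suc (Suc n)) h (tcons (Suc n) x (tsnoc n v y)))
        = SW X (\<lambda>h1 h2. g (tcons (Suc n) (act h1 x) (Th (Suc n) h2 (tsnoc n v y)))) h"
      unfolding Th_tcons[OF h a(1) tsnoc_closed[OF a(3,2)]] by (rule SW_comp[OF T_module X'(2) g]) (use a h in auto)
    also have "\<dots> = SW X (\<lambda>h1 h2. SW X (\<lambda>p q. g (tcons (Suc n) (act h1 x) (tsnoc n (Th n p v) (act q y)))) h2) h"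
      by (rule SW_eqI[OF h], subst Th_tsnoc[OF _ a(3,2)], assumption, rule SW_comp)
         (use a in \<open>auto intro!: lg TT_lin lin_intros simp: X'\<close>)
    also have "\<dots> = SW X (\<lambda>h1 h2. SW X (\<lambda>p q. lX (act h1 x) (rX (hX p (G v)) (act q y))) h2) h"
      by (intro SW_eqI h; simp add: a gp G)
    also have "\<dots> = SW X (\<lambda>h1 h2. lX (act h1 x) (hX h2 (rX (G v) y))) h"
      by (rule SW_eqI[OF h], subst equivariantD(2)[OF X'(4) _ Gc[OF a(2)] a(3)], assumption, rule SW_comp[symmetric])
         (use a in \<open>auto intro!: li lin_intros simp: X' Gc\<close>)
    also have "\<dots> = hX h (lX x (rX (G v) y))"
      by (rule equivariantD(2)[OF X'(3) h a(1), symmetric]) (use a in \<open>simp add: X' Gc\<close>)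
    finally show "g (Th (Suc (Suc n)) h (tcons (Suc n) x (tsnoc n v y))) = hX h (g (tcons (Suc n) x (tsnoc n v y)))"
      using a by (simp add: gp)
  qed (use h in \<open>auto intro!: li lg g TT_lin lin_intros\<close>)
  moreover have "p (g v) = f v" if v: "v \<in> carrier (T (Suc (Suc n)))" for v
  proof (rule T_cons_snoc_ext[OF Y'(2) lin_comp[OF g p'(1)] f'(1) _ v])
    fix x v y assume a: "x \<in> carrier A" "v \<in> carrier (T n)" "y \<in> carrier A"
    have "tcons (Suc n) x (tsnoc n v y) = Tl (Suc (Suc n)) x (Tr (Suc (Suc n)) (?w v) y)"
      using a by (simp add: Tl_tcons Tr_tcons Tr_tsnoc)
    then have "f (tcons (Suc n) x (tsnoc n v y)) = lY x (rY (f (?w v)) y)"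
      using a by (simp only: f' Tr_closed tcons_closed tsnoc_closed aone_closed)
    then show "p (g (tcons (Suc n) x (tsnoc n v y))) = f (tcons (Suc n) x (tsnoc n v y))"
      using a by (simp add: gp p' X' Gc G(3) Y' f'(5))
  qed
  ultimately show ?thesis unfolding defs equivariant_hom_def using g by blast
qed

text \<open>The lifting problem is transposed to one for equivariant maps out of the tensor power
  and solved by \<open>T_lift\<close>. The transposed solution is a lift because bimodule maps that
  agree on the elements v \<otimes> 1 are equal.\<close>

lemma Q_lift:
  assumes ss: "semisimple_algebra H" and X: "left_module E X" and Y: "left_module E Y"
    and p: "p \<in> lmod_hom E X Y" and f: "f \<in> lmod_hom E (Q n) Y" and im: "f ` carrier (Q n) \<subseteq> p ` carrier X"
  shows "\<exists>g \<in> lmod_hom E (Q n) X. \<forall>v\<in>carrier (Q n). p (g v) = f v"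
proof -
  let ?N = "T (Suc (Suc n))"
  note N = T_ebim[of n]
  note f' = flat_ehom[OF N Y f[unfolded Q_def]]
  have "\<exists>g. ehom ?N (Tl (Suc (Suc n))) (Tr (Suc (Suc n))) (Th (Suc (Suc n))) (vspace K R X) (xl X) (xr X) (adj X) g \<and>
      (\<forall>v\<in>carrier ?N. p (g v) = f (tensor_elt K ?N H v \<one>\<^bsub>H\<^esub>))"
  proof (rule T_lift[OF ss adj_ebim[OF X] adj_ebim[OF Y] E_hom_ehom[OF X Y p] f'])
    fix v assume "v \<in> carrier ?N"
    then have "tensor_elt K ?N H v \<one>\<^bsub>H\<^esub> \<in> carrier (Q n)" by (simp add: Q_sel)
    then show "f (tensor_elt K ?N H v \<one>\<^bsub>H\<^esub>) \<in> p ` carrier (vspace K R X)" using im by auto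
  qed
  then obtain g where g: "ehom ?N (Tl (Suc (Suc n))) (Tr (Suc (Suc n))) (Th (Suc (Suc n))) (vspace K R X) (xl X) (xr X) (adj X) g"
    and pg: "\<And>v. v \<in> carrier ?N \<Longrightarrow> p (g v) = f (tensor_elt K ?N H v \<one>\<^bsub>H\<^esub>)" by blast
  have h: "sharp X g \<in> lmod_hom E (Q n) X" unfolding Q_def by (rule sharp_hom[OF N X g])
  have "p (sharp X g t) = f t" if "t \<in> carrier (Q n)" for t
    by (rule E_hom_eqI[OF N Y lmod_hom_comp[OF h[unfolded Q_def] p] f[unfolded Q_def]])
       (use that in \<open>auto simp: sharp_unit[OF N X ehomD(1)[OF g]] pg Q_sel\<close>)
  then show ?thesis using h by blast
qed

end

subsection \<open>Comparison of resolutions\<close>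

lemma lmod_hom_sum:
  assumes "left_module R M" "left_module R N" "f \<in> lmod_hom R M N" "g \<in> lmod_hom R M N"
  shows "(\<lambda>x. f x \<oplus>\<^bsub>N\<^esub> g x) \<in> lmod_hom R M N"
proof -
  interpret N: left_module R N by fact
  show ?thesis
    by (rule lmod_homI)
       (use assms(3,4) in \<open>simp_all add: lmod_hom_closed lmod_hom_add lmod_hom_smult N.lsmult_r_distr N.M.a_ac\<close>)
qed

lemma lmod_hom_diff:
  assumes "left_module R M" "left_module R N" "f \<in> lmod_hom R M N" "g \<in> lmod_hom R M N"
  shows "(\<lambda>x. f x \<ominus>\<^bsub>N\<^esub> g x) \<in> lmod_hom R M N"
proof -
  interpret N: left_module R N by fact
  have "(\<lambda>x. \<ominus>\<^bsub>N\<^esub> g x) \<in> lmod_hom R M N"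
    by (rule lmod_homI)
       (use assms(4) in \<open>simp_all add: lmod_hom_closed lmod_hom_add lmod_hom_smult N.lsmult_r_minus N.M.minus_add\<close>)
  then show ?thesis unfolding a_minus_def by (rule lmod_hom_sum[OF assms(1-3)])
qed

lemma lmod_hom_null:
  assumes "left_module R N" shows "(\<lambda>x. \<zero>\<^bsub>N\<^esub>) \<in> lmod_hom R M N"
proof -
  interpret N: left_module R N by fact
  show ?thesis by (rule lmod_homI) (simp_all add: N.lsmult_r_null)
qed

text \<open>Projectivity relative to one map p. Only f with image in the image of p are considered,
  so that p may be a differential. The map p is an argument because a predicate cannot range over
  modules on all types.\<close>

definition lifts_through where
  "lifts_through R C X Y p \<longleftrightarrow> (\<forall>f \<in> lmod_hom R C Y. f ` carrier C \<subseteq> p ` carrier X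
     \<longrightarrow> (\<exists>g \<in> lmod_hom R C X. \<forall>x\<in>carrier C. p (g x) = f x))"

text \<open>Preimages under p are chosen for the images of the basis vectors and extended to the
  free module; the inclusion \<open>i\<close> restricts the result to its summand P.\<close>

lemma projective_lifts_through:
  assumes P: "projective_module R P" and X: "left_module R X" and Y: "left_module R Y" and p: "p \<in> lmod_hom R X Y"
  shows "lifts_through R P X Y p"
  unfolding lifts_through_def
proof (intro ballI impI)
  fix f assume f: "f \<in> lmod_hom R P Y" and im: "f ` carrier P \<subseteq> p ` carrier X"
  interpret P: left_module R P using P by (simp add: projective_module_def)
  let ?F = "free_module R (carrier P)"
  obtain i q where i: "i \<in> lmod_hom R P ?F" and q: "q \<in> lmod_hom R ?F P" and qi: "\<And>x. x \<in> carrier P \<Longrightarrow> q (i x) = x"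
    using P unfolding projective_module_def by blast
  define \<phi> where "\<phi> b = (SOME x. x \<in> carrier X \<and> p x = f (q (free_basis R b)))" for b
  have \<phi>: "\<phi> b \<in> carrier X \<and> p (\<phi> b) = f (q (free_basis R b))" if b: "b \<in> carrier P" for b
  proof -
    have "q (free_basis R b) \<in> carrier P"
      using lmod_hom_closed[OF q free_basis_closed[OF P.R.ring_axioms b]] .
    then have "\<exists>x. x \<in> carrier X \<and> p x = f (q (free_basis R b))" using im by force
    then show ?thesis unfolding \<phi>_def by (rule someI_ex)
  qed
  have c: "\<phi> \<in> carrier P \<rightarrow> carrier X" using \<phi> by auto
  note g = free_ext_hom[OF X c]
  have "p (free_ext R X \<phi> u) = f (q u)" if "u \<in> carrier ?F" for u
    by (rule free_module_hom_ext[OF Y lmod_hom_comp[OF g p] lmod_hom_comp[OF q f] _ that])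
       (simp add: free_ext_basis[OF X c] \<phi>)
  then have "\<forall>x\<in>carrier P. p (free_ext R X \<phi> (i x)) = f x" using lmod_hom_closed[OF i] qi by simp
  then show "\<exists>g \<in> lmod_hom R P X. \<forall>x\<in>carrier P. p (g x) = f x"
    by (intro bexI[OF _ lmod_hom_comp[OF i g]])
qed

lemma lifts_throughE:
  assumes "lifts_through R C X Y p" "f \<in> lmod_hom R C Y" "\<And>x. x \<in> carrier C \<Longrightarrow> f x \<in> p ` carrier X"
  obtains g where "g \<in> lmod_hom R C X" "\<And>x. x \<in> carrier C \<Longrightarrow> p (g x) = f x"
  using assms unfolding lifts_through_def by blast

definition left_complex where
  "left_complex R C c \<longleftrightarrow> (\<forall>n. left_module R (C n)) \<and> (\<forall>n. c n \<in> lmod_hom R (C (Suc n)) (C n)) \<and>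
     (\<forall>n. \<forall>x \<in> carrier (C (Suc (Suc n))). c n (c (Suc n) x) = \<zero>\<^bsub>C n\<^esub>)"

definition augmented where
  "augmented R C c N e \<longleftrightarrow> left_module R N \<and> left_complex R C c \<and> e \<in> lmod_hom R (C 0) N \<and> (\<forall>x \<in> carrier (C (Suc 0)). e (c 0 x) = \<zero>\<^bsub>N\<^esub>)"

definition acyclic where
  "acyclic R C c N e \<longleftrightarrow> augmented R C c N e \<and> e ` carrier (C 0) = carrier N \<and>
     (\<forall>x \<in> carrier (C 0). e x = \<zero>\<^bsub>N\<^esub> \<longrightarrow> x \<in> c 0 ` carrier (C (Suc 0))) \<and>
     (\<forall>n. \<forall>x \<in> carrier (C (Suc n)). c n x = \<zero>\<^bsub>C n\<^esub> \<longrightarrow> x \<in> c (Suc n) ` carrier (C (Suc (Suc n))))"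

text \<open>Construction degree by degree: the map obtained in degree n, composed with the
  differential of C, takes values in cycles of D, and acyclicity of D turns these into boundaries
  through which the next map can be lifted.\<close>

lemma comparison_map:
  assumes C: "augmented R C c N e" and D: "acyclic R D d N \<eta>"
    and lift0: "\<And>n. lifts_through R (C n) (D 0) N \<eta>"
    and lift: "\<And>m n. lifts_through R (C m) (D (Suc n)) (D n) (d n)"
  shows "\<exists>\<phi>. (\<forall>n. \<phi> n \<in> lmod_hom R (C n) (D n)) \<and> (\<forall>x\<in>carrier (C 0). \<eta> (\<phi> 0 x) = e x) \<and>
     (\<forall>n. \<forall>x\<in>carrier (C (Suc n)). d n (\<phi> (Suc n) x) = \<phi> n (c n x))"
proof -
  note C' = C[unfolded augmented_def left_complex_def] and D' = D[unfolded acyclic_def augmented_def left_complex_def]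
  have mC: "left_module R (C n)" and mD: "left_module R (D n)" and c: "c n \<in> lmod_hom R (C (Suc n)) (C n)"
    and d: "d n \<in> lmod_hom R (D (Suc n)) (D n)" for n using C' D' by auto
  have N: "left_module R N" and e: "e \<in> lmod_hom R (C 0) N" and \<eta>: "\<eta> \<in> lmod_hom R (D 0) N" using C' D' by auto
  have ec: "e (c 0 x) = \<zero>\<^bsub>N\<^esub>" if "x \<in> carrier (C (Suc 0))" for x using C' that by auto
  have cc: "c n (c (Suc n) x) = \<zero>\<^bsub>C n\<^esub>" if "x \<in> carrier (C (Suc (Suc n)))" for n x using C' that by auto
  have ex0: "x \<in> d 0 ` carrier (D (Suc 0))" if "x \<in> carrier (D 0)" "\<eta> x = \<zero>\<^bsub>N\<^esub>" for x using D' that by auto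
  have ex: "x \<in> d (Suc n) ` carrier (D (Suc (Suc n)))" if "x \<in> carrier (D (Suc n))" "d n x = \<zero>\<^bsub>D n\<^esub>" for n x using D' that by auto
  \<comment> \<open>The last conjunct says that the next lifting problem is solvable. It has to be
    handed on by stage n, since the map of degree n - 1 is out of reach at the next stage.\<close>
  define I where "I n f \<longleftrightarrow> f \<in> lmod_hom R (C n) (D n) \<and> (n = 0 \<longrightarrow> (\<forall>x\<in>carrier (C 0). \<eta> (f x) = e x)) \<and>
     (\<forall>x\<in>carrier (C (Suc n)). f (c n x) \<in> d n ` carrier (D (Suc n)))" for n f
  have "\<exists>\<phi>. \<forall>n. I n (\<phi> n) \<and> (\<forall>x\<in>carrier (C (Suc n)). d n (\<phi> (Suc n) x) = \<phi> n (c n x))"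
  proof (rule dependent_nat_choice)
    have "e x \<in> \<eta> ` carrier (D 0)" if "x \<in> carrier (C 0)" for x using D' lmod_hom_closed[OF e that] by auto
    then obtain f where f: "f \<in> lmod_hom R (C 0) (D 0)" "\<And>x. x \<in> carrier (C 0) \<Longrightarrow> \<eta> (f x) = e x"
      using lifts_throughE[OF lift0 e] by metis
    have "f (c 0 x) \<in> d 0 ` carrier (D (Suc 0))" if "x \<in> carrier (C (Suc 0))" for x
      using lmod_hom_closed[OF c that] by (intro ex0 lmod_hom_closed[OF f(1)]) (simp_all add: f(2) ec that)
    then show "\<exists>x. I 0 x" unfolding I_def by (intro exI[of _ f]) (simp add: f)
  next
    fix f n assume I: "I n f"
    then have f: "f \<in> lmod_hom R (C n) (D n)" and im: "\<And>x. x \<in> carrier (C (Suc n)) \<Longrightarrow> f (c n x) \<in> d n ` carrier (D (Suc n))"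
      unfolding I_def by auto
    obtain g where g: "g \<in> lmod_hom R (C (Suc n)) (D (Suc n))" "\<And>x. x \<in> carrier (C (Suc n)) \<Longrightarrow> d n (g x) = f (c n x)"
      using lifts_throughE[OF lift lmod_hom_comp[OF c f] im] by metis
    have "g (c (Suc n) x) \<in> d (Suc n) ` carrier (D (Suc (Suc n)))" if x: "x \<in> carrier (C (Suc (Suc n)))" for x
      using lmod_hom_closed[OF c x]
      by (intro ex lmod_hom_closed[OF g(1)]) (simp_all add: g(2) cc x lmod_hom_zero[OF mC mD f])
    then show "\<exists>y. I (Suc n) y \<and> (\<forall>x\<in>carrier (C (Suc n)). d n (y x) = f (c n x))"
      unfolding I_def by (intro exI[of _ g]) (simp add: g)
  qed
  then obtain \<phi> where "\<forall>n. I n (\<phi> n) \<and> (\<forall>x\<in>carrier (C (Suc n)). d n (\<phi> (Suc n) x) = \<phi> n (c n x))" by blast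
  then show ?thesis unfolding I_def by (intro exI[of _ \<phi>]) blast
qed

text \<open>The difference of two chain maps over the same augmentation is null-homotopic. The
  result reads f = (d h + h c) + g, without subtraction, which is convenient for g = id.\<close>

lemma comparison_homotopy:
  assumes C: "augmented R C c N e" and D: "acyclic R D d N \<eta>"
    and lift: "\<And>m n. lifts_through R (C m) (D (Suc n)) (D n) (d n)"
    and f: "\<And>n. f n \<in> lmod_hom R (C n) (D n)" "\<And>x. x \<in> carrier (C 0) \<Longrightarrow> \<eta> (f 0 x) = e x"
      "\<And>n x. x \<in> carrier (C (Suc n)) \<Longrightarrow> d n (f (Suc n) x) = f n (c n x)"
    and g: "\<And>n. g n \<in> lmod_hom R (C n) (D n)" "\<And>x. x \<in> carrier (C 0) \<Longrightarrow> \<eta> (g 0 x) = e x"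
      "\<And>n x. x \<in> carrier (C (Suc n)) \<Longrightarrow> d n (g (Suc n) x) = g n (c n x)"
  shows "\<exists>h. (\<forall>n. h n \<in> lmod_hom R (C n) (D (Suc n))) \<and>
     (\<forall>x\<in>carrier (C 0). f 0 x = d 0 (h 0 x) \<oplus>\<^bsub>D 0\<^esub> g 0 x) \<and>
     (\<forall>n. \<forall>x\<in>carrier (C (Suc n)). f (Suc n) x =
        (d (Suc n) (h (Suc n) x) \<oplus>\<^bsub>D (Suc n)\<^esub> h n (c n x)) \<oplus>\<^bsub>D (Suc n)\<^esub> g (Suc n) x)"
proof -
  note C' = C[unfolded augmented_def left_complex_def] and D' = D[unfolded acyclic_def augmented_def left_complex_def]
  have mC: "left_module R (C n)" and mD: "left_module R (D n)" and c: "c n \<in> lmod_hom R (C (Suc n)) (C n)"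
    and d: "d n \<in> lmod_hom R (D (Suc n)) (D n)" for n using C' D' by auto
  have N: "left_module R N" and e: "e \<in> lmod_hom R (C 0) N" and \<eta>: "\<eta> \<in> lmod_hom R (D 0) N" using C' D' by auto
  have cc: "c n (c (Suc n) x) = \<zero>\<^bsub>C n\<^esub>" if "x \<in> carrier (C (Suc (Suc n)))" for n x using C' that by auto
  have ex0: "x \<in> d 0 ` carrier (D (Suc 0))" if "x \<in> carrier (D 0)" "\<eta> x = \<zero>\<^bsub>N\<^esub>" for x using D' that by auto
  have ex: "x \<in> d (Suc n) ` carrier (D (Suc (Suc n)))" if "x \<in> carrier (D (Suc n))" "d n x = \<zero>\<^bsub>D n\<^esub>" for n x using D' that by auto
  interpret DD: left_module R "D n" for n by (rule mD)
  interpret NN: left_module R N by (rule N)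
  define u where "u n x = f n x \<ominus>\<^bsub>D n\<^esub> g n x" for n x
  have u: "u n \<in> lmod_hom R (C n) (D n)" for n unfolding u_def[abs_def] by (rule lmod_hom_diff[OF mC mD f(1) g(1)])
  have uc: "u n x \<in> carrier (D n)" if "x \<in> carrier (C n)" for n x using lmod_hom_closed[OF u that] .
  have fc: "f n x \<in> carrier (D n)" "g n x \<in> carrier (D n)" if "x \<in> carrier (C n)" for n x
    using lmod_hom_closed[OF f(1) that] lmod_hom_closed[OF g(1) that] by auto
  have u0: "\<eta> (u 0 x) = \<zero>\<^bsub>N\<^esub>" if "x \<in> carrier (C 0)" for x
    using fc[OF that] that lmod_hom_closed[OF e that]
    by (simp add: u_def a_minus_def lmod_hom_add[OF \<eta>] lmod_hom_a_inv[OF mD N \<eta>] f(2) g(2) NN.M.r_neg)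
  have du: "d n (u (Suc n) x) = u n (c n x)" if "x \<in> carrier (C (Suc n))" for n x
    using fc[OF that] that by (simp add: u_def a_minus_def lmod_hom_add[OF d] lmod_hom_a_inv[OF mD mD d] f(3) g(3))
  have fu: "f n x = y \<oplus>\<^bsub>D n\<^esub> g n x" if "u n x = y" "x \<in> carrier (C n)" for n x y
    using that fc[OF that(2)] by (auto simp: u_def a_minus_def DD.M.a_assoc DD.M.l_neg)
  \<comment> \<open>The last conjunct makes u - h c a cycle in the next degree, so that acyclicity
    of D provides the next component of the homotopy.\<close>
  define I where "I n h \<longleftrightarrow> h \<in> lmod_hom R (C n) (D (Suc n)) \<and> (n = 0 \<longrightarrow> (\<forall>x\<in>carrier (C 0). d 0 (h x) = u 0 x)) \<and>
     (\<forall>x\<in>carrier (C (Suc n)). d n (h (c n x)) = u n (c n x))" for n h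
  have "\<exists>h. \<forall>n. I n (h n) \<and> (\<forall>x\<in>carrier (C (Suc n)). d (Suc n) (h (Suc n) x) = u (Suc n) x \<ominus>\<^bsub>D (Suc n)\<^esub> h n (c n x))"
  proof (rule dependent_nat_choice)
    obtain h where h: "h \<in> lmod_hom R (C 0) (D (Suc 0))" "\<And>x. x \<in> carrier (C 0) \<Longrightarrow> d 0 (h x) = u 0 x"
      using lifts_throughE[OF lift u ex0[OF uc u0]] by metis
    then show "\<exists>x. I 0 x" unfolding I_def by (intro exI[of _ h]) (simp add: lmod_hom_closed[OF c])
  next
    fix h n assume I: "I n h"
    then have h: "h \<in> lmod_hom R (C n) (D (Suc n))" and dh: "\<And>x. x \<in> carrier (C (Suc n)) \<Longrightarrow> d n (h (c n x)) = u n (c n x)"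
      unfolding I_def by auto
    let ?v = "\<lambda>x. u (Suc n) x \<ominus>\<^bsub>D (Suc n)\<^esub> h (c n x)"
    have v: "?v \<in> lmod_hom R (C (Suc n)) (D (Suc n))"
      by (rule lmod_hom_diff[OF mC mD u lmod_hom_comp[OF c h]])
    have "d n (?v x) = \<zero>\<^bsub>D n\<^esub>" if x: "x \<in> carrier (C (Suc n))" for x
      using uc[OF x] x lmod_hom_closed[OF h lmod_hom_closed[OF c x]] uc[OF lmod_hom_closed[OF c x]]
      by (simp add: a_minus_def lmod_hom_add[OF d] lmod_hom_a_inv[OF mD mD d] du dh DD.M.r_neg)
    note dv = this
    obtain k where k: "k \<in> lmod_hom R (C (Suc n)) (D (Suc (Suc n)))" "\<And>x. x \<in> carrier (C (Suc n)) \<Longrightarrow> d (Suc n) (k x) = ?v x"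
      using lifts_throughE[OF lift v ex[OF lmod_hom_closed[OF v] dv]] by metis
    have "d (Suc n) (k (c (Suc n) x)) = u (Suc n) (c (Suc n) x)" if x: "x \<in> carrier (C (Suc (Suc n)))" for x
    proof -
      have y: "c (Suc n) x \<in> carrier (C (Suc n))" using lmod_hom_closed[OF c x] .
      have "?v (c (Suc n) x) = u (Suc n) (c (Suc n) x) \<ominus>\<^bsub>D (Suc n)\<^esub> \<zero>\<^bsub>D (Suc n)\<^esub>"
        by (simp add: cc[OF x] lmod_hom_zero[OF mC mD h])
      moreover have "\<ominus>\<^bsub>D (Suc n)\<^esub> \<zero>\<^bsub>D (Suc n)\<^esub> = \<zero>\<^bsub>D (Suc n)\<^esub>"
        by (rule DD.M.minus_equality) simp_all
      ultimately show ?thesis using k(2) y uc[OF y] by (simp add: a_minus_def)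
    qed
    then show "\<exists>y. I (Suc n) y \<and> (\<forall>x\<in>carrier (C (Suc n)). d (Suc n) (y x) = ?v x)"
      unfolding I_def by (intro exI[of _ k]) (simp add: k)
  qed
  then obtain h where h: "\<And>n. I n (h n)"
    "\<And>n x. x \<in> carrier (C (Suc n)) \<Longrightarrow> d (Suc n) (h (Suc n) x) = u (Suc n) x \<ominus>\<^bsub>D (Suc n)\<^esub> h n (c n x)" by blast
  have hh: "h n \<in> lmod_hom R (C n) (D (Suc n))" for n using h(1) unfolding I_def by blast
  have "f 0 x = d 0 (h 0 x) \<oplus>\<^bsub>D 0\<^esub> g 0 x" if "x \<in> carrier (C 0)" for x
    using fu[OF _ that] h(1)[of 0] that unfolding I_def by simp
  moreover have "f (Suc n) x = (d (Suc n) (h (Suc n) x) \<oplus>\<^bsub>D (Suc n)\<^esub> h n (c n x)) \<oplus>\<^bsub>D (Suc n)\<^esub> g (Suc n) x"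
    if x: "x \<in> carrier (C (Suc n))" for n x
  proof (rule fu[OF _ x])
    show "u (Suc n) x = d (Suc n) (h (Suc n) x) \<oplus>\<^bsub>D (Suc n)\<^esub> h n (c n x)"
      using uc[OF x] lmod_hom_closed[OF hh lmod_hom_closed[OF c x]]
      by (simp add: h(2)[OF x] a_minus_def DD.M.a_assoc DD.M.l_neg)
  qed
  ultimately show ?thesis using hh by blast
qed

subsection \<open>Isomorphisms of cohomology\<close>

lemma lmod_iso_trans:
  assumes "lmod_iso R M N" "lmod_iso R N U" shows "lmod_iso R M U"
proof -
  obtain f g where f: "f \<in> lmod_hom R M N" "bij_betw f (carrier M) (carrier N)"
    and g: "g \<in> lmod_hom R N U" "bij_betw g (carrier N) (carrier U)"
    using assms unfolding lmod_iso_def by blast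
  show ?thesis unfolding lmod_iso_def
    by (rule bexI[OF _ lmod_hom_comp[OF f(1) g(1)]]) (use bij_betw_trans[OF f(2) g(2)] in \<open>simp add: comp_def\<close>)
qed

text \<open>F and G are mutually inverse up to elements of S and T, which vanish in the
  quotients.\<close>

lemma quotient_lmod_iso:
  assumes V: "left_module R V" and W: "left_module R W" and S: "submodule S R V" and T: "submodule T R W"
    and F: "F \<in> lmod_hom R V W" and G: "G \<in> lmod_hom R W V"
    and FS: "\<And>v. v \<in> S \<Longrightarrow> F v \<in> T" and GT: "\<And>w. w \<in> T \<Longrightarrow> G w \<in> S"
    and GF: "\<And>v. v \<in> carrier V \<Longrightarrow> \<exists>s\<in>S. G (F v) = s \<oplus>\<^bsub>V\<^esub> v"
    and FG: "\<And>w. w \<in> carrier W \<Longrightarrow> \<exists>t\<in>T. F (G w) = t \<oplus>\<^bsub>W\<^esub> w"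
  shows "lmod_iso R (quotient_module V S) (quotient_module W T)"
proof -
  \<comment> \<open>Existence of the induced map on cosets, stated for arbitrary modules because it
    serves F and G alike.\<close>
  have ind: "\<exists>H. \<forall>v\<in>carrier V. H (S +>\<^bsub>V\<^esub> v) = T +>\<^bsub>W\<^esub> F v"
    if V: "left_module R V" and W: "left_module R W" and S: "submodule S R V" and T: "submodule T R W"
      and F: "F \<in> lmod_hom R V W" and FS: "\<And>v. v \<in> S \<Longrightarrow> F v \<in> T"
    for V :: "('a, 'v, 'x) module_scheme" and W :: "('a, 'w, 'y) module_scheme" and S T F
  proof -
    interpret V: left_module R V by (rule V)
    define H where "H C = T +>\<^bsub>W\<^esub> F (SOME x. x \<in> carrier V \<and> C = S +>\<^bsub>V\<^esub> x)" for C
    have "H (S +>\<^bsub>V\<^esub> v) = T +>\<^bsub>W\<^esub> F v" if v: "v \<in> carrier V" for v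
    proof -
      define x where "x = (SOME x. x \<in> carrier V \<and> S +>\<^bsub>V\<^esub> v = S +>\<^bsub>V\<^esub> x)"
      have "x \<in> carrier V \<and> S +>\<^bsub>V\<^esub> v = S +>\<^bsub>V\<^esub> x" unfolding x_def by (rule someI[of _ v]) (use v in auto)
      then have x: "x \<in> carrier V" "x \<ominus>\<^bsub>V\<^esub> v \<in> S" using quotient_module_eq_iff[OF V S, of x v] v by auto
      have "F x \<ominus>\<^bsub>W\<^esub> F v \<in> T"
        using FS[OF x(2)] x(1) v by (simp add: a_minus_def lmod_hom_add[OF F] lmod_hom_a_inv[OF V W F])
      then show ?thesis unfolding H_def x_def[symmetric]
        using quotient_module_eq_iff[OF W T] lmod_hom_closed[OF F] x(1) v by blast
    qed
    then show ?thesis by blast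
  qed
  have abs: "S +>\<^bsub>V\<^esub> (s \<oplus>\<^bsub>V\<^esub> v) = S +>\<^bsub>V\<^esub> v"
    if V: "left_module R V" and S: "submodule S R V" and v: "v \<in> carrier V" and s: "s \<in> S"
    for V :: "('a, 'v, 'x) module_scheme" and S s v
  proof -
    interpret V: left_module R V by (rule V)
    have "s \<in> carrier V" using subgroup.subset[OF submodule.axioms(1)[OF S]] s by auto
    then have "(s \<oplus>\<^bsub>V\<^esub> v) \<ominus>\<^bsub>V\<^esub> v \<in> S" using v s by (simp add: a_minus_def V.M.a_assoc V.M.r_neg)
    then show ?thesis using quotient_module_eq_iff[OF V S] v \<open>s \<in> carrier V\<close> by simp
  qed
  obtain \<Phi> where \<Phi>: "\<And>v. v \<in> carrier V \<Longrightarrow> \<Phi> (S +>\<^bsub>V\<^esub> v) = T +>\<^bsub>W\<^esub> F v" using ind[OF V W S T F FS] by blast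
  obtain \<Psi> where \<Psi>: "\<And>w. w \<in> carrier W \<Longrightarrow> \<Psi> (T +>\<^bsub>W\<^esub> w) = S +>\<^bsub>V\<^esub> G w" using ind[OF W V T S G GT] by blast
  interpret V: left_module R V by (rule V)
  interpret W: left_module R W by (rule W)
  note Fc = lmod_hom_closed[OF F] and Gc = lmod_hom_closed[OF G]
  have "\<Phi> \<in> lmod_hom R (quotient_module V S) (quotient_module W T)"
  proof (rule lmod_homI)
    fix C assume "C \<in> carrier (quotient_module V S)"
    then obtain x where x: "x \<in> carrier V" "C = S +>\<^bsub>V\<^esub> x" by (rule quotient_module_carrierE)
    then show "\<Phi> C \<in> carrier (quotient_module W T)" using Fc by (simp only: \<Phi> quotient_module_carrierI)
    fix D assume "D \<in> carrier (quotient_module V S)"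
    then obtain y where y: "y \<in> carrier V" "D = S +>\<^bsub>V\<^esub> y" by (rule quotient_module_carrierE)
    show "\<Phi> (C \<oplus>\<^bsub>quotient_module V S\<^esub> D) = \<Phi> C \<oplus>\<^bsub>quotient_module W T\<^esub> \<Phi> D"
      using x y Fc by (simp only: quotient_module_add[OF V S] quotient_module_add[OF W T] \<Phi> V.M.a_closed lmod_hom_add[OF F])
  next
    fix r C assume r: "r \<in> carrier R" and "C \<in> carrier (quotient_module V S)"
    then obtain x where x: "x \<in> carrier V" "C = S +>\<^bsub>V\<^esub> x" by (elim quotient_module_carrierE)
    then show "\<Phi> (r \<odot>\<^bsub>quotient_module V S\<^esub> C) = r \<odot>\<^bsub>quotient_module W T\<^esub> \<Phi> C"
      using r Fc by (simp only: quotient_module_smult[OF V S] quotient_module_smult[OF W T] \<Phi> V.lsmult_closed lmod_hom_smult[OF F])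
  qed
  moreover have "bij_betw \<Phi> (carrier (quotient_module V S)) (carrier (quotient_module W T))"
  proof (rule bij_betw_byWitness[of _ \<Psi>])
    show "\<forall>C\<in>carrier (quotient_module V S). \<Psi> (\<Phi> C) = C"
    proof
      fix C assume "C \<in> carrier (quotient_module V S)"
      then obtain x where x: "x \<in> carrier V" "C = S +>\<^bsub>V\<^esub> x" by (rule quotient_module_carrierE)
      obtain s where s: "s \<in> S" "G (F x) = s \<oplus>\<^bsub>V\<^esub> x" using GF[OF x(1)] by blast
      show "\<Psi> (\<Phi> C) = C" unfolding x(2) \<Phi>[OF x(1)] \<Psi>[OF Fc[OF x(1)]] s(2) by (rule abs[OF V S x(1) s(1)])
    qed
    show "\<forall>C\<in>carrier (quotient_module W T). \<Phi> (\<Psi> C) = C"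
    proof
      fix C assume "C \<in> carrier (quotient_module W T)"
      then obtain x where x: "x \<in> carrier W" "C = T +>\<^bsub>W\<^esub> x" by (rule quotient_module_carrierE)
      obtain s where s: "s \<in> T" "F (G x) = s \<oplus>\<^bsub>W\<^esub> x" using FG[OF x(1)] by blast
      show "\<Phi> (\<Psi> C) = C" unfolding x(2) \<Psi>[OF x(1)] \<Phi>[OF Gc[OF x(1)]] s(2) by (rule abs[OF W T x(1) s(1)])
    qed
    show "\<Phi> ` carrier (quotient_module V S) \<subseteq> carrier (quotient_module W T)"
      by (rule image_subsetI, erule quotient_module_carrierE) (simp only: \<Phi> quotient_module_carrierI Fc)
    show "\<Psi> ` carrier (quotient_module W T) \<subseteq> carrier (quotient_module V S)"
      by (rule image_subsetI, erule quotient_module_carrierE) (simp only: \<Psi> quotient_module_carrierI Gc)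
  qed
  ultimately show ?thesis unfolding lmod_iso_def by blast
qed

lemma lmod_hom_image_submodule:
  assumes U: "left_module R U" and V: "left_module R V" and f: "f \<in> lmod_hom R U V"
  shows "submodule (f ` carrier U) R V"
proof -
  interpret U: left_module R U by (rule U)
  interpret V: left_module R V by (rule V)
  show ?thesis
  proof (intro submodule.intro subgroup.intro submodule_axioms.intro)
    show "inv\<^bsub>add_monoid V\<^esub> y \<in> f ` carrier U" if y: "y \<in> f ` carrier U" for y
    proof -
      obtain x where x: "x \<in> carrier U" "y = f x" using y by blast
      have "\<ominus>\<^bsub>V\<^esub> y = f (\<ominus>\<^bsub>U\<^esub> x)" using x by (simp add: lmod_hom_a_inv[OF U V f])
      then show ?thesis unfolding a_inv_def[symmetric] using x by blast
    qed
    show "\<one>\<^bsub>add_monoid V\<^esub> \<in> f ` carrier U" using lmod_hom_zero[OF U V f] by (simp add: image_iff) (metis U.M.zero_closed)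
    show "x \<otimes>\<^bsub>add_monoid V\<^esub> y \<in> f ` carrier U" if xy: "x \<in> f ` carrier U" "y \<in> f ` carrier U" for x y
    proof -
      obtain u v where u: "u \<in> carrier U" "x = f u" "v \<in> carrier U" "y = f v" using xy by blast
      have "x \<oplus>\<^bsub>V\<^esub> y = f (u \<oplus>\<^bsub>U\<^esub> v)" using u by (simp add: lmod_hom_add[OF f])
      then show ?thesis using u U.M.a_closed by auto
    qed
    show "r \<odot>\<^bsub>V\<^esub> x \<in> f ` carrier U" if r: "r \<in> carrier R" and x: "x \<in> f ` carrier U" for r x
    proof -
      obtain u where u: "u \<in> carrier U" "x = f u" using x by blast
      have "r \<odot>\<^bsub>V\<^esub> x = f (r \<odot>\<^bsub>U\<^esub> u)" using u r by (simp add: lmod_hom_smult[OF f])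
      then show ?thesis using u U.lsmult_closed[OF r] by auto
    qed
  qed (use lmod_hom_closed[OF f] in auto)
qed

definition cohomology where
  "cohomology C d m = quotient_module ((C m)\<lparr>carrier := a_kernel (C m) (C (Suc m)) (d m)\<rparr>)
     (case m of 0 \<Rightarrow> {\<zero>\<^bsub>C 0\<^esub>} | Suc n \<Rightarrow> d n ` carrier (C n))"

lemma hom_cohomology_eq:
  "hom_cohomology R X \<delta> N m = cohomology (\<lambda>m. hom_space R (X m) N) (hom_diff X \<delta>) m"
  by (simp add: hom_cohomology_def cohomology_def Let_def)

lemma a_kernel_iff: "x \<in> a_kernel G H h \<longleftrightarrow> x \<in> carrier G \<and> h x = \<zero>\<^bsub>H\<^esub>"
  by (auto simp: a_kernel_def')

definition cochain_complex where
  "cochain_complex K C d \<longleftrightarrow> (\<forall>m. module K (C m)) \<and> (\<forall>m. d m \<in> lmod_hom K (C m) (C (Suc m))) \<and>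
     (\<forall>m. \<forall>x\<in>carrier (C m). d (Suc m) (d m x) = \<zero>\<^bsub>C (Suc (Suc m))\<^esub>)"

lemma cohomology_structure:
  assumes "cochain_complex K C d"
  defines "V \<equiv> \<lambda>m. (C m)\<lparr>carrier := a_kernel (C m) (C (Suc m)) (d m)\<rparr>"
  defines "S \<equiv> \<lambda>m. case m of 0 \<Rightarrow> {\<zero>\<^bsub>C 0\<^esub>} | Suc n \<Rightarrow> d n ` carrier (C n)"
  shows "left_module K (V m)" "submodule (S m) K (V m)"
proof -
  have C: "module K (C m)" and d: "d m \<in> lmod_hom K (C m) (C (Suc m))" for m
    using assms(1) unfolding cochain_complex_def by auto
  have dd: "d (Suc m) (d m x) = \<zero>\<^bsub>C (Suc (Suc m))\<^esub>" if "x \<in> carrier (C m)" for m x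
    using assms(1) that unfolding cochain_complex_def by auto
  note L = module_imp_left_module[OF C]
  have k: "a_kernel (C m) (C (Suc m)) (d m) = {x \<in> carrier (C m). d m x = \<zero>\<^bsub>C (Suc m)\<^esub>}" for m
    by (auto simp: a_kernel_iff)
  have V: "left_module K (V m)" for m
    unfolding V_def k
    by (rule module_imp_left_module[OF submodule.submodule_is_module[OF lmod_hom_kernel_submodule[OF L L d] C]])
  then show "left_module K (V m)" .
  show "submodule (S m) K (V m)"
  proof (cases m)
    case 0
    \<comment> \<open>In degree 0 the space {0} of coboundaries is treated as the image of the zero
      map, so that one lemma on images covers both cases.\<close>
    have "(\<lambda>x. \<zero>\<^bsub>V 0\<^esub>) \<in> lmod_hom K (V 0) (V 0)" by (rule lmod_hom_null[OF V])
    from lmod_hom_image_submodule[OF V V this] have "submodule ((\<lambda>x. \<zero>\<^bsub>V 0\<^esub>) ` carrier (V 0)) K (V 0)" .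
    moreover have "(\<lambda>x. \<zero>\<^bsub>V 0\<^esub>) ` carrier (V 0) = {\<zero>\<^bsub>C 0\<^esub>}"
      using abelian_monoid.zero_closed[of "V 0"] V[of 0] unfolding left_module_def abelian_group_def by (auto simp: V_def)
    ultimately show ?thesis using 0 by (simp add: S_def)
  next
    case (Suc n)
    have "d n \<in> lmod_hom K (C n) (V (Suc n))"
      by (rule lmod_homI) (auto simp: V_def a_kernel_iff lmod_hom_closed[OF d] lmod_hom_add[OF d] lmod_hom_smult[OF d] dd)
    from lmod_hom_image_submodule[OF L V this] show ?thesis using Suc by (simp add: S_def)
  qed
qed

text \<open>The composites are compared with the identity on cocycles only, and up to coboundaries.
  This covers homotopy equivalences as well as isomorphisms of complexes.\<close>

lemma cohomology_iso:
  assumes C: "cochain_complex K C c" and D: "cochain_complex K D d"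
    and F: "\<And>m. F m \<in> lmod_hom K (C m) (D m)" and G: "\<And>m. G m \<in> lmod_hom K (D m) (C m)"
    and Fc: "\<And>m x. x \<in> carrier (C m) \<Longrightarrow> F (Suc m) (c m x) = d m (F m x)"
    and Gc: "\<And>m x. x \<in> carrier (D m) \<Longrightarrow> G (Suc m) (d m x) = c m (G m x)"
    and GF: "\<And>x. x \<in> carrier (C m) \<Longrightarrow> c m x = \<zero>\<^bsub>C (Suc m)\<^esub> \<Longrightarrow>
      \<exists>s \<in> (case m of 0 \<Rightarrow> {\<zero>\<^bsub>C 0\<^esub>} | Suc n \<Rightarrow> c n ` carrier (C n)). G m (F m x) = s \<oplus>\<^bsub>C m\<^esub> x"
    and FG: "\<And>x. x \<in> carrier (D m) \<Longrightarrow> d m x = \<zero>\<^bsub>D (Suc m)\<^esub> \<Longrightarrow>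
      \<exists>s \<in> (case m of 0 \<Rightarrow> {\<zero>\<^bsub>D 0\<^esub>} | Suc n \<Rightarrow> d n ` carrier (D n)). F m (G m x) = s \<oplus>\<^bsub>D m\<^esub> x"
  shows "lmod_iso K (cohomology C c m) (cohomology D d m)"
proof -
  have LC: "left_module K (C m)" and LD: "left_module K (D m)" for m
    using C D unfolding cochain_complex_def by (auto intro: module_imp_left_module)
  note z = lmod_hom_zero[OF LC LD F] lmod_hom_zero[OF LD LC G]
  show ?thesis unfolding cohomology_def
  proof (rule quotient_lmod_iso[OF cohomology_structure(1)[OF C] cohomology_structure(1)[OF D]
        cohomology_structure(2)[OF C] cohomology_structure(2)[OF D]])
    show "F m \<in> lmod_hom K ((C m)\<lparr>carrier := a_kernel (C m) (C (Suc m)) (c m)\<rparr>) ((D m)\<lparr>carrier := a_kernel (D m) (D (Suc m)) (d m)\<rparr>)"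
      by (rule lmod_homI) (auto simp: a_kernel_iff lmod_hom_closed[OF F] lmod_hom_add[OF F] lmod_hom_smult[OF F] z simp flip: Fc)
    show "G m \<in> lmod_hom K ((D m)\<lparr>carrier := a_kernel (D m) (D (Suc m)) (d m)\<rparr>) ((C m)\<lparr>carrier := a_kernel (C m) (C (Suc m)) (c m)\<rparr>)"
      by (rule lmod_homI) (auto simp: a_kernel_iff lmod_hom_closed[OF G] lmod_hom_add[OF G] lmod_hom_smult[OF G] z simp flip: Gc)
    show "F m v \<in> (case m of 0 \<Rightarrow> {\<zero>\<^bsub>D 0\<^esub>} | Suc n \<Rightarrow> d n ` carrier (D n))"
      if "v \<in> (case m of 0 \<Rightarrow> {\<zero>\<^bsub>C 0\<^esub>} | Suc n \<Rightarrow> c n ` carrier (C n))" for v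
      using that lmod_hom_closed[OF F] by (auto split: nat.splits simp: z Fc)
    show "G m v \<in> (case m of 0 \<Rightarrow> {\<zero>\<^bsub>C 0\<^esub>} | Suc n \<Rightarrow> c n ` carrier (C n))"
      if "v \<in> (case m of 0 \<Rightarrow> {\<zero>\<^bsub>D 0\<^esub>} | Suc n \<Rightarrow> d n ` carrier (D n))" for v
      using that lmod_hom_closed[OF G] by (auto split: nat.splits simp: z Gc)
  qed (use GF FG in \<open>simp_all add: a_kernel_iff\<close>)
qed

subsection \<open>Hom complexes\<close>

lemma hom_space_sel:
  "carrier (hom_space R X N) = lmod_hom R X N \<inter> extensional (carrier X)"
  "zero (hom_space R X N) = (\<lambda>x\<in>carrier X. \<zero>\<^bsub>N\<^esub>)"
  "f \<oplus>\<^bsub>hom_space R X N\<^esub> g = (\<lambda>x\<in>carrier X. f x \<oplus>\<^bsub>N\<^esub> g x)"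
  "c \<odot>\<^bsub>hom_space R X N\<^esub> f = (\<lambda>x\<in>carrier X. (c \<odot>\<^bsub>R\<^esub> \<one>\<^bsub>R\<^esub>) \<odot>\<^bsub>N\<^esub> f x)"
  by (simp_all add: hom_space_def)

text \<open>The restriction to the carrier keeps the result extensional, as elements of
  \<open>hom_space\<close> are.\<close>

definition precomp where "precomp X u f = (\<lambda>x\<in>carrier X. f (u x))"

lemma precomp_precomp: "u \<in> lmod_hom R X Y \<Longrightarrow> precomp X u (precomp Y v f) = precomp X (\<lambda>x. v (u x)) f"
  unfolding precomp_def by (rule restrict_ext) (simp add: lmod_hom_closed)

lemma hom_diff_precomp: "hom_diff X \<delta> m = precomp (X (Suc m)) (\<delta> m)"
  by (simp add: fun_eq_iff hom_diff_def precomp_def)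

text \<open>Closure of the homomorphisms under sums and scalars is a premise. Over the enveloping
  algebra it follows from the module laws; over \<Gamma> it is read off through the adjunction from
  bimodule maps out of \<open>Q m\<close>.\<close>

lemma (in lin_alg) hom_space_module:
  fixes X :: "('r, 'x, 'w) module_scheme"
  assumes V: "module K V" and N: "carrier N = carrier V" "add N = add V" "zero N = zero V"
    and sm: "\<And>c x. c \<in> carrier K \<Longrightarrow> x \<in> carrier V \<Longrightarrow> (c \<odot>\<^bsub>R\<^esub> \<one>\<^bsub>R\<^esub>) \<odot>\<^bsub>N\<^esub> x = c \<odot>\<^bsub>V\<^esub> x"
    and add: "\<And>f g. f \<in> lmod_hom R X N \<Longrightarrow> g \<in> lmod_hom R X N \<Longrightarrow> (\<lambda>x\<in>carrier X. f x \<oplus>\<^bsub>V\<^esub> g x) \<in> lmod_hom R X N"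
    and scale: "\<And>c f. c \<in> carrier K \<Longrightarrow> f \<in> lmod_hom R X N \<Longrightarrow> (\<lambda>x\<in>carrier X. c \<odot>\<^bsub>V\<^esub> f x) \<in> lmod_hom R X N"
    and zero: "(\<lambda>x\<in>carrier X. \<zero>\<^bsub>V\<^esub>) \<in> lmod_hom R X N"
  shows "module K (hom_space R X N)"
proof -
  interpret V: module K V by (rule V)
  let ?S = "hom_space R X N"
  have c: "f x \<in> carrier V" if "f \<in> carrier ?S" "x \<in> carrier X" for f x
    using that lmod_hom_closed[of f R X N x] by (simp add: hom_space_sel N)
  have e: "f = g" if "f \<in> extensional (carrier X)" "g \<in> extensional (carrier X)" "\<And>x. x \<in> carrier X \<Longrightarrow> f x = g x"
    for f g :: "'x \<Rightarrow> 'c" by (rule extensionalityI[OF that])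
  have s: "c \<odot>\<^bsub>?S\<^esub> f = (\<lambda>x\<in>carrier X. c \<odot>\<^bsub>V\<^esub> f x)" if "c \<in> carrier K" "f \<in> carrier ?S" for c f
    unfolding hom_space_sel by (rule restrict_ext) (simp add: sm that c)
  have sc: "c \<odot>\<^bsub>?S\<^esub> f \<in> carrier ?S" if "c \<in> carrier K" "f \<in> carrier ?S" for c f
    using that by (simp only: s) (simp add: hom_space_sel scale)
  have ac: "f \<oplus>\<^bsub>?S\<^esub> g \<in> carrier ?S" if "f \<in> carrier ?S" "g \<in> carrier ?S" for f g
    using that by (simp add: hom_space_sel add N)
  have ext: "f \<in> extensional (carrier X)" if "f \<in> carrier ?S" for f using that by (simp add: hom_space_sel)
  have ag: "abelian_group ?S"
  proof (rule abelian_groupI)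
    show "\<zero>\<^bsub>?S\<^esub> \<in> carrier ?S" by (simp add: hom_space_sel zero N)
    fix f assume f: "f \<in> carrier ?S"
    have "((\<ominus>\<^bsub>K\<^esub> \<one>\<^bsub>K\<^esub>) \<odot>\<^bsub>?S\<^esub> f) \<oplus>\<^bsub>?S\<^esub> f = \<zero>\<^bsub>?S\<^esub>"
      unfolding s[OF V.R.a_inv_closed[OF V.R.one_closed] f]
      by (rule extensionalityI[of _ "carrier X"]) (use c[OF f] in \<open>auto simp: hom_space_sel N V.smult_l_minus V.M.l_neg\<close>)
    then show "\<exists>g\<in>carrier ?S. g \<oplus>\<^bsub>?S\<^esub> f = \<zero>\<^bsub>?S\<^esub>"
      using sc[OF V.R.a_inv_closed[OF V.R.one_closed] f] by (rule bexI)
    show "\<zero>\<^bsub>?S\<^esub> \<oplus>\<^bsub>?S\<^esub> f = f"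
      by (rule extensionalityI[of _ "carrier X"]) (use c[OF f] ext[OF f] in \<open>auto simp: hom_space_sel N\<close>)
    fix g assume g: "g \<in> carrier ?S"
    show "f \<oplus>\<^bsub>?S\<^esub> g \<in> carrier ?S" by (rule ac[OF f g])
    show "f \<oplus>\<^bsub>?S\<^esub> g = g \<oplus>\<^bsub>?S\<^esub> f"
      by (rule extensionalityI[of _ "carrier X"]) (use c[OF f] c[OF g] in \<open>auto simp: hom_space_sel N V.M.a_comm\<close>)
    fix h assume h: "h \<in> carrier ?S"
    show "f \<oplus>\<^bsub>?S\<^esub> g \<oplus>\<^bsub>?S\<^esub> h = f \<oplus>\<^bsub>?S\<^esub> (g \<oplus>\<^bsub>?S\<^esub> h)"
      by (rule extensionalityI[of _ "carrier X"]) (use c[OF f] c[OF g] c[OF h] in \<open>auto simp: hom_space_sel N V.M.a_assoc\<close>)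
  qed
  show ?thesis
  proof (rule moduleI[OF K_cring ag sc])
    fix a b f assume ab: "a \<in> carrier K" "b \<in> carrier K" and f: "f \<in> carrier ?S"
    show "(a \<oplus>\<^bsub>K\<^esub> b) \<odot>\<^bsub>?S\<^esub> f = a \<odot>\<^bsub>?S\<^esub> f \<oplus>\<^bsub>?S\<^esub> b \<odot>\<^bsub>?S\<^esub> f"
      unfolding s[OF ab(1) f] s[OF ab(2) f] s[OF V.R.a_closed[OF ab] f]
      by (rule extensionalityI[of _ "carrier X"]) (use c[OF f] ab in \<open>auto simp: hom_space_sel N V.smult_l_distr\<close>)
    show "(a \<otimes>\<^bsub>K\<^esub> b) \<odot>\<^bsub>?S\<^esub> f = a \<odot>\<^bsub>?S\<^esub> (b \<odot>\<^bsub>?S\<^esub> f)"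
      unfolding s[OF ab(1) sc[OF ab(2) f]] unfolding s[OF ab(2) f] s[OF V.R.m_closed[OF ab] f]
      by (rule extensionalityI[of _ "carrier X"]) (use c[OF f] ab in \<open>auto simp: V.smult_assoc1\<close>)
    fix g assume g: "g \<in> carrier ?S"
    show "a \<odot>\<^bsub>?S\<^esub> (f \<oplus>\<^bsub>?S\<^esub> g) = a \<odot>\<^bsub>?S\<^esub> f \<oplus>\<^bsub>?S\<^esub> a \<odot>\<^bsub>?S\<^esub> g"
      unfolding s[OF ab(1) ac[OF f g]] unfolding s[OF ab(1) f] s[OF ab(1) g]
      by (rule extensionalityI[of _ "carrier X"]) (use c[OF f] c[OF g] ab in \<open>auto simp: hom_space_sel N V.smult_r_distr\<close>)
  next
    fix f assume f: "f \<in> carrier ?S"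
    show "\<one>\<^bsub>K\<^esub> \<odot>\<^bsub>?S\<^esub> f = f"
      unfolding s[OF V.R.one_closed f]
      by (rule extensionalityI[of _ "carrier X"]) (use c[OF f] ext[OF f] in auto)
  qed
qed

context env_alg
begin

lemma E_hom_restrict: "left_module E X \<Longrightarrow> f \<in> lmod_hom E X N \<Longrightarrow> (\<lambda>x\<in>carrier X. f x) \<in> lmod_hom E X N"
  using lmod_hom_cong[of E X f "\<lambda>x\<in>carrier X. f x" N] by simp

text \<open>The element c 1 is central in the enveloping algebra, so multiplication by it preserves
  linearity.\<close>

lemma E_hom_scale:
  assumes "left_module E X" "left_module E N" "f \<in> lmod_hom E X N" "c \<in> carrier K"
  shows "(\<lambda>x. c \<odot>\<^bsub>vspace K R N\<^esub> f x) \<in> lmod_hom E X N"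
proof (rule lmod_homI)
  interpret V: module K "vspace K R N" by (rule vspace_module[OF assms(2)])
  have fc: "f x \<in> carrier N" if "x \<in> carrier X" for x using lmod_hom_closed[OF assms(3) that] .
  show "c \<odot>\<^bsub>vspace K R N\<^esub> f x \<in> carrier N" if "x \<in> carrier X" for x
    using V.smult_closed[OF assms(4)] fc[OF that] by simp
  show "c \<odot>\<^bsub>vspace K R N\<^esub> f (x \<oplus>\<^bsub>X\<^esub> y) = c \<odot>\<^bsub>vspace K R N\<^esub> f x \<oplus>\<^bsub>N\<^esub> c \<odot>\<^bsub>vspace K R N\<^esub> f y"
    if "x \<in> carrier X" "y \<in> carrier X" for x y
    using V.smult_r_distr[OF assms(4)] fc[OF that(1)] fc[OF that(2)] that by (simp add: lmod_hom_add[OF assms(3)])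
  show "c \<odot>\<^bsub>vspace K R N\<^esub> f (r \<odot>\<^bsub>X\<^esub> x) = r \<odot>\<^bsub>N\<^esub> (c \<odot>\<^bsub>vspace K R N\<^esub> f x)"
    if "r \<in> carrier E" "x \<in> carrier X" for r x
    using lmod_hom_smult[OF bilinD(1)[OF E_act_bilin[OF assms(2)]], of r c "f x"] that fc[OF that(2)] assms(4)
    by (simp add: lmod_hom_smult[OF assms(3)])
qed

lemma E_hom_space_module:
  assumes X: "left_module E X" and N: "left_module E N"
  shows "module K (hom_space E X N)"
proof (rule hom_space_module[OF vspace_module[OF N]])
  show "(c \<odot>\<^bsub>E\<^esub> \<one>\<^bsub>E\<^esub>) \<odot>\<^bsub>N\<^esub> x = c \<odot>\<^bsub>vspace K R N\<^esub> x" for c x by (simp add: vspace_def)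
  show "(\<lambda>x\<in>carrier X. c \<odot>\<^bsub>vspace K R N\<^esub> f x) \<in> lmod_hom E X N" if "c \<in> carrier K" "f \<in> lmod_hom E X N" for c f
    by (rule E_hom_restrict[OF X E_hom_scale[OF X N that(2,1)]])
  show "(\<lambda>x\<in>carrier X. f x \<oplus>\<^bsub>vspace K R N\<^esub> g x) \<in> lmod_hom E X N" if "f \<in> lmod_hom E X N" "g \<in> lmod_hom E X N" for f g
    using E_hom_restrict[OF X lmod_hom_sum[OF X N that]] by simp
  show "(\<lambda>x\<in>carrier X. \<zero>\<^bsub>vspace K R N\<^esub>) \<in> lmod_hom E X N"
    using E_hom_restrict[OF X lmod_hom_null[OF N]] by simp
qed simp_all

lemma E_hom_space_smult: "c \<odot>\<^bsub>hom_space E X N\<^esub> f = (\<lambda>x\<in>carrier X. c \<odot>\<^bsub>vspace K R N\<^esub> f x)"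
  by (simp add: hom_space_sel vspace_def)

lemma precomp_closed:
  assumes "left_module E X" "u \<in> lmod_hom E X Y" "f \<in> carrier (hom_space E Y N)"
  shows "precomp X u f \<in> carrier (hom_space E X N)"
proof -
  have f: "f \<in> lmod_hom E Y N" using assms(3) by (simp add: hom_space_sel)
  show ?thesis
    unfolding hom_space_sel precomp_def
    by (intro IntI E_hom_restrict[OF assms(1) lmod_hom_comp[OF assms(2) f]]) simp
qed

lemma precomp_hom:
  assumes "left_module E X" "u \<in> lmod_hom E X Y"
  shows "precomp X u \<in> lmod_hom K (hom_space E Y N) (hom_space E X N)"
  by (rule lmod_homI, erule precomp_closed[OF assms])
     (use lmod_hom_closed[OF assms(2)] in \<open>auto simp: hom_space_sel precomp_def fun_eq_iff\<close>)

lemma hom_cochain_complex: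
  assumes "left_complex E C c" "left_module E N"
  shows "cochain_complex K (\<lambda>m. hom_space E (C m) N) (hom_diff C c)"
proof -
  have C: "left_module E (C n)" and c: "c n \<in> lmod_hom E (C (Suc n)) (C n)"
    and cc: "x \<in> carrier (C (Suc (Suc n))) \<Longrightarrow> c n (c (Suc n) x) = \<zero>\<^bsub>C n\<^esub>" for n x
    using assms(1) unfolding left_complex_def by auto
  have "precomp (C (Suc (Suc m))) (c (Suc m)) (precomp (C (Suc m)) (c m) f) = (\<lambda>x\<in>carrier (C (Suc (Suc m))). \<zero>\<^bsub>N\<^esub>)"
    if "f \<in> carrier (hom_space E (C m) N)" for m f
    unfolding precomp_def
    by (rule restrict_ext) (use that in \<open>simp add: lmod_hom_closed[OF c] cc hom_space_sel lmod_hom_zero[OF C assms(2)]\<close>)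
  then show ?thesis unfolding cochain_complex_def hom_diff_precomp
    by (auto simp: E_hom_space_module[OF C assms(2)] precomp_hom[OF C c]) (simp add: hom_space_sel)
qed

text \<open>If u = d h + h d + id and f vanishes on the image of d, then f u = f h d + f, which
  differs from f by the coboundary of f h. In degree 0 the term h d is absent and f u equals f, in
  accordance with the zero space of coboundaries there.\<close>

lemma homotopy_cocycle:
  assumes D: "left_complex E D d" and N: "left_module E N"
    and h: "\<And>n. h n \<in> lmod_hom E (D n) (D (Suc n))"
    and u0: "\<And>x. x \<in> carrier (D 0) \<Longrightarrow> u 0 x = d 0 (h 0 x) \<oplus>\<^bsub>D 0\<^esub> x"
    and u: "\<And>n x. x \<in> carrier (D (Suc n)) \<Longrightarrow>
       u (Suc n) x = (d (Suc n) (h (Suc n) x) \<oplus>\<^bsub>D (Suc n)\<^esub> h n (d n x)) \<oplus>\<^bsub>D (Suc n)\<^esub> x"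
    and f: "f \<in> carrier (hom_space E (D m) N)" "hom_diff D d m f = \<zero>\<^bsub>hom_space E (D (Suc m)) N\<^esub>"
  shows "\<exists>s \<in> (case m of 0 \<Rightarrow> {\<zero>\<^bsub>hom_space E (D 0) N\<^esub>} | Suc n \<Rightarrow> hom_diff D d n ` carrier (hom_space E (D n) N)).
     precomp (D m) (u m) f = s \<oplus>\<^bsub>hom_space E (D m) N\<^esub> f"
proof -
  have DD: "left_module E (D n)" and d: "d n \<in> lmod_hom E (D (Suc n)) (D n)" for n
    using D unfolding left_complex_def by auto
  interpret DM: left_module E "D n" for n by (rule DD)
  interpret N: left_module E N by (rule N)
  have fh: "f \<in> lmod_hom E (D m) N" using f(1) by (simp add: hom_space_sel)
  have fd: "f (d m x) = \<zero>\<^bsub>N\<^esub>" if "x \<in> carrier (D (Suc m))" for x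
    using fun_cong[OF f(2), of x] that by (simp add: hom_diff_def hom_space_sel)
  note hc = lmod_hom_closed[OF h] and dc = lmod_hom_closed[OF d]
  show ?thesis
  proof (cases m)
    case 0
    have "precomp (D 0) (u 0) f = \<zero>\<^bsub>hom_space E (D 0) N\<^esub> \<oplus>\<^bsub>hom_space E (D 0) N\<^esub> f"
      unfolding precomp_def hom_space_sel
      by (rule restrict_ext) (use fd fh 0 in \<open>simp add: u0 hc dc lmod_hom_add[OF fh[unfolded 0]]\<close>)
    then show ?thesis using 0 by simp
  next
    case (Suc n)
    let ?k = "precomp (D n) (h n) f"
    have k: "?k \<in> carrier (hom_space E (D n) N)" by (rule precomp_closed[OF DD h]) (use f(1) Suc in simp)
    have "precomp (D (Suc n)) (u (Suc n)) f = hom_diff D d n ?k \<oplus>\<^bsub>hom_space E (D (Suc n)) N\<^esub> f"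
      unfolding precomp_def hom_space_sel hom_diff_def
      by (rule restrict_ext)
         (use fd Suc lmod_hom_closed[OF fh[unfolded Suc]] in \<open>simp add: u hc dc lmod_hom_add[OF fh[unfolded Suc]]\<close>)
    then show ?thesis using Suc k by auto
  qed
qed

text \<open>The lifting hypotheses stand in for projectivity: \<open>C0\<close>, \<open>CD\<close>
  and \<open>D0\<close>, \<open>DC\<close> give the chain maps between C and D, while
  \<open>CC\<close> and \<open>DD\<close> give the homotopies from their composites to the
  identities.\<close>

lemma hom_cohomology_comparison:
  assumes C: "acyclic E C c N e" and D: "acyclic E D d N \<eta>" and M: "left_module E M"
    and CC: "\<And>m n. lifts_through E (C m) (C (Suc n)) (C n) (c n)" and C0: "\<And>m. lifts_through E (C m) (D 0) N \<eta>"
    and CD: "\<And>m n. lifts_through E (C m) (D (Suc n)) (D n) (d n)" and D0: "\<And>m. lifts_through E (D m) (C 0) N e"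
    and DC: "\<And>m n. lifts_through E (D m) (C (Suc n)) (C n) (c n)" and DD: "\<And>m n. lifts_through E (D m) (D (Suc n)) (D n) (d n)"
  shows "lmod_iso K (hom_cohomology E D d M m) (hom_cohomology E C c M m)"
proof -
  have aC: "augmented E C c N e" and aD: "augmented E D d N \<eta>" using C D unfolding acyclic_def by auto
  then have lC: "left_complex E C c" and lD: "left_complex E D d" unfolding augmented_def by auto
  then have mC: "left_module E (C n)" and mD: "left_module E (D n)" and c: "c n \<in> lmod_hom E (C (Suc n)) (C n)"
    and d: "d n \<in> lmod_hom E (D (Suc n)) (D n)" for n unfolding left_complex_def by auto
  obtain \<phi> where \<phi>: "\<And>n. \<phi> n \<in> lmod_hom E (C n) (D n)" "\<And>x. x \<in> carrier (C 0) \<Longrightarrow> \<eta> (\<phi> 0 x) = e x"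
    "\<And>n x. x \<in> carrier (C (Suc n)) \<Longrightarrow> d n (\<phi> (Suc n) x) = \<phi> n (c n x)"
    using comparison_map[OF aC D C0 CD] by blast
  obtain \<psi> where \<psi>: "\<And>n. \<psi> n \<in> lmod_hom E (D n) (C n)" "\<And>x. x \<in> carrier (D 0) \<Longrightarrow> e (\<psi> 0 x) = \<eta> x"
    "\<And>n x. x \<in> carrier (D (Suc n)) \<Longrightarrow> c n (\<psi> (Suc n) x) = \<psi> n (d n x)"
    using comparison_map[OF aD C D0 DC] by blast
  note \<phi>c = lmod_hom_closed[OF \<phi>(1)] and \<psi>c = lmod_hom_closed[OF \<psi>(1)]
  have "\<exists>h. (\<forall>n. h n \<in> lmod_hom E (C n) (C (Suc n))) \<and>
     (\<forall>x\<in>carrier (C 0). \<psi> 0 (\<phi> 0 x) = c 0 (h 0 x) \<oplus>\<^bsub>C 0\<^esub> x) \<and>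
     (\<forall>n. \<forall>x\<in>carrier (C (Suc n)). \<psi> (Suc n) (\<phi> (Suc n) x) =
        (c (Suc n) (h (Suc n) x) \<oplus>\<^bsub>C (Suc n)\<^esub> h n (c n x)) \<oplus>\<^bsub>C (Suc n)\<^esub> x)"
    by (rule comparison_homotopy[OF aC C CC, where f = "\<lambda>n x. \<psi> n (\<phi> n x)" and g = "\<lambda>n x. x"])
       (auto intro: lmod_hom_comp[OF \<phi>(1) \<psi>(1)] lmod_hom_id simp: \<phi>c \<psi>c \<phi>(2,3) \<psi>(2,3))
  then obtain h where h: "\<And>n. h n \<in> lmod_hom E (C n) (C (Suc n))"
     "\<And>x. x \<in> carrier (C 0) \<Longrightarrow> \<psi> 0 (\<phi> 0 x) = c 0 (h 0 x) \<oplus>\<^bsub>C 0\<^esub> x"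
     "\<And>n x. x \<in> carrier (C (Suc n)) \<Longrightarrow> \<psi> (Suc n) (\<phi> (Suc n) x) =
        (c (Suc n) (h (Suc n) x) \<oplus>\<^bsub>C (Suc n)\<^esub> h n (c n x)) \<oplus>\<^bsub>C (Suc n)\<^esub> x" by blast
  have "\<exists>k. (\<forall>n. k n \<in> lmod_hom E (D n) (D (Suc n))) \<and>
     (\<forall>x\<in>carrier (D 0). \<phi> 0 (\<psi> 0 x) = d 0 (k 0 x) \<oplus>\<^bsub>D 0\<^esub> x) \<and>
     (\<forall>n. \<forall>x\<in>carrier (D (Suc n)). \<phi> (Suc n) (\<psi> (Suc n) x) =
        (d (Suc n) (k (Suc n) x) \<oplus>\<^bsub>D (Suc n)\<^esub> k n (d n x)) \<oplus>\<^bsub>D (Suc n)\<^esub> x)"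
    by (rule comparison_homotopy[OF aD D DD, where f = "\<lambda>n x. \<phi> n (\<psi> n x)" and g = "\<lambda>n x. x"])
       (auto intro: lmod_hom_comp[OF \<psi>(1) \<phi>(1)] lmod_hom_id simp: \<phi>c \<psi>c \<phi>(2,3) \<psi>(2,3))
  then obtain k where k: "\<And>n. k n \<in> lmod_hom E (D n) (D (Suc n))"
     "\<And>x. x \<in> carrier (D 0) \<Longrightarrow> \<phi> 0 (\<psi> 0 x) = d 0 (k 0 x) \<oplus>\<^bsub>D 0\<^esub> x"
     "\<And>n x. x \<in> carrier (D (Suc n)) \<Longrightarrow> \<phi> (Suc n) (\<psi> (Suc n) x) =
        (d (Suc n) (k (Suc n) x) \<oplus>\<^bsub>D (Suc n)\<^esub> k n (d n x)) \<oplus>\<^bsub>D (Suc n)\<^esub> x" by blast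
  show ?thesis unfolding hom_cohomology_eq
  proof (rule cohomology_iso[OF hom_cochain_complex[OF lD M] hom_cochain_complex[OF lC M],
        where F = "\<lambda>m. precomp (C m) (\<phi> m)" and G = "\<lambda>m. precomp (D m) (\<psi> m)"])
    show "precomp (C m) (\<phi> m) \<in> lmod_hom K (hom_space E (D m) M) (hom_space E (C m) M)" for m
      by (rule precomp_hom[OF mC \<phi>(1)])
    show "precomp (D m) (\<psi> m) \<in> lmod_hom K (hom_space E (C m) M) (hom_space E (D m) M)" for m
      by (rule precomp_hom[OF mD \<psi>(1)])
    show "precomp (C (Suc m)) (\<phi> (Suc m)) (hom_diff D d m f) = hom_diff C c m (precomp (C m) (\<phi> m) f)" for m f
      unfolding hom_diff_precomp precomp_precomp[OF \<phi>(1)] precomp_precomp[OF c] unfolding precomp_def by (rule restrict_ext) (simp add: \<phi>(3))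
    show "precomp (D (Suc m)) (\<psi> (Suc m)) (hom_diff C c m f) = hom_diff D d m (precomp (D m) (\<psi> m) f)" for m f
      unfolding hom_diff_precomp precomp_precomp[OF \<psi>(1)] precomp_precomp[OF d] unfolding precomp_def by (rule restrict_ext) (simp add: \<psi>(3))
    show "\<exists>s\<in>(case m of 0 \<Rightarrow> {\<zero>\<^bsub>hom_space E (D 0) M\<^esub>} | Suc n \<Rightarrow> hom_diff D d n ` carrier (hom_space E (D n) M)).
        precomp (D m) (\<psi> m) (precomp (C m) (\<phi> m) f) = s \<oplus>\<^bsub>hom_space E (D m) M\<^esub> f"
      if "f \<in> carrier (hom_space E (D m) M)" "hom_diff D d m f = \<zero>\<^bsub>hom_space E (D (Suc m)) M\<^esub>" for f
      unfolding precomp_precomp[OF \<psi>(1)]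
      by (rule homotopy_cocycle[OF lD M k(1) _ _ that, where u = "\<lambda>n x. \<phi> n (\<psi> n x)"]) (simp_all add: k)
    show "\<exists>s\<in>(case m of 0 \<Rightarrow> {\<zero>\<^bsub>hom_space E (C 0) M\<^esub>} | Suc n \<Rightarrow> hom_diff C c n ` carrier (hom_space E (C n) M)).
        precomp (C m) (\<phi> m) (precomp (D m) (\<psi> m) f) = s \<oplus>\<^bsub>hom_space E (C m) M\<^esub> f"
      if "f \<in> carrier (hom_space E (C m) M)" "hom_diff C c m f = \<zero>\<^bsub>hom_space E (C (Suc m)) M\<^esub>" for f
      unfolding precomp_precomp[OF \<phi>(1)]
      by (rule homotopy_cocycle[OF lC M h(1) _ _ that, where u = "\<lambda>n x. \<psi> n (\<phi> n x)"]) (simp_all add: h)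
  qed
qed

end

subsection \<open>Modules over Gamma\<close>

context smash_calc
begin

abbreviation "\<Gamma> \<equiv> Gamma K H A act"
abbreviation "AA \<equiv> tensor K A A"
abbreviation "GT \<equiv> tensor K AA H"
abbreviation "gpure a b h \<equiv> tensor_elt K AA H (tensor_elt K A A a b) h"

lemma Gamma_sel: "carrier \<Gamma> = carrier GT" "smult \<Gamma> = smult GT" "one \<Gamma> = gpure \<one>\<^bsub>A\<^esub> \<one>\<^bsub>A\<^esub> \<one>\<^bsub>H\<^esub>"
proof -
  have op: "tensor K A (op_algebra A) = AA" "tensor_elt K A (op_algebra A) = tensor_elt K A A"
    by (intro tensor_same_ops; simp)+
  have E: "tensor K (enveloping_algebra K A) H = GT" "tensor_elt K (enveloping_algebra K A) H = tensor_elt K AA H"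
    by (intro tensor_same_ops; simp add: enveloping_algebra_def op)+
  show "carrier \<Gamma> = carrier GT" "smult \<Gamma> = smult GT" "one \<Gamma> = gpure \<one>\<^bsub>A\<^esub> \<one>\<^bsub>A\<^esub> \<one>\<^bsub>H\<^esub>"
    by (simp_all add: Gamma_def Let_def E op)
qed

lemma Gamma_ext:
  assumes U: "module K U" and f: "f \<in> lin GT U" and g: "g \<in> lin GT U"
    and eq: "\<And>a b h. a \<in> carrier A \<Longrightarrow> b \<in> carrier A \<Longrightarrow> h \<in> carrier H \<Longrightarrow> f (gpure a b h) = g (gpure a b h)"
    and t: "t \<in> carrier GT"
  shows "f t = g t"
proof (rule tensor_hom_ext[OF _ H_module U f g _ t])
  fix u h assume u: "u \<in> carrier AA" and h: "h \<in> carrier H"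
  have l: "(\<lambda>u. tensor_elt K AA H u h) \<in> lin AA GT" by (auto intro!: lin_intros simp: h)
  show "f (tensor_elt K AA H u h) = g (tensor_elt K AA H u h)"
    by (rule tensor_hom_ext[OF A_module A_module U lin_comp[OF l f] lin_comp[OF l g] _ u]) (simp add: eq h)
qed simp

lemma Gamma_module_sel [simp]:
  "carrier (Gamma_module K V la ra ha) = carrier V" "add (Gamma_module K V la ra ha) = add V"
  "zero (Gamma_module K V la ra ha) = zero V"
  by (simp_all add: Gamma_module_def)

lemma Gamma_module_act:
  assumes V: "module K V" and b: "bilin K A V V la" "bilin K V A V ra" "bilin K H V V ha" and n: "n \<in> carrier V"
  shows "(\<lambda>t. t \<odot>\<^bsub>Gamma_module K V la ra ha\<^esub> n) \<in> lin GT V"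
    and "a \<in> carrier A \<Longrightarrow> c \<in> carrier A \<Longrightarrow> h \<in> carrier H \<Longrightarrow>
      gpure a c h \<odot>\<^bsub>Gamma_module K V la ra ha\<^esub> n = la a (ra (ha h n) c)"
proof -
  note li = bilin_left[OF b(1)] bilin_right[OF b(1)] bilin_left[OF b(2)] bilin_right[OF b(2)] bilin_left[OF b(3)] bilin_right[OF b(3)]
  note c = bilinD(3)[OF b(1)] bilinD(3)[OF b(2)] bilinD(3)[OF b(3)]
  have b1: "bilin K A A V (\<lambda>a b. la a (ra (ha h n) b))" if "h \<in> carrier H" for h
    using that by (auto intro!: li lin_intros simp: V n c)
  have b2: "bilin K AA H V (\<lambda>u h. tensor_lift K V (\<lambda>(a, b). la a (ra (ha h n) b)) u)"
  proof (rule bilinI)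
    show "(\<lambda>u. tensor_lift K V (\<lambda>(a, b). la a (ra (ha h n) b)) u) \<in> lin AA V" if "h \<in> carrier H" for h
      by (rule tensor_lift_lin[OF A_module A_module V b1[OF that]])
    show "(\<lambda>h. tensor_lift K V (\<lambda>(a, b). la a (ra (ha h n) b)) u) \<in> lin H V" if "u \<in> carrier AA" for u
      by (rule tensor_lift_param[OF A_module A_module V H_module _ that]) (auto intro!: li lin_intros simp: V n c)
  qed
  show "(\<lambda>t. t \<odot>\<^bsub>Gamma_module K V la ra ha\<^esub> n) \<in> lin GT V"
    unfolding Gamma_module_def with_action_sel by (rule tensor_lift_lin[OF _ H_module V b2]) simp
  show "gpure a c h \<odot>\<^bsub>Gamma_module K V la ra ha\<^esub> n = la a (ra (ha h n) c)"
    if a: "a \<in> carrier A" "c \<in> carrier A" "h \<in> carrier H"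
  proof -
    have "gpure a c h \<odot>\<^bsub>Gamma_module K V la ra ha\<^esub> n = tensor_lift K V (\<lambda>(a, b). la a (ra (ha h n) b)) (tensor_elt K A A a c)"
      unfolding Gamma_module_def with_action_sel by (rule tensor_lift_pure[OF _ H_module V b2]) (use a in auto)
    also have "\<dots> = la a (ra (ha h n) c)" by (rule tensor_lift_pure[OF A_module A_module V b1]) (use a in auto)
    finally show ?thesis .
  qed
qed

text \<open>A pure element a \<otimes> b \<otimes> h acts by n \<mapsto> a (h n) b. Setting two of
  its three entries to 1 separates the three actions; conversely, pure elements span \<Gamma> and
  both sides of the linearity condition are linear in the acting element.\<close>

lemma Gamma_hom_iff:
  assumes V: "module K V" "bilin K A V V la" "bilin K V A V ra" "bilin K H V V ha"
    and W: "module K W" "bilin K A W W la'" "bilin K W A W ra'" "bilin K H W W ha'"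
    and V1: "\<And>n. n \<in> carrier V \<Longrightarrow> la \<one>\<^bsub>A\<^esub> n = n" "\<And>n. n \<in> carrier V \<Longrightarrow> ra n \<one>\<^bsub>A\<^esub> = n" "\<And>n. n \<in> carrier V \<Longrightarrow> ha \<one>\<^bsub>H\<^esub> n = n"
    and W1: "\<And>n. n \<in> carrier W \<Longrightarrow> la' \<one>\<^bsub>A\<^esub> n = n" "\<And>n. n \<in> carrier W \<Longrightarrow> ra' n \<one>\<^bsub>A\<^esub> = n" "\<And>n. n \<in> carrier W \<Longrightarrow> ha' \<one>\<^bsub>H\<^esub> n = n"
  shows "f \<in> lmod_hom \<Gamma> (Gamma_module K V la ra ha) (Gamma_module K W la' ra' ha') \<longleftrightarrow> ehom V la ra ha W la' ra' ha' f"
proof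
  note gV = Gamma_module_act[OF V] and gW = Gamma_module_act[OF W]
  note cV = bilinD(3)[OF V(2)] bilinD(3)[OF V(3)] bilinD(3)[OF V(4)] and cW = bilinD(3)[OF W(2)] bilinD(3)[OF W(3)] bilinD(3)[OF W(4)]
  interpret Vm: module K V by (rule V)
  interpret Wm: module K W by (rule W)
  {
    assume f: "f \<in> lmod_hom \<Gamma> (Gamma_module K V la ra ha) (Gamma_module K W la' ra' ha')"
    have fc: "f n \<in> carrier W" if "n \<in> carrier V" for n using lmod_hom_closed[OF f, of n] that by simp
    have eq: "f (la a (ra (ha h n) b)) = la' a (ra' (ha' h (f n)) b)"
      if "n \<in> carrier V" "a \<in> carrier A" "b \<in> carrier A" "h \<in> carrier H" for n a b h
      using lmod_hom_smult[OF f, of "gpure a b h" n] that by (simp add: Gamma_sel gV(2) gW(2) fc)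
    \<comment> \<open>Linearity over K is the case of the element c 1 of A acting from the
      left.\<close>
    have "f (c \<odot>\<^bsub>V\<^esub> n) = c \<odot>\<^bsub>W\<^esub> f n" if c: "c \<in> carrier K" and n: "n \<in> carrier V" for c n
    proof -
      interpret A: module K A by simp
      have ca: "c \<odot>\<^bsub>A\<^esub> \<one>\<^bsub>A\<^esub> \<in> carrier A" using c by simp
      have "la (c \<odot>\<^bsub>A\<^esub> \<one>\<^bsub>A\<^esub>) n = c \<odot>\<^bsub>V\<^esub> n" "la' (c \<odot>\<^bsub>A\<^esub> \<one>\<^bsub>A\<^esub>) (f n) = c \<odot>\<^bsub>W\<^esub> f n"
        using c n fc[OF n] lmod_hom_smult[OF bilinD(2)[OF V(2)]] lmod_hom_smult[OF bilinD(2)[OF W(2)]]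
        by (simp_all add: V1 W1)
      then show ?thesis using eq[OF n ca, of "\<one>\<^bsub>A\<^esub>" "\<one>\<^bsub>H\<^esub>"] n fc[OF n] by (simp add: V1 W1)
    qed
    then have l: "f \<in> lin V W" using lmod_hom_add[OF f] by (intro lmod_homI) (simp_all add: fc)
    have "f (la a n) = la' a (f n)" if "a \<in> carrier A" "n \<in> carrier V" for a n
      using eq[of n a "\<one>\<^bsub>A\<^esub>" "\<one>\<^bsub>H\<^esub>"] that by (simp add: V1 W1 fc)
    moreover have "f (ra n a) = ra' (f n) a" if "a \<in> carrier A" "n \<in> carrier V" for a n
      using eq[of n "\<one>\<^bsub>A\<^esub>" a "\<one>\<^bsub>H\<^esub>"] that by (simp add: V1 W1 fc cV cW)
    moreover have "f (ha h n) = ha' h (f n)" if "h \<in> carrier H" "n \<in> carrier V" for h n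
      using eq[of n "\<one>\<^bsub>A\<^esub>" "\<one>\<^bsub>A\<^esub>" h] that by (simp add: V1 W1 fc cV cW)
    ultimately show "ehom V la ra ha W la' ra' ha' f" unfolding equivariant_hom_def using l by blast
  next
    assume f: "ehom V la ra ha W la' ra' ha' f"
    note f' = ehomD[OF f]
    show "f \<in> lmod_hom \<Gamma> (Gamma_module K V la ra ha) (Gamma_module K W la' ra' ha')"
    proof (rule lmod_homI)
      fix t n assume "t \<in> carrier \<Gamma>" and "n \<in> carrier (Gamma_module K V la ra ha)"
      then have t: "t \<in> carrier GT" and n: "n \<in> carrier V" by (simp_all add: Gamma_sel)
      show "f (t \<odot>\<^bsub>Gamma_module K V la ra ha\<^esub> n) = t \<odot>\<^bsub>Gamma_module K W la' ra' ha'\<^esub> f n"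
        by (rule Gamma_ext[OF W(1) lin_comp[OF gV(1)[OF n] f'(1)] gW(1)[OF f'(5)[OF n]] _ t])
           (simp add: gV(2) gW(2) n f' cV cW)
    qed (use f' lmod_hom_add[OF f'(1)] in simp_all)
  }
qed

text \<open>In \<open>hom_space\<close> scalars act through c 1 in \<Gamma>; on an equivariant
  bimodule this is the given scalar multiplication.\<close>

lemma Gamma_scalar:
  assumes V: "module K V" "bilin K A V V la" "bilin K V A V ra" "bilin K H V V ha"
    and V1: "\<And>n. n \<in> carrier V \<Longrightarrow> la \<one>\<^bsub>A\<^esub> n = n" "\<And>n. n \<in> carrier V \<Longrightarrow> ra n \<one>\<^bsub>A\<^esub> = n" "\<And>n. n \<in> carrier V \<Longrightarrow> ha \<one>\<^bsub>H\<^esub> n = n"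
    and c: "c \<in> carrier K" and n: "n \<in> carrier V"
  shows "(c \<odot>\<^bsub>\<Gamma>\<^esub> \<one>\<^bsub>\<Gamma>\<^esub>) \<odot>\<^bsub>Gamma_module K V la ra ha\<^esub> n = c \<odot>\<^bsub>V\<^esub> n"
  using lmod_hom_smult[OF Gamma_module_act(1)[OF V n] c, of "gpure \<one>\<^bsub>A\<^esub> \<one>\<^bsub>A\<^esub> \<one>\<^bsub>H\<^esub>"] n
  by (simp add: Gamma_sel Gamma_module_act(2)[OF V n] V1)

section \<open>The bar complex over Gamma, and its Hom complex through the adjunction\<close>

lemma bar_module_eq: "bar_module K H A act m =
   Gamma_module K (T (Suc (Suc m))) (Tl (Suc (Suc m))) (Tr (Suc (Suc m))) (Th (Suc (Suc m)))"
proof -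
  have "bar_module K H A act m = Gamma_module K (T (Suc (Suc m))) (\<lambda>a t. Tl (Suc (Suc m)) a t)
     (\<lambda>t b. Tr (Suc (Suc m)) t b) (\<lambda>h t. Th (Suc (Suc m)) h t)"
    unfolding bar_module_def Let_def Tl_def Tr_def Th_def by simp
  then show ?thesis .
qed

lemma bar_hom_iff:
  assumes W: "module K W" "bilin K A W W la'" "bilin K W A W ra'" "bilin K H W W ha'"
    and W1: "\<And>n. n \<in> carrier W \<Longrightarrow> la' \<one>\<^bsub>A\<^esub> n = n" "\<And>n. n \<in> carrier W \<Longrightarrow> ra' n \<one>\<^bsub>A\<^esub> = n" "\<And>n. n \<in> carrier W \<Longrightarrow> ha' \<one>\<^bsub>H\<^esub> n = n"
  shows "f \<in> lmod_hom \<Gamma> (bar_module K H A act m) (Gamma_module K W la' ra' ha') \<longleftrightarrow>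
    ehom (T (Suc (Suc m))) (Tl (Suc (Suc m))) (Tr (Suc (Suc m))) (Th (Suc (Suc m))) W la' ra' ha' f"
  unfolding bar_module_eq
  by (rule Gamma_hom_iff) (simp_all add: assms ebimD(5,6,7,14,15)[OF T_ebim] hmodD(4)[OF Th_hmod])

abbreviation (input) "bar \<equiv> bar_module K H A act"

lemma Q_left_complex: "left_complex E Q dQ"
  unfolding left_complex_def by (intro conjI allI ballI; rule Q_left_module dQ_hom dQ_dQ)

text \<open>The coefficients \<open>N\<close> below are an \<open>E\<close>-module \<open>X\<close>, regarded as an equivariant bimodule through \<open>adj\<close>.\<close>

lemma bar_cohomology_iso:
  fixes N :: "((('a \<times> 'a \<Rightarrow> 'k) set \<times> 'h \<Rightarrow> 'k) set, 'x, 'w) module_scheme"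
    and X :: "((('a \<times> 'h \<Rightarrow> 'k) set \<times> ('a \<times> 'h \<Rightarrow> 'k) set \<Rightarrow> 'k) set, 'x, 'v) module_scheme"
  assumes X: "left_module E X"
    and N: "carrier N = carrier X" "add N = add X" "zero N = zero X"
    and sm: "\<And>c x. c \<in> carrier K \<Longrightarrow> x \<in> carrier X \<Longrightarrow> (c \<odot>\<^bsub>\<Gamma>\<^esub> \<one>\<^bsub>\<Gamma>\<^esub>) \<odot>\<^bsub>N\<^esub> x = c \<odot>\<^bsub>vspace K R X\<^esub> x"
    and hom: "\<And>m f. f \<in> lmod_hom \<Gamma> (bar m) N \<longleftrightarrow>
      ehom (T (Suc (Suc m))) (Tl (Suc (Suc m))) (Tr (Suc (Suc m))) (Th (Suc (Suc m))) (vspace K R X) (xl X) (xr X) (adj X) f"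
  shows "lmod_iso K (hom_cohomology \<Gamma> bar (bar_diff K A) N m) (hom_cohomology E Q dQ X m)"
proof -
  let ?V = "vspace K R X"
  interpret X: left_module E X by (rule X)
  interpret V: module K ?V by (rule vspace_module[OF X])
  let ?C = "\<lambda>m. hom_space \<Gamma> (bar m) N" and ?D = "\<lambda>m. hom_space E (Q m) X"
  let ?e = "\<lambda>m v. tensor_elt K (T (Suc (Suc m))) H v \<one>\<^bsub>H\<^esub>"
  have bc: "carrier (bar m) = carrier (T (Suc (Suc m)))" for m by (simp add: bar_module_eq)
  have ec: "?e m v \<in> carrier (Q m)" if "v \<in> carrier (T (Suc (Suc m)))" for m v using that by (simp add: Q_sel)
  have C: "carrier (?C m) = lmod_hom \<Gamma> (bar m) N \<inter> extensional (carrier (T (Suc (Suc m))))" for m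
    by (simp add: hom_space_sel bc)
  have D: "carrier (?D m) = lmod_hom E (Q m) X \<inter> extensional (carrier (Q m))" for m by (simp add: hom_space_sel)
  note eh = hom[THEN iffD1]
  have lin: "f \<in> lin (T (Suc (Suc m))) ?V" if "f \<in> lmod_hom \<Gamma> (bar m) N" for f m
    using ehomD(1)[OF eh[OF that]] .
  have cl: "f v \<in> carrier X" if "f \<in> lmod_hom \<Gamma> (bar m) N" "v \<in> carrier (T (Suc (Suc m)))" for f m v
    using ehomD(5)[OF eh[OF that(1)] that(2)] by simp
  have sh: "sharp X f \<in> lmod_hom E (Q m) X" if "f \<in> lmod_hom \<Gamma> (bar m) N" for f m
    unfolding Q_def by (rule sharp_hom[OF T_ebim X eh[OF that]])
  have fl: "(\<lambda>v. g (?e m v)) \<in> lmod_hom \<Gamma> (bar m) N" if "g \<in> lmod_hom E (Q m) X" for g m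
    unfolding hom using flat_ehom[OF T_ebim X that[unfolded Q_def]] .
  have su: "sharp X f (?e m v) = f v" if "f \<in> lmod_hom \<Gamma> (bar m) N" "v \<in> carrier (T (Suc (Suc m)))" for f m v
    by (rule sharp_unit[OF T_ebim X lin[OF that(1)] that(2)])
  have eqI: "f t = g t" if "f \<in> lmod_hom E (Q m) X" "g \<in> lmod_hom E (Q m) X"
      "\<And>v. v \<in> carrier (T (Suc (Suc m))) \<Longrightarrow> f (?e m v) = g (?e m v)" "t \<in> carrier (Q m)" for f g m t
    by (rule E_hom_eqI[OF T_ebim X that(1,2)[unfolded Q_def] that(3)]) (use that(4) in \<open>simp_all add: Q_sel\<close>)
  \<comment> \<open>Membership depends on the values on the carrier alone, which permits passing
    between a map and its extensional restriction.\<close>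
  have cong: "g \<in> lmod_hom \<Gamma> (bar m) N" if f: "f \<in> lmod_hom \<Gamma> (bar m) N" and e: "\<And>v. v \<in> carrier (T (Suc (Suc m))) \<Longrightarrow> f v = g v" for f g m
  proof -
    have "g \<in> lin (T (Suc (Suc m))) ?V" using lmod_hom_cong[OF lmodule[OF T_module[of "Suc (Suc m)"]], of f g ?V] e lin[OF f] by blast
    then show ?thesis using ehomD(2,3,4)[OF eh[OF f]] unfolding hom equivariant_hom_def by (simp flip: e)
  qed
  have rs: "restrict f (carrier (bar m)) \<in> lmod_hom \<Gamma> (bar m) N" if "f \<in> lmod_hom \<Gamma> (bar m) N" for f m
    by (rule cong[OF that]) (simp add: bc)
  \<comment> \<open>To see that a pointwise combination of \<Gamma>-maps is a \<Gamma>-map, it is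
    formed for the transposes, which are bimodule maps, and pulled back along v \<mapsto> v
    \<otimes> 1.\<close>
  have flsh: "f \<in> lmod_hom \<Gamma> (bar m) N" if "g \<in> lmod_hom E (Q m) X" "\<And>v. v \<in> carrier (T (Suc (Suc m))) \<Longrightarrow> g (?e m v) = f v" for f g m
    by (rule cong[OF fl[OF that(1)] that(2)])
  have Cmod: "module K (?C m)" for m
  proof (rule hom_space_module[OF V.module_axioms])
    show "(\<lambda>x\<in>carrier (bar m). f x \<oplus>\<^bsub>?V\<^esub> g x) \<in> lmod_hom \<Gamma> (bar m) N"
      if "f \<in> lmod_hom \<Gamma> (bar m) N" "g \<in> lmod_hom \<Gamma> (bar m) N" for f g
      by (rule flsh[OF lmod_hom_sum[OF Q_left_module X sh[OF that(1)] sh[OF that(2)]]]) (simp add: su that bc)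
    show "(\<lambda>x\<in>carrier (bar m). c \<odot>\<^bsub>?V\<^esub> f x) \<in> lmod_hom \<Gamma> (bar m) N"
      if "c \<in> carrier K" "f \<in> lmod_hom \<Gamma> (bar m) N" for f c
      by (rule flsh[OF E_hom_scale[OF Q_left_module X sh[OF that(2)] that(1)]]) (simp add: su that bc)
    show "(\<lambda>x\<in>carrier (bar m). \<zero>\<^bsub>?V\<^esub>) \<in> lmod_hom \<Gamma> (bar m) N"
      by (rule flsh[OF lmod_hom_null[OF X]]) (simp add: bc)
  qed (simp_all add: N sm)
  have dC: "hom_diff bar (bar_diff K A) m f = (\<lambda>v\<in>carrier (T (Suc (Suc (Suc m)))). f (D (Suc m) v))" for m f
    by (simp add: hom_diff_def bc bar_diff_D)
  have fD: "(\<lambda>v. f (D (Suc m) v)) \<in> lmod_hom \<Gamma> (bar (Suc m)) N" if "f \<in> lmod_hom \<Gamma> (bar m) N" for f m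
    unfolding hom by (rule ehom_comp[OF D_ehom eh[OF that]])
  have dCc: "hom_diff bar (bar_diff K A) m f \<in> carrier (?C (Suc m))" if "f \<in> lmod_hom \<Gamma> (bar m) N" for f m
    unfolding C dC using rs[OF fD[OF that]] by (simp add: bc)
  have Clin: "hom_diff bar (bar_diff K A) m \<in> lmod_hom K (?C m) (?C (Suc m))" for m
    by (rule lmod_homI, rule dCc, simp add: C) (auto simp: dC hom_space_sel bc)
  have z: "f \<zero>\<^bsub>T (Suc (Suc m))\<^esub> = \<zero>\<^bsub>X\<^esub>" if "f \<in> lmod_hom \<Gamma> (bar m) N" for f m
    using lmod_hom_zero[OF lmodule[OF T_module] lmodule[OF V.module_axioms] lin[OF that]] by simp
  have CC: "cochain_complex K ?C (hom_diff bar (bar_diff K A))"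
    unfolding cochain_complex_def using Cmod Clin
    by (auto simp: dC C fun_eq_iff hom_space_sel bc D_D z N)
  note DD = hom_cochain_complex[OF Q_left_complex X]
  show ?thesis unfolding hom_cohomology_eq
  \<comment> \<open>Transposition is bijective already on cochains, so both composites are
    identities and the zero cochain is the required coboundary.\<close>
  proof (rule cohomology_iso[OF CC DD, where F = "\<lambda>m f. restrict (sharp X f) (carrier (Q m))"
        and G = "\<lambda>m g. \<lambda>v\<in>carrier (T (Suc (Suc m))). g (?e m v)"])
    fix m
    have 1: "f \<oplus>\<^bsub>?C m\<^esub> g \<in> lmod_hom \<Gamma> (bar m) N" "c \<odot>\<^bsub>?C m\<^esub> f \<in> lmod_hom \<Gamma> (bar m) N"
      if "f \<in> carrier (?C m)" "g \<in> carrier (?C m)" "c \<in> carrier K" for f g c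
      using abelian_monoid.a_closed[of "?C m" f g] module.smult_closed[OF Cmod that(3,1)] Cmod[of m] that
      unfolding module_def abelian_group_def by (auto simp: C)
    show "(\<lambda>f. restrict (sharp X f) (carrier (Q m))) \<in> lmod_hom K (?C m) (?D m)"
    proof (rule lmod_homI)
      show "restrict (sharp X f) (carrier (Q m)) \<in> carrier (?D m)" if "f \<in> carrier (?C m)" for f
        using E_hom_restrict[OF Q_left_module sh] that by (simp add: C D)
      show "restrict (sharp X (f \<oplus>\<^bsub>?C m\<^esub> g)) (carrier (Q m)) =
         restrict (sharp X f) (carrier (Q m)) \<oplus>\<^bsub>?D m\<^esub> restrict (sharp X g) (carrier (Q m))"
        if fg: "f \<in> carrier (?C m)" "g \<in> carrier (?C m)" for f g
      proof -
        have f: "f \<in> lmod_hom \<Gamma> (bar m) N" and g: "g \<in> lmod_hom \<Gamma> (bar m) N" using fg by (auto simp: C)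
        have "sharp X (f \<oplus>\<^bsub>?C m\<^esub> g) t = sharp X f t \<oplus>\<^bsub>X\<^esub> sharp X g t" if "t \<in> carrier (Q m)" for t
          by (rule eqI[OF sh[OF 1(1)[OF fg V.R.one_closed]] lmod_hom_sum[OF Q_left_module X sh[OF f] sh[OF g]] _ that])
             (simp add: su f g 1(1)[OF fg V.R.one_closed], simp add: hom_space_sel bc N)
        then show ?thesis unfolding hom_space_sel(3)[of E] by (auto simp: fun_eq_iff)
      qed
      show "restrict (sharp X (c \<odot>\<^bsub>?C m\<^esub> f)) (carrier (Q m)) = c \<odot>\<^bsub>?D m\<^esub> restrict (sharp X f) (carrier (Q m))"
        if c: "c \<in> carrier K" and fC: "f \<in> carrier (?C m)" for f c
      proof -
        have f: "f \<in> lmod_hom \<Gamma> (bar m) N" using fC by (auto simp: C)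
        have "sharp X (c \<odot>\<^bsub>?C m\<^esub> f) t = c \<odot>\<^bsub>?V\<^esub> sharp X f t" if "t \<in> carrier (Q m)" for t
          by (rule eqI[OF sh[OF 1(2)[OF fC fC c]] E_hom_scale[OF Q_left_module X sh[OF f] c] _ that])
             (simp add: su f 1(2)[OF fC fC c], simp add: hom_space_sel bc sm c cl[OF f])
        then show ?thesis unfolding E_hom_space_smult by (auto simp: fun_eq_iff)
      qed
    qed
    show "(\<lambda>g. \<lambda>v\<in>carrier (T (Suc (Suc m))). g (?e m v)) \<in> lmod_hom K (?D m) (?C m)"
    proof (rule lmod_homI)
      show "(\<lambda>v\<in>carrier (T (Suc (Suc m))). g (?e m v)) \<in> carrier (?C m)" if "g \<in> carrier (?D m)" for g
        using rs[OF fl] that by (simp add: C D bc)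
      show "(\<lambda>v\<in>carrier (T (Suc (Suc m))). (f \<oplus>\<^bsub>?D m\<^esub> g) (?e m v)) =
         (\<lambda>v\<in>carrier (T (Suc (Suc m))). f (?e m v)) \<oplus>\<^bsub>?C m\<^esub> (\<lambda>v\<in>carrier (T (Suc (Suc m))). g (?e m v))" for f g
        unfolding hom_space_sel(3) bc by (rule restrict_ext) (simp add: ec N)
      show "(\<lambda>v\<in>carrier (T (Suc (Suc m))). (c \<odot>\<^bsub>?D m\<^esub> g) (?e m v)) =
         c \<odot>\<^bsub>?C m\<^esub> (\<lambda>v\<in>carrier (T (Suc (Suc m))). g (?e m v))" if "c \<in> carrier K" "g \<in> carrier (?D m)" for c g
        unfolding E_hom_space_smult unfolding hom_space_sel(4) bc
        by (rule restrict_ext) (use that lmod_hom_closed[of g E "Q m" X] in \<open>simp add: ec sm D\<close>)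
    qed
  next
    fix m f assume "f \<in> carrier (?C m)"
    then have f: "f \<in> lmod_hom \<Gamma> (bar m) N" by (simp add: C)
    have "sharp X (hom_diff bar (bar_diff K A) m f) t = sharp X f (dQ m t)" if "t \<in> carrier (Q (Suc m))" for t
      by (rule eqI[OF sh lmod_hom_comp[OF dQ_hom sh[OF f]] _ that])
         (use dCc[OF f] in \<open>simp_all add: C su f dQ_pure dC\<close>)
    then show "restrict (sharp X (hom_diff bar (bar_diff K A) m f)) (carrier (Q (Suc m)))
       = hom_diff Q dQ m (restrict (sharp X f) (carrier (Q m)))"
      unfolding hom_diff_def by (auto simp: fun_eq_iff lmod_hom_closed[OF dQ_hom])
  next
    fix m g assume "g \<in> carrier (?D m)"
    show "(\<lambda>v\<in>carrier (T (Suc (Suc (Suc m)))). hom_diff Q dQ m g (?e (Suc m) v))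
       = hom_diff bar (bar_diff K A) m (\<lambda>v\<in>carrier (T (Suc (Suc m))). g (?e m v))"
      unfolding dC by (rule restrict_ext) (simp add: hom_diff_def ec dQ_pure)
  next
    fix f assume f: "f \<in> carrier (?C m)"
    have z: "\<zero>\<^bsub>?C m\<^esub> \<in> (case m of 0 \<Rightarrow> {\<zero>\<^bsub>?C 0\<^esub>} | Suc n \<Rightarrow> hom_diff bar (bar_diff K A) n ` carrier (?C n))"
      using subgroup.one_closed[OF submodule.axioms(1)[OF cohomology_structure(2)[OF CC, of m]]] by simp
    have "(\<lambda>v\<in>carrier (T (Suc (Suc m))). restrict (sharp X f) (carrier (Q m)) (?e m v)) = f"
      by (rule extensionalityI[of _ "carrier (T (Suc (Suc m)))"]) (use f in \<open>auto simp: C ec su\<close>)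
    also have "f = \<zero>\<^bsub>?C m\<^esub> \<oplus>\<^bsub>?C m\<^esub> f"
      using abelian_monoid.l_zero[of "?C m" f] Cmod[of m] f unfolding module_def abelian_group_def by simp
    finally show "\<exists>s\<in>(case m of 0 \<Rightarrow> {\<zero>\<^bsub>?C 0\<^esub>} | Suc n \<Rightarrow> hom_diff bar (bar_diff K A) n ` carrier (?C n)).
       (\<lambda>v\<in>carrier (T (Suc (Suc m))). restrict (sharp X f) (carrier (Q m)) (?e m v)) = s \<oplus>\<^bsub>?C m\<^esub> f"
      using z by blast
  next
    fix g assume g: "g \<in> carrier (?D m)"
    then have g': "g \<in> lmod_hom E (Q m) X" by (simp add: D)
    have z: "\<zero>\<^bsub>?D m\<^esub> \<in> (case m of 0 \<Rightarrow> {\<zero>\<^bsub>?D 0\<^esub>} | Suc n \<Rightarrow> hom_diff Q dQ n ` carrier (?D n))"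
      using subgroup.one_closed[OF submodule.axioms(1)[OF cohomology_structure(2)[OF DD, of m]]] by simp
    have r: "(\<lambda>v\<in>carrier (T (Suc (Suc m))). g (?e m v)) \<in> lmod_hom \<Gamma> (bar m) N" using rs[OF fl[OF g']] by (simp add: bc)
    have "sharp X (\<lambda>v\<in>carrier (T (Suc (Suc m))). g (?e m v)) t = g t" if "t \<in> carrier (Q m)" for t
      by (rule eqI[OF sh[OF r] g' _ that]) (simp add: su[OF r])
    then have "restrict (sharp X (\<lambda>v\<in>carrier (T (Suc (Suc m))). g (?e m v))) (carrier (Q m)) = g"
      by (intro extensionalityI[of _ "carrier (Q m)"]) (use g in \<open>auto simp: D\<close>)
    also have "g = \<zero>\<^bsub>?D m\<^esub> \<oplus>\<^bsub>?D m\<^esub> g"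
      using abelian_monoid.l_zero[of "?D m" g] E_hom_space_module[OF Q_left_module X, of m] g unfolding module_def abelian_group_def by simp
    finally show "\<exists>s\<in>(case m of 0 \<Rightarrow> {\<zero>\<^bsub>?D 0\<^esub>} | Suc n \<Rightarrow> hom_diff Q dQ n ` carrier (?D n)).
       restrict (sharp X (\<lambda>v\<in>carrier (T (Suc (Suc m))). g (?e m v))) (carrier (Q m)) = s \<oplus>\<^bsub>?D m\<^esub> g"
      using z by blast
  qed
qed

lemma Q_acyclic: "acyclic E Q dQ RM eQ"
  unfolding acyclic_def augmented_def
  by (intro conjI allI ballI impI; rule RM_left_module Q_left_complex eQ_hom dQ_eQ eQ_surj eQ_exact dQ_exact)

text \<open>These are the premises of \<open>bar_cohomology_iso\<close> for the given coefficients.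
  The actions on \<open>N\<close> are expressed by \<open>lact\<close> and \<open>ract\<close>,
  those on \<open>X\<close> through the enveloping algebra; on the common carrier they coincide, in
  particular h1 m S(h2) is \<open>adj X h m\<close>.\<close>

lemma smash_Gamma_hom_iff:
  assumes M: "bimodule K R M lact ract"
  defines "X \<equiv> enveloping_module K M lact ract" and "N \<equiv> smash_Gamma_module K H A M lact ract"
  shows "carrier N = carrier X" "add N = add X" "zero N = zero X"
    and "\<And>c x. c \<in> carrier K \<Longrightarrow> x \<in> carrier X \<Longrightarrow> (c \<odot>\<^bsub>\<Gamma>\<^esub> \<one>\<^bsub>\<Gamma>\<^esub>) \<odot>\<^bsub>N\<^esub> x = c \<odot>\<^bsub>vspace K R X\<^esub> x"
    and "\<And>m f. f \<in> lmod_hom \<Gamma> (bar m) N \<longleftrightarrow>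
      ehom (T (Suc (Suc m))) (Tl (Suc (Suc m))) (Tr (Suc (Suc m))) (Th (Suc (Suc m))) (vspace K R X) (xl X) (xr X) (adj X) f"
proof -
  have X: "left_module E X" unfolding X_def by (rule enveloping_module_left_module[OF M])
  have Mm: "module K M" using M by (rule bimodule.vector_space)
  have sel: "carrier X = carrier M" "add X = add M" "zero X = zero M"
    unfolding X_def by (simp_all add: enveloping_module_sel[OF M])
  let ?l = "\<lambda>a. lact (inA a)" and ?r = "\<lambda>m b. ract m (inA b)"
    and ?h = "\<lambda>h m. SW M (\<lambda>h1 h2. lact (inH h1) (ract m (inH (antipode H h2)))) h"
  have N: "N = Gamma_module K M ?l ?r ?h"
    by (simp add: N_def smash_Gamma_module_def inA_def inH_def sw_def)
  show s: "carrier N = carrier X" "add N = add X" "zero N = zero X" by (simp_all add: N sel)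
  have acts: "left_act K R X r x = lact r x" "right_act K R X x r = ract x r" if "r \<in> carrier AH" "x \<in> carrier M" for r x
    unfolding X_def using enveloping_module_acts[OF M] that by simp_all
  have lb: "bilin K AH M M lact" "bilin K M AH M ract"
    using lact_bilin[OF M] ract_bilin[OF M] by (simp_all add: bilin_same_ops[of R AH])
  note li = bilin_left[OF lb(1)] bilin_right[OF lb(1)] bilin_left[OF lb(2)] bilin_right[OF lb(2)]
  note lc = bilinD(3)[OF lb(1)] bilinD(3)[OF lb(2)]
  have b: "bilin K A M M ?l" "bilin K M A M ?r" "bilin K H M M ?h"
    by (auto intro!: li lin_intros simp: Mm lc)
  have adj: "adj X h x = ?h h x" if h: "h \<in> carrier H" and x: "x \<in> carrier M" for h x
  proof -
    have "adj X h x = SW (vspace K R X) (\<lambda>h1 h2. lact (inH h1) (ract x (inH (antipode H h2)))) h"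
      unfolding adj_def by (rule SW_eqI[OF h]) (simp add: acts x lc)
    moreover have "(\<lambda>x. x) \<in> lin M (vspace K R X)"
      unfolding X_def enveloping_module_lin[OF M] by (rule lin_id)
    ultimately show ?thesis
      using SW_comp[OF Mm vspace_module[OF X], of "\<lambda>x. x" "\<lambda>h1 h2. lact (inH h1) (ract x (inH (antipode H h2)))" h] h x
      by (simp add: lc)
  qed
  have one: "?l \<one>\<^bsub>A\<^esub> n = n" "?r n \<one>\<^bsub>A\<^esub> = n" "?h \<one>\<^bsub>H\<^esub> n = n" if "n \<in> carrier M" for n
    using XL_one[OF X, of n] that hmodD(4)[OF adj_hmod[OF X], of n] by (simp_all add: sel acts flip: adj)
  show "(c \<odot>\<^bsub>\<Gamma>\<^esub> \<one>\<^bsub>\<Gamma>\<^esub>) \<odot>\<^bsub>N\<^esub> x = c \<odot>\<^bsub>vspace K R X\<^esub> x" if "c \<in> carrier K" "x \<in> carrier X" for c x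
  proof -
    have x: "x \<in> carrier M" using that(2) by (simp add: sel)
    show ?thesis
      unfolding N using Gamma_scalar[OF Mm b one that(1) x] enveloping_module_vspace[OF M that(1) x] by (simp add: X_def)
  qed
  fix m f
  have "ehom (T (Suc (Suc m))) (Tl (Suc (Suc m))) (Tr (Suc (Suc m))) (Th (Suc (Suc m))) M ?l ?r ?h f \<longleftrightarrow>
    ehom (T (Suc (Suc m))) (Tl (Suc (Suc m))) (Tr (Suc (Suc m))) (Th (Suc (Suc m))) (vspace K R X) (xl X) (xr X) (adj X) f"
  proof -
    have l: "lin (T (Suc (Suc m))) (vspace K R X) = lin (T (Suc (Suc m))) M"
      unfolding X_def by (rule enveloping_module_lin[OF M])
    show ?thesis unfolding equivariant_hom_def l
      by (rule conj_cong[OF refl]) (auto simp: acts adj dest: lmod_hom_closed)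
  qed
  then show "f \<in> lmod_hom \<Gamma> (bar m) N \<longleftrightarrow>
    ehom (T (Suc (Suc m))) (Tl (Suc (Suc m))) (Tr (Suc (Suc m))) (Th (Suc (Suc m))) (vspace K R X) (xl X) (xr X) (adj X) f"
    unfolding N by (subst bar_hom_iff[OF Mm b one]) simp_all
qed

end

section \<open>Comparison of an arbitrary projective resolution with the induced one\<close>

lemma projective_resolution_acyclic:
  assumes r: "projective_resolution R N P \<delta> e" and N: "left_module R N"
  shows "acyclic R P \<delta> N e"
proof -
  have P: "left_module R (P n)" and d: "\<delta> n \<in> lmod_hom R (P (Suc n)) (P n)" and e: "e \<in> lmod_hom R (P 0) N"
    and s: "e ` carrier (P 0) = carrier N"
    and ker: "a_kernel (P (Suc n)) (P n) (\<delta> n) = \<delta> (Suc n) ` carrier (P (Suc (Suc n)))"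
    and ker0: "a_kernel (P 0) N e = \<delta> 0 ` carrier (P (Suc 0))" for n
    using r by (simp_all add: projective_resolution_def projective_module_def)
  have "\<delta> n (\<delta> (Suc n) x) = \<zero>\<^bsub>P n\<^esub>" if "x \<in> carrier (P (Suc (Suc n)))" for n x
    using a_kernel_iff[of "\<delta> (Suc n) x"] imageI[OF that, of "\<delta> (Suc n)", folded ker] by blast
  moreover have "e (\<delta> 0 x) = \<zero>\<^bsub>N\<^esub>" if "x \<in> carrier (P (Suc 0))" for x
    using a_kernel_iff[of "\<delta> 0 x"] imageI[OF that, of "\<delta> 0", folded ker0] by blast
  ultimately show ?thesis
    unfolding acyclic_def augmented_def left_complex_def
    using P d e s N by (simp add: a_kernel_iff flip: ker ker0)
qed

theorem theorem5p2:
  fixes K :: "'k ring"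
    and H :: "('k, 'h) hopf"
    and A :: "('k, 'a) module"
    and act :: "'h \<Rightarrow> 'a \<Rightarrow> 'a"
    and M :: "('k, 'm) module"
    and lact :: "('a \<times> 'h \<Rightarrow> 'k) set \<Rightarrow> 'm \<Rightarrow> 'm"
    and ract :: "'m \<Rightarrow> ('a \<times> 'h \<Rightarrow> 'k) set \<Rightarrow> 'm"
    and P :: "nat \<Rightarrow> ((('a \<times> 'h \<Rightarrow> 'k) set \<times> ('a \<times> 'h \<Rightarrow> 'k) set \<Rightarrow> 'k) set, 'p) module"
    and \<delta> :: "nat \<Rightarrow> 'p \<Rightarrow> 'p"
    and e :: "'p \<Rightarrow> ('a \<times> 'h \<Rightarrow> 'k) set"
    and m :: nat
  defines "R \<equiv> smash_product K H A act"
  assumes "field K"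
    and "hopf_algebra K H"
    and "finite_dimensional K H"
    and "semisimple_algebra H"
    and "module_algebra K H A act"
    and "bimodule K R M lact ract"
    and "bimodule_resolution K R P \<delta> e"
  shows "lmod_iso K
           (HH_Hopf K H A act (smash_Gamma_module K H A M lact ract) m)
           (HH K R P \<delta> M lact ract m)"
proof -
  let ?E = "enveloping_algebra K R"
  have res: "projective_resolution ?E (enveloping_module K R (mult R) (mult R)) P \<delta> e"
    using assms(8) unfolding bimodule_resolution_def .
  have proj: "projective_module ?E (P n)" for n using res by (simp add: projective_resolution_def)
  have PM: "left_module ?E (P n)" for n using proj[of n] by (simp add: projective_module_def)
  have "ring R" using bimodule.left[OF assms(7)] by (simp add: left_module_def)
  moreover have "ring ?E" using PM[of 0] by (simp add: left_module_def)
  ultimately interpret S: smash_calc K H A act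
    unfolding R_def by (intro smash_calc.intro hopf_calc.intro smash_calc_axioms.intro assms(3,6))
  note M = assms(7)[unfolded R_def]
  let ?X = "enveloping_module K M lact ract"
  have X: "left_module ?E ?X" unfolding R_def by (rule S.enveloping_module_left_module[OF M])
  have RM: "enveloping_module K R (mult R) (mult R) = S.RM" unfolding R_def S.RM_def ..
  have PA: "acyclic ?E P \<delta> S.RM e"
    by (rule projective_resolution_acyclic[OF res[unfolded RM]]) (unfold R_def, rule S.RM_left_module)
  have d: "\<And>n. \<delta> n \<in> lmod_hom ?E (P (Suc n)) (P n)" "e \<in> lmod_hom ?E (P 0) S.RM"
    using res by (simp_all add: projective_resolution_def RM)
  have QM: "left_module ?E (S.Q n)" "S.dQ n \<in> lmod_hom ?E (S.Q (Suc n)) (S.Q n)"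
    "S.eQ \<in> lmod_hom ?E (S.Q 0) S.RM" "left_module ?E S.RM" for n
    unfolding R_def by (rule S.Q_left_module S.dQ_hom S.eQ_hom S.RM_left_module)+
  have "lmod_iso K (hom_cohomology ?E S.Q S.dQ ?X m) (hom_cohomology ?E P \<delta> ?X m)"
    unfolding R_def
  \<comment> \<open>The given resolution \<open>P\<close> takes the place of C and the induced
    complex that of D. Lifts out of \<open>S.Q\<close> come from \<open>S.Q_lift\<close>, lifts out
    of \<open>P\<close> from projectivity.\<close>
  proof (rule S.hom_cohomology_comparison[OF PA[unfolded R_def] S.Q_acyclic X[unfolded R_def]])
    show "lifts_through (enveloping_algebra K (smash_product K H A act)) (S.Q i) (P 0) S.RM e" for i
      unfolding lifts_through_def
      by (intro ballI impI S.Q_lift[OF assms(5)]) (use PM QM d in \<open>simp_all add: R_def\<close>)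
    show "lifts_through (enveloping_algebra K (smash_product K H A act)) (S.Q i) (P (Suc n)) (P n) (\<delta> n)" for i n
      unfolding lifts_through_def
      by (intro ballI impI S.Q_lift[OF assms(5)]) (use PM QM d in \<open>simp_all add: R_def\<close>)
    show "lifts_through (enveloping_algebra K (smash_product K H A act)) (S.Q i) (S.Q (Suc n)) (S.Q n) (S.dQ n)" for i n
      unfolding lifts_through_def
      by (intro ballI impI S.Q_lift[OF assms(5)]) (use PM QM d in \<open>simp_all add: R_def\<close>)
  qed (rule projective_lifts_through[OF proj[unfolded R_def]]; use PM QM d in \<open>simp add: R_def\<close>)+
  moreover have "lmod_iso K (HH_Hopf K H A act (smash_Gamma_module K H A M lact ract) m) (hom_cohomology ?E S.Q S.dQ ?X m)"
    unfolding HH_Hopf_def R_def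
    by (rule S.bar_cohomology_iso[OF X[unfolded R_def] S.smash_Gamma_hom_iff[OF M]])
  ultimately show ?thesis unfolding HH_def by (rule lmod_iso_trans[rotated])
qed

end
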